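(* Let $\mathcal V$ be a regular category, regarded as a cartesian monoidal category, and let $F\colon\mathcal C\to\mathcal D$ be a $\mathcal V$-functor between small $\mathcal V$-categories. For objects $x_0,x_1,x_2,x_3$ of $\mathcal C$ with $y_i=Fx_i$, consider the morphisms induced by $F$ $$F_{x_0,x_1}\colon\mathcal C(x_0,x_1)\to\mathcal D(y_0,y_1),\quad F_{x_0,x_1,x_2}\colon\mathcal C(x_0,x_1,x_2)\to\mathcal D(y_0,y_1,y_2),\quad F_{x_0,x_1,x_2,x_3}\colon\mathcal C(x_0,x_1,x_2,x_3)\to\mathcal D(y_0,y_1,y_2,y_3),$$ and their (regular epi, mono)-factorizations $F_{x_0,x_1}=I_{x_0,x_1}\circ P_{x_0,x_1}$, $F_{x_0,x_1,x_2}=I_{x_0,x_1,x_2}\circ P_{x_0,x_1,x_2}$, $F_{x_0,x_1,x_2,x_3}=I_{x_0,x_1,x_2,x_3}\circ P_{x_0,x_1,x_2,x_3}$ in $\mathcal V$. Suppose that (a) $P_{x_0,x_1}$ is an effective descent morphism in $\mathcal V$ for all objects $x_0,x_1$ of $\mathcal C$; and that for all objects $y_0,y_1,y_2,y_3$ of $\mathcal D$, (b) the morphism $(I_{x_0,x_1})_{x_i\in F^*y_i}$ of $\mathsf{Fam}(\mathcal V)$, with codomain $\mathcal D(y_0,y_1)$, is an effective descent morphism; (c) the morphism $(I_{x_0,x_1,x_2})_{x_i\in F^*y_i}$ of $\mathsf{Fam}(\mathcal V)$, with codomain $\mathcal D(y_0,y_1,y_2)$, is a descent morphism; (d) the morphism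 $(I_{x_0,x_1,x_2,x_3})_{x_i\in F^*y_i}$ of $\mathsf{Fam}(\mathcal V)$, with codomain $\mathcal D(y_0,y_1,y_2,y_3)$, is an almost descent morphism. Then $F$ is an effective descent morphism in $\mathcal V\text{-}\mathsf{Cat}$.
   Context: $\mathsf{Fam}(\mathcal V)$ (free coproduct completion) has as objects set-indexed families $(X_j)_{j\in J}$ of objects of $\mathcal V$; a morphism $(X_j)_{j\in J}\to(Y_k)_{k\in K}$ is a function $f\colon J\to K$ together with morphisms $\phi_j\colon X_j\to Y_{f(j)}$. An object of $\mathcal V$ is identified with a one-member family, so a family of morphisms $(\phi_j\colon X_j\to Y)_{j\in J}$ is a morphism $(X_j)_{j\in J}\to Y$ of $\mathsf{Fam}(\mathcal V)$. The domain of the family in (b), (c), (d) is the family of images (middle objects of the factorizations), indexed by tuples of objects $x_i$ with $Fx_i=y_i$; $F^*y$ is the set of objects $x$ of $\mathcal C$ with $Fx=y$. Chains: $\mathcal D(y_0,y_1,y_2)=\mathcal D(y_1,y_2)\times\mathcal D(y_0,y_1)$ and $\mathcal D(y_0,y_1,y_2,y_3)=\mathcal D(y_1,y_2,y_3)\times\mathcal D(y_0,y_1)$; the morphisms $F_{x_0,\dots,x_n}$ are the products of the hom-morphisms of $F$. $\mathcal V\text{-}\mathsf{Cat}$ is the category of small $\mathcal V$-categories and $\mathcal V$-functors. A regular category has finite limits, coequalizers of kernel pairs, and pullback-stable regular epimorphisms. Descent: for a category $\mathcal A$ with pullbacks and $p\colon e\to b$, let $p^*\colon\mathcal A/b\to\mathcal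 A/e$ be the pullback functor, $p_!\dashv p^*$, $T^p$ the induced monad, $\mathcal K^p\colon\mathcal A/b\to T^p\text{-}\mathsf{Alg}$ the Eilenberg–Moore comparison. $p$ is an almost descent, descent, or effective descent morphism if $\mathcal K^p$ is faithful, fully faithful, or an equivalence, respectively. *)

theory Defs
  imports Main "HOL-Library.FuncSet"
begin

section \<open>Smallness\<close>

text \<open>
  The sets that index families and the object sets of small enriched categories are the small
  sets of elements of a type \<open>'u\<close>. A Grothendieck universe with its ordered pairs is an
  instance; so is every infinite type with an injective pairing and all its subsets counted as
  small. Power sets are not required to be small: that axiom would make the existence of a
  universe unprovable in HOL.
\<close>

locale universe =
  fixes small :: "'u set \<Rightarrow> bool"
    and pair :: "'u \<Rightarrow> 'u \<Rightarrow> 'u"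
  assumes pair_inject: "pair a b = pair c d \<Longrightarrow> a = c \<and> b = d"
    and small_infinite: "\<exists>A. infinite A \<and> small A"
    and small_subset: "small A \<Longrightarrow> B \<subseteq> A \<Longrightarrow> small B"
    and small_image: "small A \<Longrightarrow> small (f ` A)"
    and small_UN: "small A \<Longrightarrow> (\<And>a. a \<in> A \<Longrightarrow> small (S a)) \<Longrightarrow> small (\<Union>a\<in>A. S a)"


section \<open>Categories and functors\<close>

record ('o, 'm) cat =
  Obj :: "'o set"
  Arr :: "'m set"
  Dom :: "'m \<Rightarrow> 'o"
  Cod :: "'m \<Rightarrow> 'o"
  Id :: "'o \<Rightarrow> 'm"
  Comp :: "'m \<Rightarrow> 'm \<Rightarrow> 'm"  \<comment> \<open>\<open>Comp A g f\<close> is \<open>g\<close> after \<open>f\<close>\<close>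

definition hom :: "('o, 'm) cat \<Rightarrow> 'o \<Rightarrow> 'o \<Rightarrow> 'm set" where
  "hom A x y = {f \<in> Arr A. Dom A f = x \<and> Cod A f = y}"

locale category =
  fixes A :: "('o, 'm) cat"
  assumes dom_obj: "f \<in> Arr A \<Longrightarrow> Dom A f \<in> Obj A"
    and cod_obj: "f \<in> Arr A \<Longrightarrow> Cod A f \<in> Obj A"
    and id_hom: "x \<in> Obj A \<Longrightarrow> Id A x \<in> hom A x x"
    and comp_hom: "f \<in> hom A x y \<Longrightarrow> g \<in> hom A y z \<Longrightarrow> Comp A g f \<in> hom A x z"
    and id_left: "f \<in> hom A x y \<Longrightarrow> Comp A (Id A y) f = f"
    and id_right: "f \<in> hom A x y \<Longrightarrow> Comp A f (Id A x) = f"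
    and assoc: "f \<in> hom A w x \<Longrightarrow> g \<in> hom A x y \<Longrightarrow> h \<in> hom A y z \<Longrightarrow>
      Comp A (Comp A h g) f = Comp A h (Comp A g f)"

record ('o1, 'm1, 'o2, 'm2) func =
  fobj :: "'o1 \<Rightarrow> 'o2"
  farr :: "'m1 \<Rightarrow> 'm2"

definition is_functor ::
    "('o1, 'm1) cat \<Rightarrow> ('o2, 'm2) cat \<Rightarrow> ('o1, 'm1, 'o2, 'm2) func \<Rightarrow> bool" where
  "is_functor A B F \<longleftrightarrow>
     (\<forall>x\<in>Obj A. fobj F x \<in> Obj B) \<and>
     (\<forall>f\<in>Arr A. farr F f \<in> hom B (fobj F (Dom A f)) (fobj F (Cod A f))) \<and>
     (\<forall>x\<in>Obj A. farr F (Id A x) = Id B (fobj F x)) \<and>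
     (\<forall>f\<in>Arr A. \<forall>g\<in>Arr A. Dom A g = Cod A f \<longrightarrow>
        farr F (Comp A g f) = Comp B (farr F g) (farr F f))"

definition id_func :: "('o, 'm, 'o, 'm) func" where
  "id_func = \<lparr>fobj = (\<lambda>x. x), farr = (\<lambda>f. f)\<rparr>"

definition comp_func :: "('o2, 'm2, 'o3, 'm3) func \<Rightarrow> ('o1, 'm1, 'o2, 'm2) func \<Rightarrow>
    ('o1, 'm1, 'o3, 'm3) func" where
  "comp_func G F = \<lparr>fobj = fobj G \<circ> fobj F, farr = farr G \<circ> farr F\<rparr>"

definition is_iso :: "('o, 'm) cat \<Rightarrow> 'm \<Rightarrow> bool" where
  "is_iso A f \<longleftrightarrow> f \<in> Arr A \<and>
     (\<exists>g \<in> hom A (Cod A f) (Dom A f).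
        Comp A g f = Id A (Dom A f) \<and> Comp A f g = Id A (Cod A f))"

definition is_nat_iso :: "('o1, 'm1) cat \<Rightarrow> ('o2, 'm2) cat \<Rightarrow> ('o1, 'm1, 'o2, 'm2) func \<Rightarrow>
    ('o1, 'm1, 'o2, 'm2) func \<Rightarrow> ('o1 \<Rightarrow> 'm2) \<Rightarrow> bool" where
  "is_nat_iso A B F G \<theta> \<longleftrightarrow>
     (\<forall>x\<in>Obj A. \<theta> x \<in> hom B (fobj F x) (fobj G x) \<and> is_iso B (\<theta> x)) \<and>
     (\<forall>f\<in>Arr A. Comp B (\<theta> (Cod A f)) (farr F f) = Comp B (farr G f) (\<theta> (Dom A f)))"

definition is_faithful ::
    "('o1, 'm1) cat \<Rightarrow> ('o2, 'm2) cat \<Rightarrow> ('o1, 'm1, 'o2, 'm2) func \<Rightarrow> bool" where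
  "is_faithful A B F \<longleftrightarrow> is_functor A B F \<and>
     (\<forall>x\<in>Obj A. \<forall>y\<in>Obj A. inj_on (farr F) (hom A x y))"

definition is_fully_faithful ::
    "('o1, 'm1) cat \<Rightarrow> ('o2, 'm2) cat \<Rightarrow> ('o1, 'm1, 'o2, 'm2) func \<Rightarrow> bool" where
  "is_fully_faithful A B F \<longleftrightarrow> is_functor A B F \<and>
     (\<forall>x\<in>Obj A. \<forall>y\<in>Obj A. bij_betw (farr F) (hom A x y) (hom B (fobj F x) (fobj F y)))"

definition is_equivalence ::
    "('o1, 'm1) cat \<Rightarrow> ('o2, 'm2) cat \<Rightarrow> ('o1, 'm1, 'o2, 'm2) func \<Rightarrow> bool" where
  "is_equivalence A B F \<longleftrightarrow> is_functor A B F \<and>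
     (\<exists>G. is_functor B A G \<and>
        (\<exists>\<eta>. is_nat_iso A A id_func (comp_func G F) \<eta>) \<and>
        (\<exists>\<epsilon>. is_nat_iso B B (comp_func F G) id_func \<epsilon>))"


section \<open>Limits and regular categories\<close>

definition is_cone :: "('i, 'a) cat \<Rightarrow> ('o, 'm) cat \<Rightarrow> ('i, 'a, 'o, 'm) func \<Rightarrow>
    'o \<Rightarrow> ('i \<Rightarrow> 'm) \<Rightarrow> bool" where
  "is_cone J A F l \<pi> \<longleftrightarrow> l \<in> Obj A \<and>
     (\<forall>i\<in>Obj J. \<pi> i \<in> hom A l (fobj F i)) \<and>
     (\<forall>u\<in>Arr J. Comp A (farr F u) (\<pi> (Dom J u)) = \<pi> (Cod J u))"

definition is_limit :: "('i, 'a) cat \<Rightarrow> ('o, 'm) cat \<Rightarrow> ('i, 'a, 'o, 'm) func \<Rightarrow>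
    'o \<Rightarrow> ('i \<Rightarrow> 'm) \<Rightarrow> bool" where
  "is_limit J A F l \<pi> \<longleftrightarrow> is_cone J A F l \<pi> \<and>
     (\<forall>l' \<pi>'. is_cone J A F l' \<pi>' \<longrightarrow>
        (\<exists>!h. h \<in> hom A l' l \<and> (\<forall>i\<in>Obj J. Comp A (\<pi> i) h = \<pi>' i)))"

text \<open>Every finite category is isomorphic to one whose objects and arrows are natural numbers.\<close>

definition has_finite_limits :: "('o, 'm) cat \<Rightarrow> bool" where
  "has_finite_limits A \<longleftrightarrow>
     (\<forall>(J :: (nat, nat) cat) F.
        category J \<and> finite (Obj J) \<and> finite (Arr J) \<and> is_functor J A F \<longrightarrow>
        (\<exists>l \<pi>. is_limit J A F l \<pi>))"

definition is_terminal :: "('o, 'm) cat \<Rightarrow> 'o \<Rightarrow> bool" where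
  "is_terminal A t \<longleftrightarrow> t \<in> Obj A \<and> (\<forall>x\<in>Obj A. \<exists>!f. f \<in> hom A x t)"

definition is_product :: "('o, 'm) cat \<Rightarrow> 'o \<Rightarrow> 'o \<Rightarrow> 'm \<Rightarrow> 'm \<Rightarrow> bool" where
  "is_product A x y a b \<longleftrightarrow>
     a \<in> Arr A \<and> b \<in> Arr A \<and> Dom A a = Dom A b \<and> Cod A a = x \<and> Cod A b = y \<and>
     (\<forall>u\<in>Arr A. \<forall>v\<in>Arr A. Dom A u = Dom A v \<and> Cod A u = x \<and> Cod A v = y \<longrightarrow>
        (\<exists>!h. h \<in> hom A (Dom A u) (Dom A a) \<and> Comp A a h = u \<and> Comp A b h = v))"

definition is_pullback :: "('o, 'm) cat \<Rightarrow> 'm \<Rightarrow> 'm \<Rightarrow> 'm \<Rightarrow> 'm \<Rightarrow> bool" where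
  "is_pullback A f g a b \<longleftrightarrow>
     f \<in> Arr A \<and> g \<in> Arr A \<and> Cod A f = Cod A g \<and>
     a \<in> Arr A \<and> b \<in> Arr A \<and> Dom A a = Dom A b \<and>
     Cod A a = Dom A f \<and> Cod A b = Dom A g \<and> Comp A f a = Comp A g b \<and>
     (\<forall>u\<in>Arr A. \<forall>v\<in>Arr A.
        Dom A u = Dom A v \<and> Cod A u = Dom A f \<and> Cod A v = Dom A g \<and>
        Comp A f u = Comp A g v \<longrightarrow>
        (\<exists>!h. h \<in> hom A (Dom A u) (Dom A a) \<and> Comp A a h = u \<and> Comp A b h = v))"

definition has_pullbacks :: "('o, 'm) cat \<Rightarrow> bool" where
  "has_pullbacks A \<longleftrightarrow>
     (\<forall>f\<in>Arr A. \<forall>g\<in>Arr A. Cod A f = Cod A g \<longrightarrow> (\<exists>a b. is_pullback A f g a b))"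

definition is_coequalizer :: "('o, 'm) cat \<Rightarrow> 'm \<Rightarrow> 'm \<Rightarrow> 'm \<Rightarrow> bool" where
  "is_coequalizer A a b q \<longleftrightarrow>
     a \<in> Arr A \<and> b \<in> Arr A \<and> Dom A a = Dom A b \<and> Cod A a = Cod A b \<and>
     q \<in> Arr A \<and> Dom A q = Cod A a \<and> Comp A q a = Comp A q b \<and>
     (\<forall>u\<in>Arr A. Dom A u = Cod A a \<and> Comp A u a = Comp A u b \<longrightarrow>
        (\<exists>!h. h \<in> hom A (Cod A q) (Cod A u) \<and> Comp A h q = u))"

definition is_regular_epi :: "('o, 'm) cat \<Rightarrow> 'm \<Rightarrow> bool" where
  "is_regular_epi A q \<longleftrightarrow> (\<exists>a b. is_coequalizer A a b q)"

definition is_mono :: "('o, 'm) cat \<Rightarrow> 'm \<Rightarrow> bool" where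
  "is_mono A f \<longleftrightarrow> f \<in> Arr A \<and>
     (\<forall>u\<in>Arr A. \<forall>v\<in>Arr A. Dom A u = Dom A v \<and> Cod A u = Dom A f \<and> Cod A v = Dom A f \<and>
        Comp A f u = Comp A f v \<longrightarrow> u = v)"

definition regular_category :: "('o, 'm) cat \<Rightarrow> bool" where
  "regular_category A \<longleftrightarrow> category A \<and> has_finite_limits A \<and>
     (\<forall>f a b. is_pullback A f f a b \<longrightarrow> (\<exists>q. is_coequalizer A a b q)) \<and>
     (\<forall>f g a b. is_pullback A f g a b \<and> is_regular_epi A g \<longrightarrow> is_regular_epi A a)"

definition is_regepi_mono_fact :: "('o, 'm) cat \<Rightarrow> 'm \<Rightarrow> 'm \<Rightarrow> 'm \<Rightarrow> bool" where
  "is_regepi_mono_fact A f e m \<longleftrightarrow>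
     is_regular_epi A e \<and> is_mono A m \<and> Dom A m = Cod A e \<and> f = Comp A m e"


section \<open>Monads and Eilenberg--Moore algebras\<close>

record ('o, 'm) monad =
  mfun :: "('o, 'm, 'o, 'm) func"
  munit :: "'o \<Rightarrow> 'm"
  mmult :: "'o \<Rightarrow> 'm"

definition is_algebra :: "('o, 'm) cat \<Rightarrow> ('o, 'm) monad \<Rightarrow> 'o \<times> 'm \<Rightarrow> bool" where
  "is_algebra A T = (\<lambda>(x, a). x \<in> Obj A \<and> a \<in> hom A (fobj (mfun T) x) x \<and>
     Comp A a (munit T x) = Id A x \<and>
     Comp A a (farr (mfun T) a) = Comp A a (mmult T x))"

definition EM :: "('o, 'm) cat \<Rightarrow> ('o, 'm) monad \<Rightarrow>
    ('o \<times> 'm, ('o \<times> 'm) \<times> 'm \<times> ('o \<times> 'm)) cat" where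
  "EM A T = \<lparr>
     Obj = {X. is_algebra A T X},
     Arr = {(X, h, Y). is_algebra A T X \<and> is_algebra A T Y \<and> h \<in> hom A (fst X) (fst Y) \<and>
       Comp A h (snd X) = Comp A (snd Y) (farr (mfun T) h)},
     Dom = (\<lambda>(X, h, Y). X),
     Cod = (\<lambda>(X, h, Y). Y),
     Id = (\<lambda>X. (X, Id A (fst X), X)),
     Comp = (\<lambda>(Y, k, Z) (X, h, Y'). (X, Comp A k h, Z))\<rparr>"

text \<open>
  For an adjunction \<open>L \<stileturn> R\<close> between \<open>A\<close> and \<open>B\<close> with \<open>L : A \<rightarrow> B\<close>, unit \<open>\<eta>\<close>
  and counit \<open>\<epsilon>\<close>: the induced monad on \<open>A\<close>, and the comparison functor from \<open>B\<close> to its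
  algebras.
\<close>

definition induced_monad :: "('o1, 'm1, 'o2, 'm2) func \<Rightarrow> ('o2, 'm2, 'o1, 'm1) func \<Rightarrow>
    ('o1 \<Rightarrow> 'm1) \<Rightarrow> ('o2 \<Rightarrow> 'm2) \<Rightarrow> ('o1, 'm1) monad" where
  "induced_monad L R \<eta> \<epsilon> =
     \<lparr>mfun = comp_func R L, munit = \<eta>, mmult = (\<lambda>x. farr R (\<epsilon> (fobj L x)))\<rparr>"

definition comparison :: "('o2, 'm2) cat \<Rightarrow> ('o2, 'm2, 'o1, 'm1) func \<Rightarrow> ('o2 \<Rightarrow> 'm2) \<Rightarrow>
    ('o2, 'm2, 'o1 \<times> 'm1, ('o1 \<times> 'm1) \<times> 'm1 \<times> ('o1 \<times> 'm1)) func" where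
  "comparison B R \<epsilon> = (let K = (\<lambda>y. (fobj R y, farr R (\<epsilon> y))) in
     \<lparr>fobj = K, farr = (\<lambda>g. (K (Dom B g), farr R g, K (Cod B g)))\<rparr>)"


section \<open>Slices and descent\<close>

text \<open>An arrow of the slice from \<open>f\<close> to \<open>g\<close> is recorded as \<open>(f, h, g)\<close> with \<open>g \<circ> h = f\<close>.\<close>

definition Slice :: "('o, 'm) cat \<Rightarrow> 'o \<Rightarrow> ('m, 'm \<times> 'm \<times> 'm) cat" where
  "Slice A b = \<lparr>
     Obj = {f \<in> Arr A. Cod A f = b},
     Arr = {(f, h, g). f \<in> Arr A \<and> g \<in> Arr A \<and> Cod A f = b \<and> Cod A g = b \<and>
       h \<in> hom A (Dom A f) (Dom A g) \<and> Comp A g h = f},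
     Dom = (\<lambda>(f, h, g). f),
     Cod = (\<lambda>(f, h, g). g),
     Id = (\<lambda>f. (f, Id A (Dom A f), f)),
     Comp = (\<lambda>(g, k, l) (f, h, g'). (f, Comp A k h, l))\<rparr>"

text \<open>
  A fixed choice of pullbacks; another choice gives an isomorphic pullback functor, hence the
  same descent notions.
\<close>

definition pb :: "('o, 'm) cat \<Rightarrow> 'm \<Rightarrow> 'm \<Rightarrow> 'm \<times> 'm" where
  "pb A f g = (SOME (a, b). is_pullback A f g a b)"

definition pb1 :: "('o, 'm) cat \<Rightarrow> 'm \<Rightarrow> 'm \<Rightarrow> 'm" where
  "pb1 A f g = fst (pb A f g)"

definition pb2 :: "('o, 'm) cat \<Rightarrow> 'm \<Rightarrow> 'm \<Rightarrow> 'm" where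
  "pb2 A f g = snd (pb A f g)"

definition pb_pairing :: "('o, 'm) cat \<Rightarrow> 'm \<Rightarrow> 'm \<Rightarrow> 'm \<Rightarrow> 'm \<Rightarrow> 'm" where
  "pb_pairing A f g u v = (THE h. h \<in> hom A (Dom A u) (Dom A (pb1 A f g)) \<and>
     Comp A (pb1 A f g) h = u \<and> Comp A (pb2 A f g) h = v)"

definition pushforward :: "('o, 'm) cat \<Rightarrow> 'm \<Rightarrow> ('m, 'm \<times> 'm \<times> 'm, 'm, 'm \<times> 'm \<times> 'm) func" where
  "pushforward A p = \<lparr>
     fobj = (\<lambda>f. Comp A p f),
     farr = (\<lambda>(f, h, g). (Comp A p f, h, Comp A p g))\<rparr>"

definition base_change :: "('o, 'm) cat \<Rightarrow> 'm \<Rightarrow> ('m, 'm \<times> 'm \<times> 'm, 'm, 'm \<times> 'm \<times> 'm) func" where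
  "base_change A p = \<lparr>
     fobj = (\<lambda>f. pb1 A p f),
     farr = (\<lambda>(f, h, g).
       (pb1 A p f, pb_pairing A p g (pb1 A p f) (Comp A h (pb2 A p f)), pb1 A p g))\<rparr>"

definition bc_unit :: "('o, 'm) cat \<Rightarrow> 'm \<Rightarrow> 'm \<Rightarrow> 'm \<times> 'm \<times> 'm" where
  "bc_unit A p f =
     (f, pb_pairing A p (Comp A p f) f (Id A (Dom A f)), pb1 A p (Comp A p f))"

definition bc_counit :: "('o, 'm) cat \<Rightarrow> 'm \<Rightarrow> 'm \<Rightarrow> 'm \<times> 'm \<times> 'm" where
  "bc_counit A p g = (Comp A p (pb1 A p g), pb2 A p g, g)"

definition descent_monad :: "('o, 'm) cat \<Rightarrow> 'm \<Rightarrow> ('m, 'm \<times> 'm \<times> 'm) monad" where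
  "descent_monad A p =
     induced_monad (pushforward A p) (base_change A p) (bc_unit A p) (bc_counit A p)"

abbreviation descent_algebras where
  "descent_algebras A p \<equiv> EM (Slice A (Dom A p)) (descent_monad A p)"

abbreviation descent_comparison where
  "descent_comparison A p \<equiv> comparison (Slice A (Cod A p)) (base_change A p) (bc_counit A p)"

definition almost_descent :: "('o, 'm) cat \<Rightarrow> 'm \<Rightarrow> bool" where
  "almost_descent A p \<longleftrightarrow> category A \<and> has_pullbacks A \<and> p \<in> Arr A \<and>
     is_faithful (Slice A (Cod A p)) (descent_algebras A p) (descent_comparison A p)"

definition descent :: "('o, 'm) cat \<Rightarrow> 'm \<Rightarrow> bool" where
  "descent A p \<longleftrightarrow> category A \<and> has_pullbacks A \<and> p \<in> Arr A \<and>
     is_fully_faithful (Slice A (Cod A p)) (descent_algebras A p) (descent_comparison A p)"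

definition effective_descent :: "('o, 'm) cat \<Rightarrow> 'm \<Rightarrow> bool" where
  "effective_descent A p \<longleftrightarrow> category A \<and> has_pullbacks A \<and> p \<in> Arr A \<and>
     is_equivalence (Slice A (Cod A p)) (descent_algebras A p) (descent_comparison A p)"


section \<open>The free coproduct completion\<close>

text \<open>Families and their morphisms are extensional, so that equality is equality on the index set.\<close>

record ('u, 'o) family =
  idx :: "'u set"
  mem :: "'u \<Rightarrow> 'o"

record ('u, 'o, 'm) fam_arr =
  fa_dom :: "('u, 'o) family"
  fa_cod :: "('u, 'o) family"
  fa_idx :: "'u \<Rightarrow> 'u"
  fa_mem :: "'u \<Rightarrow> 'm"

definition fam_objs :: "('u set \<Rightarrow> bool) \<Rightarrow> ('o, 'm) cat \<Rightarrow> ('u, 'o) family set" where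
  "fam_objs small V = {X. small (idx X) \<and> mem X \<in> (idx X \<rightarrow>\<^sub>E Obj V)}"

definition Fam :: "('u set \<Rightarrow> bool) \<Rightarrow> ('o, 'm) cat \<Rightarrow>
    (('u, 'o) family, ('u, 'o, 'm) fam_arr) cat" where
  "Fam small V = \<lparr>
     Obj = fam_objs small V,
     Arr = {f. fa_dom f \<in> fam_objs small V \<and> fa_cod f \<in> fam_objs small V \<and>
       fa_idx f \<in> (idx (fa_dom f) \<rightarrow>\<^sub>E idx (fa_cod f)) \<and>
       fa_mem f \<in> (\<Pi>\<^sub>E j\<in>idx (fa_dom f).
         hom V (mem (fa_dom f) j) (mem (fa_cod f) (fa_idx f j)))},
     Dom = fa_dom,
     Cod = fa_cod,
     Id = (\<lambda>X. \<lparr>fa_dom = X, fa_cod = X,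
       fa_idx = (\<lambda>j\<in>idx X. j), fa_mem = (\<lambda>j\<in>idx X. Id V (mem X j))\<rparr>),
     Comp = (\<lambda>g f. \<lparr>fa_dom = fa_dom f, fa_cod = fa_cod g,
       fa_idx = (\<lambda>j\<in>idx (fa_dom f). fa_idx g (fa_idx f j)),
       fa_mem = (\<lambda>j\<in>idx (fa_dom f). Comp V (fa_mem g (fa_idx f j)) (fa_mem f j))\<rparr>)\<rparr>"

text \<open>The single index of a one-member family is immaterial and taken to be \<open>undefined\<close>.\<close>

definition one_member :: "'o \<Rightarrow> ('u, 'o) family" where
  "one_member y = \<lparr>idx = {undefined}, mem = (\<lambda>k\<in>{undefined}. y)\<rparr>"

text \<open>
  The morphism \<open>(\<phi>\<^sub>t)\<^sub>t\<^sub>\<in>\<^sub>T\<close> into the one-member family \<open>y\<close>, where \<open>T\<close> is a set of tuples that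
  \<open>code\<close> maps injectively into the index type.
\<close>

definition fam_into :: "('o, 'm) cat \<Rightarrow> ('t \<Rightarrow> 'u) \<Rightarrow> 't set \<Rightarrow> ('t \<Rightarrow> 'm) \<Rightarrow> 'o \<Rightarrow>
    ('u, 'o, 'm) fam_arr" where
  "fam_into V code T \<phi> y = \<lparr>
     fa_dom = \<lparr>idx = code ` T, mem = (\<lambda>k\<in>code ` T. Dom V (\<phi> (inv_into T code k)))\<rparr>,
     fa_cod = one_member y,
     fa_idx = (\<lambda>k\<in>code ` T. undefined),
     fa_mem = (\<lambda>k\<in>code ` T. \<phi> (inv_into T code k))\<rparr>"

definition code2 :: "('u \<Rightarrow> 'u \<Rightarrow> 'u) \<Rightarrow> 'u \<times> 'u \<Rightarrow> 'u" where
  "code2 pair = (\<lambda>(x0, x1). pair x0 x1)"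

definition code3 :: "('u \<Rightarrow> 'u \<Rightarrow> 'u) \<Rightarrow> 'u \<times> 'u \<times> 'u \<Rightarrow> 'u" where
  "code3 pair = (\<lambda>(x0, x1, x2). pair x0 (pair x1 x2))"

definition code4 :: "('u \<Rightarrow> 'u \<Rightarrow> 'u) \<Rightarrow> 'u \<times> 'u \<times> 'u \<times> 'u \<Rightarrow> 'u" where
  "code4 pair = (\<lambda>(x0, x1, x2, x3). pair x0 (pair x1 (pair x2 x3)))"


section \<open>Cartesian structure\<close>

text \<open>A fixed choice of finite products, which makes the category cartesian monoidal.\<close>

definition unit_obj :: "('o, 'm) cat \<Rightarrow> 'o" where
  "unit_obj V = (SOME t. is_terminal V t)"

definition prod_cone :: "('o, 'm) cat \<Rightarrow> 'o \<Rightarrow> 'o \<Rightarrow> 'm \<times> 'm" where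
  "prod_cone V x y = (SOME (a, b). is_product V x y a b)"

definition pr1 :: "('o, 'm) cat \<Rightarrow> 'o \<Rightarrow> 'o \<Rightarrow> 'm" where
  "pr1 V x y = fst (prod_cone V x y)"

definition pr2 :: "('o, 'm) cat \<Rightarrow> 'o \<Rightarrow> 'o \<Rightarrow> 'm" where
  "pr2 V x y = snd (prod_cone V x y)"

definition prod_obj :: "('o, 'm) cat \<Rightarrow> 'o \<Rightarrow> 'o \<Rightarrow> 'o" where
  "prod_obj V x y = Dom V (pr1 V x y)"

definition pairing :: "('o, 'm) cat \<Rightarrow> 'm \<Rightarrow> 'm \<Rightarrow> 'm" where
  "pairing V f g = (THE h. h \<in> hom V (Dom V f) (prod_obj V (Cod V f) (Cod V g)) \<and>
     Comp V (pr1 V (Cod V f) (Cod V g)) h = f \<and> Comp V (pr2 V (Cod V f) (Cod V g)) h = g)"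

definition prod_arr :: "('o, 'm) cat \<Rightarrow> 'm \<Rightarrow> 'm \<Rightarrow> 'm" where
  "prod_arr V f g = pairing V
     (Comp V f (pr1 V (Dom V f) (Dom V g))) (Comp V g (pr2 V (Dom V f) (Dom V g)))"

text \<open>The associator \<open>(x \<times> y) \<times> z \<rightarrow> x \<times> (y \<times> z)\<close>.\<close>

definition associator :: "('o, 'm) cat \<Rightarrow> 'o \<Rightarrow> 'o \<Rightarrow> 'o \<Rightarrow> 'm" where
  "associator V x y z = (let q1 = pr1 V (prod_obj V x y) z; q2 = pr2 V (prod_obj V x y) z in
     pairing V (Comp V (pr1 V x y) q1) (pairing V (Comp V (pr2 V x y) q1) q2))"


section \<open>Enriched categories\<close>

record ('u, 'o, 'm) vcat =
  VObj :: "'u set"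
  VHom :: "'u \<times> 'u \<Rightarrow> 'o"
  VUnit :: "'u \<Rightarrow> 'm"
  VComp :: "'u \<times> 'u \<times> 'u \<Rightarrow> 'm"

definition chain3 :: "('o, 'm) cat \<Rightarrow> ('u, 'o, 'm) vcat \<Rightarrow> 'u \<times> 'u \<times> 'u \<Rightarrow> 'o" where
  "chain3 V C = (\<lambda>(x0, x1, x2). prod_obj V (VHom C (x1, x2)) (VHom C (x0, x1)))"

definition chain4 :: "('o, 'm) cat \<Rightarrow> ('u, 'o, 'm) vcat \<Rightarrow> 'u \<times> 'u \<times> 'u \<times> 'u \<Rightarrow> 'o" where
  "chain4 V C = (\<lambda>(x0, x1, x2, x3). prod_obj V (chain3 V C (x1, x2, x3)) (VHom C (x0, x1)))"

text \<open>
  In the unit laws the unitors \<open>1 \<times> x \<rightarrow> x\<close> and \<open>x \<times> 1 \<rightarrow> x\<close> are the product projections.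
\<close>

definition is_vcat :: "('o, 'm) cat \<Rightarrow> ('u, 'o, 'm) vcat \<Rightarrow> bool" where
  "is_vcat V C \<longleftrightarrow>
     VHom C \<in> (VObj C \<times> VObj C \<rightarrow>\<^sub>E Obj V) \<and>
     VUnit C \<in> (\<Pi>\<^sub>E x\<in>VObj C. hom V (unit_obj V) (VHom C (x, x))) \<and>
     VComp C \<in> (\<Pi>\<^sub>E (x, y, z)\<in>VObj C \<times> VObj C \<times> VObj C.
       hom V (chain3 V C (x, y, z)) (VHom C (x, z))) \<and>
     (\<forall>w\<in>VObj C. \<forall>x\<in>VObj C. \<forall>y\<in>VObj C. \<forall>z\<in>VObj C.
        Comp V (VComp C (w, x, z))
          (prod_arr V (VComp C (x, y, z)) (Id V (VHom C (w, x)))) =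
        Comp V (VComp C (w, y, z))
          (Comp V (prod_arr V (Id V (VHom C (y, z))) (VComp C (w, x, y)))
            (associator V (VHom C (y, z)) (VHom C (x, y)) (VHom C (w, x))))) \<and>
     (\<forall>x\<in>VObj C. \<forall>y\<in>VObj C.
        Comp V (VComp C (x, y, y)) (prod_arr V (VUnit C y) (Id V (VHom C (x, y)))) =
          pr2 V (unit_obj V) (VHom C (x, y)) \<and>
        Comp V (VComp C (x, x, y)) (prod_arr V (Id V (VHom C (x, y))) (VUnit C x)) =
          pr1 V (VHom C (x, y)) (unit_obj V))"

record ('u, 'o, 'm) vfunctor =
  vf_dom :: "('u, 'o, 'm) vcat"
  vf_cod :: "('u, 'o, 'm) vcat"
  vf_obj :: "'u \<Rightarrow> 'u"
  vf_hom :: "'u \<times> 'u \<Rightarrow> 'm"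

definition is_vfunctor :: "('o, 'm) cat \<Rightarrow> ('u, 'o, 'm) vfunctor \<Rightarrow> bool" where
  "is_vfunctor V F \<longleftrightarrow> (let C = vf_dom F; D = vf_cod F in
     vf_obj F \<in> (VObj C \<rightarrow>\<^sub>E VObj D) \<and>
     vf_hom F \<in> (\<Pi>\<^sub>E (x, y)\<in>VObj C \<times> VObj C.
       hom V (VHom C (x, y)) (VHom D (vf_obj F x, vf_obj F y))) \<and>
     (\<forall>x\<in>VObj C. Comp V (vf_hom F (x, x)) (VUnit C x) = VUnit D (vf_obj F x)) \<and>
     (\<forall>x\<in>VObj C. \<forall>y\<in>VObj C. \<forall>z\<in>VObj C.
        Comp V (vf_hom F (x, z)) (VComp C (x, y, z)) =
        Comp V (VComp D (vf_obj F x, vf_obj F y, vf_obj F z))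
          (prod_arr V (vf_hom F (y, z)) (vf_hom F (x, y)))))"

definition VCat :: "('u set \<Rightarrow> bool) \<Rightarrow> ('o, 'm) cat \<Rightarrow>
    (('u, 'o, 'm) vcat, ('u, 'o, 'm) vfunctor) cat" where
  "VCat small V = \<lparr>
     Obj = {C. small (VObj C) \<and> is_vcat V C},
     Arr = {F. small (VObj (vf_dom F)) \<and> is_vcat V (vf_dom F) \<and>
       small (VObj (vf_cod F)) \<and> is_vcat V (vf_cod F) \<and> is_vfunctor V F},
     Dom = vf_dom,
     Cod = vf_cod,
     Id = (\<lambda>C. \<lparr>vf_dom = C, vf_cod = C, vf_obj = (\<lambda>x\<in>VObj C. x),
       vf_hom = (\<lambda>(x, y)\<in>VObj C \<times> VObj C. Id V (VHom C (x, y)))\<rparr>),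
     Comp = (\<lambda>G F. \<lparr>vf_dom = vf_dom F, vf_cod = vf_cod G,
       vf_obj = (\<lambda>x\<in>VObj (vf_dom F). vf_obj G (vf_obj F x)),
       vf_hom = (\<lambda>(x, y)\<in>VObj (vf_dom F) \<times> VObj (vf_dom F).
         Comp V (vf_hom G (vf_obj F x, vf_obj F y)) (vf_hom F (x, y)))\<rparr>)\<rparr>"

definition vf_chain3 :: "('o, 'm) cat \<Rightarrow> ('u, 'o, 'm) vfunctor \<Rightarrow> 'u \<times> 'u \<times> 'u \<Rightarrow> 'm" where
  "vf_chain3 V F = (\<lambda>(x0, x1, x2). prod_arr V (vf_hom F (x1, x2)) (vf_hom F (x0, x1)))"

definition vf_chain4 :: "('o, 'm) cat \<Rightarrow> ('u, 'o, 'm) vfunctor \<Rightarrow> 'u \<times> 'u \<times> 'u \<times> 'u \<Rightarrow> 'm" where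
  "vf_chain4 V F =
     (\<lambda>(x0, x1, x2, x3). prod_arr V (vf_chain3 V F (x1, x2, x3)) (vf_hom F (x0, x1)))"

definition vf_fiber :: "('u, 'o, 'm) vfunctor \<Rightarrow> 'u \<Rightarrow> 'u set" where
  "vf_fiber F y = {x \<in> VObj (vf_dom F). vf_obj F x = y}"

end

theory Submission
  imports Defs
begin

text \<open>
  An algebra of the descent monad of \<open>p\<close> is an action on generalized elements: an element of the
  total object can be transported along any two elements of the domain of \<open>p\<close> with the same image.
  Hence \<open>p\<close> is an almost descent morphism iff the elements that lift along \<open>p\<close> separate arrows, a
  descent morphism iff in addition arrows can be glued from such elements, and effective iff
  moreover every action has a quotient.

  Regular epimorphisms of \<open>V\<close> generate universally effective-epimorphic sieves, so the image
  factorizations may be replaced by the given morphisms: the elements of \<open>D(y\<^sub>0, y\<^sub>1)\<close> and of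
  \<open>D(y\<^sub>0, y\<^sub>1, y\<^sub>2)\<close> that lift to some chain of \<open>C\<close> form a universally effective-epimorphic sieve by (b)
  and (c), and those of \<open>D(y\<^sub>0, y\<^sub>1, y\<^sub>2, y\<^sub>3)\<close> at least separate arrows by (d). The quotient of an
  action along \<open>F\<close> then has hom-objects by effectiveness in (a) and (b); its composition is glued
  over composable pairs by (c), and its associativity is tested on composable triples by (d).
\<close>

section \<open>Categories\<close>

text \<open>\<open>V\<close> need not have coproducts, so the hom-morphisms over a fixed pair of
  objects of \<open>D\<close> cannot be merged into one morphism of \<open>V\<close>. They stay an
  indexed family, and an action along a family also transports elements between different indices.
  Testing with one-member families brings the hypotheses on \<open>Fam\<close> back to
  \<open>V\<close>. Two facts are visible in \<open>Fam\<close> only: the families are nonempty,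
  which makes \<open>F\<close> surjective on objects, and the quotient of an action over a
  one-member family has again a single member. The quotient of an action along \<open>F\<close> is
  built by hand. On objects a section of \<open>F\<close> selects a representative of each orbit. On
  hom-objects two stages are needed, because (a) speaks of each regular epimorphism separately and
  (b) of all the monomorphisms together; between the stages the transport across indices has to be
  glued. Working with elements keeps this equational: chosen pullbacks serve mainly as universal
  elements, at which an action is read off as an arrow.\<close>

context category
begin

abbreviation arr where "arr f \<equiv> f : Arr A"
abbreviation dom where "dom f \<equiv> Dom A f"
abbreviation cod where "cod f \<equiv> Cod A f"

abbreviation comp (infixr "**" 70) where "g ** f \<equiv> Comp A g f"

lemma arr_comp [simp]:
  "arr f ==> arr g ==> dom g = cod f ==> g ** f : Arr A"
  and dom_comp [simp]:
  "arr f ==> arr g ==> dom g = cod f ==> dom (g ** f) = dom f"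
  and cod_comp [simp]:
  "arr f ==> arr g ==> dom g = cod f ==> cod (g ** f) = cod g"
  using comp_hom[of f "dom f" "cod f" g "cod g"] by (auto simp: hom_def)

lemma comp_assoc [simp]:
  "arr f ==> arr g ==> arr h ==> dom g = cod f ==> dom h = cod g ==>
    (h ** g) ** f = h ** g ** f"
  by (rule assoc[of f "dom f" "cod f" g "cod g" h "cod h"]) (auto simp: hom_def)

lemma id_arr [simp]: "x : Obj A ==> Id A x : Arr A"
  and id_dom [simp]: "x : Obj A ==> dom (Id A x) = x"
  and id_cod [simp]: "x : Obj A ==> cod (Id A x) = x"
  using id_hom[of x] by (auto simp: hom_def)

lemma id_comp [simp]: "arr f ==> cod f = x ==> Id A x ** f = f"
  by (rule id_left[of f "dom f"]) (simp add: hom_def)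

lemma comp_id [simp]: "arr f ==> dom f = x ==> f ** Id A x = f"
  by (rule id_right[of f _ "cod f"]) (simp add: hom_def)

lemmas dom_obj' [simp] = dom_obj
lemmas cod_obj' [simp] = cod_obj

lemma comp_eq_comp:
  "g ** f = g' ** f' ==> arr f ==> arr g ==> arr f' ==> arr g' ==> arr r ==>
    dom g = cod f ==> dom g' = cod f' ==> cod r = dom f ==> cod r = dom f' ==>
    g ** f ** r = g' ** f' ** r"
  using comp_assoc[of r f g] comp_assoc[of r f' g'] by metis

lemma comp_eq_arr:
  "g ** f = h ==> arr f ==> arr g ==> arr r ==>
    dom g = cod f ==> cod r = dom f ==> g ** f ** r = h ** r"
  using comp_assoc[of r f g] by metis

lemma pullback_arrs:
  assumes "is_pullback A f g a b"
  shows "arr f" "arr g" "arr a" "arr b" "cod f = cod g"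
    "dom a = dom b" "cod a = dom f" "cod b = dom g" "f ** a = g ** b"
  using assms by (auto simp: is_pullback_def)

lemma pullback_universal:
  assumes "is_pullback A f g a b" "u : hom A q (dom f)" "v : hom A q (dom g)" "f ** u = g ** v"
  shows "\<exists>!h. h : hom A q (dom a) \<and> a ** h = u \<and> b ** h = v"
proof -
  have uv: "arr u" "arr v" "dom u = q"
    "dom u = dom v \<and> cod u = dom f \<and> cod v = dom g \<and> f ** u = g ** v"
    using assms(2-4) by (auto simp: hom_def)
  have "\<forall>u\<in>Arr A. \<forall>v\<in>Arr A. dom u = dom v \<and> cod u = dom f \<and> cod v = dom g \<and>
      f ** u = g ** v --> (\<exists>!h. h : hom A (dom u) (dom a) \<and> a ** h = u \<and> b ** h = v)"
    using assms(1) unfolding is_pullback_def by (elim conjE)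
  from mp[OF bspec[OF bspec[OF this uv(1)] uv(2)] uv(4)] uv(3) show ?thesis by simp
qed

lemma pullback_lift:
  assumes "is_pullback A f g a b" "u : hom A q (dom f)" "v : hom A q (dom g)" "f ** u = g ** v"
  obtains h where "h : hom A q (dom a)" "a ** h = u" "b ** h = v"
  using ex1_implies_ex[OF pullback_universal[OF assms]] by (elim exE conjE)

lemma pullback_eq:
  assumes "is_pullback A f g a b" "h : hom A q (dom a)" "h' : hom A q (dom a)"
    "a ** h = a ** h'" "b ** h = b ** h'"
  shows "h = h'"
proof -
  note P = pullback_arrs[OF assms(1)]
  have h: "arr h" "dom h = q" "cod h = dom a"
    using assms(2) by (auto simp: hom_def)
  have "f ** a ** h = g ** b ** h"
    using comp_eq_comp[OF P(9)] P h by simp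
  then have "\<exists>!k. k : hom A q (dom a) \<and> a ** k = a ** h \<and> b ** k = b ** h"
    using P h by (intro pullback_universal[OF assms(1)]) (simp_all add: hom_def)
  then show ?thesis
    using assms(2-5) by metis
qed

text \<open>Existence and uniqueness of the lift are separate premises: later squares get the first
  from a construction and the second from joint monicity of the projections.\<close>

lemma is_pullbackI:
  assumes "arr f" "arr g" "arr a" "arr b" "cod f = cod g"
    "dom a = dom b" "cod a = dom f" "cod b = dom g" "f ** a = g ** b"
    and "\<And>u v q. u : hom A q (dom f) ==> v : hom A q (dom g) ==> f ** u = g ** v ==>
      \<exists>h\<in>hom A q (dom a). a ** h = u \<and> b ** h = v"
    and "\<And>h h' q. h : hom A q (dom a) ==> h' : hom A q (dom a) ==>
      a ** h = a ** h' ==> b ** h = b ** h' ==> h = h'"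
  shows "is_pullback A f g a b"
  unfolding is_pullback_def
proof (intro conjI ballI impI)
  fix u v
  assume uv: "arr u" "arr v"
    "dom u = dom v \<and> cod u = dom f \<and> cod v = dom g \<and> f ** u = g ** v"
  then have "u : hom A (dom u) (dom f)" "v : hom A (dom u) (dom g)" "f ** u = g ** v"
    by (simp_all add: hom_def)
  from assms(10)[OF this]
  obtain h where h: "h : hom A (dom u) (dom a)" "a ** h = u" "b ** h = v"
    by blast
  show "\<exists>!h. h : hom A (dom u) (dom a) \<and> a ** h = u \<and> b ** h = v"
  proof (rule ex1I[of _ h])
    fix k assume "k : hom A (dom u) (dom a) \<and> a ** k = u \<and> b ** k = v"
    then show "k = h" using assms(11)[of k "dom u" h] h by simp
  qed (use h in simp)
qed (use assms in auto)

end

section \<open>Functors and equivalences\<close>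

lemma functor_hom:
  assumes "is_functor A B F" "f : hom A x y"
  shows "farr F f : hom B (fobj F x) (fobj F y)"
proof -
  have "f : Arr A" "Dom A f = x" "Cod A f = y" using assms(2) by (simp_all add: hom_def)
  then show ?thesis using assms(1) unfolding is_functor_def by metis
qed

lemma functor_comp:
  assumes "is_functor A B F" "f : hom A x y" "g : hom A y z"
  shows "farr F (Comp A g f) = Comp B (farr F g) (farr F f)"
proof -
  have "f : Arr A" "g : Arr A" "Dom A g = Cod A f" using assms(2,3) by (simp_all add: hom_def)
  then show ?thesis using assms(1) unfolding is_functor_def by metis
qed

lemma functor_id: "is_functor A B F ==> x : Obj A ==> farr F (Id A x) = Id B (fobj F x)"
  by (auto simp: is_functor_def)

lemma functor_obj: "is_functor A B F ==> x : Obj A ==> fobj F x : Obj B"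
  by (auto simp: is_functor_def)

lemma is_functor_comp_func:
  assumes "is_functor A B F" "is_functor B C G"
  shows "is_functor A C (comp_func G F)"
  unfolding is_functor_def
proof (intro conjI ballI impI)
  fix f assume "f : Arr A"
  then have "f : hom A (Dom A f) (Cod A f)" by (simp add: hom_def)
  from functor_hom[OF assms(2) functor_hom[OF assms(1) this]]
  show "farr (comp_func G F) f : hom C (fobj (comp_func G F) (Dom A f)) (fobj (comp_func G F) (Cod A f))"
    by (simp add: comp_func_def)
next
  fix f g assume "f : Arr A" "g : Arr A" "Dom A g = Cod A f"
  then have fg: "f : hom A (Dom A f) (Cod A f)" "g : hom A (Cod A f) (Cod A g)"
    by (simp_all add: hom_def)
  show "farr (comp_func G F) (Comp A g f) = Comp C (farr (comp_func G F) g) (farr (comp_func G F) f)"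
    by (simp add: comp_func_def functor_comp[OF assms(1) fg]
        functor_comp[OF assms(2) functor_hom[OF assms(1) fg(1)] functor_hom[OF assms(1) fg(2)]])
qed (use assms in \<open>simp_all add: comp_func_def is_functor_def\<close>)

lemma (in category) iso_inverse:
  assumes "is_iso A i"
  obtains j where "i : Arr A" "j : Arr A" "Dom A j = Cod A i" "Cod A j = Dom A i"
    "j ** i = Id A (Dom A i)" "i ** j = Id A (Cod A i)"
  using assms unfolding is_iso_def hom_def by blast

lemma (in category) iso_cancel_left:
  assumes "is_iso A i" "f : Arr A" "g : Arr A" "Cod A f = Dom A i" "Cod A g = Dom A i"
    "i ** f = i ** g"
  shows "f = g"
proof -
  obtain j where j: "i : Arr A" "j : Arr A" "Dom A j = Cod A i" "Cod A j = Dom A i"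
    "j ** i = Id A (Dom A i)" "i ** j = Id A (Cod A i)"
    by (rule iso_inverse[OF assms(1)])
  have "j ** i ** f = f" "j ** i ** g = g"
    using comp_eq_arr[OF j(5), of f] comp_eq_arr[OF j(5), of g] j(1-4) assms(2-5) by simp_all
  then show ?thesis using assms(6) by metis
qed

lemma (in category) iso_cancel_right:
  assumes "is_iso A i" "f : Arr A" "g : Arr A" "Dom A f = Cod A i" "Dom A g = Cod A i"
    "f ** i = g ** i"
  shows "f = g"
proof -
  obtain j where j: "i : Arr A" "j : Arr A" "Dom A j = Cod A i" "Cod A j = Dom A i"
    "j ** i = Id A (Dom A i)" "i ** j = Id A (Cod A i)"
    by (rule iso_inverse[OF assms(1)])
  have "f ** i ** j = g ** i ** j"
    using comp_eq_comp[OF assms(6), of j] j assms(2-5) by simp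
  then show ?thesis unfolding j(6) using j(1) assms(2-5) by simp
qed

text \<open>The isomorphism \<eta> makes \<open>F\<close> faithful and \<epsilon> makes
  \<open>G\<close> faithful; hence a preimage under \<open>F\<close> need only be correct after
  applying \<open>G\<close>, which gives fullness.\<close>

lemma equivalence_fully_faithful:
  assumes A: "category A" and B: "category B" and "is_equivalence A B F"
  shows "is_fully_faithful A B F"
proof -
  interpret A: category A by fact
  interpret B: category B by fact
  obtain G \<eta> \<epsilon> where F: "is_functor A B F" and G: "is_functor B A G"
    and \<eta>: "is_nat_iso A A id_func (comp_func G F) \<eta>"
    and \<epsilon>: "is_nat_iso B B (comp_func F G) id_func \<epsilon>"
    using assms(3) unfolding is_equivalence_def by blast
  have eta: "\<eta> x : hom A x (fobj G (fobj F x))" "is_iso A (\<eta> x)" if "x : Obj A" for x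
    using \<eta> that by (auto simp: is_nat_iso_def id_func_def comp_func_def)
  have eta_nat: "Comp A (\<eta> y) f = Comp A (farr G (farr F f)) (\<eta> x)" if "f : hom A x y" for f x y
    using \<eta> that by (auto simp: is_nat_iso_def id_func_def comp_func_def hom_def)
  have eps: "\<epsilon> x : hom B (fobj F (fobj G x)) x" "is_iso B (\<epsilon> x)" if "x : Obj B" for x
    using \<epsilon> that by (auto simp: is_nat_iso_def id_func_def comp_func_def)
  have eps_nat: "Comp B (\<epsilon> y) (farr F (farr G f)) = Comp B f (\<epsilon> x)" if "f : hom B x y" for f x y
    using \<epsilon> that by (auto simp: is_nat_iso_def id_func_def comp_func_def hom_def)
  have G_faithful: "f = g" if "f : hom B x y" "g : hom B x y" "farr G f = farr G g" "x : Obj B" for f g x y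
  proof (rule B.iso_cancel_right[of "\<epsilon> x" f g])
    show "Comp B f (\<epsilon> x) = Comp B g (\<epsilon> x)"
      using eps_nat[OF that(1)] eps_nat[OF that(2)] that(3) by metis
  qed (use that(1,2) eps[OF that(4)] in \<open>auto simp: hom_def\<close>)
  show ?thesis
    unfolding is_fully_faithful_def bij_betw_def
  proof (intro conjI ballI F inj_onI)
    fix x y f g
    assume xy: "x : Obj A" "y : Obj A" and fg: "f : hom A x y" "g : hom A x y" "farr F f = farr F g"
    show "f = g"
    proof (rule A.iso_cancel_left[of "\<eta> y" f g])
      show "Comp A (\<eta> y) f = Comp A (\<eta> y) g"
        using eta_nat[OF fg(1)] eta_nat[OF fg(2)] fg(3) by metis
    qed (use fg(1,2) eta[OF xy(2)] in \<open>auto simp: hom_def\<close>)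
  next
    fix x y
    assume xy: "x : Obj A" "y : Obj A"
    show "farr F ` hom A x y = hom B (fobj F x) (fobj F y)"
    proof (intro equalityI subsetI)
      fix h assume "h : farr F ` hom A x y"
      then show "h : hom B (fobj F x) (fobj F y)" using functor_hom[OF F] by auto
    next
      fix h assume h: "h : hom B (fobj F x) (fobj F y)"
      obtain j where j: "j : hom A (fobj G (fobj F y)) y" "Comp A j (\<eta> y) = Id A y"
        "Comp A (\<eta> y) j = Id A (fobj G (fobj F y))"
        using eta[OF xy(2)] by (auto simp: is_iso_def hom_def)
      \<comment> \<open>The only possible preimage of \<open>h\<close>: naturality of \<eta> forces
        \<open>\<eta> y\<close> after \<open>f\<close> to equal \<open>farr G h\<close> after
        \<open>\<eta> x\<close>.\<close>
      define f where "f = Comp A j (Comp A (farr G h) (\<eta> x))"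
      have Gh: "farr G h : hom A (fobj G (fobj F x)) (fobj G (fobj F y))"
        by (rule functor_hom[OF G h])
      have f: "f : hom A x y"
        using Gh j eta[OF xy(1)] by (auto simp: f_def hom_def)
      have "Comp A (\<eta> y) f = Comp A (farr G h) (\<eta> x)"
        using A.comp_eq_arr[OF j(3), of "Comp A (farr G h) (\<eta> x)"]
          Gh j(1) eta(1)[OF xy(1)] eta(1)[OF xy(2)] unfolding f_def
        by (simp add: hom_def)
      then have eq: "Comp A (farr G (farr F f)) (\<eta> x) = Comp A (farr G h) (\<eta> x)"
        using eta_nat[OF f] by metis
      have "farr G (farr F f) = farr G h"
        by (rule A.iso_cancel_right[OF eta(2)[OF xy(1)] _ _ _ _ eq])
          (use eta(1)[OF xy(1)] functor_hom[OF G functor_hom[OF F f]] Gh in \<open>auto simp: hom_def\<close>)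
      then have "farr F f = h"
        using G_faithful[OF functor_hom[OF F f] h] functor_obj[OF F xy(1)] by simp
      then show "h : farr F ` hom A x y" using f by blast
    qed
  qed
qed

lemma equivalence_ess_surj:
  assumes "category B" "is_equivalence A B F" "y : Obj B"
  obtains x f where "x : Obj A" "f : hom B (fobj F x) y" "is_iso B f"
proof -
  obtain G \<epsilon> where G: "is_functor B A G" and \<epsilon>: "is_nat_iso B B (comp_func F G) id_func \<epsilon>"
    using assms(2) unfolding is_equivalence_def by blast
  then show ?thesis
    using that[of "fobj G y" "\<epsilon> y"] assms(3)
    by (auto simp: is_nat_iso_def id_func_def comp_func_def is_functor_def)
qed

text \<open>A quasi-inverse arises by choosing for each object a preimage up to isomorphism and
  conjugating arrows with the chosen isomorphisms. Equations in \<open>A\<close> are checked after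
  applying \<open>F\<close>, which is injective on hom-sets.\<close>

lemma equivalenceI:
  assumes A: "category A" and B: "category B" and ff: "is_fully_faithful A B F"
    and es: "\<And>y. y : Obj B ==> \<exists>x\<in>Obj A. \<exists>f\<in>hom B (fobj F x) y. is_iso B f"
  shows "is_equivalence A B F"
proof -
  interpret A: category A by fact
  interpret B: category B by fact
  have F: "is_functor A B F" using ff by (simp add: is_fully_faithful_def)
  \<comment> \<open>The inverse \<open>j\<close> is chosen together with \<open>e\<close>, so that
    all later conjugations are by explicit arrows.\<close>
  have "\<forall>y\<in>Obj B. \<exists>x e j. x : Obj A \<and> e : hom B (fobj F x) y \<and> j : hom B y (fobj F x) \<and>
    Comp B j e = Id B (fobj F x) \<and> Comp B e j = Id B y"
  proof
    fix y assume "y : Obj B"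
    then obtain x f where x: "x : Obj A" "f : hom B (fobj F x) y" "is_iso B f" using es by blast
    then obtain j where "j : hom B y (fobj F x)"
      "Comp B j f = Id B (fobj F x)" "Comp B f j = Id B y"
      by (auto simp: is_iso_def hom_def)
    with x show "\<exists>x e j. x : Obj A \<and> e : hom B (fobj F x) y \<and> j : hom B y (fobj F x) \<and>
      Comp B j e = Id B (fobj F x) \<and> Comp B e j = Id B y"
      by blast
  qed
  then obtain g e j where gej: "\<And>y. y : Obj B ==> g y : Obj A \<and> e y : hom B (fobj F (g y)) y \<and>
    j y : hom B y (fobj F (g y)) \<and> Comp B (j y) (e y) = Id B (fobj F (g y)) \<and> Comp B (e y) (j y) = Id B y"
    by metis
  have g: "g y : Obj A" and e: "e y : Arr B" "Dom B (e y) = fobj F (g y)" "Cod B (e y) = y"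
    and j: "j y : Arr B" "Cod B (j y) = fobj F (g y)" "Dom B (j y) = y"
    and je: "Comp B (j y) (e y) = Id B (fobj F (g y))" and ej: "Comp B (e y) (j y) = Id B y"
    if "y : Obj B" for y
    using gej[OF that] by (auto simp: hom_def)
  have je': "Comp B (j y) (Comp B (e y) r) = r"
    if "y : Obj B" "r : Arr B" "Cod B r = fobj F (g y)" for y r
    using that B.comp_eq_arr[OF je, of y r] e j by simp
  have ej': "Comp B (e y) (Comp B (j y) r) = r"
    if "y : Obj B" "r : Arr B" "Cod B r = y" for y r
    using that B.comp_eq_arr[OF ej, of y r] e j by simp
  define pre where "pre x x' = the_inv_into (hom A x x') (farr F)" for x x'
  have bij: "bij_betw (farr F) (hom A x y) (hom B (fobj F x) (fobj F y))"
    if "x : Obj A" "y : Obj A" for x y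
    using ff that by (simp add: is_fully_faithful_def)
  have inj: "f = f'" if "f : hom A x y" "f' : hom A x y" "farr F f = farr F f'" for x y f f'
  proof -
    have "x : Obj A" "y : Obj A" using that(1) by (auto simp: hom_def)
    then show ?thesis using bij[of x y] that by (meson bij_betw_imp_inj_on inj_onD)
  qed
  have pre: "pre x y h : hom A x y" "farr F (pre x y h) = h"
    if "h : hom B (fobj F x) (fobj F y)" "x : Obj A" "y : Obj A" for x y h
    using bij[OF that(2,3)] that(1) unfolding pre_def bij_betw_def
    by (metis the_inv_into_into order_refl, metis f_the_inv_into_f)
  define G where "G = \<lparr>fobj = g, farr = (\<lambda>h. pre (g (Dom B h)) (g (Cod B h))
    (Comp B (j (Cod B h)) (Comp B h (e (Dom B h)))))\<rparr>"
  have Gfobj [simp]: "fobj G = g" by (simp add: G_def)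
  have conj_hom: "Comp B (j y) (Comp B h (e x)) : hom B (fobj F (g x)) (fobj F (g y))"
    if "h : hom B x y" for h x y
    using that e j by (auto simp: hom_def)
  have Gh: "farr G h : hom A (g x) (g y)" "farr F (farr G h) = Comp B (j y) (Comp B h (e x))"
    if "h : hom B x y" for h x y
    using that pre[OF conj_hom[OF that]] g by (auto simp: G_def hom_def)
  have Fobj [simp]: "fobj F x : Obj B" if "x : Obj A" for x
    using functor_obj[OF F that] .
  have G: "is_functor B A G"
    unfolding is_functor_def
  proof (intro conjI ballI impI)
    fix f h assume f: "f : Arr B" "h : Arr B" "Dom B h = Cod B f"
    then have ff: "f : hom B (Dom B f) (Cod B f)" and hh: "h : hom B (Cod B f) (Cod B h)"
      by (auto simp: hom_def)
    have "farr F (Comp A (farr G h) (farr G f)) = Comp B (farr F (farr G h)) (farr F (farr G f))"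
      by (rule functor_comp[OF F Gh(1)[OF ff] Gh(1)[OF hh]])
    also have "\<dots> = Comp B (j (Cod B h)) (Comp B (Comp B h f) (e (Dom B f)))"
      using f e j by (simp add: Gh(2)[OF ff] Gh(2)[OF hh] ej')
    also have "\<dots> = farr F (farr G (Comp B h f))"
      by (rule Gh(2)[OF B.comp_hom[OF ff hh], symmetric])
    finally show "farr G (Comp B h f) = Comp A (farr G h) (farr G f)"
      by (rule inj[OF Gh(1)[OF B.comp_hom[OF ff hh]] A.comp_hom[OF Gh(1)[OF ff] Gh(1)[OF hh]] sym])
  next
    fix x assume x: "x : Obj B"
    have "farr F (farr G (Id B x)) = farr F (Id A (g x))"
      unfolding Gh(2)[OF B.id_hom[OF x]] functor_id[OF F g[OF x]] using x e je by simp
    from inj[OF Gh(1)[OF B.id_hom[OF x]] A.id_hom[OF g[OF x]] this]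
    show "farr G (Id B x) = Id A (fobj G x)" by simp
  next
    fix f assume "f : Arr B"
    then show "farr G f : hom A (fobj G (Dom B f)) (fobj G (Cod B f))"
      unfolding Gfobj by (intro Gh(1)) (simp add: hom_def)
  qed (simp add: g)
  \<comment> \<open>The unit has to live in \<open>A\<close>, so it is the preimage under
    \<open>F\<close> of the chosen arrow \<open>j\<close> at \<open>fobj F x\<close>. The preimage
    \<open>\<eta>'\<close> of \<open>e\<close> is its inverse.\<close>
  define \<eta> where "\<eta> x = pre x (g (fobj F x)) (j (fobj F x))" for x
  define \<eta>' where "\<eta>' x = pre (g (fobj F x)) x (e (fobj F x))" for x
  have \<eta>: "\<eta> x : hom A x (g (fobj F x))" "farr F (\<eta> x) = j (fobj F x)"
    and \<eta>': "\<eta>' x : hom A (g (fobj F x)) x" "farr F (\<eta>' x) = e (fobj F x)"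
    if "x : Obj A" for x
  proof -
    have "j (fobj F x) : hom B (fobj F x) (fobj F (g (fobj F x)))"
      "e (fobj F x) : hom B (fobj F (g (fobj F x))) (fobj F x)" "g (fobj F x) : Obj A"
      using gej[OF Fobj[OF that]] by auto
    then show "\<eta> x : hom A x (g (fobj F x))" "farr F (\<eta> x) = j (fobj F x)"
      "\<eta>' x : hom A (g (fobj F x)) x" "farr F (\<eta>' x) = e (fobj F x)"
      unfolding \<eta>_def \<eta>'_def using that by (simp_all add: pre)
  qed
  have "is_nat_iso A A id_func (comp_func G F) \<eta>"
    unfolding is_nat_iso_def
  proof (intro conjI ballI)
    fix x assume x: "x : Obj A"
    show "\<eta> x : hom A (fobj id_func x) (fobj (comp_func G F) x)"
      using \<eta>[OF x] by (simp add: id_func_def comp_func_def)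
    note Fx = Fobj[OF x]
    have "farr F (Comp A (\<eta>' x) (\<eta> x)) = farr F (Id A x)"
      unfolding functor_comp[OF F \<eta>(1)[OF x] \<eta>'(1)[OF x]] functor_id[OF F x] \<eta>(2)[OF x] \<eta>'(2)[OF x]
      by (rule ej[OF Fx])
    from inj[OF A.comp_hom[OF \<eta>(1)[OF x] \<eta>'(1)[OF x]] A.id_hom[OF x] this]
    have "Comp A (\<eta>' x) (\<eta> x) = Id A x" .
    moreover
    have "farr F (Comp A (\<eta> x) (\<eta>' x)) = farr F (Id A (g (fobj F x)))"
      unfolding functor_comp[OF F \<eta>'(1)[OF x] \<eta>(1)[OF x]] functor_id[OF F g[OF Fx]] \<eta>(2)[OF x] \<eta>'(2)[OF x]
      by (rule je[OF Fx])
    from inj[OF A.comp_hom[OF \<eta>'(1)[OF x] \<eta>(1)[OF x]] A.id_hom[OF g[OF Fx]] this]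
    have "Comp A (\<eta> x) (\<eta>' x) = Id A (g (fobj F x))" .
    ultimately show "is_iso A (\<eta> x)"
      using \<eta>[OF x] \<eta>'[OF x] unfolding is_iso_def by (auto simp: hom_def)
  next
    fix f assume f: "f : Arr A"
    define x y where "x = Dom A f" and "y = Cod A f"
    have fxy: "f : hom A x y" "x : Obj A" "y : Obj A" using f by (auto simp: x_def y_def hom_def)
    note Ff = functor_hom[OF F fxy(1)]
    have eq: "farr F (Comp A (\<eta> y) f) = farr F (Comp A (farr G (farr F f)) (\<eta> x))"
      unfolding functor_comp[OF F fxy(1) \<eta>(1)[OF fxy(3)]] Gh(2)[OF Ff] \<eta>(2)[OF fxy(3)]
        functor_comp[OF F \<eta>(1)[OF fxy(2)] Gh(1)[OF Ff]] \<eta>(2)[OF fxy(2)]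
      using Ff fxy(2,3) e j ej by (simp add: hom_def)
    have "Comp A (\<eta> y) f = Comp A (farr G (farr F f)) (\<eta> x)"
      by (rule inj[OF A.comp_hom[OF fxy(1) \<eta>(1)[OF fxy(3)]] A.comp_hom[OF \<eta>(1)[OF fxy(2)] Gh(1)[OF Ff]] eq])
    then show "Comp A (\<eta> (Cod A f)) (farr id_func f) = Comp A (farr (comp_func G F) f) (\<eta> (Dom A f))"
      by (simp add: id_func_def comp_func_def x_def y_def)
  qed
  moreover have "is_nat_iso B B (comp_func F G) id_func e"
    unfolding is_nat_iso_def
  proof (intro conjI ballI)
    fix y assume y: "y : Obj B"
    show "e y : hom B (fobj (comp_func F G) y) (fobj id_func y)"
      using y e by (simp add: id_func_def comp_func_def hom_def)
    show "is_iso B (e y)"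
      unfolding is_iso_def
      by (intro conjI bexI[of _ "j y"]) (use y e j je ej in \<open>simp_all add: hom_def\<close>)
  next
    fix f assume f: "f : Arr B"
    then have "f : hom B (Dom B f) (Cod B f)" by (simp add: hom_def)
    from Gh(2)[OF this]
    show "Comp B (e (Cod B f)) (farr (comp_func F G) f) = Comp B (farr id_func f) (e (Dom B f))"
      using f e j by (simp add: id_func_def comp_func_def ej')
  qed
  ultimately show ?thesis
    using F G unfolding is_equivalence_def by blast
qed

section \<open>Descent in terms of generalized elements\<close>

locale pb_category = category A for A :: "('o, 'm) cat" +
  assumes has_pullbacks: "has_pullbacks A"

context category
begin

text \<open>A generalized element of the fibre product of \<open>f\<close> and \<open>g\<close> at
  the stage \<open>dom t\<close>, given without a choice of pullback.\<close>

definition span :: "'m => 'm => 'm => 'm => bool" where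
  "span f g t s \<longleftrightarrow> arr t \<and> arr s \<and> dom t = dom s \<and>
     cod t = dom f \<and> cod s = dom g \<and> f ** t = g ** s"

text \<open>
  The structure of an algebra of the descent monad on \<open>f\<close>, seen on generalized elements: \<open>\<alpha> t s\<close> is
  the element \<open>s\<close> transported to lie over \<open>t\<close>.
\<close>

definition action :: "'m => 'm => ('m => 'm => 'm) => bool" where
  "action p f \<alpha> \<longleftrightarrow> arr f \<and> cod f = dom p \<and>
     (\<forall>t s. span p (p ** f) t s --> \<alpha> t s : hom A (dom s) (dom f) \<and> f ** \<alpha> t s = t) \<and>
     (\<forall>t s r. span p (p ** f) t s --> arr r --> cod r = dom s -->
        \<alpha> (t ** r) (s ** r) = \<alpha> t s ** r) \<and>
     (\<forall>t t' s. span p (p ** f) t s --> span p (p ** f) t' s --> \<alpha> t' (\<alpha> t s) = \<alpha> t' s) \<and>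
     (\<forall>s. arr s --> cod s = dom f --> \<alpha> (f ** s) s = s)"

text \<open>The data of an algebra map between the base changes of \<open>g\<close> and
  \<open>g'\<close>, read on elements. The value \<open>u q\<close> depends on \<open>q\<close> but
  not on its lift \<open>t\<close>; this independence is the form that equivariance takes
  here.\<close>

definition lifts :: "'m => 'm => 'm => ('m => 'm) => bool" where
  "lifts p g g' u \<longleftrightarrow>
     (\<forall>t q. span p g t q --> u q : hom A (dom q) (dom g') \<and> g' ** u q = g ** q) \<and>
     (\<forall>t q r. span p g t q --> arr r --> cod r = dom q --> u (q ** r) = u q ** r)"

text \<open>Faithfulness of the comparison functor on elements: arrows of the slice are tested only
  on those elements \<open>q\<close> of \<open>g\<close> whose image lifts along
  \<open>p\<close>.\<close>

definition separates :: "'m => bool" where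
  "separates p \<longleftrightarrow> (\<forall>g g' k k'. arr g --> arr g' --> cod g = cod p --> cod g' = cod p -->
     k : hom A (dom g) (dom g') --> k' : hom A (dom g) (dom g') -->
     g' ** k = g --> g' ** k' = g --> (\<forall>t q. span p g t q --> k ** q = k' ** q) --> k = k')"

text \<open>Fullness of the comparison functor on elements; uniqueness of the glued arrow is left to
  \<open>separates\<close>.\<close>

definition glues :: "'m => bool" where
  "glues p \<longleftrightarrow> (\<forall>g g' u. arr g --> arr g' --> cod g = cod p --> cod g' = cod p -->
     lifts p g g' u -->
     (\<exists>k. k : hom A (dom g) (dom g') \<and> g' ** k = g \<and> (\<forall>t q. span p g t q --> k ** q = u q)))"

text \<open>Essential surjectivity of the comparison functor. The pullback square identifies
  \<open>f\<close> with the base change of \<open>g\<close>, and invariance of \<open>q\<close>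
  identifies \<alpha> with the canonical action on that base change.\<close>

definition actions_effective :: "'m => bool" where
  "actions_effective p \<longleftrightarrow> (\<forall>f \<alpha>. action p f \<alpha> -->
     (\<exists>g q. is_pullback A p g f q \<and> (\<forall>t s. span p (p ** f) t s --> q ** \<alpha> t s = q ** s)))"

lemma spanD:
  assumes "span f g t s"
  shows "arr t" "arr s" "dom t = dom s" "cod t = dom f" "cod s = dom g"
    "f ** t = g ** s"
  using assms unfolding span_def by simp_all

lemma span_comp:
  assumes "span f g t s" "arr f" "arr g" "arr r" "cod r = dom s"
  shows "span f g (t ** r) (s ** r)"
  using spanD[OF assms(1)] comp_eq_comp[OF spanD(6)[OF assms(1)], of r] assms(2-)
  by (simp add: span_def)

lemma actionD:
  assumes "action p f \<alpha>"
  shows "arr f" "cod f = dom p"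
    and "span p (p ** f) t s ==> \<alpha> t s : hom A (dom s) (dom f)"
    and "span p (p ** f) t s ==> f ** \<alpha> t s = t"
    and "span p (p ** f) t s ==> arr r ==> cod r = dom s ==> \<alpha> (t ** r) (s ** r) = \<alpha> t s ** r"
    and "span p (p ** f) t s ==> span p (p ** f) t' s ==> \<alpha> t' (\<alpha> t s) = \<alpha> t' s"
    and "arr s ==> cod s = dom f ==> \<alpha> (f ** s) s = s"
  using assms unfolding action_def by simp_all

section \<open>Slice categories and categories of algebras\<close>

lemma Slice_simps [simp]:
  "Obj (Slice A b) = {f : Arr A. cod f = b}"
  "Dom (Slice A b) (f, h, g) = f" "Cod (Slice A b) (f, h, g) = g"
  "Id (Slice A b) f = (f, Id A (dom f), f)"
  "Comp (Slice A b) (g', k, l) (f, h, g) = (f, k ** h, l)"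
  by (simp_all add: Slice_def)

lemma Slice_arr [simp]:
  "(f, h, g) : Arr (Slice A b) \<longleftrightarrow> arr f \<and> arr g \<and> cod f = b \<and> cod g = b \<and>
    arr h \<and> dom h = dom f \<and> cod h = dom g \<and> g ** h = f"
  by (auto simp: Slice_def hom_def)

lemma Slice_hom:
  "H : hom (Slice A b) f g \<longleftrightarrow> (\<exists>h. H = (f, h, g) \<and> (f, h, g) : Arr (Slice A b))"
  by (cases H) (auto simp: hom_def)

lemma Slice_homE:
  assumes "H : hom (Slice A b) f g"
  obtains h where "H = (f, h, g)" "arr f" "arr g" "cod f = b" "cod g = b"
    "arr h" "dom h = dom f" "cod h = dom g" "g ** h = f"
  using assms unfolding Slice_hom Slice_arr by (elim exE conjE)

lemma category_Slice: "category (Slice A b)"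
proof
  fix f assume "f : Arr (Slice A b)"
  then show "Dom (Slice A b) f : Obj (Slice A b)" "Cod (Slice A b) f : Obj (Slice A b)"
    by (cases f; simp)+
next
  fix f assume "f : Obj (Slice A b)"
  then show "Id (Slice A b) f : hom (Slice A b) f f"
    unfolding Slice_hom by simp
next
  fix f x y assume "f : hom (Slice A b) x y"
  from Slice_homE[OF this] obtain h where h: "f = (x, h, y)" "arr h" "dom h = dom x"
    "cod h = dom y" by metis
  then show "Comp (Slice A b) (Id (Slice A b) y) f = f" "Comp (Slice A b) f (Id (Slice A b) x) = f"
    by simp_all
next
  fix f g x y z assume f: "f : hom (Slice A b) x y" and g: "g : hom (Slice A b) y z"
  from f obtain h where h: "f = (x, h, y)" "arr x" "arr y" "cod x = b" "cod y = b"
    "arr h" "dom h = dom x" "cod h = dom y" "y ** h = x" by (rule Slice_homE)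
  from g obtain k where k: "g = (y, k, z)" "arr y" "arr z" "cod y = b" "cod z = b"
    "arr k" "dom k = dom y" "cod k = dom z" "z ** k = y" by (rule Slice_homE)
  have "z ** k ** h = x" using comp_eq_arr[OF k(9), of h] h k by simp
  then show "Comp (Slice A b) g f : hom (Slice A b) x z"
    unfolding h(1) k(1) Slice_hom using h(2-8) k(2-8) by simp
next
  fix f g h w x y z
  assume f: "f : hom (Slice A b) w x" and g: "g : hom (Slice A b) x y" and h: "h : hom (Slice A b) y z"
  from Slice_homE[OF f] obtain f' where f': "f = (w, f', x)" "arr f'" "cod f' = dom x" by metis
  from Slice_homE[OF g] obtain g' where g': "g = (x, g', y)" "arr g'" "dom g' = dom x"
    "cod g' = dom y" by metis
  from Slice_homE[OF h] obtain h' where h': "h = (y, h', z)" "arr h'" "dom h' = dom y" by metis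
  show "Comp (Slice A b) (Comp (Slice A b) h g) f = Comp (Slice A b) h (Comp (Slice A b) g f)"
    using f' g' h' by simp
qed

end

lemma EM_simps [simp]:
  "Obj (EM A T) = {X. is_algebra A T X}"
  "Dom (EM A T) (X, h, Y) = X" "Cod (EM A T) (X, h, Y) = Y"
  "Id (EM A T) X = (X, Id A (fst X), X)"
  "Comp (EM A T) (Y', k, Z) (X, h, Y) = (X, Comp A k h, Z)"
  "(X, h, Y) : Arr (EM A T) \<longleftrightarrow> is_algebra A T X \<and> is_algebra A T Y \<and>
    h : hom A (fst X) (fst Y) \<and> Comp A h (snd X) = Comp A (snd Y) (farr (mfun T) h)"
  by (simp_all add: EM_def)

lemma EM_hom:
  "H : hom (EM A T) X Y \<longleftrightarrow> (\<exists>h. H = (X, h, Y) \<and> (X, h, Y) : Arr (EM A T))"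
  by (cases H) (auto simp: hom_def)

lemma algebraD:
  assumes "is_algebra A T X"
  shows "fst X : Obj A" "snd X : hom A (fobj (mfun T) (fst X)) (fst X)"
  using assms by (cases X; simp add: is_algebra_def)+

lemma category_EM:
  assumes "category A" "is_functor A A (mfun T)"
  shows "category (EM A T)"
proof -
  interpret category A by fact
  note T = assms(2)
  show ?thesis
  proof
    fix f assume "f : Arr (EM A T)"
    then show "Dom (EM A T) f : Obj (EM A T)" "Cod (EM A T) f : Obj (EM A T)"
      by (cases f; simp)+
  next
    fix X assume X: "X : Obj (EM A T)"
    then have a: "is_algebra A T X" by simp
    have "Comp A (Id A (fst X)) (snd X) = Comp A (snd X) (farr (mfun T) (Id A (fst X)))"
      unfolding functor_id[OF T algebraD(1)[OF a]] using algebraD[OF a] by (simp add: hom_def)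
    then show "Id (EM A T) X : hom (EM A T) X X"
      using a id_hom[OF algebraD(1)[OF a]] unfolding EM_hom by simp
  next
    fix F G X Y Z assume "F : hom (EM A T) X Y" "G : hom (EM A T) Y Z"
    then obtain f g where F: "F = (X, f, Y)" "(X, f, Y) : Arr (EM A T)"
      and G: "G = (Y, g, Z)" "(Y, g, Z) : Arr (EM A T)"
      unfolding EM_hom by blast
    have f: "is_algebra A T X" "is_algebra A T Y" "f : hom A (fst X) (fst Y)"
      "f ** snd X = snd Y ** farr (mfun T) f" using F by simp_all
    have g: "is_algebra A T Z" "g : hom A (fst Y) (fst Z)"
      "g ** snd Y = snd Z ** farr (mfun T) g" using G by simp_all
    note ty = algebraD(2)[OF f(1)] algebraD(2)[OF f(2)] algebraD(2)[OF g(1)] f(3) g(2)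
      functor_hom[OF T f(3)] functor_hom[OF T g(2)]
    have "(g ** f) ** snd X = g ** snd Y ** farr (mfun T) f"
      using ty f(4) by (simp add: hom_def)
    also have "\<dots> = snd Z ** farr (mfun T) g ** farr (mfun T) f"
      by (rule comp_eq_comp[OF g(3)]) (use ty in \<open>simp_all add: hom_def\<close>)
    also have "\<dots> = snd Z ** farr (mfun T) (g ** f)"
      by (simp add: functor_comp[OF T f(3) g(2)])
    finally show "Comp (EM A T) G F : hom (EM A T) X Z"
      using F(1) G(1) f g comp_hom[OF f(3) g(2)] unfolding EM_hom by simp
  next
    fix F X Y assume "F : hom (EM A T) X Y"
    then show "Comp (EM A T) (Id (EM A T) Y) F = F" "Comp (EM A T) F (Id (EM A T) X) = F"
      unfolding EM_hom by (auto simp: id_left id_right)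
  next
    fix F G H W X Y Z
    assume "F : hom (EM A T) W X" "G : hom (EM A T) X Y" "H : hom (EM A T) Y Z"
    then show "Comp (EM A T) (Comp (EM A T) H G) F = Comp (EM A T) H (Comp (EM A T) G F)"
      unfolding EM_hom by (auto simp: assoc)
  qed
qed

section \<open>Chosen pullbacks and base change\<close>

context pb_category
begin

abbreviation pi1 where "pi1 \<equiv> pb1 A"
abbreviation pi2 where "pi2 \<equiv> pb2 A"

lemma pb_is_pullback:
  assumes "arr f" "arr g" "cod f = cod g"
  shows "is_pullback A f g (pi1 f g) (pi2 f g)"
proof -
  obtain a b where "is_pullback A f g a b"
    using has_pullbacks assms unfolding has_pullbacks_def by blast
  then have "\<exists>x. case x of (a, b) => is_pullback A f g a b" by auto
  then have "case pb A f g of (a, b) => is_pullback A f g a b" unfolding pb_def by (rule someI_ex)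
  then show ?thesis by (simp add: pb1_def pb2_def split_beta)
qed

lemma pb_simps [simp]:
  assumes "arr f" "arr g" "cod f = cod g"
  shows "pi1 f g : Arr A" "pi2 f g : Arr A" "dom (pi2 f g) = dom (pi1 f g)"
    "cod (pi1 f g) = dom f" "cod (pi2 f g) = dom g"
  using pullback_arrs[OF pb_is_pullback[OF assms]] by simp_all

lemma pb_span:
  assumes "arr f" "arr g" "cod f = cod g"
  shows "span f g (pi1 f g) (pi2 f g)"
  using assms pullback_arrs[OF pb_is_pullback[OF assms]] by (simp add: span_def)

lemma pb_pairing:
  assumes "arr f" "arr g" "cod f = cod g" "span f g t s"
  shows pb_pairing_arr: "pb_pairing A f g t s : Arr A" "dom (pb_pairing A f g t s) = dom s"
    "cod (pb_pairing A f g t s) = dom (pi1 f g)"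
    and pi1_pairing: "pi1 f g ** pb_pairing A f g t s = t"
    and pi2_pairing: "pi2 f g ** pb_pairing A f g t s = s"
proof -
  note s = spanD[OF assms(4)]
  have "\<exists>!h. h : hom A (dom t) (dom (pi1 f g)) \<and> pi1 f g ** h = t \<and> pi2 f g ** h = s"
    by (rule pullback_universal[OF pb_is_pullback[OF assms(1-3)]]) (use s in \<open>simp_all add: hom_def\<close>)
  from theI'[OF this]
  show "pb_pairing A f g t s : Arr A" "dom (pb_pairing A f g t s) = dom s"
    "cod (pb_pairing A f g t s) = dom (pi1 f g)"
    "pi1 f g ** pb_pairing A f g t s = t" "pi2 f g ** pb_pairing A f g t s = s"
    unfolding pb_pairing_def hom_def by (simp_all add: s)
qed

lemma pb_eqI:
  assumes "arr f" "arr g" "cod f = cod g"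
    and "arr h" "arr h'" "dom h = dom h'" "cod h = dom (pi1 f g)"
    "cod h' = dom (pi1 f g)" "pi1 f g ** h = pi1 f g ** h'" "pi2 f g ** h = pi2 f g ** h'"
  shows "h = h'"
  by (rule pullback_eq[OF pb_is_pullback[OF assms(1-3)]]) (use assms(4-) in \<open>simp_all add: hom_def\<close>)

lemma pi_comp_pairing:
  assumes "arr f" "arr g" "cod f = cod g" "span f g t s" "arr r" "cod r = dom s"
  shows "pi1 f g ** pb_pairing A f g t s ** r = t ** r" "pi2 f g ** pb_pairing A f g t s ** r = s ** r"
  using comp_eq_arr[OF pi1_pairing[OF assms(1-4)], of r] comp_eq_arr[OF pi2_pairing[OF assms(1-4)], of r]
    pb_pairing_arr[OF assms(1-4)] assms(1-3,5-) by simp_all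

lemma pairing_comp:
  assumes "arr f" "arr g" "cod f = cod g" "span f g t s" "arr r" "cod r = dom s"
  shows "pb_pairing A f g t s ** r = pb_pairing A f g (t ** r) (s ** r)"
proof -
  note sp = span_comp[OF assms(4,1,2,5,6)]
  show ?thesis
    by (rule pb_eqI[OF assms(1-3)])
      (use pb_pairing[OF assms(1-4)] pb_pairing[OF assms(1-3) sp] pi_comp_pairing[OF assms]
        assms(5,6) spanD[OF assms(4)] in simp_all)
qed

lemma pairing_eta:
  assumes "arr f" "arr g" "cod f = cod g" "arr h" "cod h = dom (pi1 f g)"
  shows "pb_pairing A f g (pi1 f g ** h) (pi2 f g ** h) = h" "span f g (pi1 f g ** h) (pi2 f g ** h)"
proof -
  have s: "span f g (pi1 f g ** h) (pi2 f g ** h)"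
    by (rule span_comp[OF pb_span]) (use assms in simp_all)
  show "pb_pairing A f g (pi1 f g ** h) (pi2 f g ** h) = h"
    by (rule pb_eqI[OF assms(1-3)]) (use assms pb_pairing[OF assms(1-3) s] in simp_all)
  show "span f g (pi1 f g ** h) (pi2 f g ** h)" by fact
qed

end

locale arrow_pb = pb_category A for A :: "('o, 'm) cat" +
  fixes p :: 'm
  assumes p [simp]: "p : Arr A"
begin

abbreviation \<K> where "\<K> \<equiv> descent_comparison A p"
abbreviation Talg where "Talg \<equiv> descent_algebras A p"

abbreviation pairp where "pairp \<equiv> pb_pairing A p"

lemma pb_pairing_p:
  assumes "arr g" "cod g = cod p" "span p g t s"
  shows "pairp g t s : Arr A" "dom (pairp g t s) = dom s"
    "cod (pairp g t s) = dom (pi1 p g)" "pi1 p g ** pairp g t s = t" "pi2 p g ** pairp g t s = s"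
  by (rule pb_pairing[OF p assms(1) assms(2)[symmetric] assms(3)])+

text \<open>A slice arrow preserves images in the base, so a lift along \<open>p\<close> of an
  element also lifts the image of that element.\<close>

lemma map_span:
  assumes "arr g" "arr g'" "cod g = cod p" "cod g' = cod p"
    "arr k" "dom k = dom g" "cod k = dom g'" "g' ** k = g" "span p g t s"
  shows "span p g' t (k ** s)"
  using spanD[OF assms(9)] comp_eq_arr[OF assms(8), of s] assms(1-8) by (simp add: span_def)

text \<open>The underlying arrow of the base change of the slice arrow \<open>k\<close>, kept apart
  from the triples that record slice arrows.\<close>

definition bc_map where "bc_map g g' k = pairp g' (pi1 p g) (k ** pi2 p g)"

lemma bc_map:
  assumes "arr g" "arr g'" "cod g = cod p" "cod g' = cod p"
    "arr k" "dom k = dom g" "cod k = dom g'" "g' ** k = g"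
  shows "bc_map g g' k : Arr A" "dom (bc_map g g' k) = dom (pi1 p g)"
    "cod (bc_map g g' k) = dom (pi1 p g')"
    "pi1 p g' ** bc_map g g' k = pi1 p g" "pi2 p g' ** bc_map g g' k = k ** pi2 p g"
    and "span p g t s ==> bc_map g g' k ** pairp g t s = pairp g' t (k ** s)"
proof -
  note s = map_span[OF assms pb_span[OF p assms(1) assms(3)[symmetric]]]
  show 1: "bc_map g g' k : Arr A" "dom (bc_map g g' k) = dom (pi1 p g)"
    "cod (bc_map g g' k) = dom (pi1 p g')"
    "pi1 p g' ** bc_map g g' k = pi1 p g" "pi2 p g' ** bc_map g g' k = k ** pi2 p g"
    using pb_pairing_p[OF assms(2,4) s] assms by (simp_all add: bc_map_def)
  assume t: "span p g t s"
  note P = pb_pairing_p[OF assms(1,3) t]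
  show "bc_map g g' k ** pairp g t s = pairp g' t (k ** s)"
    unfolding bc_map_def
    using pairing_comp[OF p assms(2) assms(4)[symmetric] s, of "pairp g t s"] P assms by simp
qed

lemma pushforward_functor: "is_functor (Slice A (dom p)) (Slice A (cod p)) (pushforward A p)"
  unfolding is_functor_def
proof (intro conjI ballI impI)
  fix H assume "H : Arr (Slice A (dom p))"
  then show "farr (pushforward A p) H : hom (Slice A (cod p))
      (fobj (pushforward A p) (Dom (Slice A (dom p)) H)) (fobj (pushforward A p) (Cod (Slice A (dom p)) H))"
    by (cases H) (auto simp: pushforward_def Slice_hom)
next
  fix H K assume "H : Arr (Slice A (dom p))" "K : Arr (Slice A (dom p))"
    "Dom (Slice A (dom p)) K = Cod (Slice A (dom p)) H"
  then show "farr (pushforward A p) (Comp (Slice A (dom p)) K H) =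
    Comp (Slice A (cod p)) (farr (pushforward A p) K) (farr (pushforward A p) H)"
    by (cases H; cases K) (auto simp: pushforward_def)
qed (auto simp: pushforward_def)

lemma base_change_simps:
  "fobj (base_change A p) g = pi1 p g"
  "farr (base_change A p) (g, k, g') = (pi1 p g, bc_map g g' k, pi1 p g')"
  by (simp_all add: base_change_def bc_map_def)

lemma base_change_functor: "is_functor (Slice A (cod p)) (Slice A (dom p)) (base_change A p)"
  unfolding is_functor_def
proof (intro conjI ballI impI)
  fix g assume "g : Obj (Slice A (cod p))"
  then show "fobj (base_change A p) g : Obj (Slice A (dom p))" by (simp add: base_change_simps)
next
  fix H assume "H : Arr (Slice A (cod p))"
  then show "farr (base_change A p) H : hom (Slice A (dom p))
      (fobj (base_change A p) (Dom (Slice A (cod p)) H)) (fobj (base_change A p) (Cod (Slice A (cod p)) H))"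
    by (cases H) (auto simp: base_change_simps Slice_hom bc_map)
next
  fix g assume "g : Obj (Slice A (cod p))"
  then have g: "arr g" "cod g = cod p" by simp_all
  have "bc_map g g (Id A (dom g)) = Id A (dom (pi1 p g))"
    by (rule pb_eqI[OF p g(1) g(2)[symmetric]]) (use g in \<open>simp_all add: bc_map\<close>)
  then show "farr (base_change A p) (Id (Slice A (cod p)) g) =
      Id (Slice A (dom p)) (fobj (base_change A p) g)"
    by (simp add: base_change_simps)
next
  fix H K assume "H : Arr (Slice A (cod p))" "K : Arr (Slice A (cod p))"
    "Dom (Slice A (cod p)) K = Cod (Slice A (cod p)) H"
  then obtain g h g' k g'' where HK: "H = (g, h, g')" "K = (g', k, g'')"
    and h: "(g, h, g') : Arr (Slice A (cod p))" and k: "(g', k, g'') : Arr (Slice A (cod p))"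
    by (cases H; cases K) auto
  from h have h: "arr g" "arr g'" "cod g = cod p" "cod g' = cod p"
    "arr h" "dom h = dom g" "cod h = dom g'" "g' ** h = g" by simp_all
  from k have k: "arr g'" "arr g''" "cod g' = cod p" "cod g'' = cod p"
    "arr k" "dom k = dom g'" "cod k = dom g''" "g'' ** k = g'" by simp_all
  have gkh: "g'' ** k ** h = g" using comp_eq_arr[OF k(8), of h] h k by simp
  have kh: "k ** h : Arr A" "dom (k ** h) = dom g" "cod (k ** h) = dom g''"
    using h(1-7) k(1-7) by simp_all
  note B = bc_map[OF h] bc_map[OF k] bc_map[OF h(1) k(2) h(3) k(4) kh gkh]
  have "bc_map g g'' (k ** h) = bc_map g' g'' k ** bc_map g g' h"
  proof (rule pb_eqI[OF p k(2) k(4)[symmetric]])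
    show "pi1 p g'' ** bc_map g g'' (k ** h) = pi1 p g'' ** bc_map g' g'' k ** bc_map g g' h"
      using comp_eq_arr[OF B(10), of "bc_map g g' h"] B(1-5,7-16) k(2,4) p by simp
    have "pi2 p g'' ** bc_map g' g'' k ** bc_map g g' h = k ** pi2 p g' ** bc_map g g' h"
      using comp_eq_comp[OF B(11), of "bc_map g g' h"] B(1-3,7-9) k(1-7) h(1-7) p by simp
    also have "\<dots> = pi2 p g'' ** bc_map g g'' (k ** h)"
      using B(5) B(17) h(1-7) k(1-7) p by simp
    finally show "pi2 p g'' ** bc_map g g'' (k ** h) = pi2 p g'' ** bc_map g' g'' k ** bc_map g g' h" ..
  qed (use B(1-3,7-9,13-15) in simp_all)
  then show "farr (base_change A p) (Comp (Slice A (cod p)) K H) =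
    Comp (Slice A (dom p)) (farr (base_change A p) K) (farr (base_change A p) H)"
    by (simp add: HK base_change_simps)
qed

lemma category_descent_algebras: "category Talg"
  by (rule category_EM[OF category_Slice])
    (simp add: descent_monad_def induced_monad_def
      is_functor_comp_func[OF pushforward_functor base_change_functor])

section \<open>Algebras of the descent monad as actions\<close>

abbreviation total where "total f \<equiv> pi1 p (p ** f)"

text \<open>Forgetting the first coordinate of an element of the base change leaves an element of
  \<open>g\<close>, and \<open>t\<close> is still a lift of it.\<close>

lemma span_pi1D:
  assumes "arr g" "cod g = cod p" "span p (p ** pi1 p g) t s"
  shows "span p g t (pi2 p g ** s)"
proof -
  note s = spanD[OF assms(3)]
  have P: "p ** pi1 p g = g ** pi2 p g"
    using spanD(6)[OF pb_span[OF p assms(1) assms(2)[symmetric]]] .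
  have "g ** pi2 p g ** s = p ** pi1 p g ** s"
    using comp_eq_comp[OF P, of s] s assms by simp
  then show ?thesis using s assms by (simp add: span_def)
qed

text \<open>Here \<open>total f\<close> is the value of the descent monad at \<open>f\<close>. With
  the slice triples unpacked, an algebra is an arrow \<xi> over \<open>total f\<close>; the
  multiplication is the base change of the second projection, so the last law compares two arrows
  out of the twice iterated pullback.\<close>

lemma is_algebra_iff:
  "is_algebra (Slice A (dom p)) (descent_monad A p) (f, a) \<longleftrightarrow>
    arr f \<and> cod f = dom p \<and> (\<exists>\<xi>. a = (total f, \<xi>, f) \<and>
      arr \<xi> \<and> dom \<xi> = dom (total f) \<and> cod \<xi> = dom f \<and> f ** \<xi> = total f \<and>
      \<xi> ** pairp (p ** f) f (Id A (dom f)) = Id A (dom f) \<and>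
      \<xi> ** bc_map (p ** total f) (p ** f) \<xi> = \<xi> ** bc_map (p ** total f) (p ** f) (pi2 p (p ** f)))"
proof -
  have [simp]: "mfun (descent_monad A p) = comp_func (base_change A p) (pushforward A p)"
    "munit (descent_monad A p) = bc_unit A p"
    "mmult (descent_monad A p) f = (pi1 p (p ** total f), bc_map (p ** total f) (p ** f) (pi2 p (p ** f)), total f)"
    by (simp_all add: descent_monad_def induced_monad_def pushforward_def bc_counit_def base_change_simps)
  have 1: "fobj (comp_func (base_change A p) (pushforward A p)) f = total f"
    by (simp add: comp_func_def pushforward_def base_change_simps)
  have 2: "farr (comp_func (base_change A p) (pushforward A p)) (total f, \<xi>, f) =
     (pi1 p (p ** total f), bc_map (p ** total f) (p ** f) \<xi>, total f)" for \<xi>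
    by (simp add: comp_func_def pushforward_def base_change_simps)
  show ?thesis
    unfolding is_algebra_def prod.case
    by (simp add: 1 Slice_hom) (auto simp: 2 bc_unit_def)
qed

text \<open>By the Yoneda argument an action is determined by its value at the universal span, the
  pair of projections of the chosen pullback. That value is the structure arrow.\<close>

definition structure_of :: "'m => ('m => 'm => 'm) => 'm \<times> 'm \<times> 'm" where
  "structure_of f \<alpha> = (total f, \<alpha> (total f) (pi2 p (p ** f)), f)"

text \<open>Composing the structure arrow with the pairing of a span transports an element.
  Naturality is that of the pairing; the remaining laws are the slice triangle, the multiplication
  law and the unit law, evaluated on elements.\<close>

lemma algebra_action:
  assumes "is_algebra (Slice A (dom p)) (descent_monad A p) (f, a)"
  obtains \<xi> where "a = (total f, \<xi>, f)" "arr \<xi>" "dom \<xi> = dom (total f)" "cod \<xi> = dom f"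
    "action p f (\<lambda>t s. \<xi> ** pairp (p ** f) t s)"
proof -
  from assms obtain \<xi> where f: "arr f" "cod f = dom p" and a: "a = (total f, \<xi>, f)"
    and x: "arr \<xi>" "dom \<xi> = dom (total f)" "cod \<xi> = dom f" "f ** \<xi> = total f"
    and u: "\<xi> ** pairp (p ** f) f (Id A (dom f)) = Id A (dom f)"
    and m: "\<xi> ** bc_map (p ** total f) (p ** f) \<xi> = \<xi> ** bc_map (p ** total f) (p ** f) (pi2 p (p ** f))"
    unfolding is_algebra_iff by (elim conjE exE)
  have pf: "p ** f : Arr A" "cod (p ** f) = cod p" using f by simp_all
  have "action p f (\<lambda>t s. \<xi> ** pairp (p ** f) t s)"
    unfolding action_def
  proof (intro conjI allI impI)
    fix t s assume s: "span p (p ** f) t s"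
    note P = pb_pairing_p[OF pf s]
    show "\<xi> ** pairp (p ** f) t s : hom A (dom s) (dom f)"
      using P x f by (simp add: hom_def)
    have "f ** \<xi> ** pairp (p ** f) t s = total f ** pairp (p ** f) t s"
      using comp_eq_arr[OF x(4)] P x f by simp
    then show "f ** \<xi> ** pairp (p ** f) t s = t" using P by simp
  next
    fix t s r assume s: "span p (p ** f) t s" and r: "arr r" "cod r = dom s"
    note P = pb_pairing_p[OF pf s]
    show "\<xi> ** pairp (p ** f) (t ** r) (s ** r) = (\<xi> ** pairp (p ** f) t s) ** r"
      using pairing_comp[OF p pf(1) pf(2)[symmetric] s r] P x f r by simp
  next
    fix t t' s assume s: "span p (p ** f) t s" and s': "span p (p ** f) t' s"
    note P = pb_pairing_p[OF pf s] pb_pairing_p[OF pf s']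
    note S = spanD[OF s] spanD[OF s']
    have tf: "p ** total f : Arr A" "cod (p ** total f) = cod p" using pf p by simp_all
    have tf': "p ** total f = (p ** f) ** pi2 p (p ** f)"
      using spanD(6)[OF pb_span[OF p pf(1) pf(2)[symmetric]]] .
    have tf2: "(p ** f) ** \<xi> = p ** total f" using x f by simp
    \<comment> \<open>A span whose second component is itself an element of \<open>total f\<close>,
      hence an element of the twice iterated pullback. There one side of the multiplication law
      transports twice and the other side only once.\<close>
    have sp: "span p (p ** total f) t' (pairp (p ** f) t s)"
      using S P pf f p by (simp add: span_def)
    note Q = pb_pairing_p[OF tf sp]
    have d1: "dom \<xi> = dom (p ** total f)" "cod \<xi> = dom (p ** f)"
      and d2: "pi2 p (p ** f) : Arr A" "dom (pi2 p (p ** f)) = dom (p ** total f)"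
        "cod (pi2 p (p ** f)) = dom (p ** f)"
      using x(1-3) f p pf by simp_all
    note B1 = bc_map[OF tf(1) pf(1) tf(2) pf(2) x(1) d1 tf2]
    note B2 = bc_map[OF tf(1) pf(1) tf(2) pf(2) d2 tf'[symmetric]]
    have "\<xi> ** pairp (p ** f) t' (\<xi> ** pairp (p ** f) t s) =
        \<xi> ** bc_map (p ** total f) (p ** f) \<xi> ** pairp (p ** total f) t' (pairp (p ** f) t s)"
      unfolding B1(6)[OF sp] ..
    also have "\<dots> = \<xi> ** bc_map (p ** total f) (p ** f) (pi2 p (p ** f)) **
        pairp (p ** total f) t' (pairp (p ** f) t s)"
      by (rule comp_eq_comp[OF m]) (use B1(1-3) B2(1-3) x(1-3) f p pf Q in simp_all)
    also have "\<dots> = \<xi> ** pairp (p ** f) t' s"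
      unfolding B2(6)[OF sp] using P by simp
    finally show "\<xi> ** pairp (p ** f) t' (\<xi> ** pairp (p ** f) t s) = \<xi> ** pairp (p ** f) t' s" .
  next
    fix s assume s: "arr s" "cod s = dom f"
    have sp: "span p (p ** f) f (Id A (dom f))" using f by (simp add: span_def)
    note P = pb_pairing_p[OF pf sp]
    have "\<xi> ** pairp (p ** f) (f ** s) s = \<xi> ** pairp (p ** f) f (Id A (dom f)) ** s"
      using pairing_comp[OF p pf(1) pf(2)[symmetric] sp, of s] s f by simp
    also have "\<dots> = s"
      using comp_eq_arr[OF u, of s] P s f x by simp
    finally show "\<xi> ** pairp (p ** f) (f ** s) s = s" .
  qed (use f in simp_all)
  then show ?thesis using that a x by blast
qed

text \<open>Naturality along the pairing carries the value at the universal span to every other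
  span.\<close>

lemma action_structure:
  assumes "action p f \<alpha>"
  defines "\<xi> \<equiv> \<alpha> (total f) (pi2 p (p ** f))"
  shows "arr \<xi>" "dom \<xi> = dom (total f)" "cod \<xi> = dom f" "f ** \<xi> = total f"
    and "span p (p ** f) t s ==> \<xi> ** pairp (p ** f) t s = \<alpha> t s"
proof -
  note a = actionD[OF assms(1)]
  have pf: "p ** f : Arr A" "cod (p ** f) = cod p" using a by simp_all
  note sp = pb_span[OF p pf(1) pf(2)[symmetric]]
  show "arr \<xi>" "dom \<xi> = dom (total f)" "cod \<xi> = dom f" "f ** \<xi> = total f"
    using a(3,4)[OF sp] pf by (simp_all add: \<xi>_def hom_def)
  assume s: "span p (p ** f) t s"
  note P = pb_pairing_p[OF pf s]
  show "\<xi> ** pairp (p ** f) t s = \<alpha> t s"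
    unfolding \<xi>_def using a(5)[OF sp P(1), symmetric] P pf p by simp
qed

lemma action_algebra:
  assumes "action p f \<alpha>"
  shows "is_algebra (Slice A (dom p)) (descent_monad A p) (f, structure_of f \<alpha>)"
proof -
  define \<xi> where "\<xi> = \<alpha> (total f) (pi2 p (p ** f))"
  note a = actionD[OF assms(1)]
  note x = action_structure[OF assms, folded \<xi>_def]
  have pf: "p ** f : Arr A" "cod (p ** f) = cod p" using a by simp_all
  note sp0 = pb_span[OF p pf(1) pf(2)[symmetric]]
  have tf: "p ** total f : Arr A" "cod (p ** total f) = cod p" using pf p by simp_all
  have tf': "p ** total f = (p ** f) ** pi2 p (p ** f)"
    using spanD(6)[OF pb_span[OF p pf(1) pf(2)[symmetric]]] .
  have tf2: "(p ** f) ** \<xi> = p ** total f" using x(1-4) a(1,2) by simp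
  note sp1 = pb_span[OF p tf(1) tf(2)[symmetric]]
  \<comment> \<open>The universal element of the twice iterated pullback; the multiplication law is
    the law of repeated transport at this element.\<close>
  define q1 q2 where "q1 = pi1 p (p ** total f)" and "q2 = pi2 p (p ** total f)"
  have q: "arr q1" "arr q2" "dom q1 = dom q2" "cod q1 = dom p" "cod q2 = dom (total f)"
    and qe: "p ** q1 = (p ** total f) ** q2"
    using spanD[OF sp1] tf pf p by (simp_all add: q1_def q2_def)
  have b1: "bc_map (p ** total f) (p ** f) \<xi> = pairp (p ** f) q1 (\<xi> ** q2)"
    and b2: "bc_map (p ** total f) (p ** f) (pi2 p (p ** f)) = pairp (p ** f) q1 (pi2 p (p ** f) ** q2)"
    by (simp_all add: bc_map_def q1_def q2_def)
  have s1: "span p (p ** f) q1 (\<xi> ** q2)" "span p (p ** f) q1 (pi2 p (p ** f) ** q2)"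
    unfolding q1_def q2_def
    by (rule map_span[OF tf(1) pf(1) tf(2) pf(2) _ _ _ _ sp1]; use x(1-3) tf' tf2 pf a(1,2) in simp)+
  have s2: "span p (p ** f) (total f ** q2) (pi2 p (p ** f) ** q2)"
    by (rule span_comp[OF sp0 p pf(1)]) (use q pf in simp_all)
  have "\<xi> ** bc_map (p ** total f) (p ** f) \<xi> = \<alpha> q1 (\<xi> ** q2)"
    unfolding b1 by (rule x(5)[OF s1(1)])
  also have "\<xi> ** q2 = \<alpha> (total f ** q2) (pi2 p (p ** f) ** q2)"
    using a(5)[OF sp0 q(2)] q pf by (simp add: \<xi>_def)
  also have "\<alpha> q1 (\<alpha> (total f ** q2) (pi2 p (p ** f) ** q2)) = \<alpha> q1 (pi2 p (p ** f) ** q2)"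
    by (rule a(6)[OF s2 s1(2)])
  also have "\<dots> = \<xi> ** bc_map (p ** total f) (p ** f) (pi2 p (p ** f))"
    unfolding b2 by (rule x(5)[OF s1(2), symmetric])
  finally have m: "\<xi> ** bc_map (p ** total f) (p ** f) \<xi> = \<xi> ** bc_map (p ** total f) (p ** f) (pi2 p (p ** f))" .
  have "\<xi> ** pairp (p ** f) f (Id A (dom f)) = \<alpha> f (Id A (dom f))"
    by (rule x(5)) (use a(1,2) in \<open>simp add: span_def\<close>)
  also have "\<dots> = Id A (dom f)" using a(7)[of "Id A (dom f)"] a(1) by simp
  finally show ?thesis
    unfolding is_algebra_iff structure_of_def using m x(1-4) a(1,2) by (simp add: \<xi>_def)
qed

text \<open>An element of the base change is a pair of an element of \<open>dom p\<close> and an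
  element of \<open>g\<close>; transport replaces the former and keeps the latter.\<close>

lemma canonical_action:
  assumes "arr g" "cod g = cod p"
  shows "action p (pi1 p g) (\<lambda>t s. pairp g t (pi2 p g ** s))"
proof -
  have g: "cod p = cod g" using assms by simp
  show ?thesis
  unfolding action_def
  proof (intro conjI allI impI)
    fix t s assume s: "span p (p ** pi1 p g) t s"
    note s' = span_pi1D[OF assms s]
    note P = pb_pairing_p[OF assms s']
    show "pairp g t (pi2 p g ** s) : hom A (dom s) (dom (pi1 p g))"
      using P spanD[OF s] assms by (simp add: hom_def)
    show "pi1 p g ** pairp g t (pi2 p g ** s) = t" using P by simp
    fix r assume r: "arr r" "cod r = dom s"
    show "pairp g (t ** r) (pi2 p g ** s ** r) = pairp g t (pi2 p g ** s) ** r"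
      using pairing_comp[OF p assms(1) g s' r(1)] r spanD[OF s] assms by simp
  next
    fix t t' s assume s: "span p (p ** pi1 p g) t s"
    show "pairp g t' (pi2 p g ** pairp g t (pi2 p g ** s)) = pairp g t' (pi2 p g ** s)"
      using pb_pairing_p[OF assms span_pi1D[OF assms s]] by simp
  next
    fix s assume "arr s" "cod s = dom (pi1 p g)"
    then show "pairp g (pi1 p g ** s) (pi2 p g ** s) = s"
      by (rule pairing_eta(1)[OF p assms(1) g])
  qed (use assms in simp_all)
qed

lemma comparison_obj:
  "fobj \<K> g = (pi1 p g, structure_of (pi1 p g) (\<lambda>t s. pairp g t (pi2 p g ** s)))"
  by (simp add: comparison_def structure_of_def bc_counit_def base_change_simps bc_map_def)

lemma comparison_arr:
  "farr \<K> (g, k, g') =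
    (fobj \<K> g, (pi1 p g, bc_map g g' k, pi1 p g'), fobj \<K> g')"
  by (simp add: comparison_def base_change_simps)

text \<open>Algebra maps are the equivariant arrows. The algebra condition is equivariance at the
  universal span, and naturality spreads it to all spans.\<close>

lemma algebra_arr_iff:
  assumes "action p f \<alpha>" "action p f' \<alpha>'"
  shows "((f, structure_of f \<alpha>), (f, k, f'), (f', structure_of f' \<alpha>')) : Arr Talg \<longleftrightarrow>
    arr k \<and> dom k = dom f \<and> cod k = dom f' \<and> f' ** k = f \<and>
    (\<forall>t s. span p (p ** f) t s --> k ** \<alpha> t s = \<alpha>' t (k ** s))" (is "?L \<longleftrightarrow> ?R")
proof -
  note a = actionD[OF assms(1)] and a' = actionD[OF assms(2)]
  note x = action_structure[OF assms(1)] and x' = action_structure[OF assms(2)]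
  have pf: "p ** f : Arr A" "cod (p ** f) = cod p" "p ** f' : Arr A" "cod (p ** f') = cod p"
    using a(1,2) a'(1,2) by simp_all
  note sp0 = pb_span[OF p pf(1) pf(2)[symmetric]]
  have mf: "farr (mfun (descent_monad A p)) (f, k, f') = (total f, bc_map (p ** f) (p ** f') k, total f')"
    by (simp add: descent_monad_def induced_monad_def comp_func_def pushforward_def base_change_simps)
  have "?L \<longleftrightarrow> arr k \<and> dom k = dom f \<and> cod k = dom f' \<and> f' ** k = f \<and>
    k ** \<alpha> (total f) (pi2 p (p ** f)) = \<alpha>' (total f') (pi2 p (p ** f')) ** bc_map (p ** f) (p ** f') k"
    using action_algebra[OF assms(1)] action_algebra[OF assms(2)] a(1,2) a'(1,2)
    by (simp add: structure_of_def Slice_hom mf)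
  also have "\<dots> \<longleftrightarrow> ?R"
  proof (rule iffI; elim conjE)
    assume k: "arr k" "dom k = dom f" "cod k = dom f'" "f' ** k = f"
      and e: "k ** \<alpha> (total f) (pi2 p (p ** f)) = \<alpha>' (total f') (pi2 p (p ** f')) ** bc_map (p ** f) (p ** f') k"
    have pk: "(p ** f') ** k = p ** f" using k a(1,2) a'(1,2) by simp
    have kd: "dom k = dom (p ** f)" "cod k = dom (p ** f')" using k a(1,2) a'(1,2) by simp_all
    note B = bc_map[OF pf(1,3,2,4) k(1) kd pk]
    have "k ** \<alpha> t s = \<alpha>' t (k ** s)" if s: "span p (p ** f) t s" for t s
    proof -
      note P = pb_pairing_p[OF pf(1,2) s]
      have s': "span p (p ** f') t (k ** s)"
        by (rule map_span[OF pf(1,3,2,4) k(1) kd pk s])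
      have "k ** \<alpha> t s = k ** \<alpha> (total f) (pi2 p (p ** f)) ** pairp (p ** f) t s"
        using x(5)[OF s] by simp
      also have "\<dots> = \<alpha>' (total f') (pi2 p (p ** f')) ** bc_map (p ** f) (p ** f') k ** pairp (p ** f) t s"
        by (rule comp_eq_comp[OF e]) (use x(1-3) x'(1-3) B(1-3) P k in simp_all)
      also have "\<dots> = \<alpha>' t (k ** s)"
        unfolding B(6)[OF s] by (rule x'(5)[OF s'])
      finally show ?thesis .
    qed
    then show ?R using k by blast
  next
    assume k: "arr k" "dom k = dom f" "cod k = dom f'" "f' ** k = f"
      and e: "\<forall>t s. span p (p ** f) t s --> k ** \<alpha> t s = \<alpha>' t (k ** s)"
    have pk: "(p ** f') ** k = p ** f" using k a(1,2) a'(1,2) by simp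
    have kd: "dom k = dom (p ** f)" "cod k = dom (p ** f')" using k a(1,2) a'(1,2) by simp_all
    have s': "span p (p ** f') (total f) (k ** pi2 p (p ** f))"
      by (rule map_span[OF pf(1,3,2,4) k(1) kd pk sp0])
    have "k ** \<alpha> (total f) (pi2 p (p ** f)) = \<alpha>' (total f) (k ** pi2 p (p ** f))"
      using e sp0 by blast
    also have "\<dots> = \<alpha>' (total f') (pi2 p (p ** f')) ** bc_map (p ** f) (p ** f') k"
      unfolding bc_map_def by (rule x'(5)[OF s', symmetric])
    finally show "arr k \<and> dom k = dom f \<and> cod k = dom f' \<and> f' ** k = f \<and>
      k ** \<alpha> (total f) (pi2 p (p ** f)) = \<alpha>' (total f') (pi2 p (p ** f')) ** bc_map (p ** f) (p ** f') k"
      using k by blast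
  qed
  finally show ?thesis .
qed

lemma comparison_arr_iff:
  assumes "arr g" "arr g'" "cod g = cod p" "cod g' = cod p"
  shows "H : hom Talg (fobj \<K> g) (fobj \<K> g') \<longleftrightarrow>
    (\<exists>h. H = (fobj \<K> g, (pi1 p g, h, pi1 p g'), fobj \<K> g') \<and>
      arr h \<and> dom h = dom (pi1 p g) \<and> cod h = dom (pi1 p g') \<and> pi1 p g' ** h = pi1 p g \<and>
      (\<forall>t s. span p (p ** pi1 p g) t s -->
        h ** pairp g t (pi2 p g ** s) = pairp g' t (pi2 p g' ** h ** s)))"
proof -
  note iff = algebra_arr_iff[OF canonical_action[OF assms(1,3)] canonical_action[OF assms(2,4)]]
  have "H : hom Talg (fobj \<K> g) (fobj \<K> g') \<longleftrightarrow>
    (\<exists>h. H = (fobj \<K> g, (pi1 p g, h, pi1 p g'), fobj \<K> g') \<and>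
     (fobj \<K> g, (pi1 p g, h, pi1 p g'), fobj \<K> g') : Arr Talg)"
  proof
    assume "H : hom Talg (fobj \<K> g) (fobj \<K> g')"
    then obtain H' where H': "H = (fobj \<K> g, H', fobj \<K> g')"
      "(fobj \<K> g, H', fobj \<K> g') : Arr Talg"
      unfolding EM_hom by blast
    then have "H' : hom (Slice A (dom p)) (pi1 p g) (pi1 p g')"
      by (simp add: comparison_obj)
    then obtain h where "H' = (pi1 p g, h, pi1 p g')" unfolding Slice_hom by blast
    then show "\<exists>h. H = (fobj \<K> g, (pi1 p g, h, pi1 p g'), fobj \<K> g') \<and>
     (fobj \<K> g, (pi1 p g, h, pi1 p g'), fobj \<K> g') : Arr Talg"
      using H' by blast
  qed (auto simp only: EM_hom)
  then show ?thesis unfolding comparison_obj iff .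
qed

lemma comparison_functor:
  "is_functor (Slice A (cod p)) Talg \<K>"
  unfolding is_functor_def
proof (intro conjI ballI impI)
  fix g assume "g : Obj (Slice A (cod p))"
  then show "fobj \<K> g : Obj Talg"
    by (simp add: comparison_obj action_algebra canonical_action)
next
  fix H assume "H : Arr (Slice A (cod p))"
  then obtain g k g' where H: "H = (g, k, g')" and "(g, k, g') : Arr (Slice A (cod p))"
    by (cases H) auto
  then have k: "arr g" "arr g'" "cod g = cod p" "cod g' = cod p"
    "arr k" "dom k = dom g" "cod k = dom g'" "g' ** k = g" by simp_all
  note B = bc_map[OF k]
  have "bc_map g g' k ** pairp g t (pi2 p g ** s) = pairp g' t (pi2 p g' ** bc_map g g' k ** s)"
    if "span p (p ** pi1 p g) t s" for t s
    using B(6)[OF span_pi1D[OF k(1,3) that]] comp_eq_comp[OF B(5), of s] spanD[OF that] B(1-3) k by simp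
  then show "farr \<K> H : hom Talg
      (fobj \<K> (Dom (Slice A (cod p)) H)) (fobj \<K> (Cod (Slice A (cod p)) H))"
    using B(1-4) unfolding H comparison_arr Slice_simps comparison_arr_iff[OF k(1-4)] by blast
next
  fix g assume "g : Obj (Slice A (cod p))"
  then show "farr \<K> (Id (Slice A (cod p)) g) =
      Id Talg (fobj \<K> g)"
    using functor_id[OF base_change_functor, of g]
    by (simp add: comparison_arr base_change_simps) (simp add: comparison_obj)
next
  fix H K assume "H : Arr (Slice A (cod p))" "K : Arr (Slice A (cod p))"
    "Dom (Slice A (cod p)) K = Cod (Slice A (cod p)) H"
  then show "farr \<K> (Comp (Slice A (cod p)) K H) =
    Comp Talg (farr \<K> K) (farr \<K> H)"
    using functor_comp[OF base_change_functor, of H "Dom (Slice A (cod p)) H" "Cod (Slice A (cod p)) H" K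
        "Cod (Slice A (cod p)) K"]
    by (cases H; cases K) (simp add: comparison_arr base_change_simps hom_def)
qed

section \<open>From the comparison functor to conditions on elements\<close>

lemma bc_map_eqD:
  assumes "arr g" "arr g'" "cod g = cod p" "cod g' = cod p"
    "arr k" "dom k = dom g" "cod k = dom g'" "g' ** k = g"
    and "h = bc_map g g' k" "span p g t q"
  shows "k ** q = pi2 p g' ** h ** pairp g t q"
  using bc_map(6)[OF assms(1-8,10)] pb_pairing_p(5)[OF assms(2,4) map_span[OF assms(1-8,10)]] assms(9)
  by simp

text \<open>The base change of \<open>k\<close> is determined by \<open>k\<close> after the second
  projection, and that projection is itself an element whose image lifts along
  \<open>p\<close>.\<close>

lemma faithful_separates:
  assumes "is_faithful (Slice A (cod p)) Talg \<K>"
  shows "separates p"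
  unfolding separates_def
proof (intro allI impI)
  fix g g' k k'
  assume g: "arr g" "arr g'" "cod g = cod p" "cod g' = cod p"
    and k: "k : hom A (dom g) (dom g')" "k' : hom A (dom g) (dom g')" "g' ** k = g" "g' ** k' = g"
    and e: "\<forall>t q. span p g t q --> k ** q = k' ** q"
  have "bc_map g g' k = bc_map g g' k'"
    using e pb_span[OF p g(1) g(3)[symmetric]] by (simp add: bc_map_def)
  then have "farr \<K> (g, k, g') = farr \<K> (g, k', g')"
    by (simp add: comparison_arr)
  moreover have "inj_on (farr \<K>) (hom (Slice A (cod p)) g g')"
    using assms g unfolding is_faithful_def by simp
  ultimately have "(g, k, g') = (g, k', g')"
    using k g by (elim inj_onD) (simp_all add: Slice_hom hom_def)
  then show "k = k'" by simp
qed

lemma fully_faithful_faithful: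
  "is_fully_faithful B C F ==> is_faithful B C F"
  by (simp add: is_fully_faithful_def is_faithful_def bij_betw_def)

text \<open>The data \<open>u\<close> become an arrow between the base changes. As \<open>u\<close>
  ignores the lift, this arrow commutes with transport, and fullness provides a slice arrow inducing
  it.\<close>

lemma fully_faithful_glues:
  assumes "is_fully_faithful (Slice A (cod p)) Talg \<K>"
  shows "glues p"
  unfolding glues_def
proof (intro allI impI)
  fix g g' u
  assume g: "arr g" "arr g'" "cod g = cod p" "cod g' = cod p"
    and u: "lifts p g g' u"
  have ut: "u q : Arr A" "dom (u q) = dom q" "cod (u q) = dom g'" "g' ** u q = g ** q"
    if "span p g t q" for t q
    using u that unfolding lifts_def hom_def by blast+
  have un: "u (q ** r) = u q ** r" if "span p g t q" "arr r" "cod r = dom q" for t q r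
    using u that unfolding lifts_def by blast
  note sp0 = pb_span[OF p g(1) g(3)[symmetric]]
  have us: "span p g' t (u q)" if "span p g t q" for t q
    using spanD[OF that] ut[OF that] by (simp add: span_def)
  \<comment> \<open>The value of \<open>u\<close> at the universal liftable element, placed over the
    first projection: the only candidate for the base change of the glued arrow.\<close>
  define h where "h = pairp g' (pi1 p g) (u (pi2 p g))"
  have h: "arr h" "dom h = dom (pi1 p g)" "cod h = dom (pi1 p g')" "pi1 p g' ** h = pi1 p g"
    "pi2 p g' ** h = u (pi2 p g)"
    using pb_pairing_p[OF g(2,4) us[OF sp0]] ut[OF sp0] g by (simp_all add: h_def)
  have hc: "h ** pairp g t q = pairp g' t (u q)" if "span p g t q" for t q
  proof -
    note P = pb_pairing_p[OF g(1,3) that]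
    show ?thesis
      using pairing_comp[OF p g(2) g(4)[symmetric] us[OF sp0], of "pairp g t q"] P ut[OF sp0]
        un[OF sp0, of "pairp g t q"] g by (simp add: h_def)
  qed
  have "(fobj \<K> g, (pi1 p g, h, pi1 p g'), fobj \<K> g') \<in>
     hom Talg (fobj \<K> g) (fobj \<K> g')"
    unfolding comparison_arr_iff[OF g]
  proof (intro exI conjI allI impI)
    fix t s assume s: "span p (p ** pi1 p g) t s"
    \<comment> \<open>Both sides place the same value of \<open>u\<close> over \<open>t\<close>,
      because \<open>u\<close> sees only the second coordinate of \<open>s\<close>.\<close>
    show "h ** pairp g t (pi2 p g ** s) = pairp g' t (pi2 p g' ** h ** s)"
      using hc[OF span_pi1D[OF g(1,3) s]] comp_eq_arr[OF h(5), of s] spanD[OF s] g h(1-3)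
        un[OF sp0, of s] by simp
  qed (use h in simp_all)
  moreover have "farr \<K> ` hom (Slice A (cod p)) g g' =
      hom Talg (fobj \<K> g) (fobj \<K> g')"
    using assms g unfolding is_fully_faithful_def bij_betw_def by simp
  ultimately have "(fobj \<K> g, (pi1 p g, h, pi1 p g'), fobj \<K> g') \<in>
      farr \<K> ` hom (Slice A (cod p)) g g'"
    by (simp only:)
  then obtain H where H: "H : hom (Slice A (cod p)) g g'" "farr \<K> H =
      (fobj \<K> g, (pi1 p g, h, pi1 p g'), fobj \<K> g')"
    by (elim imageE) (rule that, assumption, rule sym)
  then obtain k where Hk: "H = (g, k, g')" and k: "arr k" "dom k = dom g" "cod k = dom g'" "g' ** k = g"
    unfolding Slice_hom Slice_arr by blast
  have hk: "h = bc_map g g' k" using H(2) by (simp add: Hk comparison_arr)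
  have "k ** q = u q" if s: "span p g t q" for t q
    using bc_map_eqD[OF g k hk s] hc[OF s] pb_pairing_p(5)[OF g(2,4) us[OF s]] by simp
  then show "\<exists>k. k : hom A (dom g) (dom g') \<and> g' ** k = g \<and> (\<forall>t q. span p g t q --> k ** q = u q)"
    using k by (intro exI[of _ k]) (simp add: hom_def)
qed

text \<open>Essential surjectivity gives some \<open>g\<close> and an algebra isomorphism between
  its base change and the algebra on \<open>f\<close>; the pullback square and its invariance are
  carried to \<open>f\<close> along this isomorphism.\<close>

lemma equivalence_actions_effective:
  assumes "is_equivalence (Slice A (cod p)) Talg \<K>"
  shows "actions_effective p"
  unfolding actions_effective_def
proof (intro allI impI)
  fix f \<alpha> assume act: "action p f \<alpha>"
  note a = actionD[OF act]
  have "(f, structure_of f \<alpha>) : Obj Talg"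
    using action_algebra[OF act] by simp
  from equivalence_ess_surj[OF category_descent_algebras assms this]
  obtain g H where "g : Obj (Slice A (cod p))" and
    H: "H : hom Talg (fobj \<K> g) (f, structure_of f \<alpha>)"
    and iso: "is_iso Talg H" .
  then have g: "arr g" "cod g = cod p" by simp_all
  from iso obtain K where K: "K : hom Talg (f, structure_of f \<alpha>) (fobj \<K> g)"
    and KH: "Comp Talg K H = Id Talg (fobj \<K> g)"
    and HK: "Comp Talg H K = Id Talg (f, structure_of f \<alpha>)"
  proof -
    have "Dom Talg H = fobj \<K> g"
      "Cod Talg H = (f, structure_of f \<alpha>)"
      using H unfolding hom_def by blast+
    then show thesis using iso that unfolding is_iso_def by metis
  qed
  obtain H' where H': "H = (fobj \<K> g, H', (f, structure_of f \<alpha>))"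
      "H' : hom (Slice A (dom p)) (pi1 p g) f"
  proof -
    obtain H' where "H = (fobj \<K> g, H', (f, structure_of f \<alpha>))"
      "(fobj \<K> g, H', (f, structure_of f \<alpha>)) : Arr Talg"
      using H unfolding EM_hom by blast
    then show thesis using that[of H'] by (simp add: comparison_obj)
  qed
  obtain K' where K': "K = ((f, structure_of f \<alpha>), K', fobj \<K> g)"
      "K' : hom (Slice A (dom p)) f (pi1 p g)"
    and Karr: "K : Arr Talg"
  proof -
    obtain K' where "K = ((f, structure_of f \<alpha>), K', fobj \<K> g)"
      "((f, structure_of f \<alpha>), K', fobj \<K> g) : Arr Talg"
      using K unfolding EM_hom by blast
    then show thesis using that[of K'] by (simp add: comparison_obj)
  qed
  obtain h where h: "H' = (pi1 p g, h, f)" "arr h" "dom h = dom (pi1 p g)" "cod h = dom f"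
    "f ** h = pi1 p g" using H'(2) unfolding Slice_hom Slice_arr by blast
  obtain k where k: "K' = (f, k, pi1 p g)" "arr k" "dom k = dom f" "cod k = dom (pi1 p g)"
    "pi1 p g ** k = f" using K'(2) unfolding Slice_hom Slice_arr by blast
  have kh: "k ** h = Id A (dom (pi1 p g))" "h ** k = Id A (dom f)"
    using KH HK by (simp_all add: H' K' h(1) k(1) comparison_obj)
  have ke: "k ** \<alpha> t s = pairp g t (pi2 p g ** k ** s)" if "span p (p ** f) t s" for t s
    using Karr that unfolding K'(1) k(1) comparison_obj
      algebra_arr_iff[OF act canonical_action[OF g]] by blast
  \<comment> \<open>The second projection of the base change, moved to \<open>f\<close> by the
    isomorphism \<open>k\<close>.\<close>
  define q where "q = pi2 p g ** k"
  have q: "arr q" "dom q = dom f" "cod q = dom g" using k g by (simp_all add: q_def)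
  note sp0 = pb_span[OF p g(1) g(2)[symmetric]]
  have gq: "p ** f = g ** q"
    using comp_eq_comp[OF spanD(6)[OF sp0], of k] k g by (simp add: q_def)
  have "is_pullback A p g f q"
  proof (rule is_pullbackI)
    fix t v x assume tv: "t : hom A x (dom p)" "v : hom A x (dom g)" "p ** t = g ** v"
    then have s: "span p g t v" by (simp add: span_def hom_def)
    note P = pb_pairing_p[OF g s]
    have "f ** h ** pairp g t v = t" using comp_eq_arr[OF h(5)] h(2-4) P a(1) by simp
    moreover have "q ** h ** pairp g t v = v"
      using comp_eq_arr[OF kh(1), of "pairp g t v"] h(2-4) k(2-4) P g by (simp add: q_def)
    ultimately show "\<exists>h'\<in>hom A x (dom f). f ** h' = t \<and> q ** h' = v"
      using P h(2-4) tv by (intro bexI[of _ "h ** pairp g t v"]) (simp_all add: hom_def)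
  next
    fix s s' x assume "s : hom A x (dom f)" "s' : hom A x (dom f)"
      and e: "f ** s = f ** s'" "q ** s = q ** s'"
    then have s: "arr s" "arr s'" "cod s = dom f" "cod s' = dom f" "dom s = dom s'"
      by (simp_all add: hom_def)
    have "k ** s = k ** s'"
    proof (rule pb_eqI[OF p g(1) g(2)[symmetric]])
      show "pi1 p g ** k ** s = pi1 p g ** k ** s'"
        using comp_eq_arr[OF k(5), of s] comp_eq_arr[OF k(5), of s'] e(1) s k(2-4) g by simp
      show "pi2 p g ** k ** s = pi2 p g ** k ** s'"
        using e(2) s k(2-4) g by (simp add: q_def)
    qed (use s k(2-4) in simp_all)
    then have "h ** k ** s = h ** k ** s'" by simp
    then show "s = s'"
      using comp_eq_arr[OF kh(2), of s] comp_eq_arr[OF kh(2), of s'] s k(2-4) h(2-4) by simp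
  qed (use a(1,2) g q gq in simp_all)
  moreover have "q ** \<alpha> t s = q ** s" if s: "span p (p ** f) t s" for t s
  proof -
    note S = spanD[OF s]
    have "p ** t = g ** q ** s" using S(6) comp_eq_comp[OF gq, of s] S a(1,2) g q by simp
    then have s': "span p g t (pi2 p g ** k ** s)"
      using S a(1,2) k(2-4) g by (simp add: span_def q_def)
    have al: "\<alpha> t s : Arr A" "cod (\<alpha> t s) = dom f" using a(3)[OF s] by (simp_all add: hom_def)
    show ?thesis
      using ke[OF s] pb_pairing_p(5)[OF g s'] al S a(1,2) k(2-4) g by (simp add: q_def)
  qed
  ultimately show "\<exists>g q. is_pullback A p g f q \<and> (\<forall>t s. span p (p ** f) t s --> q ** \<alpha> t s = q ** s)"
    by blast
qed

section \<open>From conditions on elements back to the comparison functor\<close>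

lemma separates_eq:
  assumes "separates p" "arr g" "arr g'" "cod g = cod p" "cod g' = cod p"
    "k : hom A (dom g) (dom g')" "k' : hom A (dom g) (dom g')" "g' ** k = g" "g' ** k' = g"
    "\<And>t q. span p g t q ==> k ** q = k' ** q"
  shows "k = k'"
  using assms unfolding separates_def by metis

text \<open>An algebra map \<open>h\<close> between base changes induces data on the liftable
  elements of \<open>g\<close>: choose a lift, apply \<open>h\<close>, project. Gluing these data
  gives the slice arrow that induces \<open>h\<close>.\<close>

lemma comparison_fully_faithful:
  assumes "separates p" "glues p"
  shows "is_fully_faithful (Slice A (cod p)) Talg \<K>"
  unfolding is_fully_faithful_def bij_betw_def
proof (intro conjI ballI comparison_functor)
  fix g g' assume "g : Obj (Slice A (cod p))" "g' : Obj (Slice A (cod p))"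
  then have g: "arr g" "arr g'" "cod g = cod p" "cod g' = cod p" by simp_all
  note sp0 = pb_span[OF p g(1) g(3)[symmetric]]
  show "inj_on (farr \<K>) (hom (Slice A (cod p)) g g')"
  proof (rule inj_onI)
    fix H H' assume H: "H : hom (Slice A (cod p)) g g'" and H': "H' : hom (Slice A (cod p)) g g'"
      and e: "farr \<K> H = farr \<K> H'"
    obtain k where k: "H = (g, k, g')" "arr k" "dom k = dom g" "cod k = dom g'" "g' ** k = g"
      using H unfolding Slice_hom Slice_arr by blast
    obtain k' where k': "H' = (g, k', g')" "arr k'" "dom k' = dom g" "cod k' = dom g'" "g' ** k' = g"
      using H' unfolding Slice_hom Slice_arr by blast
    have "bc_map g g' k = bc_map g g' k'" using e by (simp add: k(1) k'(1) comparison_arr)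
    then have "k ** q = k' ** q" if "span p g t q" for t q
      using bc_map_eqD[OF g k(2-5) refl that] bc_map_eqD[OF g k'(2-5) refl that] by simp
    from separates_eq[OF assms(1) g _ _ k(5) k'(5) this] have "k = k'"
      using k(2-4) k'(2-4) by (simp add: hom_def)
    then show "H = H'" by (simp add: k(1) k'(1))
  qed
  show "farr \<K> ` hom (Slice A (cod p)) g g' =
      hom Talg (fobj \<K> g) (fobj \<K> g')"
  proof (intro equalityI subsetI)
    fix H assume "H : farr \<K> ` hom (Slice A (cod p)) g g'"
    then show "H : hom Talg (fobj \<K> g) (fobj \<K> g')"
      using functor_hom[OF comparison_functor] by blast
  next
    fix H assume "H : hom Talg (fobj \<K> g) (fobj \<K> g')"
    then obtain h where H: "H = (fobj \<K> g, (pi1 p g, h, pi1 p g'), fobj \<K> g')"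
      and h: "arr h" "dom h = dom (pi1 p g)" "cod h = dom (pi1 p g')" "pi1 p g' ** h = pi1 p g"
      and hs: "\<And>t s. span p (p ** pi1 p g) t s ==> h ** pairp g t (pi2 p g ** s) = pairp g' t (pi2 p g' ** h ** s)"
      unfolding comparison_arr_iff[OF g] by blast
    \<comment> \<open>Any lift of \<open>q\<close> may serve here; \<open>indep\<close> shows that
      the result does not depend on it.\<close>
    define u where "u q = pi2 p g' ** h ** pairp g (SOME t. span p g t q) q" for q
    \<comment> \<open>Equivariance of \<open>h\<close>, applied to the element of the base change
      that lies over \<open>t'\<close> and is moved to lie over \<open>t\<close>.\<close>
    have indep: "pi2 p g' ** h ** pairp g t q = pi2 p g' ** h ** pairp g t' q"
      if s: "span p g t q" and s': "span p g t' q" for t t' q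
    proof -
      note P = pb_pairing_p[OF g(1,3) s] pb_pairing_p[OF g(1,3) s']
      have sp: "span p (p ** pi1 p g) t (pairp g t' q)"
        using P spanD[OF s] spanD[OF s'] g by (simp add: span_def)
      have sp': "span p g' t (pi2 p g' ** h ** pairp g t' q)"
        using spanD[OF s] spanD[OF s'] P h(1-3) g
          comp_eq_comp[OF spanD(6)[OF pb_span[OF p g(2) g(4)[symmetric]]], of "h ** pairp g t' q"]
          comp_eq_arr[OF h(4), of "pairp g t' q"]
        by (simp add: span_def)
      have "h ** pairp g t q = pairp g' t (pi2 p g' ** h ** pairp g t' q)"
        using hs[OF sp] P by simp
      then show ?thesis using pb_pairing_p(5)[OF g(2,4) sp'] by simp
    qed
    have u: "u q = pi2 p g' ** h ** pairp g t q" if "span p g t q" for t q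
      unfolding u_def using someI[of "\<lambda>t. span p g t q", OF that] indep that by blast
    have "lifts p g g' u"
      unfolding lifts_def
    proof (intro conjI allI impI)
      fix t q assume s: "span p g t q"
      note P = pb_pairing_p[OF g(1,3) s] and S = spanD[OF s]
      show "u q : hom A (dom q) (dom g')"
        unfolding u[OF s] using P h(1-3) g S by (simp add: hom_def)
      show "g' ** u q = g ** q"
        unfolding u[OF s]
        using comp_eq_comp[OF spanD(6)[OF pb_span[OF p g(2) g(4)[symmetric]]], of "h ** pairp g t q"]
          comp_eq_arr[OF h(4), of "pairp g t q"] P h(1-3) g S by simp
      fix r assume r: "arr r" "cod r = dom q"
      note P' = pb_pairing_p[OF g(1,3) span_comp[OF s p g(1) r]]
      show "u (q ** r) = u q ** r"
        unfolding u[OF s] u[OF span_comp[OF s p g(1) r]]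
        using pairing_comp[OF p g(1) g(3)[symmetric] s r] P h(1-3) g S r by simp
    qed
    then obtain k where k: "arr k" "dom k = dom g" "cod k = dom g'" "g' ** k = g"
      and ku: "\<And>t q. span p g t q ==> k ** q = u q"
      using assms(2) g unfolding glues_def hom_def by blast
    have "pairp g (pi1 p g) (pi2 p g) = Id A (dom (pi1 p g))"
      using pairing_eta(1)[OF p g(1) g(3)[symmetric], of "Id A (dom (pi1 p g))"] g by simp
    then have k2: "k ** pi2 p g = pi2 p g' ** h"
      unfolding ku[OF sp0] u[OF sp0] using h(1-3) g by simp
    note B = bc_map(1-5)[OF g k]
    have "h = bc_map g g' k"
      by (rule pb_eqI[OF p g(2) g(4)[symmetric] h(1) B(1)]) (simp_all only: B(2-5) h(2-4) k2)
    then have "H = farr \<K> (g, k, g')"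
      by (simp add: H comparison_arr)
    moreover have "(g, k, g') : hom (Slice A (cod p)) g g'"
      using g k by (simp add: Slice_hom)
    ultimately show "H : farr \<K> ` hom (Slice A (cod p)) g g'" by blast
  qed
qed

text \<open>The given pullback of \<open>g\<close> and the chosen one are isomorphic over
  \<open>dom p\<close>, and invariance of \<open>q\<close> makes this isomorphism equivariant in
  both directions.\<close>

lemma comparison_ess_surj:
  assumes "actions_effective p" "X : Obj Talg"
  shows "\<exists>g\<in>Obj (Slice A (cod p)). \<exists>H\<in>hom Talg (fobj \<K> g) X.
    is_iso Talg H"
proof -
  obtain f a where X: "X = (f, a)" by (cases X)
  have alg: "is_algebra (Slice A (dom p)) (descent_monad A p) (f, a)" using assms(2) by (simp add: X)
  from algebra_action[OF this] obtain \<xi> where \<xi>: "a = (total f, \<xi>, f)" "arr \<xi>"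
    "dom \<xi> = dom (total f)" "cod \<xi> = dom f" and act: "action p f (\<lambda>t s. \<xi> ** pairp (p ** f) t s)" .
  define \<alpha> where "\<alpha> = (\<lambda>t s. \<xi> ** pairp (p ** f) t s)"
  note act = act[folded \<alpha>_def]
  note a = actionD[OF act]
  have pf: "p ** f : Arr A" "cod (p ** f) = cod p" using a(1,2) by simp_all
  have "pairp (p ** f) (total f) (pi2 p (p ** f)) = Id A (dom (total f))"
    using pairing_eta(1)[OF p pf(1) pf(2)[symmetric], of "Id A (dom (total f))"] pf by simp
  \<comment> \<open>Evaluated at the universal span, the action of \<xi> returns \<xi>, since the
    two projections pair to the identity.\<close>
  then have X: "X = (f, structure_of f \<alpha>)"
    using \<xi> by (simp add: X structure_of_def \<alpha>_def)
  obtain g q where pb: "is_pullback A p g f q" and q\<alpha>: "\<And>t s. span p (p ** f) t s ==> q ** \<alpha> t s = q ** s"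
    using assms(1) act unfolding actions_effective_def by blast
  note B = pullback_arrs[OF pb]
  have g: "arr g" "cod g = cod p" using B by simp_all
  note sp0 = pb_span[OF p g(1) g(2)[symmetric]]
  obtain h where "h : hom A (dom (pi1 p g)) (dom f)" and fh: "f ** h = pi1 p g" and qh: "q ** h = pi2 p g"
    by (rule pullback_lift[OF pb, of "pi1 p g" "dom (pi1 p g)" "pi2 p g"])
      (use spanD[OF sp0] in \<open>simp_all add: hom_def\<close>)
  then have h: "arr h" "dom h = dom (pi1 p g)" "cod h = dom f" by (simp_all add: hom_def)
  have sk: "span p g f q" using B by (simp add: span_def)
  define k where "k = pairp g f q"
  have k: "arr k" "dom k = dom f" "cod k = dom (pi1 p g)" "pi1 p g ** k = f" "pi2 p g ** k = q"
    using pb_pairing_p[OF g sk] B by (simp_all add: k_def)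
  have kh: "k ** h = Id A (dom (pi1 p g))"
    by (rule pb_eqI[OF p g(1) g(2)[symmetric]])
      (use comp_eq_arr[OF k(4), of h] comp_eq_arr[OF k(5), of h] k(1-3) h fh qh g in simp_all)
  have hk: "h ** k = Id A (dom f)"
    by (rule pullback_eq[OF pb, of _ "dom f"])
      (use comp_eq_arr[OF fh, of k] comp_eq_arr[OF qh, of k] k h B in \<open>simp_all add: hom_def\<close>)
  define Kg where "Kg = fobj \<K> g"
  have Kg: "Kg = (pi1 p g, structure_of (pi1 p g) (\<lambda>t s. pairp g t (pi2 p g ** s)))"
    by (simp add: Kg_def comparison_obj)
  have "h ** pairp g t (pi2 p g ** s) = \<alpha> t (h ** s)" if s: "span p (p ** pi1 p g) t s" for t s
  proof (rule pullback_eq[OF pb, of _ "dom s"])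
    note s1 = span_pi1D[OF g s]
    note P = pb_pairing_p[OF g s1] and S = spanD[OF s]
    have s2: "span p (p ** f) t (h ** s)"
      using S h B(3,7) g comp_eq_arr[OF fh, of s] by (simp add: span_def)
    show "h ** pairp g t (pi2 p g ** s) : hom A (dom s) (dom f)" "\<alpha> t (h ** s) : hom A (dom s) (dom f)"
      using a(3)[OF s2] P h S g by (simp_all add: hom_def)
    show "f ** h ** pairp g t (pi2 p g ** s) = f ** \<alpha> t (h ** s)"
      unfolding a(4)[OF s2] using comp_eq_arr[OF fh, of "pairp g t (pi2 p g ** s)"] P h B by simp
    show "q ** h ** pairp g t (pi2 p g ** s) = q ** \<alpha> t (h ** s)"
    proof -
      have "q ** h ** pairp g t (pi2 p g ** s) = pi2 p g ** pairp g t (pi2 p g ** s)"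
        by (rule comp_eq_arr[OF qh]) (use P(1-3) h B(3,4,6) in simp_all)
      also have "\<dots> = q ** h ** s"
        unfolding P(5) by (rule comp_eq_arr[OF qh, symmetric]) (use S(1-5) h B(3,4,6) g in simp_all)
      finally show ?thesis unfolding q\<alpha>[OF s2] .
    qed
  qed
  then have H: "(Kg, (pi1 p g, h, f), X) : Arr Talg"
    unfolding Kg X algebra_arr_iff[OF canonical_action[OF g] act] using h fh by blast
  have "k ** \<alpha> t s = pairp g t (pi2 p g ** k ** s)" if s: "span p (p ** f) t s" for t s
  proof (rule pb_eqI[OF p g(1) g(2)[symmetric]])
    note S = spanD[OF s]
    have al: "\<alpha> t s : Arr A" "dom (\<alpha> t s) = dom s" "cod (\<alpha> t s) = dom f"
      using a(3)[OF s] by (simp_all add: hom_def)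
    have e: "pi2 p g ** k ** s = q ** s"
      by (rule comp_eq_arr[OF k(5)]) (use S(1-5) k(1-3) B(3,7) g in simp_all)
    have "g ** q ** s = p ** f ** s"
      by (rule comp_eq_comp[OF B(9)[symmetric]]) (use S(1-5) B(1-8) in simp_all)
    then have s': "span p g t (q ** s)"
      using S B(1-8) by (simp add: span_def)
    note P = pb_pairing_p[OF g s']
    show "k ** \<alpha> t s : Arr A" "cod (k ** \<alpha> t s) = dom (pi1 p g)" using al k by simp_all
    show "pairp g t (pi2 p g ** k ** s) : Arr A" "cod (pairp g t (pi2 p g ** k ** s)) = dom (pi1 p g)"
      "dom (k ** \<alpha> t s) = dom (pairp g t (pi2 p g ** k ** s))"
      unfolding e using P(1-3) al k(1-3) S(1-5) B(1-8) by simp_all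
    show "pi1 p g ** k ** \<alpha> t s = pi1 p g ** pairp g t (pi2 p g ** k ** s)"
      unfolding e P(4) using comp_eq_arr[OF k(4), of "\<alpha> t s"] a(4)[OF s] al k(1-3) g by simp
    show "pi2 p g ** k ** \<alpha> t s = pi2 p g ** pairp g t (pi2 p g ** k ** s)"
      unfolding e P(5) using comp_eq_arr[OF k(5), of "\<alpha> t s"] q\<alpha>[OF s] al k(1-3) g by simp
  qed
  then have K: "(X, (f, k, pi1 p g), Kg) : Arr Talg"
    unfolding Kg X algebra_arr_iff[OF act canonical_action[OF g]] using k by blast
  have "is_iso Talg (Kg, (pi1 p g, h, f), X)"
    unfolding is_iso_def
  proof (intro conjI bexI[of _ "(X, (f, k, pi1 p g), Kg)"] H)
    show "Comp Talg (X, (f, k, pi1 p g), Kg) (Kg, (pi1 p g, h, f), X) =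
        Id Talg (Dom Talg (Kg, (pi1 p g, h, f), X))"
      by (simp add: kh) (simp add: Kg)
    show "Comp Talg (Kg, (pi1 p g, h, f), X) (X, (f, k, pi1 p g), Kg) =
        Id Talg (Cod Talg (Kg, (pi1 p g, h, f), X))"
      by (simp add: hk) (simp add: X)
    show "(X, (f, k, pi1 p g), Kg) : hom Talg
       (Cod Talg (Kg, (pi1 p g, h, f), X)) (Dom Talg (Kg, (pi1 p g, h, f), X))"
      using K unfolding hom_def by simp
  qed
  moreover have "(Kg, (pi1 p g, h, f), X) : hom Talg (fobj \<K> g) X"
    unfolding EM_hom Kg_def[symmetric] using H by blast
  ultimately show ?thesis using g by (intro bexI[of _ g]) auto
qed

end

lemma almost_descent_separates:
  assumes "almost_descent A p"
  shows "category.separates A p"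
proof -
  interpret category A using assms by (simp add: almost_descent_def)
  interpret arrow_pb A p using assms by unfold_locales (simp_all add: almost_descent_def)
  show ?thesis using assms by (intro faithful_separates) (simp add: almost_descent_def)
qed

lemma descent_glues:
  assumes "descent A p"
  shows "category.glues A p" "category.separates A p"
proof -
  interpret category A using assms by (simp add: descent_def)
  interpret arrow_pb A p using assms by unfold_locales (simp_all add: descent_def)
  have "is_fully_faithful (Slice A (Cod A p)) (descent_algebras A p) (descent_comparison A p)"
    using assms by (simp add: descent_def)
  then show "glues p" "separates p"
    by (rule fully_faithful_glues, intro faithful_separates fully_faithful_faithful)
qed

text \<open>The three conditions are faithfulness, fullness and essential surjectivity of the
  comparison functor, in this order. They mention neither chosen pullbacks nor algebras, so descent
  in \<open>V\<close>, among families and along enriched functors can be compared through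
  them.\<close>

lemma effective_descent_iff:
  assumes "category A" "has_pullbacks A" "p : Arr A"
  shows "effective_descent A p \<longleftrightarrow>
    category.separates A p \<and> category.glues A p \<and> category.actions_effective A p"
proof -
  interpret category A by fact
  interpret arrow_pb A p using assms by unfold_locales
  have 1: "effective_descent A p \<longleftrightarrow>
      is_equivalence (Slice A (Cod A p)) (descent_algebras A p) (descent_comparison A p)"
    using assms by (simp add: effective_descent_def)
  show ?thesis
  proof
    assume "effective_descent A p"
    then have e: "is_equivalence (Slice A (Cod A p)) (descent_algebras A p) (descent_comparison A p)"
      unfolding 1 .
    have ff: "is_fully_faithful (Slice A (Cod A p)) (descent_algebras A p) (descent_comparison A p)"
      by (rule equivalence_fully_faithful[OF category_Slice category_descent_algebras e])
    show "separates p \<and> glues p \<and> actions_effective p"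
      by (intro conjI fully_faithful_glues[OF ff] equivalence_actions_effective[OF e]
          faithful_separates[OF fully_faithful_faithful[OF ff]])
  next
    assume "separates p \<and> glues p \<and> actions_effective p"
    then show "effective_descent A p"
      unfolding 1
      by (intro equivalenceI category_Slice category_descent_algebras comparison_fully_faithful
          comparison_ess_surj) auto
  qed
qed

section \<open>Finite limits\<close>

definition discrete_cat :: "nat set => (nat, nat) cat" where
  "discrete_cat S = \<lparr>Obj = S, Arr = S, Dom = (\<lambda>i. i), Cod = (\<lambda>i. i), Id = (\<lambda>i. i), Comp = (\<lambda>g f. f)\<rparr>"

text \<open>The objects 0, 1, 2 are their own identities, and the arrows 3 and 4 go from 0 and 1 to
  2. In every composite at least one factor is an identity: if \<open>f\<close> is 3 or 4 then
  \<open>g\<close> is the identity 2, and otherwise \<open>f\<close> is an identity.\<close>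

definition cospan_cat :: "(nat, nat) cat" where
  "cospan_cat = \<lparr>Obj = {0, 1, 2}, Arr = {0, 1, 2, 3, 4},
     Dom = (\<lambda>i. if i = 3 then 0 else if i = 4 then 1 else i),
     Cod = (\<lambda>i. if i = 3 \<or> i = 4 then 2 else i), Id = (\<lambda>i. i),
     Comp = (\<lambda>g f. if f = 3 \<or> f = 4 then f else g)\<rparr>"

lemma category_discrete_cat: "category (discrete_cat S)"
  by unfold_locales (auto simp: discrete_cat_def hom_def)

lemma category_cospan_cat: "category cospan_cat"
  by unfold_locales (auto simp: cospan_cat_def hom_def split: if_splits)

text \<open>Serves twice: two indices give binary products and none gives the terminal
  object.\<close>

lemma (in category) discrete_limit:
  fixes S :: "nat set"
  assumes "has_finite_limits A" "finite S" "\<And>i. i : S ==> x i : Obj A"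
  obtains l \<pi> where "l : Obj A" "\<And>i. i : S ==> \<pi> i : hom A l (x i)"
    "\<And>l' \<pi>'. l' : Obj A ==> (\<And>i. i : S ==> \<pi>' i : hom A l' (x i)) ==>
      \<exists>!h. h : hom A l' l \<and> (\<forall>i\<in>S. \<pi> i ** h = \<pi>' i)"
proof -
  define F where "F = \<lparr>fobj = x, farr = (\<lambda>i. Id A (x i))\<rparr>"
  have "is_functor (discrete_cat S) A F"
    using assms(3) by (auto simp: is_functor_def discrete_cat_def F_def id_hom)
  then obtain l \<pi> where l: "is_limit (discrete_cat S) A F l \<pi>"
    using assms(1,2) category_discrete_cat[of S] unfolding has_finite_limits_def
    by (metis discrete_cat_def cat.simps(1,2))
  have cone: "is_cone (discrete_cat S) A F l' \<pi>' \<longleftrightarrow> l' : Obj A \<and> (\<forall>i\<in>S. \<pi>' i : hom A l' (x i))" for l' \<pi>'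
    unfolding is_cone_def by (auto simp: discrete_cat_def F_def hom_def)
  have [simp]: "Obj (discrete_cat S) = S" by (simp add: discrete_cat_def)
  show thesis
    using that[of l \<pi>] l unfolding is_limit_def cone by simp
qed

lemma (in category) finite_limits_products:
  assumes "has_finite_limits A" "x : Obj A" "y : Obj A"
  shows "\<exists>a b. is_product A x y a b"
proof -
  define z where "z i = (if i = (0 :: nat) then x else y)" for i
  obtain l \<pi> where l: "l : Obj A" "\<And>i. i : {0, 1} ==> \<pi> i : hom A l (z i)"
    and u: "\<And>l' \<pi>'. l' : Obj A ==> (\<And>i. i : {0, 1} ==> \<pi>' i : hom A l' (z i)) ==>
      \<exists>!h. h : hom A l' l \<and> (\<forall>i\<in>{0, 1}. \<pi> i ** h = \<pi>' i)"
  proof (rule discrete_limit[OF assms(1), of "{0, 1}" z])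
    show "z i : Obj A" for i using assms(2,3) by (simp add: z_def)
  qed (use that in blast)+
  have p: "\<pi> 0 : hom A l x" "\<pi> 1 : hom A l y" using l(2)[of 0] l(2)[of 1] by (simp_all add: z_def)
  have "is_product A x y (\<pi> 0) (\<pi> 1)"
    unfolding is_product_def
  proof (intro conjI ballI impI)
    fix a b assume a: "a : Arr A" "b : Arr A" "Dom A a = Dom A b \<and> Cod A a = x \<and> Cod A b = y"
    have "\<exists>!h. h : hom A (Dom A a) l \<and> (\<forall>i\<in>{0, 1}. \<pi> i ** h = (if i = 0 then a else b))"
      by (rule u) (use a in \<open>auto simp: z_def hom_def\<close>)
    then show "\<exists>!h. h : hom A (Dom A a) (Dom A (\<pi> 0)) \<and> \<pi> 0 ** h = a \<and> \<pi> 1 ** h = b"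
      using p by (simp add: hom_def)
  qed (use p in \<open>simp_all add: hom_def\<close>)
  then show ?thesis by blast
qed

lemma (in category) finite_limits_terminal:
  assumes "has_finite_limits A"
  shows "\<exists>t. is_terminal A t"
proof -
  obtain l where "l : Obj A" "\<And>l'. l' : Obj A ==> \<exists>!h. h : hom A l' l"
    by (rule discrete_limit[OF assms, of "{}" "\<lambda>_. undefined"]) auto
  then show ?thesis unfolding is_terminal_def by blast
qed

lemma (in category) finite_limits_pullbacks:
  assumes "has_finite_limits A"
  shows "has_pullbacks A"
  unfolding has_pullbacks_def
proof (intro ballI impI)
  fix f g assume fg: "f : Arr A" "g : Arr A" "Cod A f = Cod A g"
  define F where "F = \<lparr>fobj = (\<lambda>i. if i = (0 :: nat) then Dom A f else if i = 1 then Dom A g else Cod A f),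
    farr = (\<lambda>i. if i = 3 then f else if i = 4 then g else
      Id A (if i = (0 :: nat) then Dom A f else if i = 1 then Dom A g else Cod A f))\<rparr>"
  have arr: "Arr cospan_cat = {0, 1, 2, 3, 4}" "Obj cospan_cat = {0, 1, 2}" by (simp_all add: cospan_cat_def)
  have "is_functor cospan_cat A F"
    unfolding is_functor_def arr using fg
    by (simp add: cospan_cat_def F_def hom_def)
  then obtain l \<pi> where l: "is_limit cospan_cat A F l \<pi>"
    using assms category_cospan_cat unfolding has_finite_limits_def
    by (metis arr finite.emptyI finite.insertI)
  \<comment> \<open>The third leg of a cone is determined by either of the other two, so that cones
    over the cospan are commuting squares.\<close>
  have cone: "is_cone cospan_cat A F l' \<pi>' \<longleftrightarrow> l' : Obj A \<and> \<pi>' 0 : hom A l' (Dom A f) \<and>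
      \<pi>' 1 : hom A l' (Dom A g) \<and> f ** \<pi>' 0 = \<pi>' 2 \<and> g ** \<pi>' 1 = \<pi>' 2" for l' \<pi>'
  proof (rule iffI; (elim conjE)?)
    assume "is_cone cospan_cat A F l' \<pi>'"
    then show "l' : Obj A \<and> \<pi>' 0 : hom A l' (Dom A f) \<and>
      \<pi>' 1 : hom A l' (Dom A g) \<and> f ** \<pi>' 0 = \<pi>' 2 \<and> g ** \<pi>' 1 = \<pi>' 2"
      unfolding is_cone_def arr using fg by (simp add: F_def cospan_cat_def)
  next
    assume c: "l' : Obj A" "\<pi>' 0 : hom A l' (Dom A f)" "\<pi>' 1 : hom A l' (Dom A g)"
      "f ** \<pi>' 0 = \<pi>' 2" "g ** \<pi>' 1 = \<pi>' 2"
    have "f ** \<pi>' 0 : hom A l' (Cod A f)" using c(2) fg by (simp add: hom_def)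
    then have "\<pi>' 2 : hom A l' (Cod A f)" unfolding c(4) .
    with c show "is_cone cospan_cat A F l' \<pi>'"
      unfolding is_cone_def arr using fg by (simp add: F_def cospan_cat_def hom_def)
  qed
  define a b where "a = \<pi> 0" and "b = \<pi> 1"
  have ab: "l : Obj A" "a : hom A l (Dom A f)" "b : hom A l (Dom A g)" "f ** a = g ** b" and c: "\<pi> 2 = f ** a"
    using l unfolding is_limit_def cone a_def b_def by auto
  have u: "\<exists>!h. h : hom A q l \<and> a ** h = u \<and> b ** h = v"
    if "q : Obj A" "u : hom A q (Dom A f)" "v : hom A q (Dom A g)" "f ** u = g ** v" for q u v
  proof -
    have "is_cone cospan_cat A F q (\<lambda>i. if i = 0 then u else if i = 1 then v else f ** u)"
      unfolding cone using that by simp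
    then have 1: "\<exists>!h. h : hom A q l \<and> (\<forall>i\<in>Obj cospan_cat. \<pi> i ** h = (if i = 0 then u else if i = 1 then v else f ** u))"
      using l unfolding is_limit_def by blast
    have 2: "(f ** a) ** h = f ** u" if "h : hom A q l" "a ** h = u" for h
      using that ab(2) fg(1) comp_assoc[of h a f] by (simp add: hom_def)
    have "(h : hom A q l \<and> (\<forall>i\<in>Obj cospan_cat. \<pi> i ** h = (if i = 0 then u else if i = 1 then v else f ** u))) \<longleftrightarrow>
      (h : hom A q l \<and> a ** h = u \<and> b ** h = v)" for h
      unfolding arr using 2[of h] by (simp add: a_def b_def c) blast
    with 1 show ?thesis by simp
  qed
  have "is_pullback A f g a b"
  proof (rule is_pullbackI)
    fix u v q assume "u : hom A q (Dom A f)" "v : hom A q (Dom A g)" "f ** u = g ** v"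
    moreover from this have "q : Obj A" by (auto simp: hom_def)
    ultimately show "\<exists>h\<in>hom A q (Dom A a). a ** h = u \<and> b ** h = v"
      using u[of q u v] ab(2) by (auto simp: hom_def)
  next
    fix h h' q assume h: "h : hom A q (Dom A a)" "h' : hom A q (Dom A a)" "a ** h = a ** h'" "b ** h = b ** h'"
    have d: "Dom A a = l" "q : Obj A" using ab(2) h by (auto simp: hom_def)
    have "\<exists>!k. k : hom A q l \<and> a ** k = a ** h \<and> b ** k = b ** h"
    proof (rule u)
      show "f ** a ** h = g ** b ** h"
        by (rule comp_eq_comp[OF ab(4)]) (use ab(1-3) fg h(1) d in \<open>simp_all add: hom_def\<close>)
    qed (use d h ab in \<open>simp_all add: hom_def\<close>)
    then show "h = h'" using h d by metis
  qed (use ab fg in \<open>simp_all add: hom_def\<close>)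
  then show "\<exists>a b. is_pullback A f g a b" by blast
qed

section \<open>Calculus of products and the terminal object\<close>

locale cartesian = pb_category A for A :: "('o, 'm) cat" +
  assumes has_products: "x : Obj A ==> y : Obj A ==> \<exists>a b. is_product A x y a b"
    and has_terminal: "\<exists>t. is_terminal A t"
begin

lemma prod_cone_is_product:
  assumes "x : Obj A" "y : Obj A"
  shows "is_product A x y (pr1 A x y) (pr2 A x y)"
proof -
  have "\<exists>z. case z of (a, b) => is_product A x y a b" using has_products[OF assms] by auto
  then have "case prod_cone A x y of (a, b) => is_product A x y a b"
    unfolding prod_cone_def by (rule someI_ex)
  then show ?thesis by (simp add: pr1_def pr2_def split_beta)
qed

lemma pr_simps [simp]:
  assumes "x : Obj A" "y : Obj A"
  shows "pr1 A x y : Arr A" "pr2 A x y : Arr A" "dom (pr1 A x y) = prod_obj A x y"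
    "dom (pr2 A x y) = prod_obj A x y" "cod (pr1 A x y) = x" "cod (pr2 A x y) = y"
    "prod_obj A x y : Obj A"
  using prod_cone_is_product[OF assms] unfolding is_product_def prod_obj_def by auto

lemma product_universal:
  assumes "arr u" "arr v" "dom u = dom v"
  shows "\<exists>!h. h : hom A (dom u) (prod_obj A (cod u) (cod v)) \<and>
    pr1 A (cod u) (cod v) ** h = u \<and> pr2 A (cod u) (cod v) ** h = v"
proof -
  have "\<forall>u'\<in>Arr A. \<forall>v'\<in>Arr A. dom u' = dom v' \<and> cod u' = cod u \<and> cod v' = cod v -->
        (\<exists>!h. h : hom A (dom u') (dom (pr1 A (cod u) (cod v))) \<and>
          pr1 A (cod u) (cod v) ** h = u' \<and> pr2 A (cod u) (cod v) ** h = v')"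
    using prod_cone_is_product[of "cod u" "cod v"] assms(1,2) unfolding is_product_def by simp
  from mp[OF bspec[OF bspec[OF this assms(1)] assms(2)]] show ?thesis
    using assms by simp
qed

lemma pairing_simps [simp]:
  assumes "arr u" "arr v" "dom u = dom v" "cod u = x" "cod v = y"
  shows "pairing A u v : Arr A" "dom (pairing A u v) = dom v"
    "cod (pairing A u v) = prod_obj A x y"
    "pr1 A x y ** pairing A u v = u" "pr2 A x y ** pairing A u v = v"
  using theI'[OF product_universal[OF assms(1-3)]] assms unfolding pairing_def hom_def by auto

lemma pairing_pr [simp]:
  assumes "arr u" "arr v" "dom u = dom v" "cod u = x" "cod v = y"
    "arr r" "cod r = dom v"
  shows "pr1 A x y ** pairing A u v ** r = u ** r" "pr2 A x y ** pairing A u v ** r = v ** r"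
proof -
  note P = pairing_simps[OF assms(1-5)]
  have "x : Obj A" "y : Obj A" using assms by auto
  then show "pr1 A x y ** pairing A u v ** r = u ** r" "pr2 A x y ** pairing A u v ** r = v ** r"
    using comp_eq_arr[OF P(4), of r] comp_eq_arr[OF P(5), of r] P(1-3) assms(6,7) by simp_all
qed

lemma product_eqI:
  assumes "arr h" "arr h'" "dom h = dom h'" "cod h = prod_obj A x y" "cod h' = prod_obj A x y"
    "x : Obj A" "y : Obj A" "pr1 A x y ** h = pr1 A x y ** h'" "pr2 A x y ** h = pr2 A x y ** h'"
  shows "h = h'"
proof -
  have "\<exists>!k. k : hom A (dom (pr1 A x y ** h)) (prod_obj A (cod (pr1 A x y ** h)) (cod (pr2 A x y ** h))) \<and>
    pr1 A (cod (pr1 A x y ** h)) (cod (pr2 A x y ** h)) ** k = pr1 A x y ** h \<and>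
    pr2 A (cod (pr1 A x y ** h)) (cod (pr2 A x y ** h)) ** k = pr2 A x y ** h"
    by (rule product_universal) (use assms(1-7) in simp_all)
  then have "\<exists>!k. k : hom A (dom h) (prod_obj A x y) \<and> pr1 A x y ** k = pr1 A x y ** h \<and> pr2 A x y ** k = pr2 A x y ** h"
    using assms(1-7) by simp
  then show ?thesis using assms(1-5,8,9) unfolding hom_def by (metis (mono_tags, lifting) mem_Collect_eq)
qed

lemma pairing_comp' [simp]:
  assumes "arr u" "arr v" "dom u = dom v" "arr r" "cod r = dom v"
  shows "pairing A u v ** r = pairing A (u ** r) (v ** r)"
  by (rule product_eqI[of _ _ "cod u" "cod v"]) (use assms in simp_all)

lemma pairing_eta [simp]:
  assumes "arr h" "cod h = prod_obj A x y" "x : Obj A" "y : Obj A"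
  shows "pairing A (pr1 A x y ** h) (pr2 A x y ** h) = h"
  by (rule product_eqI[of _ _ x y]) (use assms in simp_all)

lemma pairing_pr_id [simp]:
  assumes "x : Obj A" "y : Obj A"
  shows "pairing A (pr1 A x y) (pr2 A x y) = Id A (prod_obj A x y)"
  by (rule product_eqI[of _ _ x y]) (use assms in simp_all)

lemma prod_arr_simps [simp]:
  assumes "arr f" "arr g"
  shows "prod_arr A f g : Arr A" "dom (prod_arr A f g) = prod_obj A (dom f) (dom g)"
    "cod (prod_arr A f g) = prod_obj A (cod f) (cod g)"
  using assms by (simp_all add: prod_arr_def)

lemma prod_arr_pairing [simp]:
  assumes "arr f" "arr g" "arr u" "arr v" "dom u = dom v"
    "cod u = dom f" "cod v = dom g"
  shows "prod_arr A f g ** pairing A u v = pairing A (f ** u) (g ** v)"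
  using assms by (simp add: prod_arr_def)

lemma associator_pairing:
  assumes "arr u" "arr v" "arr w" "dom u = dom w" "dom v = dom w"
    "cod u = x" "cod v = y" "cod w = z"
  shows "associator A x y z ** pairing A (pairing A u v) w = pairing A u (pairing A v w)"
    "associator A x y z : Arr A" "dom (associator A x y z) = prod_obj A (prod_obj A x y) z"
    "cod (associator A x y z) = prod_obj A x (prod_obj A y z)"
proof -
  have "x : Obj A" "y : Obj A" "z : Obj A" using assms by auto
  then show "associator A x y z ** pairing A (pairing A u v) w = pairing A u (pairing A v w)"
    "associator A x y z : Arr A" "dom (associator A x y z) = prod_obj A (prod_obj A x y) z"
    "cod (associator A x y z) = prod_obj A x (prod_obj A y z)"
    using assms by (simp_all add: associator_def Let_def)
qed

lemma unit_terminal: "is_terminal A (unit_obj A)"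
  unfolding unit_obj_def by (rule someI_ex[OF has_terminal])

lemma unit_obj [simp]: "unit_obj A : Obj A"
  using unit_terminal by (simp add: is_terminal_def)

definition bang :: "'o => 'm" where "bang q = (THE f. f : hom A q (unit_obj A))"

lemma bang_simps [simp]:
  assumes "q : Obj A"
  shows "bang q : Arr A" "dom (bang q) = q" "cod (bang q) = unit_obj A"
proof -
  have "\<exists>!f. f : hom A q (unit_obj A)" using unit_terminal assms by (simp add: is_terminal_def)
  from theI'[OF this] show "bang q : Arr A" "dom (bang q) = q" "cod (bang q) = unit_obj A"
    by (simp_all add: bang_def hom_def)
qed

lemma terminal_eq:
  assumes "arr f" "arr g" "dom f = dom g" "cod f = unit_obj A" "cod g = unit_obj A"
  shows "f = g"
proof -
  have "\<exists>!h. h : hom A (dom f) (unit_obj A)" using unit_terminal assms by (simp add: is_terminal_def)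
  then show ?thesis using assms unfolding hom_def by (metis (mono_tags, lifting) mem_Collect_eq)
qed

lemma bang_comp [simp]:
  assumes "arr r" "cod r = q"
  shows "bang q ** r = bang (dom r)"
  by (rule terminal_eq) (use assms in auto)

end

lemma (in category) finite_limits_cartesian:
  "has_finite_limits A ==> cartesian A"
  by unfold_locales (simp_all add: finite_limits_pullbacks finite_limits_products finite_limits_terminal)

section \<open>Universally effective-epimorphic sieves\<close>

context category
begin

text \<open>A matching family with values in \<open>x\<close> for the pullback along
  \<open>g\<close> of the sieve given by \<open>R\<close>. It is indexed by the arrows
  \<open>q\<close> of the sieve themselves, so compatibility on overlaps reduces to
  naturality.\<close>

definition matching :: "'m => ('m => bool) => 'o => ('m => 'm) => bool" where
  "matching g R x u \<longleftrightarrow> (\<forall>q. arr q --> cod q = dom g --> R (g ** q) -->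
     u q : hom A (dom q) x \<and> (\<forall>r. arr r --> cod r = dom q --> u (q ** r) = u q ** r))"

definition sieve :: "'o => ('m => bool) => bool" where
  "sieve y R \<longleftrightarrow> (\<forall>f r. arr f --> cod f = y --> R f --> arr r --> cod r = dom f --> R (f ** r))"

text \<open>The quantifier over \<open>g\<close> asks for separation by every pullback of the sieve;
  stability then amounts to reassociating composites.\<close>

definition separating :: "'o => ('m => bool) => bool" where
  "separating y R \<longleftrightarrow> (\<forall>g k k'. arr g --> cod g = y --> arr k --> arr k' -->
     dom k = dom g --> dom k' = dom g --> cod k = cod k' -->
     (\<forall>q. arr q --> cod q = dom g --> R (g ** q) --> k ** q = k' ** q) --> k = k')"

text \<open>For a sieve \<open>R\<close>: the sheaf condition of all representable presheaves, on
  \<open>R\<close> and on every pullback of \<open>R\<close>. These are the covering sieves of the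
  canonical topology.\<close>

definition covers :: "'o => ('m => bool) => bool" where
  "covers y R \<longleftrightarrow> separating y R \<and> (\<forall>g x u. arr g --> cod g = y --> x : Obj A --> matching g R x u -->
     (\<exists>k. arr k \<and> dom k = dom g \<and> cod k = x \<and>
       (\<forall>q. arr q --> cod q = dom g --> R (g ** q) --> k ** q = u q)))"

text \<open>The sieve generated by one arrow; \<open>family_factors\<close> is the sieve generated
  by a family.\<close>

definition factors :: "'m => 'm => bool" where
  "factors e f \<longleftrightarrow> (\<exists>t. arr t \<and> cod t = dom e \<and> e ** t = f)"

definition family_factors :: "'i set => ('i => 'm) => 'm => bool" where
  "family_factors J \<phi> f \<longleftrightarrow> (\<exists>i\<in>J. factors (\<phi> i) f)"

lemma separatingD:
  assumes "separating y R" "arr g" "cod g = y" "arr k" "arr k'"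
    "dom k = dom g" "dom k' = dom g" "cod k = cod k'"
    "\<And>q. arr q ==> cod q = dom g ==> R (g ** q) ==> k ** q = k' ** q"
  shows "k = k'"
  using assms unfolding separating_def by simp

lemma covers_separating: "covers y R ==> separating y R"
  by (simp add: covers_def)

lemma coversE:
  assumes "covers y R" "arr g" "cod g = y" "x : Obj A" "matching g R x u"
  obtains k where "arr k" "dom k = dom g" "cod k = x"
    "\<And>q. arr q ==> cod q = dom g ==> R (g ** q) ==> k ** q = u q"
proof -
  have "\<exists>k. arr k \<and> dom k = dom g \<and> cod k = x \<and>
       (\<forall>q. arr q --> cod q = dom g --> R (g ** q) --> k ** q = u q)"
    using assms unfolding covers_def by simp
  then show thesis using that by (elim exE conjE) simp
qed

lemma matchingD:
  assumes "matching g R x u" "arr q" "cod q = dom g" "R (g ** q)"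
  shows "u q : Arr A" "dom (u q) = dom q" "cod (u q) = x"
    and "arr r ==> cod r = dom q ==> u (q ** r) = u q ** r"
  using assms unfolding matching_def hom_def by simp_all

section \<open>Stability and local character of covering sieves\<close>

lemma separating_stable:
  assumes "separating y R" "arr h" "cod h = y"
  shows "separating (dom h) (\<lambda>f. R (h ** f))"
  unfolding separating_def
proof (intro allI impI)
  fix g k k' assume g: "arr g" "cod g = dom h" and k: "arr k" "arr k'"
     "dom k = dom g" "dom k' = dom g" "cod k = cod k'"
    and e: "\<forall>q. arr q --> cod q = dom g --> R (h ** g ** q) --> k ** q = k' ** q"
  show "k = k'"
    by (rule separatingD[OF assms(1), of "h ** g"]) (use g k e assms(2,3) in simp_all)
qed

lemma covers_stable:
  assumes "covers y R" "arr h" "cod h = y"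
  shows "covers (dom h) (\<lambda>f. R (h ** f))"
  unfolding covers_def
proof (intro conjI allI impI separating_stable[OF covers_separating[OF assms(1)] assms(2,3)])
  fix g x u assume g: "arr g" "cod g = dom h" "x : Obj A" and u: "matching g (\<lambda>f. R (h ** f)) x u"
  have m: "matching (h ** g) R x u"
    using u g assms(2) unfolding matching_def by simp
  have "h ** g : Arr A" "cod (h ** g) = y" using g assms(2,3) by simp_all
  from coversE[OF assms(1) this g(3) m]
  obtain k where k: "arr k" "dom k = dom (h ** g)" "cod k = x"
    "\<And>q. arr q ==> cod q = dom (h ** g) ==> R ((h ** g) ** q) ==> k ** q = u q"
    by metis
  show "\<exists>k. arr k \<and> dom k = dom g \<and> cod k = x \<and>
     (\<forall>q. arr q --> cod q = dom g --> R (h ** g ** q) --> k ** q = u q)"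
    by (rule exI[of _ k]) (use k g assms(2) in simp)
qed

lemma separating_trans:
  assumes "separating y R" "\<And>f. arr f ==> cod f = y ==> R f ==> separating (dom f) (\<lambda>r. R' (f ** r))"
  shows "separating y R'"
  unfolding separating_def
proof (intro allI impI)
  fix g k k' assume g: "arr g" "cod g = y" and k: "arr k" "arr k'"
     "dom k = dom g" "dom k' = dom g" "cod k = cod k'"
    and e: "\<forall>q. arr q --> cod q = dom g --> R' (g ** q) --> k ** q = k' ** q"
  show "k = k'"
  proof (rule separatingD[OF assms(1) g])
    fix q assume q: "arr q" "cod q = dom g" "R (g ** q)"
    have s: "separating (dom (g ** q)) (\<lambda>r. R' ((g ** q) ** r))"
      by (rule assms(2)) (use g q in simp_all)
    show "k ** q = k' ** q"
    proof (rule separatingD[OF s, of "Id A (dom q)"])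
      fix r assume r: "arr r" "cod r = dom (Id A (dom q))" "R' ((g ** q) ** Id A (dom q) ** r)"
      then have "k ** q ** r = k' ** q ** r" using e g q by simp
      then show "(k ** q) ** r = (k' ** q) ** r" using r q k g by simp
    qed (use g q k in simp_all)
  qed (use k in simp_all)
qed

text \<open>Local character. Over each member of \<open>R\<close> the family glues along the pulled
  back \<open>R'\<close>; by uniqueness these local arrows match, and they are glued along
  \<open>R\<close>. On a member of \<open>R'\<close> the result is checked after restriction to
  \<open>R\<close>, where both sides solve the local problem.\<close>

lemma covers_trans:
  assumes R: "covers y R" and Rs: "sieve y R" and R': "sieve y R'"
    and loc: "\<And>f. arr f ==> cod f = y ==> R f ==> covers (dom f) (\<lambda>r. R' (f ** r))"
  shows "covers y R'"
  unfolding covers_def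
proof (intro conjI allI impI)
  show sep: "separating y R'"
    by (rule separating_trans[OF covers_separating[OF R] covers_separating[OF loc]])
  fix g x u assume g: "arr g" "cod g = y" "x : Obj A" and u: "matching g R' x u"
  note uD = matchingD[OF u]
  have sv: "R' (g ** q ** r)" if "R' (g ** q)" "arr q" "cod q = dom g" "arr r" "cod r = dom q" for q r
    using R' that g unfolding sieve_def by (metis arr_comp comp_assoc cod_comp dom_comp)
  \<comment> \<open>The gluing problem over the member \<open>q\<close> of \<open>R\<close>;
    \<open>ex\<close> and \<open>uniq\<close> show that it has exactly one solution.\<close>
  define P where "P q v \<longleftrightarrow> arr v \<and> dom v = dom q \<and> cod v = x \<and>
      (\<forall>r. arr r --> cod r = dom q --> R' (g ** q ** r) --> v ** r = u (q ** r))" for q v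
  have locq: "covers (dom q) (\<lambda>r. R' (g ** q ** r))"
    if q: "arr q" "cod q = dom g" "R (g ** q)" for q
  proof -
    have c: "covers (dom (g ** q)) (\<lambda>r. R' ((g ** q) ** r))"
      by (rule loc) (use g q in simp_all)
    have "covers (dom (Id A (dom q))) (\<lambda>r. R' ((g ** q) ** Id A (dom q) ** r))"
      by (rule covers_stable[OF c]) (use g q in simp_all)
    moreover have "R' ((g ** q) ** Id A (dom q) ** r) = R' (g ** q ** r)" if "arr r" "cod r = dom q" for r
      using that g q by simp
    ultimately show ?thesis
      using q g unfolding covers_def separating_def matching_def by simp
  qed
  have ex: "\<exists>v. P q v" if q: "arr q" "cod q = dom g" "R (g ** q)" for q
  proof -
    have "matching (Id A (dom q)) (\<lambda>r. R' (g ** q ** r)) x (\<lambda>r. u (q ** r))"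
      unfolding matching_def
    proof (intro allI impI conjI)
      fix r assume r: "arr r" "cod r = dom (Id A (dom q))" "R' (g ** q ** Id A (dom q) ** r)"
      then have qr: "q ** r : Arr A" "cod (q ** r) = dom g" "R' (g ** q ** r)" "cod r = dom q"
        using q by simp_all
      show "u (q ** r) : hom A (dom r) x"
        using uD(1-3)[OF qr(1-3)] q r(1) qr(4) by (simp add: hom_def)
      fix s assume s: "arr s" "cod s = dom r"
      show "u (q ** r ** s) = u (q ** r) ** s"
        using uD(4)[OF qr(1-3) s(1)] q r(1) qr(4) s by simp
    qed
    from coversE[OF locq[OF q] _ _ g(3) this] obtain v where v: "arr v" "dom v = dom (Id A (dom q))" "cod v = x"
      "\<And>r. arr r ==> cod r = dom (Id A (dom q)) ==> R' (g ** q ** Id A (dom q) ** r) ==> v ** r = u (q ** r)"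
      using q by auto
    have "P q v" unfolding P_def using v q by simp
    then show ?thesis ..
  qed
  have uniq: "v = v'" if q: "arr q" "cod q = dom g" "R (g ** q)" and v: "P q v" "P q v'" for q v v'
    by (rule separatingD[OF covers_separating[OF locq[OF q]], of "Id A (dom q)"])
      (use v q in \<open>simp_all add: P_def\<close>)
  define v where "v q = (SOME v. P q v)" for q
  have v: "P q (v q)" if "arr q" "cod q = dom g" "R (g ** q)" for q
    unfolding v_def using someI_ex[OF ex[OF that]] .
  have svR: "R (g ** q ** r)" if "R (g ** q)" "arr q" "cod q = dom g" "arr r" "cod r = dom q" for q r
    using Rs that g unfolding sieve_def by (metis arr_comp comp_assoc cod_comp dom_comp)
  have vr: "v (q ** r) = v q ** r"
    if q: "arr q" "cod q = dom g" "R (g ** q)" and r: "arr r" "cod r = dom q" for q r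
  proof (rule uniq[of "q ** r"])
    show "P (q ** r) (v (q ** r))" by (rule v) (use that svR in simp_all)
    show "P (q ** r) (v q ** r)"
      using v[OF q] q r g unfolding P_def by simp
  qed (use that svR in simp_all)
  have "matching g R x v"
    unfolding matching_def
  proof (intro allI impI conjI)
    fix q assume q: "arr q" "cod q = dom g" "R (g ** q)"
    show "v q : hom A (dom q) x" using v[OF q] by (simp add: P_def hom_def)
    show "v (q ** r) = v q ** r" if "arr r" "cod r = dom q" for r by (rule vr[OF q that])
  qed
  from coversE[OF R g this] obtain k where k: "arr k" "dom k = dom g" "cod k = x"
    and kv: "\<And>q. arr q ==> cod q = dom g ==> R (g ** q) ==> k ** q = v q"
    by metis
  have "k ** q = u q" if q: "arr q" "cod q = dom g" "R' (g ** q)" for q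
  \<comment> \<open>After restriction to a member of \<open>R\<close> the arrow
    \<open>u q ** r\<close> solves the local problem, and uniqueness identifies it with the
    restriction of the glued arrow.\<close>
  proof (rule separatingD[OF covers_separating[OF R], of "g ** q"])
    note uq = uD[OF q]
    show "k ** q : Arr A" "u q : Arr A" "dom (k ** q) = dom (g ** q)" "dom (u q) = dom (g ** q)"
      "cod (k ** q) = cod (u q)"
      using uq(1-3) k q g by simp_all
    fix r assume r: "arr r" "cod r = dom (g ** q)" "R ((g ** q) ** r)"
    then have qr: "q ** r : Arr A" "cod (q ** r) = dom g" "R (g ** q ** r)" "cod r = dom q"
      using q g by simp_all
    have "P (q ** r) (u q ** r)"
      unfolding P_def
    proof (intro conjI allI impI)
      fix s assume s: "arr s" "cod s = dom (q ** r)" "R' (g ** (q ** r) ** s)"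
      have "u (q ** r ** s) = u q ** r ** s"
        by (rule uq(4)) (use s q r(1) qr(4) in simp_all)
      then show "(u q ** r) ** s = u ((q ** r) ** s)" using s q r(1) qr(4) uq(1-3) by simp
    qed (use uq(1-3) q r(1) qr(4) in simp_all)
    then have "v (q ** r) = u q ** r"
      by (rule uniq[OF qr(1-3) v[OF qr(1-3)]])
    then show "(k ** q) ** r = u q ** r"
      using kv[OF qr(1-3)] k q r(1) qr(4) by simp
  qed (use g q in simp_all)
  then show "\<exists>k. arr k \<and> dom k = dom g \<and> cod k = x \<and>
     (\<forall>q. arr q --> cod q = dom g --> R' (g ** q) --> k ** q = u q)"
    using k by blast
qed

lemma factorsI: "arr t ==> cod t = dom e ==> e ** t = f ==> factors e f"
  by (auto simp: factors_def)

lemma sieve_factors: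
  assumes "arr e"
  shows "sieve (cod e) (factors e)"
  unfolding sieve_def
proof (intro allI impI)
  fix f r assume r: "arr r" "cod r = dom f" "factors e f"
  then obtain t where t: "arr t" "cod t = dom e" "e ** t = f" unfolding factors_def by blast
  show "factors e (f ** r)"
    by (rule factorsI[of "t ** r"]) (use t r assms in auto)
qed

lemma sieve_family:
  assumes "\<And>i. i : J ==> \<phi> i : Arr A \<and> cod (\<phi> i) = y"
  shows "sieve y (family_factors J \<phi>)"
  using assms sieve_factors unfolding sieve_def family_factors_def by metis

lemma sieve_stable:
  assumes "sieve y R" "arr h" "cod h = y"
  shows "sieve (dom h) (\<lambda>f. R (h ** f))"
  unfolding sieve_def
proof (intro allI impI)
  fix f r assume f: "arr f" "cod f = dom h" "R (h ** f)" and r: "arr r" "cod r = dom f"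
  have "R ((h ** f) ** r)"
    using assms(1)[unfolded sieve_def, rule_format, of "h ** f" r] assms(2,3) f r by simp
  then show "R (h ** f ** r)" using assms(2) f r by simp
qed

lemma covers_cong:
  assumes "covers y R" "\<And>f. arr f ==> cod f = y ==> R f = R' f"
  shows "covers y R'"
proof -
  have "R (g ** q) = R' (g ** q)" if "arr g" "cod g = y" "arr q" "cod q = dom g" for g q
    using assms(2) that by simp
  then show ?thesis using assms(1) unfolding covers_def separating_def matching_def by simp
qed

lemma covers_inter:
  assumes "covers y R" "sieve y R" "covers y R'" "sieve y R'"
  shows "covers y (\<lambda>f. R f \<and> R' f)"
proof (rule covers_trans[OF assms(1,2)])
  show "sieve y (\<lambda>f. R f \<and> R' f)" using assms(2,4) unfolding sieve_def by blast
  fix f assume f: "arr f" "cod f = y" "R f"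
  have "covers (dom f) (\<lambda>r. R' (f ** r))" by (rule covers_stable[OF assms(3) f(1,2)])
  then show "covers (dom f) (\<lambda>r. R (f ** r) \<and> R' (f ** r))"
    by (rule covers_cong) (use assms(2) f in \<open>auto simp: sieve_def\<close>)
qed

text \<open>Pulled back along a member of \<open>R\<close>, the larger sieve contains every arrow,
  in particular the identity; evaluating a matching family there glues it.\<close>

lemma covers_mono:
  assumes "covers y R" "sieve y R" "sieve y R'" "\<And>f. arr f ==> cod f = y ==> R f ==> R' f"
  shows "covers y R'"
proof (rule covers_trans[OF assms(1-3)])
  fix f assume f: "arr f" "cod f = y" "R f"
  have R': "R' (f ** g)" if "arr g" "cod g = dom f" for g
    using assms(3) assms(4)[OF f] f that unfolding sieve_def by blast
  show "covers (dom f) (\<lambda>r. R' (f ** r))"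
    unfolding covers_def
  proof (intro conjI allI impI)
    show "separating (dom f) (\<lambda>r. R' (f ** r))"
      unfolding separating_def
    proof (intro allI impI)
      fix g k k' assume g: "arr g" "cod g = dom f" and k: "arr k" "arr k'"
         "dom k = dom g" "dom k' = dom g"
        and e: "\<forall>q. arr q --> cod q = dom g --> R' (f ** g ** q) --> k ** q = k' ** q"
      show "k = k'" using e[rule_format, of "Id A (dom g)"] R' k g by simp
    qed
    fix g x u assume g: "arr g" "cod g = dom f" "x : Obj A" and m: "matching g (\<lambda>r. R' (f ** r)) x u"
    note M = matchingD[OF m, of "Id A (dom g)"]
    show "\<exists>k. arr k \<and> dom k = dom g \<and> cod k = x \<and>
       (\<forall>q. arr q --> cod q = dom g --> R' (f ** g ** q) --> k ** q = u q)"
    proof (intro exI[of _ "u (Id A (dom g))"] conjI allI impI)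
      fix q assume q: "arr q" "cod q = dom g"
      show "u (Id A (dom g)) ** q = u q" using M(4)[of q] R' g q by simp
    qed (use M(1-3) R' g in simp_all)
  qed
qed

text \<open>An element that factors through \<open>I i\<close> by some \<open>t\<close> lifts
  further along \<open>P i\<close> on the pullback along \<open>t\<close> of the sieve of
  \<open>P i\<close>, and this sieve covers. Local character then transfers covering, or separation
  alone, from the \<open>I i\<close> to the composites.\<close>

lemma family_covers_comp:
  assumes \<phi>: "\<And>i. i : J ==> P i : Arr A \<and> I i : Arr A \<and> dom (I i) = cod (P i) \<and> cod (I i) = y \<and> \<phi> i = I i ** P i"
    and P: "\<And>i. i : J ==> covers (cod (P i)) (factors (P i))"
  shows "covers y (family_factors J I) ==> covers y (family_factors J \<phi>)"
    and "separating y (family_factors J I) ==> separating y (family_factors J \<phi>)"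
proof -
  have sI: "sieve y (family_factors J I)" by (rule sieve_family) (use \<phi> in simp)
  have sp: "sieve y (family_factors J \<phi>)" by (rule sieve_family) (use \<phi> in simp)
  have loc: "covers (dom f) (\<lambda>r. family_factors J \<phi> (f ** r))"
    if f: "arr f" "cod f = y" "family_factors J I f" for f
  proof -
    obtain i t where i: "i : J" and t: "arr t" "cod t = dom (I i)" "I i ** t = f"
      using f(3) unfolding family_factors_def factors_def by blast
    note \<phi>i = \<phi>[OF i]
    have t': "cod t = cod (P i)" using t \<phi>i by simp
    have d: "dom (I i ** t) = dom t" using t(1,2) \<phi>i by simp
    show ?thesis
      unfolding t(3)[symmetric] d
      proof (rule covers_mono[OF covers_stable[OF P[OF i] t(1) t']])
        show "sieve (dom t) (\<lambda>f. factors (P i) (t ** f))"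
          by (rule sieve_stable[OF sieve_factors t(1) t']) (use \<phi>i in simp)
        show "sieve (dom t) (\<lambda>r. family_factors J \<phi> ((I i ** t) ** r))"
          using sieve_stable[OF sp f(1,2)] unfolding t(3)[symmetric] d .
      next
        fix r assume r: "arr r" "cod r = dom t" "factors (P i) (t ** r)"
        then obtain s where s: "arr s" "cod s = dom (P i)" "P i ** s = t ** r"
          unfolding factors_def by blast
        have "\<phi> i ** s = I i ** P i ** s" using s(1,2) \<phi>i by simp
        also have "\<dots> = (I i ** t) ** r"
          unfolding s(3) by (rule comp_assoc[symmetric]) (use t(1,2) r(1,2) \<phi>i in simp_all)
        finally have "\<phi> i ** s = (I i ** t) ** r" .
        then show "family_factors J \<phi> ((I i ** t) ** r)"
          unfolding family_factors_def using i s(1,2) \<phi>i by (auto intro!: factorsI[of s] bexI[of _ i])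
      qed
  qed
  show "covers y (family_factors J \<phi>)" if "covers y (family_factors J I)"
    by (rule covers_trans[OF that sI sp loc])
  show "separating y (family_factors J \<phi>)" if "separating y (family_factors J I)"
    by (rule separating_trans[OF that covers_separating[OF loc]])
qed

section \<open>Regular epimorphisms generate covering sieves\<close>

lemma coequalizerD:
  assumes "is_coequalizer A a b q"
  shows "arr a" "arr b" "dom a = dom b" "cod a = cod b" "arr q"
    "dom q = cod a" "q ** a = q ** b"
    and "arr u ==> dom u = cod a ==> u ** a = u ** b ==>
      \<exists>!h. h : hom A (cod q) (cod u) \<and> h ** q = u"
  using assms unfolding is_coequalizer_def by simp_all

lemma regular_epi_arr: "is_regular_epi A q ==> arr q"
  unfolding is_regular_epi_def using coequalizerD(5) by blast

lemma regular_epi_cancel: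
  assumes "is_regular_epi A q" "arr k" "arr k'" "dom k = cod q" "dom k' = cod q"
    "cod k = cod k'" "k ** q = k' ** q"
  shows "k = k'"
proof -
  obtain a b where co: "is_coequalizer A a b q"
    using assms(1) unfolding is_regular_epi_def by blast
  note c = coequalizerD(1-7)[OF co]
  have "(k ** q) ** a = (k ** q) ** b" using assms(2,4) c by simp
  then have ex: "\<exists>!h. h : hom A (cod q) (cod (k ** q)) \<and> h ** q = k ** q"
    by (intro coequalizerD(8)[OF co]) (use assms(2,4) c in simp_all)
  have h: "k : hom A (cod q) (cod (k ** q))" "k' : hom A (cod q) (cod (k ** q))"
    using assms(2-6) c by (simp_all add: hom_def)
  from ex obtain x where x: "\<And>y. y : hom A (cod q) (cod (k ** q)) ==> y ** q = k ** q ==> y = x"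
    by (elim ex1E) blast
  have "k = x" "k' = x" using x[OF h(1)] x[OF h(2) assms(7)[symmetric]] by simp_all
  then show ?thesis by simp
qed

text \<open>The parallel pair whose coequalizer is \<open>q\<close> is replaced by all pairs that
  \<open>q\<close> identifies, so the condition refers to \<open>q\<close> alone.\<close>

lemma regular_epi_desc:
  assumes "is_regular_epi A q" "arr u" "dom u = dom q"
    "\<And>a b. arr a ==> arr b ==> dom a = dom b ==> cod a = dom q ==>
      cod b = dom q ==> q ** a = q ** b ==> u ** a = u ** b"
  obtains k where "arr k" "dom k = cod q" "cod k = cod u" "k ** q = u"
proof -
  obtain a b where co: "is_coequalizer A a b q"
    using assms(1) unfolding is_regular_epi_def by blast
  note c = coequalizerD(1-7)[OF co]
  have "u ** a = u ** b" by (rule assms(4)) (use c in simp_all)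
  then have "\<exists>!h. h : hom A (cod q) (cod u) \<and> h ** q = u"
    by (intro coequalizerD(8)[OF co]) (use assms(2,3) c in simp_all)
  then show thesis using that unfolding hom_def by blast
qed

end

text \<open>The pullback of \<open>e\<close> along \<open>g\<close> is a regular epimorphism and
  yields a member of the sieve. The value of a matching family on it identifies whatever it
  identifies, hence factors through it.\<close>

lemma (in pb_category) regular_epi_covers:
  assumes stable: "\<And>f g a b. is_pullback A f g a b ==> is_regular_epi A g ==> is_regular_epi A a"
    and e: "is_regular_epi A e"
  shows "covers (Cod A e) (factors e)"
proof -
  note eA = regular_epi_arr[OF e]
  show ?thesis
    unfolding covers_def separating_def
  proof (intro conjI allI impI)
    fix g k k' assume g: "g : Arr A" "Cod A g = Cod A e" and k: "k : Arr A" "k' : Arr A"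
       "Dom A k = Dom A g" "Dom A k' = Dom A g" "Cod A k = Cod A k'"
      and eq: "\<forall>q. q : Arr A --> Cod A q = Dom A g --> factors e (g ** q) --> k ** q = k' ** q"
    note sp = pb_span[OF g(1) eA g(2)]
    have re: "is_regular_epi A (pi1 g e)" by (rule stable[OF pb_is_pullback[OF g(1) eA g(2)] e])
    have "factors e (g ** pi1 g e)" by (rule factorsI[of "pi2 g e"]) (use spanD[OF sp] in simp_all)
    then have "k ** pi1 g e = k' ** pi1 g e" using eq g eA by simp
    from regular_epi_cancel[OF re k(1,2) _ _ _ this] show "k = k'" using k g eA by simp
  next
    fix g x u assume g: "g : Arr A" "Cod A g = Cod A e" "x : Obj A" and m: "matching g (factors e) x u"
    note sp = pb_span[OF g(1) eA g(2)]
    define q where "q = pi1 g e"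
    have q: "q : Arr A" "Cod A q = Dom A g" "Dom A (pi2 g e) = Dom A q" using g eA by (simp_all add: q_def)
    have re: "is_regular_epi A q" unfolding q_def by (rule stable[OF pb_is_pullback[OF g(1) eA g(2)] e])
    have fq: "factors e (g ** q)" unfolding q_def by (rule factorsI[of "pi2 g e"]) (use spanD[OF sp] in simp_all)
    note M = matchingD[OF m q(1,2) fq]
    \<comment> \<open>By naturality both sides are the value of \<open>u\<close> at the same arrow
      \<open>q ** a = q ** b\<close>.\<close>
    have eqs: "u q ** a = u q ** b" if "a : Arr A" "b : Arr A" "Cod A a = Dom A q" "Cod A b = Dom A q" "q ** a = q ** b" for a b
      using M(4)[of a] M(4)[of b] that by simp
    obtain k where k: "k : Arr A" "Dom A k = Cod A q" "Cod A k = Cod A (u q)" "k ** q = u q"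
      by (rule regular_epi_desc[OF re M(1,2)]) (use eqs in blast)+
    have "k ** r = u r" if r: "r : Arr A" "Cod A r = Dom A g" "factors e (g ** r)" for r
    proof -
      obtain t where t: "t : Arr A" "Cod A t = Dom A e" "e ** t = g ** r" using r(3) unfolding factors_def by blast
      have "Dom A t = Dom A r" using t r g eA by (metis dom_comp)
      then have s: "span g e r t" using t r by (simp add: span_def)
      note P = pb_pairing[OF g(1) eA g(2) s]
      have "k ** q ** pb_pairing A g e r t = u q ** pb_pairing A g e r t"
        by (rule comp_eq_arr[OF k(4)]) (use k P q in \<open>simp_all add: q_def\<close>)
      also have "\<dots> = u (q ** pb_pairing A g e r t)"
        by (rule M(4)[symmetric]) (use P in \<open>simp_all add: q_def\<close>)
      finally show ?thesis using P(4) by (simp add: q_def)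
    qed
    then show "\<exists>k. k : Arr A \<and> Dom A k = Dom A g \<and> Cod A k = x \<and>
       (\<forall>q. q : Arr A --> Cod A q = Dom A g --> factors e (g ** q) --> k ** q = u q)"
      using k q M(3) by (intro exI[of _ k]) simp
  qed
qed

section \<open>Families effective for descent\<close>

context category
begin

text \<open>
  The analogue of \<open>action\<close> for a family with common codomain: \<open>\<xi> i t j s\<close> is the element \<open>s\<close>
  of the \<open>j\<close>-th object transported to lie over the element \<open>t\<close> of the \<open>i\<close>-th one.
\<close>

definition family_action :: "'i set => ('i => 'm) => ('i => 'm) => ('i => 'm => 'i => 'm => 'm) => bool" where
  "family_action J \<phi> f \<xi> \<longleftrightarrow>
     (\<forall>i\<in>J. f i : Arr A \<and> cod (f i) = dom (\<phi> i)) \<and>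
     (\<forall>i\<in>J. \<forall>j\<in>J. \<forall>t s. span (\<phi> i) (\<phi> j ** f j) t s -->
        \<xi> i t j s : hom A (dom s) (dom (f i)) \<and> f i ** \<xi> i t j s = t) \<and>
     (\<forall>i\<in>J. \<forall>j\<in>J. \<forall>t s r. span (\<phi> i) (\<phi> j ** f j) t s --> arr r --> cod r = dom s -->
        \<xi> i (t ** r) j (s ** r) = \<xi> i t j s ** r) \<and>
     (\<forall>i\<in>J. \<forall>i'\<in>J. \<forall>j\<in>J. \<forall>t t' s. span (\<phi> i) (\<phi> j ** f j) t s --> span (\<phi> i') (\<phi> j ** f j) t' s -->
        \<xi> i' t' i (\<xi> i t j s) = \<xi> i' t' j s) \<and>
     (\<forall>i\<in>J. \<forall>s. arr s --> cod s = dom (f i) --> \<xi> i (f i ** s) i s = s)"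

text \<open>One arrow \<open>g\<close> serves all members of the family, while the projection
  \<kappa> depends on the index; invariance also compares different indices.\<close>

definition family_effective :: "'i set => ('i => 'm) => bool" where
  "family_effective J \<phi> \<longleftrightarrow> (\<forall>f \<xi>. family_action J \<phi> f \<xi> -->
     (\<exists>g \<kappa>. \<forall>i\<in>J. is_pullback A (\<phi> i) g (f i) (\<kappa> i) \<and>
        (\<forall>j\<in>J. \<forall>t s. span (\<phi> i) (\<phi> j ** f j) t s --> \<kappa> i ** \<xi> i t j s = \<kappa> j ** s)))"

lemma family_actionD:
  assumes "family_action J \<phi> f \<xi>"
  shows "i : J ==> f i : Arr A" "i : J ==> cod (f i) = dom (\<phi> i)"
    and "i : J ==> j : J ==> span (\<phi> i) (\<phi> j ** f j) t s ==> \<xi> i t j s : Arr A"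
    and "i : J ==> j : J ==> span (\<phi> i) (\<phi> j ** f j) t s ==> dom (\<xi> i t j s) = dom s"
    and "i : J ==> j : J ==> span (\<phi> i) (\<phi> j ** f j) t s ==> cod (\<xi> i t j s) = dom (f i)"
    and "i : J ==> j : J ==> span (\<phi> i) (\<phi> j ** f j) t s ==> f i ** \<xi> i t j s = t"
    and "i : J ==> j : J ==> span (\<phi> i) (\<phi> j ** f j) t s ==> arr r ==> cod r = dom s ==>
      \<xi> i (t ** r) j (s ** r) = \<xi> i t j s ** r"
    and "i : J ==> i' : J ==> j : J ==> span (\<phi> i) (\<phi> j ** f j) t s ==> span (\<phi> i') (\<phi> j ** f j) t' s ==>
      \<xi> i' t' i (\<xi> i t j s) = \<xi> i' t' j s"
    and "i : J ==> arr s ==> cod s = dom (f i) ==> \<xi> i (f i ** s) i s = s"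
  using assms unfolding family_action_def hom_def by simp_all

text \<open>Pulled back along \<open>g\<close>, the sieve of \<open>p\<close> becomes the sieve of
  the projection \<open>q\<close>; lifting along quotient projections is controlled in this
  way.\<close>

lemma pullback_factors:
  assumes "is_pullback A p g f q" "arr v" "cod v = dom g"
  shows "factors q v \<longleftrightarrow> factors p (g ** v)"
proof
  note B = pullback_arrs[OF assms(1)]
  {
    assume "factors q v"
    then obtain s where s: "arr s" "cod s = dom q" "q ** s = v" unfolding factors_def by blast
    have "p ** f ** s = g ** q ** s"
      by (rule comp_eq_comp[OF B(9)]) (use s(1,2) B(1-8) in simp_all)
    then show "factors p (g ** v)"
      by (intro factorsI[of "f ** s"]) (use s B(1-8) in simp_all)
  next
    assume "factors p (g ** v)"
    then obtain t where t: "arr t" "cod t = dom p" "p ** t = g ** v" unfolding factors_def by blast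
    have "dom t = dom (p ** t)" using t(1,2) B(1) by simp
    also have "\<dots> = dom v" unfolding t(3) using assms(2,3) B(2) by simp
    finally have "t : hom A (dom v) (dom p)" "v : hom A (dom v) (dom g)"
      using t(1,2) assms(2,3) by (simp_all add: hom_def)
    from pullback_lift[OF assms(1) this t(3)] obtain h where "h : hom A (dom v) (dom f)" "q ** h = v"
      by metis
    then show "factors q v" using B(6) by (intro factorsI[of h]) (simp_all add: hom_def)
  }
qed

lemma pullback_paste:
  assumes "is_pullback A P g f q" "is_pullback A I g' g \<kappa>"
  shows "is_pullback A (I ** P) g' f (\<kappa> ** q)"
proof (rule is_pullbackI)
  note B = pullback_arrs[OF assms(1)] and B' = pullback_arrs[OF assms(2)]
  have "(I ** P) ** f = I ** g ** q" using B B'(1-8) by simp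
  also have "\<dots> = g' ** \<kappa> ** q" by (rule comp_eq_comp[OF B'(9)]) (use B(1-8) B'(1-8) in simp_all)
  finally show "(I ** P) ** f = g' ** \<kappa> ** q" .
  show "I ** P : Arr A" "arr g'" "arr f" "\<kappa> ** q : Arr A" "cod (I ** P) = cod g'"
    "dom f = dom (\<kappa> ** q)" "cod f = dom (I ** P)" "cod (\<kappa> ** q) = dom g'"
    using B(1-8) B'(1-8) by simp_all
  fix x
  {
    fix u v assume u: "u : hom A x (dom (I ** P))" and v: "v : hom A x (dom g')" and e: "(I ** P) ** u = g' ** v"
    have u': "arr u" "dom u = x" "cod u = dom P"
      using u B(1-8) B'(1-8) by (simp_all add: hom_def)
    have e': "I ** P ** u = g' ** v" using e u' B(1-8) B'(1-8) by simp
    obtain w where w: "w : hom A x (dom g)" "g ** w = P ** u" "\<kappa> ** w = v"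
      by (rule pullback_lift[OF assms(2) _ v e']) (use u' B(1-8) B'(1-8) in \<open>simp_all add: hom_def\<close>)
    obtain h where h: "h : hom A x (dom f)" "f ** h = u" "q ** h = w"
      by (rule pullback_lift[OF assms(1) _ w(1) w(2)[symmetric]]) (use u' in \<open>simp_all add: hom_def\<close>)
    have "(\<kappa> ** q) ** h = \<kappa> ** q ** h" using h(1) B(1-8) B'(1-8) by (simp add: hom_def)
    then show "\<exists>h\<in>hom A x (dom f). f ** h = u \<and> (\<kappa> ** q) ** h = v"
      using h w(3) by (intro bexI[of _ h]) simp_all
  next
    fix h h' assume h: "h : hom A x (dom f)" and h': "h' : hom A x (dom f)"
      and e: "f ** h = f ** h'" "(\<kappa> ** q) ** h = (\<kappa> ** q) ** h'"
    have H: "arr h" "dom h = x" "cod h = dom f" "arr h'" "dom h' = x" "cod h' = dom f"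
      using h h' by (simp_all add: hom_def)
    have 1: "\<kappa> ** q ** h = \<kappa> ** q ** h'" using e(2) H B(1-8) B'(1-8) by simp
    have 2: "g ** q ** k = P ** f ** k" if "arr k" "cod k = dom f" for k
      by (rule comp_eq_comp[OF B(9)[symmetric]]) (use that B(1-8) in simp_all)
    have "q ** h = q ** h'"
      by (rule pullback_eq[OF assms(2) _ _ _ 1, of x])
        (use H B(1-8) B'(1-8) 2 e(1) in \<open>simp_all add: hom_def\<close>)
    then show "h = h'" by (rule pullback_eq[OF assms(1) h h' e(1)])
  }
qed

text \<open>The quotient is formed in two stages. For each \<open>i\<close>, transport within this
  index is an action along \<open>P i\<close>, with a quotient \<open>g i\<close> over the codomain
  of \<open>P i\<close>. Transport between indices passes to these quotients as \<beta>, by gluing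
  over elements that lift, and is an action along the family \<open>I\<close>. The quotient of the
  latter is the required one, as pullback squares paste.\<close>

lemma family_effective_comp:
  assumes \<phi>: "\<And>i. i : J ==> P i : Arr A \<and> I i : Arr A \<and> dom (I i) = cod (P i) \<and> \<phi> i = I i ** P i"
    and cov: "\<And>i. i : J ==> covers (cod (P i)) (factors (P i))"
    and Peff: "\<And>i. i : J ==> actions_effective (P i)"
    and Ieff: "family_effective J I"
  shows "family_effective J \<phi>"
  unfolding family_effective_def
proof (intro allI impI)
  fix f \<xi> assume act: "family_action J \<phi> f \<xi>"
  note a = family_actionD[OF act]
  have ty: "P i : Arr A" "I i : Arr A" "dom (I i) = cod (P i)" "dom (\<phi> i) = dom (P i)"
    "cod (f i) = dom (P i)" "f i : Arr A" if "i : J" for i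
    using \<phi>[OF that] a(1,2)[OF that] by simp_all
  have \<phi>c: "\<phi> i ** t = I i ** P i ** t" if "i : J" "arr t" "cod t = dom (P i)" for i t
    using \<phi>[OF that(1)] that(2,3) by simp
  have \<phi>f: "(\<phi> j ** f j) ** s = I j ** P j ** f j ** s" "dom (\<phi> j ** f j) = dom (f j)"
    if "j : J" "arr s" "cod s = dom (f j)" for j s
    using \<phi>[OF that(1)] ty[OF that(1)] that(2,3) by simp_all
  have \<phi>span: "span (\<phi> i) (\<phi> j ** f j) t s"
    if "i : J" "j : J" "arr t" "arr s" "dom t = dom s" "cod t = dom (P i)" "cod s = dom (f j)"
      "I i ** P i ** t = I j ** P j ** f j ** s" for i j t s
    unfolding span_def using that ty[OF that(1)] \<phi>c[OF that(1,3,6)] \<phi>f[OF that(2,4,7)] by simp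
  have Pspan: "span (P i) (P i ** f i) t s \<longleftrightarrow> arr t \<and> arr s \<and> dom t = dom s \<and>
      cod t = dom (P i) \<and> cod s = dom (f i) \<and> P i ** t = P i ** f i ** s" if "i : J" for i t s
    unfolding span_def using ty[OF that] by auto
  have P\<phi>: "span (\<phi> i) (\<phi> i ** f i) t s" if "i : J" "span (P i) (P i ** f i) t s" for i t s
    using that Pspan[OF that(1)] by (intro \<phi>span) simp_all
  \<comment> \<open>First stage: the part of \<xi> that stays at the index \<open>i\<close> is an
    ordinary action along \<open>P i\<close>.\<close>
  have "\<exists>g q. is_pullback A (P i) g (f i) q \<and> (\<forall>t s. span (P i) (P i ** f i) t s --> q ** \<xi> i t i s = q ** s)"
    if i: "i : J" for i
  proof -
    have "action (P i) (f i) (\<lambda>t s. \<xi> i t i s)"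
      unfolding action_def
    proof (intro conjI allI impI)
      fix t s assume "span (P i) (P i ** f i) t s"
      from P\<phi>[OF i this] show "\<xi> i t i s : hom A (dom s) (dom (f i))" "f i ** \<xi> i t i s = t"
        "\<And>r. arr r ==> cod r = dom s ==> \<xi> i (t ** r) i (s ** r) = \<xi> i t i s ** r"
        using a(3-7)[OF i i] by (simp_all add: hom_def)
    next
      fix t t' s assume "span (P i) (P i ** f i) t s" "span (P i) (P i ** f i) t' s"
      then show "\<xi> i t' i (\<xi> i t i s) = \<xi> i t' i s" by (intro a(8)[OF i i i] P\<phi>[OF i])
    next
      fix s assume "arr s" "cod s = dom (f i)"
      then show "\<xi> i (f i ** s) i s = s" by (rule a(9)[OF i])
    qed (use ty[OF i] in simp_all)
    then show ?thesis using Peff[OF i] unfolding actions_effective_def by blast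
  qed
  then obtain g q where gq: "\<And>i. i : J ==> is_pullback A (P i) (g i) (f i) (q i) \<and>
    (\<forall>t s. span (P i) (P i ** f i) t s --> q i ** \<xi> i t i s = q i ** s)"
    by metis
  have pb: "is_pullback A (P i) (g i) (f i) (q i)" if "i : J" for i using gq[OF that] by blast
  have q\<xi>: "q i ** \<xi> i t i s = q i ** s" if "i : J" "span (P i) (P i ** f i) t s" for i t s
    using gq[OF that(1)] that(2) by blast
  note B = pullback_arrs[OF pb]
  have gq_eq: "g i ** q i ** s = P i ** f i ** s" if "i : J" "arr s" "cod s = dom (f i)" for i s
    by (rule comp_eq_comp[OF B(9)[OF that(1), symmetric]]) (use that B(1-8)[OF that(1)] in simp_all)
  have gt: "g i : Arr A" "cod (g i) = cod (P i)" "q i : Arr A" "dom (q i) = dom (f i)" "cod (q i) = dom (g i)"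
    if "i : J" for i using B(1-8)[OF that] by simp_all

  \<comment> \<open>After restriction along \<open>r\<close>, the element \<sigma> of the image
    lifts to \<open>t\<close> along \<open>P i\<close> and the element \<tau> of the first quotient
    lifts to \<open>s\<close> along \<open>q j\<close>. On such lifts the descended transport has to
    be the class of \<open>\<xi> i t j s\<close>.\<close>
  define L where "L i \<sigma> j \<tau> r t s \<longleftrightarrow> arr t \<and> arr s \<and> cod t = dom (P i) \<and> cod s = dom (f j) \<and>
    dom t = dom r \<and> dom s = dom r \<and> P i ** t = \<sigma> ** r \<and> q j ** s = \<tau> ** r" for i \<sigma> j \<tau> r t s
  have Isp: "arr \<sigma>" "arr \<tau>" "dom \<sigma> = dom \<tau>" "cod \<sigma> = cod (P i)" "cod \<tau> = dom (g j)"
      "I i ** \<sigma> = I j ** g j ** \<tau>"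
    if "i : J" "j : J" "span (I i) (I j ** g j) \<sigma> \<tau>" for i j \<sigma> \<tau>
    using spanD[OF that(3)] ty(1-3)[OF that(1)] ty(1-3)[OF that(2)] gt[OF that(2)] by simp_all
  have Ispan: "span (I i) (I j ** g j) \<sigma> \<tau>"
    if "i : J" "j : J" "arr \<sigma>" "arr \<tau>" "dom \<sigma> = dom \<tau>" "cod \<sigma> = cod (P i)" "cod \<tau> = dom (g j)"
      "I i ** \<sigma> = I j ** g j ** \<tau>" for i j \<sigma> \<tau>
    using that ty(1-3)[OF that(1)] ty(1-3)[OF that(2)] gt[OF that(2)] by (simp add: span_def)
  have Lspan: "span (\<phi> i) (\<phi> j ** f j) t s"
    if ij: "i : J" "j : J" and sp: "span (I i) (I j ** g j) \<sigma> \<tau>" and r: "arr r" "cod r = dom \<tau>"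
      and L: "L i \<sigma> j \<tau> r t s" for i \<sigma> j \<tau> r t s
  proof (rule \<phi>span[OF ij])
    note S = Isp[OF ij sp]
    have "I i ** P i ** t = I i ** \<sigma> ** r" using L by (simp add: L_def)
    also have "\<dots> = I j ** (g j ** \<tau>) ** r"
      by (rule comp_eq_comp[OF S(6)]) (use S(1-5) r ty(1-3)[OF ij(1)] ty(1-3)[OF ij(2)] gt[OF ij(2)] in simp_all)
    also have "\<dots> = I j ** g j ** \<tau> ** r" using S(1-5) r gt[OF ij(2)] by simp
    also have "\<tau> ** r = q j ** s" using L by (simp add: L_def)
    also have "g j ** q j ** s = P j ** f j ** s" by (rule gq_eq[OF ij(2)]) (use L in \<open>simp_all add: L_def\<close>)
    finally show "I i ** P i ** t = I j ** P j ** f j ** s" .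
  qed (use L in \<open>simp_all add: L_def\<close>)
  \<comment> \<open>Other lifts give the same class: \<open>s'\<close> is a transport of
    \<open>s\<close> within the index \<open>j\<close>, and passing from \<open>t\<close> to
    \<open>t'\<close> is a transport within the index \<open>i\<close>, which \<open>q i\<close>
    does not see.\<close>
  have Luniq: "q i ** \<xi> i t' j s' = q i ** \<xi> i t j s"
    if ij: "i : J" "j : J" and sp: "span (I i) (I j ** g j) \<sigma> \<tau>" and r: "arr r" "cod r = dom \<tau>"
      and L: "L i \<sigma> j \<tau> r t s" and L': "L i \<sigma> j \<tau> r t' s'" for i \<sigma> j \<tau> r t s t' s'
  proof -
    note ls = Lspan[OF ij sp r L] and ls' = Lspan[OF ij sp r L']
    note l = L[unfolded L_def] L'[unfolded L_def]
    have s1: "arr s" "cod s = dom (f j)" and s2: "arr s'" "cod s' = dom (f j)"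
      and ds: "dom s' = dom s" "dom t' = dom s" using l by simp_all
    have qs: "q j ** s' = q j ** s" using l by simp
    have Pf: "P j ** f j ** s' = P j ** f j ** s"
      using gq_eq[OF ij(2) s1] gq_eq[OF ij(2) s2] qs by simp
    have jsp: "span (P j) (P j ** f j) (f j ** s') s"
      unfolding Pspan[OF ij(2)] using s1 s2 ds Pf ty[OF ij(2)] by simp
    note jsp' = P\<phi>[OF ij(2) jsp]
    \<comment> \<open>Both sides lie over \<open>f j ** s'\<close> and have the same class under
      \<open>q j\<close>; together these determine an element of the pullback.\<close>
    have s': "\<xi> j (f j ** s') j s = s'"
    proof (rule pullback_eq[OF pb[OF ij(2)], of _ "dom s"])
      show "\<xi> j (f j ** s') j s : hom A (dom s) (dom (f j))" "s' : hom A (dom s) (dom (f j))"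
        using a(3-5)[OF ij(2) ij(2) jsp'] s2 ds by (simp_all add: hom_def)
      show "f j ** \<xi> j (f j ** s') j s = f j ** s'" by (rule a(6)[OF ij(2) ij(2) jsp'])
      show "q j ** \<xi> j (f j ** s') j s = q j ** s'" using q\<xi>[OF ij(2) jsp] qs by simp
    qed
    have ts: "span (\<phi> i) (\<phi> j ** f j) t' s"
    proof (rule \<phi>span[OF ij])
      have "I i ** P i ** t' = I i ** P i ** t" using l by simp
      also have "\<dots> = (\<phi> j ** f j) ** s" using spanD(6)[OF ls] \<phi>c[OF ij(1), of t] l by simp
      finally show "I i ** P i ** t' = I j ** P j ** f j ** s" unfolding \<phi>f(1)[OF ij(2) s1] .
    qed (use l in simp_all)
    define w where "w = \<xi> i t j s"
    have w: "arr w" "dom w = dom s" "cod w = dom (f i)" "f i ** w = t"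
      using a(3-6)[OF ij ls] by (simp_all add: w_def)
    have "\<xi> i t' j s' = \<xi> i t' j s"
      using a(8)[OF ij(2) ij(1) ij(2) jsp' ts] s' by simp
    also have "\<dots> = \<xi> i t' i w" unfolding w_def by (rule a(8)[OF ij(1) ij(1) ij(2) ls ts, symmetric])
    finally have "q i ** \<xi> i t' j s' = q i ** \<xi> i t' i w" by simp
    also have "\<dots> = q i ** w"
      by (rule q\<xi>[OF ij(1)]) (use w l in \<open>simp add: Pspan[OF ij(1)]\<close>)
    finally show ?thesis by (simp add: w_def)
  qed
  have Lcomp: "L i \<sigma> j \<tau> (r ** r') (t ** r') (s ** r')"
    if ij: "i : J" "j : J" and L: "L i \<sigma> j \<tau> r t s" and r: "arr r" "arr r'" "cod r' = dom r"
      "arr \<sigma>" "arr \<tau>" "cod r = dom \<sigma>" "cod r = dom \<tau>" for i \<sigma> j \<tau> r t s r'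
  proof -
    note l = L[unfolded L_def]
    have l': "arr t" "arr s" "cod t = dom (P i)" "cod s = dom (f j)" "dom t = dom r" "dom s = dom r"
      using l by simp_all
    have "P i ** t ** r' = \<sigma> ** r ** r'" "q j ** s ** r' = \<tau> ** r ** r'"
      by (rule comp_eq_comp; use l l' r ty(1)[OF ij(1)] gt[OF ij(2)] in simp)+
    then show ?thesis unfolding L_def using l' r by simp
  qed
  \<comment> \<open>The sieve on which both elements have lifts. It covers, as the intersection of
    pullbacks of the covering sieves of \<open>P i\<close> and \<open>P j\<close>.\<close>
  define K where "K i \<sigma> j \<tau> r \<longleftrightarrow> factors (P i) (\<sigma> ** r) \<and> factors (q j) (\<tau> ** r)" for i \<sigma> j \<tau> r
  have Ksieves: "covers (dom \<tau>) (\<lambda>r. factors (P i) (\<sigma> ** r))" "sieve (dom \<tau>) (\<lambda>r. factors (P i) (\<sigma> ** r))"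
    if "i : J" "arr \<sigma>" "cod \<sigma> = cod (P i)" "dom \<sigma> = dom \<tau>" for i \<sigma> \<tau>
    using covers_stable[OF cov[OF that(1)] that(2,3)] sieve_stable[OF sieve_factors[OF ty(1)[OF that(1)]] that(2,3)]
    by (simp_all add: that(4))
  have Kcov: "covers (dom \<tau>) (K i \<sigma> j \<tau>)" "sieve (dom \<tau>) (K i \<sigma> j \<tau>)"
    if ij: "i : J" "j : J" and sp: "span (I i) (I j ** g j) \<sigma> \<tau>" for i \<sigma> j \<tau>
  proof -
    note S = Isp[OF ij sp]
    note 1 = Ksieves[OF ij(1) S(1,4,3)]
    have "covers (dom \<tau>) (\<lambda>r. factors (P j) ((g j ** \<tau>) ** r))"
      by (rule Ksieves(1)[OF ij(2)]) (use S gt[OF ij(2)] in simp_all)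
    then have 2: "covers (dom \<tau>) (\<lambda>r. factors (q j) (\<tau> ** r))"
    proof (rule covers_cong)
      fix r assume r: "arr r" "cod r = dom \<tau>"
      have "factors (q j) (\<tau> ** r) \<longleftrightarrow> factors (P j) (g j ** \<tau> ** r)"
        by (rule pullback_factors[OF pb[OF ij(2)]]) (use r S(2,5) in simp_all)
      then show "factors (P j) ((g j ** \<tau>) ** r) = factors (q j) (\<tau> ** r)"
        using r S(2,5) gt(1)[OF ij(2)] by simp
    qed
    have 3: "sieve (dom \<tau>) (\<lambda>r. factors (q j) (\<tau> ** r))"
      by (rule sieve_stable[OF sieve_factors[OF gt(3)[OF ij(2)]]]) (use S(2,5) gt(5)[OF ij(2)] in simp_all)
    show "covers (dom \<tau>) (K i \<sigma> j \<tau>)"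
      unfolding K_def by (rule covers_inter[OF 1 2 3])
    show "sieve (dom \<tau>) (K i \<sigma> j \<tau>)"
      using 1(2) 3 unfolding K_def sieve_def by blast
  qed
  have KL: "\<exists>t s. L i \<sigma> j \<tau> r t s"
    if ij: "i : J" "j : J" and K: "K i \<sigma> j \<tau> r" and r: "arr r" "arr \<sigma>" "arr \<tau>" "cod r = dom \<sigma>" "cod r = dom \<tau>"
    for i \<sigma> j \<tau> r
  proof -
    obtain t where t: "arr t" "cod t = dom (P i)" "P i ** t = \<sigma> ** r" using K unfolding K_def factors_def by blast
    obtain s where s: "arr s" "cod s = dom (q j)" "q j ** s = \<tau> ** r" using K unfolding K_def factors_def by blast
    have "dom t = dom (P i ** t)" "dom s = dom (q j ** s)" using t(1,2) s(1,2) ty(1)[OF ij(1)] gt(3)[OF ij(2)] by simp_all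
    then have "dom t = dom r" "dom s = dom r" unfolding t(3) s(3) using r by simp_all
    then show ?thesis unfolding L_def using t s gt(4)[OF ij(2)] by auto
  qed
  have KI: "K i \<sigma> j \<tau> r" if "L i \<sigma> j \<tau> r t s" "j : J" for i \<sigma> j \<tau> r t s
    using that gt(4)[OF that(2)] unfolding L_def K_def factors_def by auto

  \<comment> \<open>Second stage: the arrow glued from the classes of the transported lifts.\<close>
  define \<beta> where "\<beta> i \<sigma> j \<tau> = (SOME k. arr k \<and> dom k = dom \<tau> \<and> cod k = dom (g i) \<and>
    (\<forall>r t s. arr r --> cod r = dom \<tau> --> L i \<sigma> j \<tau> r t s --> k ** r = q i ** \<xi> i t j s))" for i \<sigma> j \<tau>
  have \<beta>: "\<beta> i \<sigma> j \<tau> : Arr A \<and> dom (\<beta> i \<sigma> j \<tau>) = dom \<tau> \<and> cod (\<beta> i \<sigma> j \<tau>) = dom (g i) \<and>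
    (\<forall>r t s. arr r --> cod r = dom \<tau> --> L i \<sigma> j \<tau> r t s --> \<beta> i \<sigma> j \<tau> ** r = q i ** \<xi> i t j s)"
    if ij: "i : J" "j : J" and sp: "span (I i) (I j ** g j) \<sigma> \<tau>" for i \<sigma> j \<tau>
    unfolding \<beta>_def
  proof (rule someI_ex)
    note S = Isp[OF ij sp]
    define u where "u r = (SOME w. \<exists>t s. L i \<sigma> j \<tau> r t s \<and> w = q i ** \<xi> i t j s)" for r
    have u: "u r = q i ** \<xi> i t j s" if "arr r" "cod r = dom \<tau>" "L i \<sigma> j \<tau> r t s" for r t s
      unfolding u_def
    proof (rule some_equality)
      show "\<exists>t' s'. L i \<sigma> j \<tau> r t' s' \<and> q i ** \<xi> i t j s = q i ** \<xi> i t' j s'" using that(3) by blast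
      fix w assume "\<exists>t s. L i \<sigma> j \<tau> r t s \<and> w = q i ** \<xi> i t j s"
      then obtain t' s' where "L i \<sigma> j \<tau> r t' s'" "w = q i ** \<xi> i t' j s'" by blast
      then show "w = q i ** \<xi> i t j s" using Luniq[OF ij sp that] by simp
    qed
    have d\<tau>: "Id A (dom \<tau>) : Arr A" "dom (Id A (dom \<tau>)) = dom \<tau>" "cod (Id A (dom \<tau>)) = dom \<tau>"
      "dom (g i) : Obj A" using S(2) gt(1)[OF ij(1)] by simp_all
    have "matching (Id A (dom \<tau>)) (K i \<sigma> j \<tau>) (dom (g i)) u"
      unfolding matching_def d\<tau>(2)
    proof (intro allI impI conjI)
      fix r assume r: "arr r" "cod r = dom \<tau>" and "K i \<sigma> j \<tau> (Id A (dom \<tau>) ** r)"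
      then have "K i \<sigma> j \<tau> r" by simp
      then obtain t s where L: "L i \<sigma> j \<tau> r t s" using KL[OF ij _ r(1) S(1,2)] r S(3) by auto
      note w = a(3-6)[OF ij Lspan[OF ij sp r L]]
      have ds: "dom s = dom r" "dom t = dom r" using L by (simp_all add: L_def)
      show "u r : hom A (dom r) (dom (g i))"
        unfolding u[OF r L] using w(1-3) ds gt[OF ij(1)] by (simp add: hom_def)
      fix r' assume r': "arr r'" "cod r' = dom r"
      have L': "L i \<sigma> j \<tau> (r ** r') (t ** r') (s ** r')"
        by (rule Lcomp[OF ij L r(1) r' S(1,2)]) (use r S(3) in simp_all)
      have "u (r ** r') = q i ** \<xi> i (t ** r') j (s ** r')"
        by (rule u[OF _ _ L']) (use r r' in simp_all)
      also have "\<dots> = (q i ** \<xi> i t j s) ** r'"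
        using a(7)[OF ij Lspan[OF ij sp r L] r'(1)] w(1-3) ds r' gt[OF ij(1)] by simp
      finally show "u (r ** r') = u r ** r'" unfolding u[OF r L] .
    qed
    from coversE[OF Kcov(1)[OF ij sp] d\<tau>(1,3,4) this] obtain k where
      k: "arr k" "dom k = dom \<tau>" "cod k = dom (g i)"
      and ku: "\<And>r. arr r ==> cod r = dom \<tau> ==> K i \<sigma> j \<tau> (Id A (dom \<tau>) ** r) ==> k ** r = u r"
      unfolding d\<tau>(2) by metis
    show "\<exists>k. arr k \<and> dom k = dom \<tau> \<and> cod k = dom (g i) \<and>
      (\<forall>r t s. arr r --> cod r = dom \<tau> --> L i \<sigma> j \<tau> r t s --> k ** r = q i ** \<xi> i t j s)"
    proof (intro exI[of _ k] conjI allI impI k)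
      fix r t s assume r: "arr r" "cod r = dom \<tau>" and L: "L i \<sigma> j \<tau> r t s"
      have "k ** r = u r" by (rule ku[OF r]) (use KI[OF L ij(2)] r in simp)
      then show "k ** r = q i ** \<xi> i t j s" unfolding u[OF r L] .
    qed
  qed
  have \<beta>t: "\<beta> i \<sigma> j \<tau> : Arr A" "dom (\<beta> i \<sigma> j \<tau>) = dom \<tau>" "cod (\<beta> i \<sigma> j \<tau>) = dom (g i)"
    if ij: "i : J" "j : J" and sp: "span (I i) (I j ** g j) \<sigma> \<tau>" for i \<sigma> j \<tau>
    using \<beta>[OF that] by blast+
  have \<beta>L: "\<beta> i \<sigma> j \<tau> ** r = q i ** \<xi> i t j s"
    if "i : J" "j : J" "span (I i) (I j ** g j) \<sigma> \<tau>" "arr r" "cod r = dom \<tau>" "L i \<sigma> j \<tau> r t s" for i \<sigma> j \<tau> r t s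
    using \<beta>[OF that(1-3)] that(4-6) by blast

  \<comment> \<open>Arrows on the domain of \<tau> may be compared on lifted elements only; all laws
    of \<beta> are verified in this way.\<close>
  have local_eq: "k = k'"
    if ij: "i : J" "j : J" and sp: "span (I i) (I j ** g j) \<sigma> \<tau>"
      and k: "arr k" "arr k'" "dom k = dom \<tau>" "dom k' = dom \<tau>" "cod k = cod k'"
      and e: "\<And>r t s. arr r ==> cod r = dom \<tau> ==> L i \<sigma> j \<tau> r t s ==> k ** r = k' ** r" for i \<sigma> j \<tau> k k'
  proof -
    note S = Isp[OF ij sp]
    show ?thesis
    proof (rule separatingD[OF covers_separating[OF Kcov(1)[OF ij sp]], of "Id A (dom \<tau>)"])
      fix r assume r: "arr r" "cod r = dom (Id A (dom \<tau>))" "K i \<sigma> j \<tau> (Id A (dom \<tau>) ** r)"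
      then have r': "cod r = dom \<tau>" "K i \<sigma> j \<tau> r" using S(2) by simp_all
      then obtain t s where "L i \<sigma> j \<tau> r t s" using KL[OF ij _ r(1) S(1,2)] r S(3) by auto
      then show "k ** r = k' ** r" by (rule e[OF r(1) r'(1)])
    qed (use k S in simp_all)
  qed
  have "family_action J I g \<beta>"
    unfolding family_action_def
  proof (intro conjI ballI allI impI)
    fix i assume i: "i : J"
    show "g i : Arr A" "cod (g i) = dom (I i)" using gt[OF i] ty[OF i] by simp_all
    fix \<tau> assume \<tau>: "arr \<tau>" "cod \<tau> = dom (g i)"
    have sp: "span (I i) (I i ** g i) (g i ** \<tau>) \<tau>"
      by (rule Ispan[OF i i]) (use \<tau> gt[OF i] in simp_all)
    show "\<beta> i (g i ** \<tau>) i \<tau> = \<tau>"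
    proof (rule local_eq[OF i i sp])
      fix r t s assume r: "arr r" "cod r = dom \<tau>" and L: "L i (g i ** \<tau>) i \<tau> r t s"
      note l = L[unfolded L_def]
      have "P i ** t = g i ** \<tau> ** r" using l r \<tau> gt(1)[OF i] by simp
      also have "\<dots> = g i ** q i ** s" using l by simp
      also have "\<dots> = P i ** f i ** s" by (rule gq_eq[OF i]) (use l in simp_all)
      finally have "span (P i) (P i ** f i) t s" unfolding Pspan[OF i] using l by simp
      from q\<xi>[OF i this] have "q i ** \<xi> i t i s = \<tau> ** r" using l by simp
      then show "\<beta> i (g i ** \<tau>) i \<tau> ** r = \<tau> ** r" unfolding \<beta>L[OF i i sp r L] .
    qed (use \<beta>t[OF i i sp] \<tau> in simp_all)
  next
    fix i j \<sigma> \<tau> assume ij: "i : J" "j : J" and sp: "span (I i) (I j ** g j) \<sigma> \<tau>"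
    note S = Isp[OF ij sp]
    show "\<beta> i \<sigma> j \<tau> : hom A (dom \<tau>) (dom (g i))" using \<beta>t[OF ij sp] by (simp add: hom_def)
    show "g i ** \<beta> i \<sigma> j \<tau> = \<sigma>"
    proof (rule local_eq[OF ij sp])
      fix r t s assume r: "arr r" "cod r = dom \<tau>" and L: "L i \<sigma> j \<tau> r t s"
      note w = a(3-6)[OF ij Lspan[OF ij sp r L]]
      have "(g i ** \<beta> i \<sigma> j \<tau>) ** r = g i ** \<beta> i \<sigma> j \<tau> ** r"
        by (rule comp_assoc) (use r \<beta>t[OF ij sp] gt(1)[OF ij(1)] in simp_all)
      also have "\<dots> = g i ** q i ** \<xi> i t j s" unfolding \<beta>L[OF ij sp r L] ..
      also have "\<dots> = P i ** f i ** \<xi> i t j s" by (rule gq_eq[OF ij(1) w(1,3)])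
      also have "\<dots> = \<sigma> ** r" unfolding w(4) using L by (simp add: L_def)
      finally show "(g i ** \<beta> i \<sigma> j \<tau>) ** r = \<sigma> ** r" .
    qed (use \<beta>t[OF ij sp] gt[OF ij(1)] S in simp_all)
    fix \<rho> assume \<rho>: "arr \<rho>" "cod \<rho> = dom \<tau>"
    have sp': "span (I i) (I j ** g j) (\<sigma> ** \<rho>) (\<tau> ** \<rho>)"
      by (rule span_comp[OF sp]) (use \<rho> ty(1-3)[OF ij(1)] ty(1-3)[OF ij(2)] gt[OF ij(2)] in simp_all)
    have d: "dom (\<tau> ** \<rho>) = dom \<rho>" using \<rho> S(2) by simp
    show "\<beta> i (\<sigma> ** \<rho>) j (\<tau> ** \<rho>) = \<beta> i \<sigma> j \<tau> ** \<rho>"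
    proof (rule local_eq[OF ij sp'])
      fix r t s assume r: "arr r" "cod r = dom (\<tau> ** \<rho>)" and L: "L i (\<sigma> ** \<rho>) j (\<tau> ** \<rho>) r t s"
      have L': "L i \<sigma> j \<tau> (\<rho> ** r) t s" using L r d \<rho> S(1-5) unfolding L_def by simp
      have "\<beta> i \<sigma> j \<tau> ** \<rho> ** r = q i ** \<xi> i t j s"
        by (rule \<beta>L[OF ij sp _ _ L']) (use r d \<rho> in simp_all)
      then show "\<beta> i (\<sigma> ** \<rho>) j (\<tau> ** \<rho>) ** r = (\<beta> i \<sigma> j \<tau> ** \<rho>) ** r"
        unfolding \<beta>L[OF ij sp' r L] using \<beta>t[OF ij sp] \<rho> r d by simp
    qed (use \<beta>t[OF ij sp] \<beta>t[OF ij sp'] \<rho> d in simp_all)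
  next
    fix i i' j \<sigma> \<sigma>' \<tau> assume ij: "i : J" "i' : J" "j : J"
      and sp: "span (I i) (I j ** g j) \<sigma> \<tau>" and sp': "span (I i') (I j ** g j) \<sigma>' \<tau>"
    note S = Isp[OF ij(1,3) sp] and S' = Isp[OF ij(2,3) sp'] and b = \<beta>t[OF ij(1,3) sp]
    have gb: "g i ** \<beta> i \<sigma> j \<tau> = \<sigma>"
    proof (rule local_eq[OF ij(1,3) sp])
      fix r t s assume r: "arr r" "cod r = dom \<tau>" and L: "L i \<sigma> j \<tau> r t s"
      note w = a(3-6)[OF ij(1,3) Lspan[OF ij(1,3) sp r L]]
      have "(g i ** \<beta> i \<sigma> j \<tau>) ** r = g i ** \<beta> i \<sigma> j \<tau> ** r"
        by (rule comp_assoc) (use r b gt(1)[OF ij(1)] in simp_all)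
      also have "\<dots> = g i ** q i ** \<xi> i t j s" unfolding \<beta>L[OF ij(1,3) sp r L] ..
      also have "\<dots> = P i ** f i ** \<xi> i t j s" by (rule gq_eq[OF ij(1) w(1,3)])
      also have "\<dots> = \<sigma> ** r" unfolding w(4) using L by (simp add: L_def)
      finally show "(g i ** \<beta> i \<sigma> j \<tau>) ** r = \<sigma> ** r" .
    qed (use b gt[OF ij(1)] S in simp_all)
    have sp2: "span (I i') (I i ** g i) \<sigma>' (\<beta> i \<sigma> j \<tau>)"
      by (rule Ispan[OF ij(2,1)]) (use S S' b gb in simp_all)
    note b2 = \<beta>t[OF ij(2,1) sp2] and b3 = \<beta>t[OF ij(2,3) sp']
    \<comment> \<open>Three elements must be lifted here, so the test is refined twice: along
      \<open>r\<close> there are lifts of \<sigma> and \<tau>, and along \<open>r'\<close> one of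
      the restriction of \<open>\<sigma>'\<close> as well.\<close>
    show "\<beta> i' \<sigma>' i (\<beta> i \<sigma> j \<tau>) = \<beta> i' \<sigma>' j \<tau>"
    proof (rule local_eq[OF ij(1,3) sp])
      fix r t s assume r: "arr r" "cod r = dom \<tau>" and L: "L i \<sigma> j \<tau> r t s"
      have spr: "span (I i') (I j ** g j) (\<sigma>' ** r) (\<tau> ** r)"
        by (rule span_comp[OF sp']) (use r ty(1-3)[OF ij(2)] ty(1-3)[OF ij(3)] gt[OF ij(3)] in simp_all)
      have d: "dom (\<tau> ** r) = dom r" using r S(2) by simp
      show "\<beta> i' \<sigma>' i (\<beta> i \<sigma> j \<tau>) ** r = \<beta> i' \<sigma>' j \<tau> ** r"
      proof (rule local_eq[OF ij(2,3) spr])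
        fix r' t' s' assume r': "arr r'" "cod r' = dom (\<tau> ** r)" and L': "L i' (\<sigma>' ** r) j (\<tau> ** r) r' t' s'"
        have rr: "r ** r' : Arr A" "cod (r ** r') = dom \<tau>" using r r' d by simp_all
        have L1: "L i \<sigma> j \<tau> (r ** r') (t ** r') (s ** r')"
          by (rule Lcomp[OF ij(1,3) L r(1) r'(1) _ S(1,2)]) (use r r' d S(3) in simp_all)
        have L2: "L i' \<sigma>' j \<tau> (r ** r') t' s'" using L' r r' d S'(1-5) unfolding L_def by simp
        have L3: "L i' \<sigma>' j \<tau> (r ** r') t' (s ** r')" using L1 L2 unfolding L_def by simp
        note ls1 = Lspan[OF ij(1,3) sp rr L1] and ls3 = Lspan[OF ij(2,3) sp' rr L3]
        note w = a(3-6)[OF ij(1,3) ls1]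
        have b1: "\<beta> i \<sigma> j \<tau> ** r ** r' = q i ** \<xi> i (t ** r') j (s ** r')"
          by (rule \<beta>L[OF ij(1,3) sp rr L1])
        \<comment> \<open>The transport by \<xi> of the lifts is itself a lift of the class computed
          by \<beta>, so the outer \<beta> can be evaluated on it.\<close>
        have L4: "L i' \<sigma>' i (\<beta> i \<sigma> j \<tau>) (r ** r') t' (\<xi> i (t ** r') j (s ** r'))"
          using L3 L1 w(1-3) b1 unfolding L_def by simp
        have "\<beta> i' \<sigma>' i (\<beta> i \<sigma> j \<tau>) ** r ** r' = q i' ** \<xi> i' t' i (\<xi> i (t ** r') j (s ** r'))"
          by (rule \<beta>L[OF ij(2,1) sp2 _ _ L4]) (use rr b in simp_all)
        also have "\<dots> = q i' ** \<xi> i' t' j (s ** r')"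
          using a(8)[OF ij(1,2,3) ls1 ls3] by simp
        also have "\<dots> = \<beta> i' \<sigma>' j \<tau> ** r ** r'"
          by (rule \<beta>L[OF ij(2,3) sp' rr L3, symmetric])
        finally show "(\<beta> i' \<sigma>' i (\<beta> i \<sigma> j \<tau>) ** r) ** r' = (\<beta> i' \<sigma>' j \<tau> ** r) ** r'"
          using b b2 b3 r r' d by simp
      qed (use b b2 b3 r d in simp_all)
    qed (use b b2 b3 in simp_all)
  qed
  then obtain g' \<kappa> where g\<kappa>: "\<And>i. i : J ==> is_pullback A (I i) g' (g i) (\<kappa> i) \<and>
      (\<forall>j\<in>J. \<forall>\<sigma> \<tau>. span (I i) (I j ** g j) \<sigma> \<tau> --> \<kappa> i ** \<beta> i \<sigma> j \<tau> = \<kappa> j ** \<tau>)"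
    using Ieff unfolding family_effective_def by blast
  have pb': "is_pullback A (I i) g' (g i) (\<kappa> i)" if "i : J" for i using g\<kappa>[OF that] by blast
  have \<kappa>\<beta>: "\<kappa> i ** \<beta> i \<sigma> j \<tau> = \<kappa> j ** \<tau>" if "i : J" "j : J" "span (I i) (I j ** g j) \<sigma> \<tau>" for i j \<sigma> \<tau>
    using g\<kappa>[OF that(1)] that(2,3) by blast
  have \<kappa>t: "\<kappa> i : Arr A" "dom (\<kappa> i) = dom (g i)" if "i : J" for i
    using pullback_arrs[OF pb'[OF that]] by simp_all
  show "\<exists>g \<kappa>. \<forall>i\<in>J. is_pullback A (\<phi> i) g (f i) (\<kappa> i) \<and>
        (\<forall>j\<in>J. \<forall>t s. span (\<phi> i) (\<phi> j ** f j) t s --> \<kappa> i ** \<xi> i t j s = \<kappa> j ** s)"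
  proof (intro exI[of _ g'] exI[of _ "\<lambda>i. \<kappa> i ** q i"] ballI conjI allI impI)
    fix i assume i: "i : J"
    show "is_pullback A (\<phi> i) g' (f i) (\<kappa> i ** q i)"
      using pullback_paste[OF pb[OF i] pb'[OF i]] \<phi>[OF i] by simp
    fix j t s assume j: "j : J" and s: "span (\<phi> i) (\<phi> j ** f j) t s"
    note S = spanD(1-5)[OF s]
    have S': "arr t" "arr s" "dom t = dom s" "cod t = dom (P i)" "cod s = dom (f j)"
      using S ty[OF i] ty[OF j] \<phi>[OF j] by simp_all
    have "I i ** P i ** t = I j ** P j ** f j ** s"
      using spanD(6)[OF s] \<phi>c[OF i S'(1,4)] \<phi>f(1)[OF j S'(2,5)] by simp
    then have sp: "span (I i) (I j ** g j) (P i ** t) (q j ** s)"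
      by (intro Ispan[OF i j]) (use S' gq_eq[OF j S'(2,5)] ty(1)[OF i] gt[OF j] in simp_all)
    have d: "dom (q j ** s) = dom s" using S' gt[OF j] by simp
    \<comment> \<open>Elements that come from the objects above are their own lifts; with the
      identity as restriction, \<beta> is the class of \<xi>.\<close>
    have L: "L i (P i ** t) j (q j ** s) (Id A (dom s)) t s"
      using S' ty(1)[OF i] gt[OF j] by (simp add: L_def)
    note w = a(3-5)[OF i j s]
    have "q i ** \<xi> i t j s = \<beta> i (P i ** t) j (q j ** s) ** Id A (dom s)"
      by (rule \<beta>L[OF i j sp _ _ L, symmetric]) (use S' d in simp_all)
    also have "\<dots> = \<beta> i (P i ** t) j (q j ** s)" using \<beta>t[OF i j sp] d by simp
    finally have "\<kappa> i ** q i ** \<xi> i t j s = \<kappa> j ** q j ** s" using \<kappa>\<beta>[OF i j sp] by simp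
    then show "(\<kappa> i ** q i) ** \<xi> i t j s = (\<kappa> j ** q j) ** s"
      using w S' \<kappa>t[OF i] \<kappa>t[OF j] gt[OF i] gt[OF j] by simp
  qed
qed

end

section \<open>Descent for families in the free coproduct completion\<close>

lemma Fam_simps [simp]:
  "Obj (Fam small A) = fam_objs small A" "Dom (Fam small A) = fa_dom" "Cod (Fam small A) = fa_cod"
  "Comp (Fam small A) g f = \<lparr>fa_dom = fa_dom f, fa_cod = fa_cod g,
       fa_idx = (\<lambda>j\<in>idx (fa_dom f). fa_idx g (fa_idx f j)),
       fa_mem = (\<lambda>j\<in>idx (fa_dom f). Comp A (fa_mem g (fa_idx f j)) (fa_mem f j))\<rparr>"
  by (simp_all add: Fam_def)

lemma Fam_arr_iff:
  "f : Arr (Fam small A) \<longleftrightarrow> fa_dom f : fam_objs small A \<and> fa_cod f : fam_objs small A \<and>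
       fa_idx f : (idx (fa_dom f) \<rightarrow>\<^sub>E idx (fa_cod f)) \<and>
       fa_mem f : (\<Pi>\<^sub>E j\<in>idx (fa_dom f). hom A (mem (fa_dom f) j) (mem (fa_cod f) (fa_idx f j)))"
  by (simp add: Fam_def)

lemma Fam_arrD:
  assumes "f : Arr (Fam small A)"
  shows "fa_dom f : fam_objs small A" "fa_cod f : fam_objs small A"
    and "k : idx (fa_dom f) ==> fa_idx f k : idx (fa_cod f)"
    and "k : idx (fa_dom f) ==> fa_mem f k : Arr A"
    and "k : idx (fa_dom f) ==> Dom A (fa_mem f k) = mem (fa_dom f) k"
    and "k : idx (fa_dom f) ==> Cod A (fa_mem f k) = mem (fa_cod f) (fa_idx f k)"
  using assms unfolding Fam_arr_iff hom_def by auto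

lemma Fam_arr_eqI:
  assumes "f : Arr (Fam small A)" "g : Arr (Fam small A)" "fa_dom f = fa_dom g" "fa_cod f = fa_cod g"
    "\<And>k. k : idx (fa_dom g) ==> fa_idx f k = fa_idx g k"
    "\<And>k. k : idx (fa_dom g) ==> fa_mem f k = fa_mem g k"
  shows "f = g"
proof -
  have e: "fa_idx f : extensional (idx (fa_dom g))" "fa_idx g : extensional (idx (fa_dom g))"
    "fa_mem f : extensional (idx (fa_dom g))" "fa_mem g : extensional (idx (fa_dom g))"
    using assms(1-3) unfolding Fam_arr_iff PiE_def by auto
  have "fa_idx f = fa_idx g" by (rule extensionalityI[OF e(1,2) assms(5)])
  moreover have "fa_mem f = fa_mem g" by (rule extensionalityI[OF e(3,4) assms(6)])
  ultimately show ?thesis using assms(3,4) by simp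
qed

lemma one_member_simps [simp]:
  "idx (one_member x) = {undefined}" "mem (one_member x) undefined = x"
  by (simp_all add: one_member_def)

text \<open>An arrow from a one-member family picks a member \<open>z\<close> of \<open>Y\<close>
  and an arrow into it; these are the generalized elements on which families are tested.\<close>

definition single :: "('o, 'm) cat => ('u, 'o) family => 'u => 'm => ('u, 'o, 'm) fam_arr" where
  "single A Y z q = \<lparr>fa_dom = one_member (Dom A q), fa_cod = Y,
     fa_idx = (\<lambda>k\<in>{undefined}. z), fa_mem = (\<lambda>k\<in>{undefined}. q)\<rparr>"

lemma single_simps [simp]:
  "fa_dom (single A Y z q) = one_member (Dom A q)" "fa_cod (single A Y z q) = Y"
  "fa_idx (single A Y z q) undefined = z" "fa_mem (single A Y z q) undefined = q"
  by (simp_all add: single_def)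

lemma single_inject:
  assumes "single A Y z q = single A Y' z' q'"
  shows "z = z'" "q = q'"
  using assms single_simps(3,4) by metis+

locale universe_cartesian = universe small pair + cartesian A
  for small :: "'u set => bool" and pair :: "'u => 'u => 'u" and A :: "('o, 'm) cat"
begin

abbreviation fc where "fc \<equiv> Fam small A"

text \<open>An infinite small set is nonempty, and a constant map collapses it to a
  singleton.\<close>

lemma small_singleton: "small {a}"
proof -
  obtain S where S: "infinite S" "small S" using small_infinite by blast
  then have "(\<lambda>_. a) ` S = {a}" by (metis image_constant_conv finite.emptyI)
  then show ?thesis using small_image[OF S(2), of "\<lambda>_. a"] by simp
qed

lemma small_empty: "small {}"
  by (rule small_subset[OF small_singleton]) simp

lemma one_member_obj: "x : Obj A ==> one_member x : fam_objs small A"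
  by (auto simp: fam_objs_def one_member_def small_singleton)

lemma single_arr:
  assumes "Y : fam_objs small A" "z : idx Y" "arr q" "cod q = mem Y z"
  shows "single A Y z q : Arr fc"
  using assms one_member_obj[of "dom q"] unfolding Fam_arr_iff by (auto simp: single_def hom_def)

lemma comp_single:
  assumes "f : Arr fc" "fa_dom f = Y" "z : idx Y" "arr q" "cod q = mem Y z"
  shows "Comp fc f (single A Y z q) = single A (fa_cod f) (fa_idx f z) (fa_mem f z ** q)"
  using Fam_arrD(4-6)[OF assms(1)] assms(2-) by (auto simp: single_def fun_eq_iff)

lemma arr_single:
  assumes "f : Arr fc" "fa_dom f = one_member x"
  shows "f = single A (fa_cod f) (fa_idx f undefined) (fa_mem f undefined)"
    "dom (fa_mem f undefined) = x" "fa_mem f undefined : Arr A"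
    "cod (fa_mem f undefined) = mem (fa_cod f) (fa_idx f undefined)" "fa_idx f undefined : idx (fa_cod f)"
proof -
  note D = Fam_arrD(3-6)[OF assms(1), of undefined] Fam_arrD(1,2)[OF assms(1)]
  show 1: "dom (fa_mem f undefined) = x" "fa_mem f undefined : Arr A"
    "cod (fa_mem f undefined) = mem (fa_cod f) (fa_idx f undefined)" "fa_idx f undefined : idx (fa_cod f)"
    using D by (simp_all add: assms(2))
  show "f = single A (fa_cod f) (fa_idx f undefined) (fa_mem f undefined)"
    by (rule Fam_arr_eqI[OF assms(1) single_arr]) (use D 1 assms(2) in simp_all)
qed

end

section \<open>Families over one member: descent read back in the base category\<close>

locale family_into = universe_cartesian small pair A + F: category "Fam small A"
  for small :: "'u set => bool" and pair :: "'u => 'u => 'u" and A :: "('o, 'm) cat" +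
  fixes code :: "'t => 'u" and T :: "'t set" and \<phi> :: "'t => 'm" and y :: 'o
  assumes code_inj: "inj_on code T"
    and into_arr: "fam_into A code T \<phi> y : Arr (Fam small A)"
begin

abbreviation p where "p \<equiv> fam_into A code T \<phi> y"
abbreviation ix where "ix \<equiv> inv_into T code"

lemma ix_code [simp]: "i : T ==> ix (code i) = i"
  by (rule inv_into_f_f[OF code_inj])

lemma ix_in [simp]: "k : code ` T ==> ix k : T"
  by (rule inv_into_into)

lemma into_simps [simp]:
  "idx (fa_dom p) = code ` T" "fa_cod p = one_member y"
  "k : code ` T ==> fa_idx p k = undefined" "k : code ` T ==> fa_mem p k = \<phi> (ix k)"
  "k : code ` T ==> mem (fa_dom p) k = dom (\<phi> (ix k))"
  by (simp_all add: fam_into_def)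

lemma \<phi>_arr: "i : T ==> \<phi> i : Arr A" "i : T ==> cod (\<phi> i) = y"
  using Fam_arrD(4,6)[OF into_arr, of "code i"] by auto

lemma y_obj: "y : Obj A"
  using Fam_arrD(2)[OF into_arr] by (auto simp: fam_objs_def one_member_def)

lemma into_obj: "fa_dom p : fam_objs small A" "small (code ` T)"
  using Fam_arrD(1)[OF into_arr] by (auto simp: fam_objs_def)

text \<open>Equality of composites in families is equality on each member: a lift along
  \<open>p\<close> chooses an index in \<open>T\<close> and a factorization through that member of
  \<phi>.\<close>

lemma span_decode:
  assumes g: "g : Arr fc" "fa_cod g = one_member y"
    and s: "F.span p g t q" and k: "k : idx (fa_dom q)"
  shows "fa_dom t = fa_dom q" "fa_idx t k : code ` T" "fa_mem t k : Arr A" "fa_mem q k : Arr A"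
    "dom (fa_mem t k) = mem (fa_dom q) k" "dom (fa_mem q k) = mem (fa_dom q) k"
    "cod (fa_mem t k) = dom (\<phi> (ix (fa_idx t k)))"
    "fa_idx q k : idx (fa_dom g)" "cod (fa_mem q k) = mem (fa_dom g) (fa_idx q k)"
    "\<phi> (ix (fa_idx t k)) ** fa_mem t k = fa_mem g (fa_idx q k) ** fa_mem q k"
proof -
  have S: "t : Arr fc" "q : Arr fc" "fa_dom t = fa_dom q" "fa_cod t = fa_dom p"
    "fa_cod q = fa_dom g" and e: "Comp fc p t = Comp fc g q"
    using F.spanD[OF s] by simp_all
  note t = Fam_arrD(3-6)[OF S(1), of k] and q = Fam_arrD(3-6)[OF S(2), of k]
  show "fa_dom t = fa_dom q" by fact
  show i: "fa_idx t k : code ` T" and "fa_mem t k : Arr A" "fa_mem q k : Arr A"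
    "dom (fa_mem t k) = mem (fa_dom q) k" "dom (fa_mem q k) = mem (fa_dom q) k"
    "fa_idx q k : idx (fa_dom g)" "cod (fa_mem q k) = mem (fa_dom g) (fa_idx q k)"
    using t q k S(3-5) by simp_all
  show "cod (fa_mem t k) = dom (\<phi> (ix (fa_idx t k)))"
    using t(4) k S(3,4) into_simps(5)[OF i] by simp
  have "fa_mem (Comp fc p t) k = fa_mem (Comp fc g q) k" using e by (rule arg_cong)
  then show "\<phi> (ix (fa_idx t k)) ** fa_mem t k = fa_mem g (fa_idx q k) ** fa_mem q k"
    using k S(3) i by simp
qed

lemma span_encode:
  assumes g: "g : Arr fc" "fa_cod g = one_member y" "fa_dom g = Z"
    and i: "i : T" and z: "z : idx Z"
    and t: "arr t" "cod t = dom (\<phi> i)" and q: "arr q" "cod q = mem Z z" "dom t = dom q"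
    and e: "\<phi> i ** t = fa_mem g z ** q"
  shows "F.span p g (single A (fa_dom p) (code i) t) (single A Z z q)"
proof -
  note gz = Fam_arrD(3)[OF g(1), of z] Fam_arrD(1)[OF g(1)]
  have 1: "single A (fa_dom p) (code i) t : Arr fc"
    by (rule single_arr[OF into_obj(1)]) (use i t in simp_all)
  have 2: "single A Z z q : Arr fc"
    by (rule single_arr) (use gz g(3) z q in simp_all)
  have "Comp fc p (single A (fa_dom p) (code i) t) = single A (one_member y) undefined (\<phi> i ** t)"
    by (subst comp_single[OF into_arr refl]) (use i t in simp_all)
  moreover have "Comp fc g (single A Z z q) = single A (one_member y) undefined (fa_mem g z ** q)"
    by (subst comp_single[OF g(1,3) z q(1,2)]) (use gz g z in simp)
  ultimately show ?thesis
    unfolding F.span_def using 1 2 e q(3) g(3) by (simp del: Fam_simps(4))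
qed

text \<open>The embedding of \<open>A\<close> into its families, on arrows.\<close>

definition point :: "'m => ('u, 'o, 'm) fam_arr" where
  "point g = single A (one_member (cod g)) undefined g"

lemma point_simps [simp]:
  "fa_dom (point g) = one_member (dom g)" "fa_cod (point g) = one_member (cod g)"
  "fa_idx (point g) undefined = undefined" "fa_mem (point g) undefined = g"
  by (simp_all add: point_def)

lemma point_arr: "arr g ==> point g : Arr fc"
  unfolding point_def by (rule single_arr) (simp_all add: one_member_obj)

lemma point_comp:
  "arr g ==> arr f ==> cod f = dom g ==> Comp fc (point g) (point f) = point (g ** f)"
  using comp_single[OF point_arr, of g "one_member (dom g)" undefined f] by (simp add: point_def)

lemma comp_point_eqI:
  assumes q: "q : Arr fc" "fa_cod q = one_member (dom k)" "arr k"
    and r: "r : Arr fc" "fa_dom r = fa_dom q" "fa_cod r = one_member (cod k)"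
    and e: "\<And>j. j : idx (fa_dom q) ==> k ** fa_mem q j = fa_mem r j"
  shows "Comp fc (point k) q = r"
proof (rule Fam_arr_eqI[OF F.arr_comp r(1)])
  fix j assume j: "j : idx (fa_dom r)"
  have u: "fa_idx q j = undefined" "fa_idx r j = undefined"
    using Fam_arrD(3)[OF q(1), of j] Fam_arrD(3)[OF r(1), of j] j q(2) r(2,3) by simp_all
  show "fa_idx (Comp fc (point k) q) j = fa_idx r j" using u j r(2) by simp
  show "fa_mem (Comp fc (point k) q) j = fa_mem r j" using u j r(2) e by simp
qed (use point_arr[OF q(3)] q r in simp_all)

text \<open>Separation along \<open>p\<close> concerns two arrows over the base, whereas here
  \<open>k\<close> and \<open>k'\<close> only share a codomain \<open>x\<close>. Their graphs are
  arrows over the base from \<open>g\<close> into the product of \<open>z\<close> and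
  \<open>x\<close>, to which separation in the slice applies.\<close>

lemma separates_separating:
  assumes "F.separates p"
  shows "separating y (family_factors T \<phi>)"
  unfolding separating_def
proof (intro allI impI)
  fix g k k' assume g: "arr g" "cod g = y"
    and k: "arr k" "arr k'" "dom k = dom g" "dom k' = dom g" "cod k = cod k'"
    and e: "\<forall>q. arr q --> cod q = dom g --> family_factors T \<phi> (g ** q) --> k ** q = k' ** q"
  define z x where "z = dom g" and "x = cod k"
  have zx: "z : Obj A" "x : Obj A" using g k by (simp_all add: z_def x_def)
  define g' where "g' = g ** pr1 A z x"
  define K K' where "K = pairing A (Id A z) k" and "K' = pairing A (Id A z) k'"
  have g': "arr g'" "dom g' = prod_obj A z x" "cod g' = y" using g zx by (simp_all add: g'_def z_def)
  have K: "arr K" "dom K = z" "cod K = prod_obj A z x" "g' ** K = g"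
    using g k zx by (simp_all add: K_def g'_def z_def x_def)
  have K': "arr K'" "dom K' = z" "cod K' = prod_obj A z x" "g' ** K' = g"
    using g k zx by (simp_all add: K'_def g'_def z_def x_def)
  have "point K = point K'"
  proof (rule assms[unfolded F.separates_def, rule_format, of "point g" "point g'"])
    show "point g : Arr fc" "point g' : Arr fc" using g g' by (simp_all add: point_arr)
    show "point K : hom fc (Dom fc (point g)) (Dom fc (point g'))"
      "point K' : hom fc (Dom fc (point g)) (Dom fc (point g'))"
      using K K' g' by (simp_all add: hom_def point_arr z_def)
    show "Comp fc (point g') (point K) = point g" "Comp fc (point g') (point K') = point g"
      by (subst point_comp; use K K' g' in simp)+
    fix t q assume s: "F.span p (point g) t q"
    have qa: "q : Arr fc" "fa_cod q = one_member z" using F.spanD[OF s] by (simp_all add: z_def)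
    have Kq: "Comp fc (point K') q : Arr fc"
      by (rule F.arr_comp) (use qa K' in \<open>simp_all add: point_arr\<close>)
    show "Comp fc (point K) q = Comp fc (point K') q"
    proof (rule comp_point_eqI[OF qa(1) _ K(1) Kq])
      fix j assume j: "j : idx (fa_dom q)"
      note d = span_decode[OF point_arr[OF g(1)] _ s j]
      have u: "fa_idx q j = undefined" using Fam_arrD(3)[OF qa(1) j] qa(2) by simp
      have "family_factors T \<phi> (g ** fa_mem q j)"
        unfolding family_factors_def factors_def using d(2,3,7,10) g u by auto
      then have "k ** fa_mem q j = k' ** fa_mem q j" using e d(4,9) g u by simp
      then have "K ** fa_mem q j = K' ** fa_mem q j"
        unfolding K_def K'_def using d(4,9) g u k zx by (simp add: z_def)
      then show "K ** fa_mem q j = fa_mem (Comp fc (point K') q) j" using j u by simp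
    qed (use qa K K' in simp_all)
  qed (use g g' in simp_all)
  then have "K = K'" by (metis point_simps(4))
  then have "pr2 A z x ** K = pr2 A z x ** K'" by simp
  then show "k = k'" using g k zx by (simp add: K_def K'_def z_def x_def)
qed

text \<open>Again by graphs: pairing each element with its value turns the matching family
  \<open>u\<close> into data \<open>U\<close> over the base. The glued arrow is a graph, and its
  second component glues \<open>u\<close>.\<close>

lemma glues_covers:
  assumes "F.separates p" "F.glues p"
  shows "covers y (family_factors T \<phi>)"
  unfolding covers_def
proof (intro conjI allI impI separates_separating[OF assms(1)])
  fix g x u assume g: "arr g" "cod g = y" "x : Obj A" and m: "matching g (family_factors T \<phi>) x u"
  define z where "z = dom g"
  have z: "z : Obj A" using g by (simp add: z_def)
  define g' where "g' = g ** pr1 A z x"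
  have g': "arr g'" "dom g' = prod_obj A z x" "cod g' = y" using g z by (simp_all add: g'_def z_def)
  define U :: "('u, 'o, 'm) fam_arr => ('u, 'o, 'm) fam_arr" where "U q = \<lparr>fa_dom = fa_dom q, fa_cod = one_member (prod_obj A z x),
    fa_idx = (\<lambda>k\<in>idx (fa_dom q). undefined), fa_mem = (\<lambda>k\<in>idx (fa_dom q). pairing A (fa_mem q k) (u (fa_mem q k)))\<rparr>" for q
  have q: "fa_idx q k = undefined" "fa_mem q k : Arr A" "dom (fa_mem q k) = mem (fa_dom q) k"
      "cod (fa_mem q k) = z" "family_factors T \<phi> (g ** fa_mem q k)"
    if s: "F.span p (point g) t q" and k: "k : idx (fa_dom q)" for t q k
  proof -
    note d = span_decode[OF point_arr[OF g(1)] _ s k]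
    have qa: "q : Arr fc" "fa_cod q = one_member z" using F.spanD[OF s] by (simp_all add: z_def)
    show u: "fa_idx q k = undefined" using Fam_arrD(3)[OF qa(1) k] qa(2) by simp
    show "fa_mem q k : Arr A" "dom (fa_mem q k) = mem (fa_dom q) k" "cod (fa_mem q k) = z"
      using d(4,6,9) g u by (simp_all add: z_def)
    show "family_factors T \<phi> (g ** fa_mem q k)"
      unfolding family_factors_def factors_def using d(2,3,7,10) g u by auto
  qed
  have uq: "u (fa_mem q k) : Arr A" "dom (u (fa_mem q k)) = mem (fa_dom q) k" "cod (u (fa_mem q k)) = x"
    if s: "F.span p (point g) t q" and k: "k : idx (fa_dom q)" for t q k
    using matchingD(1-3)[OF m q(2)[OF s k] _ q(5)[OF s k]] q(3,4)[OF s k] by (simp_all add: z_def)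
  have Uarr: "U q : Arr fc" if s: "F.span p (point g) t q" for t q
    using Fam_arrD(1)[OF F.spanD(2)[OF s]] q[OF s] uq[OF s] one_member_obj[of "prod_obj A z x"] g z
    unfolding Fam_arr_iff by (auto simp: U_def hom_def)
  have "F.lifts p (point g) (point g') U"
    unfolding F.lifts_def
  proof (intro conjI allI impI)
    fix t q assume s: "F.span p (point g) t q"
    have qa: "q : Arr fc" "fa_cod q = one_member z" using F.spanD[OF s] by (simp_all add: z_def)
    show "U q : hom fc (Dom fc q) (Dom fc (point g'))"
      using Uarr[OF s] g' by (simp add: hom_def) (simp add: U_def)
    have gq: "Comp fc (point g) q : Arr fc"
      by (rule F.arr_comp) (use qa g in \<open>simp_all add: point_arr z_def\<close>)
    show "Comp fc (point g') (U q) = Comp fc (point g) q"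
    proof (rule comp_point_eqI[OF Uarr[OF s] _ g'(1) gq])
      fix j assume "j : idx (fa_dom (U q))"
      then have j: "j : idx (fa_dom q)" by (simp add: U_def)
      show "g' ** fa_mem (U q) j = fa_mem (Comp fc (point g) q) j"
        using j q(1-4)[OF s j] uq[OF s j] g z by (simp add: U_def g'_def z_def)
    qed (use g g' in \<open>simp_all add: U_def\<close>)
    fix r assume r: "r : Arr fc" "Cod fc r = Dom fc q"
    have s': "F.span p (point g) (Comp fc t r) (Comp fc q r)"
      by (rule F.span_comp[OF s into_arr point_arr[OF g(1)] r])
    show "U (Comp fc q r) = Comp fc (U q) r"
    proof (rule Fam_arr_eqI[OF Uarr[OF s'] F.arr_comp[OF r(1) Uarr[OF s]]])
      fix j assume "j : idx (fa_dom (Comp fc (U q) r))"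
      then have j: "j : idx (fa_dom r)" by simp
      note rj = Fam_arrD(3-6)[OF r(1) j]
      have rj': "fa_idx r j : idx (fa_dom q)" using rj r(2) by simp
      note Q = q[OF s rj'] and UQ = uq[OF s rj']
      have "u (fa_mem q (fa_idx r j) ** fa_mem r j) = u (fa_mem q (fa_idx r j)) ** fa_mem r j"
        by (rule matchingD(4)[OF m Q(2) _ Q(5)]) (use Q(3,4) rj r(2) in \<open>simp_all add: z_def\<close>)
      then show "fa_mem (U (Comp fc q r)) j = fa_mem (Comp fc (U q) r) j"
        using j rj rj' Q UQ r(2) by (simp add: U_def)
      show "fa_idx (U (Comp fc q r)) j = fa_idx (Comp fc (U q) r) j"
        using j rj' by (simp add: U_def)
    qed (use r in \<open>simp_all add: U_def\<close>)
  qed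
  then have "\<exists>K. K : hom fc (Dom fc (point g)) (Dom fc (point g')) \<and>
      Comp fc (point g') K = point g \<and>
      (\<forall>t q. F.span p (point g) t q --> Comp fc K q = U q)"
    by (intro assms(2)[unfolded F.glues_def, rule_format]) (use g g' in \<open>simp_all add: point_arr\<close>)
  then obtain K where K: "K : hom fc (Dom fc (point g)) (Dom fc (point g'))"
    and KU: "\<And>t q. F.span p (point g) t q ==> Comp fc K q = U q"
    by blast
  have Ka: "K : Arr fc" "fa_dom K = one_member z" "fa_cod K = one_member (prod_obj A z x)"
    using K g' by (simp_all add: hom_def z_def)
  note Ks = arr_single[OF Ka(1,2)]
  define k0 where "k0 = fa_mem K undefined"
  have Kp: "K = point k0" and k0: "arr k0" "dom k0 = z" "cod k0 = prod_obj A z x"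
    using Ks Ka(3) by (simp_all add: k0_def point_def)
  have "(pr2 A z x ** k0) ** q = u q" if q: "arr q" "cod q = dom g" "family_factors T \<phi> (g ** q)" for q
  proof -
    obtain i t where i: "i : T" and t: "arr t" "cod t = dom (\<phi> i)" "\<phi> i ** t = g ** q"
      using q(3) unfolding family_factors_def factors_def by blast
    have "dom t = dom (\<phi> i ** t)" using t(1,2) \<phi>_arr[OF i] by simp
    also have "\<dots> = dom q" unfolding t(3) using q g by simp
    finally have dt: "dom t = dom q" .
    \<comment> \<open>A single factorization of \<open>g ** q\<close> gives a span of one-member
      families; the value of \<open>K\<close> on it is the pair of \<open>q\<close> and
      \<open>u q\<close>.\<close>
    have s: "F.span p (point g) (single A (fa_dom p) (code i) t) (single A (one_member z) undefined q)"
      by (rule span_encode[OF point_arr[OF g(1)]]) (use g q i t dt in \<open>simp_all add: z_def\<close>)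
    have pq: "single A (one_member z) undefined q = point q" using q by (simp add: point_def z_def)
    have "point (k0 ** q) = U (point q)"
      using KU[OF s] unfolding pq Kp by (subst (asm) point_comp) (use k0 q in \<open>simp_all add: z_def\<close>)
    then have "fa_mem (point (k0 ** q)) undefined = fa_mem (U (point q)) undefined" by simp
    then have "k0 ** q = pairing A q (u q)" by (simp add: U_def)
    moreover note M = matchingD(1-3)[OF m q]
    ultimately show ?thesis using k0 q z g by (simp add: z_def)
  qed
  then show "\<exists>k. arr k \<and> dom k = dom g \<and> cod k = x \<and>
       (\<forall>q. arr q --> cod q = dom g --> family_factors T \<phi> (g ** q) --> k ** q = u q)"
    using k0 z g by (intro exI[of _ "pr2 A z x ** k0"]) (simp add: z_def)
qed

text \<open>In the terminal category \<open>A\<close> the empty sieve covers, so nonemptiness is only visible in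
  the category of families: the empty family admits no arrow from a nonempty one.\<close>

lemma glues_nonempty:
  assumes "F.glues p"
  shows "T \<noteq> {}"
proof
  assume T: "T = {}"
  define E :: "('u, 'o) family" where "E = \<lparr>idx = {}, mem = (\<lambda>_. undefined)\<rparr>"
  define mt :: "('u, 'o) family => ('u, 'o) family => ('u, 'o, 'm) fam_arr"
    where "mt X Y = \<lparr>fa_dom = X, fa_cod = Y, fa_idx = (\<lambda>_. undefined), fa_mem = (\<lambda>_. undefined)\<rparr>" for X Y
  have E: "E : fam_objs small A" by (auto simp: E_def fam_objs_def small_empty)
  have mt: "mt X Y : Arr fc" if "X : fam_objs small A" "Y : fam_objs small A" "idx X = {}" for X Y
    using that unfolding Fam_arr_iff by (auto simp: mt_def)
  have mt_eq: "f = mt X Y" if "f : Arr fc" "fa_dom f = X" "fa_cod f = Y" "idx X = {}" for f X Y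
    by (rule Fam_arr_eqI[OF that(1) mt]) (use Fam_arrD(1,2)[OF that(1)] that in \<open>auto simp: mt_def\<close>)
  have yo: "one_member y : fam_objs small A" by (rule one_member_obj[OF y_obj])
  have ida: "point (Id A y) : Arr fc" using y_obj by (intro point_arr) simp
  have q: "idx (fa_dom q) = {}" "q : Arr fc" "fa_dom q : fam_objs small A"
    if s: "F.span p (point (Id A y)) t q" for t q
  proof -
    show q: "q : Arr fc" "fa_dom q : fam_objs small A"
      using F.spanD(2)[OF s] Fam_arrD(1)[OF F.spanD(2)[OF s]] by simp_all
    have "t : Arr fc" "fa_dom t = fa_dom q" "fa_cod t = fa_dom p"
      using F.spanD[OF s] by simp_all
    then have "fa_idx t k : code ` T" if "k : idx (fa_dom q)" for k
      using Fam_arrD(3)[of t small A k] that by simp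
    then show "idx (fa_dom q) = {}" using T by blast
  qed
  \<comment> \<open>With \<open>T\<close> empty, a family that lifts along \<open>p\<close> has no
    members, and its unique arrow to the empty family \<open>E\<close> serves as data over the base.
    The glued arrow would lead from a one-member family to \<open>E\<close>.\<close>
  have "F.lifts p (point (Id A y)) (mt E (one_member y)) (\<lambda>q. mt (fa_dom q) E)"
    unfolding F.lifts_def
  proof (intro conjI allI impI)
    fix t q assume s: "F.span p (point (Id A y)) t q"
    note Q = q[OF s]
    show "mt (fa_dom q) E : hom fc (Dom fc q) (Dom fc (mt E (one_member y)))"
      using mt[OF Q(3) E Q(1)] by (simp add: hom_def) (simp add: mt_def)
    have 1: "Comp fc (mt E (one_member y)) (mt (fa_dom q) E) : Arr fc"
      by (rule F.arr_comp[OF mt[OF Q(3) E Q(1)] mt[OF E yo]]) (simp_all add: mt_def E_def)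
    have 2: "Comp fc (point (Id A y)) q : Arr fc"
      by (rule F.arr_comp[OF Q(2) ida]) (use F.spanD[OF s] in simp)
    have "Comp fc (mt E (one_member y)) (mt (fa_dom q) E) = mt (fa_dom q) (one_member y)"
      by (rule mt_eq[OF 1]) (use Q in \<open>simp_all add: mt_def\<close>)
    moreover have "Comp fc (point (Id A y)) q = mt (fa_dom q) (one_member y)"
      by (rule mt_eq[OF 2]) (use Q y_obj in simp_all)
    ultimately show "Comp fc (mt E (one_member y)) (mt (fa_dom q) E) = Comp fc (point (Id A y)) q"
      by (rule trans[OF _ sym])
    fix r assume r: "r : Arr fc" "Cod fc r = Dom fc q"
    have rE: "idx (fa_dom r) = {}" using Fam_arrD(3)[OF r(1)] r(2) Q(1) by auto
    have 3: "Comp fc (mt (fa_dom q) E) r : Arr fc"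
      by (rule F.arr_comp[OF r(1) mt[OF Q(3) E Q(1)]]) (use r in \<open>simp add: mt_def\<close>)
    have "Comp fc (mt (fa_dom q) E) r = mt (fa_dom r) E"
      by (rule mt_eq[OF 3]) (use rE in \<open>simp_all add: mt_def\<close>)
    then show "mt (fa_dom (Comp fc q r)) E = Comp fc (mt (fa_dom q) E) r"
      by simp
  qed
  then have "\<exists>K. K : hom fc (Dom fc (point (Id A y))) (Dom fc (mt E (one_member y))) \<and>
      Comp fc (mt E (one_member y)) K = point (Id A y) \<and>
      (\<forall>t q. F.span p (point (Id A y)) t q --> Comp fc K q = mt (fa_dom q) E)"
    by (rule assms[unfolded F.glues_def, rule_format, OF ida mt[OF E yo], rotated -1])
      (use y_obj in \<open>simp_all add: mt_def E_def\<close>)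
  then obtain K where K: "K : hom fc (Dom fc (point (Id A y))) (Dom fc (mt E (one_member y)))"
    by blast
  then have "K : Arr fc" "fa_dom K = one_member y" "fa_cod K = E"
    using y_obj by (simp_all add: hom_def mt_def)
  then show False using Fam_arrD(3)[of K small A undefined] by (simp add: E_def)
qed

text \<open>The \<open>f i\<close> are assembled into one family over the domain of
  \<open>p\<close>, with member \<open>code i\<close> for each \<open>i\<close>, and the indexed
  transport into one action. Its quotient is a priori a family over \<open>y\<close>; comparing
  indices shows that it has exactly one member, and this member is the common arrow.\<close>

lemma effective_family_effective:
  assumes eff: "F.actions_effective p" and ne: "T \<noteq> {}"
  shows "family_effective T \<phi>"
  unfolding family_effective_def
proof (intro allI impI)
  fix f \<xi> assume act: "family_action T \<phi> f \<xi>"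
  note a = family_actionD[OF act]
  define W :: "('u, 'o) family" where "W = \<lparr>idx = code ` T, mem = (\<lambda>k\<in>code ` T. dom (f (ix k)))\<rparr>"
  have Wi [simp]: "idx W = code ` T" "k : code ` T ==> mem W k = dom (f (ix k))" for k by (simp_all add: W_def)
  have W: "W : fam_objs small A" using into_obj(2) a(1) by (auto simp: fam_objs_def W_def)
  define fh where "fh = \<lparr>fa_dom = W, fa_cod = fa_dom p, fa_idx = (\<lambda>k\<in>code ` T. k), fa_mem = (\<lambda>k\<in>code ` T. f (ix k))\<rparr>"
  have fh [simp]: "fa_dom fh = W" "fa_cod fh = fa_dom p" "k : code ` T ==> fa_idx fh k = k"
    "k : code ` T ==> fa_mem fh k = f (ix k)" for k by (simp_all add: fh_def)
  have fha: "fh : Arr fc"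
    using W into_obj(1) a(1,2) unfolding Fam_arr_iff by (auto simp: fh_def hom_def)
  define pf where "pf = Comp fc p fh"
  have pf: "pf : Arr fc" "fa_dom pf = W" "fa_cod pf = one_member y"
    "k : code ` T ==> fa_mem pf k = \<phi> (ix k) ** f (ix k)" for k
    unfolding pf_def using F.arr_comp[OF fha into_arr] by simp_all
  \<comment> \<open>Transport acts member by member. The new index is that of \<open>t\<close>, so
    an element may move to another member of \<open>W\<close>.\<close>
  define \<alpha> :: "('u, 'o, 'm) fam_arr => ('u, 'o, 'm) fam_arr => ('u, 'o, 'm) fam_arr"
    where "\<alpha> t s = \<lparr>fa_dom = fa_dom s, fa_cod = W, fa_idx = fa_idx t,
    fa_mem = (\<lambda>k\<in>idx (fa_dom s). \<xi> (ix (fa_idx t k)) (fa_mem t k) (ix (fa_idx s k)) (fa_mem s k))\<rparr>" for t s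
  have dec: "fa_idx t k : code ` T" "fa_idx s k : code ` T"
      "span (\<phi> (ix (fa_idx t k))) (\<phi> (ix (fa_idx s k)) ** f (ix (fa_idx s k))) (fa_mem t k) (fa_mem s k)"
      "dom (fa_mem s k) = mem (fa_dom s) k" "fa_mem s k : Arr A" "cod (fa_mem s k) = dom (f (ix (fa_idx s k)))"
      "fa_mem t k : Arr A" "dom (fa_mem t k) = mem (fa_dom s) k"
    if s: "F.span p pf t s" and k: "k : idx (fa_dom s)" for t s k
  proof -
    note d = span_decode[OF pf(1,3) s k]
    show i: "fa_idx t k : code ` T" "fa_idx s k : code ` T" using d(2,8) pf(2) by simp_all
    show "dom (fa_mem s k) = mem (fa_dom s) k" "fa_mem s k : Arr A" "cod (fa_mem s k) = dom (f (ix (fa_idx s k)))"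
      "fa_mem t k : Arr A" "dom (fa_mem t k) = mem (fa_dom s) k"
      using d pf(2) i by simp_all
    show "span (\<phi> (ix (fa_idx t k))) (\<phi> (ix (fa_idx s k)) ** f (ix (fa_idx s k))) (fa_mem t k) (fa_mem s k)"
      unfolding span_def using d i pf(2,4) \<phi>_arr[OF ix_in[OF i(2)]] a(1,2)[OF ix_in[OF i(2)]] by simp
  qed
  have \<alpha>arr: "\<alpha> t s : Arr fc" if s: "F.span p pf t s" for t s
  proof -
    have S: "t : Arr fc" "s : Arr fc" "fa_dom t = fa_dom s" "fa_cod t = fa_dom p"
      using F.spanD[OF s] by simp_all
    have "fa_idx t : idx (fa_dom s) \<rightarrow>\<^sub>E code ` T" using S unfolding Fam_arr_iff by simp
    moreover have "\<xi> (ix (fa_idx t k)) (fa_mem t k) (ix (fa_idx s k)) (fa_mem s k) : hom A (mem (fa_dom s) k) (mem W (fa_idx t k))"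
      if "k : idx (fa_dom s)" for k
      using dec[OF s that] a(3-5)[OF ix_in[OF dec(1)[OF s that]] ix_in[OF dec(2)[OF s that]] dec(3)[OF s that]]
      by (simp add: hom_def)
    ultimately show ?thesis
      using W Fam_arrD(1)[OF S(2)] unfolding Fam_arr_iff by (auto simp: \<alpha>_def)
  qed
  have "F.action p fh \<alpha>"
    unfolding F.action_def pf_def[symmetric]
  proof (intro conjI allI impI)
    show "fh : Arr fc" by (rule fha)
    show "Cod fc fh = Dom fc p" by simp
    fix t s assume s: "F.span p pf t s"
    have S: "t : Arr fc" "s : Arr fc" "fa_dom t = fa_dom s" "fa_cod t = fa_dom p" "fa_cod s = W"
      using F.spanD[OF s] pf(2) by simp_all
    show "\<alpha> t s : hom fc (Dom fc s) (Dom fc fh)"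
      using \<alpha>arr[OF s] by (simp add: hom_def) (simp add: \<alpha>_def)
    show "Comp fc fh (\<alpha> t s) = t"
    proof (rule Fam_arr_eqI[OF F.arr_comp[OF \<alpha>arr[OF s] fha] S(1)])
      fix k assume "k : idx (fa_dom t)"
      then have k: "k : idx (fa_dom s)" using S(3) by simp
      note d = dec[OF s k]
      show "fa_idx (Comp fc fh (\<alpha> t s)) k = fa_idx t k" using k d(1) by (simp add: \<alpha>_def)
      show "fa_mem (Comp fc fh (\<alpha> t s)) k = fa_mem t k"
        using k d(1) a(6)[OF ix_in[OF d(1)] ix_in[OF d(2)] d(3)] by (simp add: \<alpha>_def)
    qed (use S in \<open>simp_all add: \<alpha>_def\<close>)
  next
    fix t s r assume s: "F.span p pf t s" and r: "r : Arr fc" "Cod fc r = Dom fc s"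
    have S: "t : Arr fc" "s : Arr fc" "fa_dom t = fa_dom s" "fa_cod t = fa_dom p" "fa_cod s = W"
      using F.spanD[OF s] pf(2) by simp_all
    note s' = F.span_comp[OF s into_arr pf(1) r]
    show "\<alpha> (Comp fc t r) (Comp fc s r) = Comp fc (\<alpha> t s) r"
    proof (rule Fam_arr_eqI[OF \<alpha>arr[OF s'] F.arr_comp[OF r(1) \<alpha>arr[OF s]]])
      fix k assume "k : idx (fa_dom (Comp fc (\<alpha> t s) r))"
      then have k: "k : idx (fa_dom r)" by simp
      note R = Fam_arrD(3-6)[OF r(1) k]
      have rk: "fa_idx r k : idx (fa_dom s)" using R r(2) by simp
      note d = dec[OF s rk]
      show "fa_idx (\<alpha> (Comp fc t r) (Comp fc s r)) k = fa_idx (Comp fc (\<alpha> t s) r) k"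
        using k by (simp add: \<alpha>_def)
      show "fa_mem (\<alpha> (Comp fc t r) (Comp fc s r)) k = fa_mem (Comp fc (\<alpha> t s) r) k"
        using k rk R r(2) d(4) a(7)[OF ix_in[OF d(1)] ix_in[OF d(2)] d(3), of "fa_mem r k"] by (simp add: \<alpha>_def)
    qed (use r in \<open>simp_all add: \<alpha>_def\<close>)
  next
    fix t t' s assume s: "F.span p pf t s" and s': "F.span p pf t' s"
    have S: "t : Arr fc" "s : Arr fc" "fa_dom t = fa_dom s" "fa_cod t = fa_dom p" "fa_cod s = W"
      "t' : Arr fc" "fa_dom t' = fa_dom s"
      using F.spanD[OF s] F.spanD[OF s'] pf(2) by simp_all
    have "fa_mem (\<alpha> t' (\<alpha> t s)) = fa_mem (\<alpha> t' s)"
    proof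
      fix k show "fa_mem (\<alpha> t' (\<alpha> t s)) k = fa_mem (\<alpha> t' s) k"
      proof (cases "k : idx (fa_dom s)")
        case True
        note d = dec[OF s True] and d' = dec[OF s' True]
        show ?thesis
          using True a(8)[OF ix_in[OF d(1)] ix_in[OF d'(1)] ix_in[OF d(2)] d(3) d'(3)] by (simp add: \<alpha>_def)
      qed (simp add: \<alpha>_def)
    qed
    then show "\<alpha> t' (\<alpha> t s) = \<alpha> t' s" by (simp add: \<alpha>_def)
  next
    fix s assume s: "s : Arr fc" "Cod fc s = Dom fc fh"
    then have sW: "fa_cod s = W" by simp
    have fs: "Comp fc fh s : Arr fc" by (rule F.arr_comp[OF s(1) fha]) (use s in simp)
    have si: "fa_idx s : idx (fa_dom s) \<rightarrow>\<^sub>E code ` T" using s(1) sW unfolding Fam_arr_iff by simp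
    have "fa_mem (\<alpha> (Comp fc fh s) s) k = fa_mem s k" for k
    proof (cases "k : idx (fa_dom s)")
      case True
      note S = Fam_arrD(3-6)[OF s(1) True]
      have i: "fa_idx s k : code ` T" using S(1) sW by simp
      show ?thesis using True S i sW a(9)[OF ix_in[OF i], of "fa_mem s k"] by (simp add: \<alpha>_def)
    next
      case False
      have "fa_mem s : extensional (idx (fa_dom s))" using s(1) unfolding Fam_arr_iff PiE_def by auto
      then show ?thesis using False by (simp add: \<alpha>_def extensional_def)
    qed
    moreover have "fa_idx (\<alpha> (Comp fc fh s) s) k = fa_idx s k" for k
    proof (cases "k : idx (fa_dom s)")
      case True
      then have "fa_idx s k : code ` T" using si by auto
      then show ?thesis using True by (simp add: \<alpha>_def)
    next
      case False
      then show ?thesis using si by (simp add: \<alpha>_def PiE_def extensional_def)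
    qed
    ultimately have "fa_mem (\<alpha> (Comp fc fh s) s) = fa_mem s"
      "fa_idx (\<alpha> (Comp fc fh s) s) = fa_idx s" by (simp_all add: fun_eq_iff)
    moreover have "fa_dom (\<alpha> (Comp fc fh s) s) = fa_dom s" "fa_cod (\<alpha> (Comp fc fh s) s) = fa_cod s"
      using sW by (simp_all add: \<alpha>_def)
    ultimately show "\<alpha> (Comp fc fh s) s = s"
      by (intro fam_arr.equality) (simp_all del: Fam_simps(4))
  qed
  then obtain g q where pb: "is_pullback fc p g fh q"
    and q\<alpha>: "\<And>t s. F.span p pf t s ==> Comp fc q (\<alpha> t s) = Comp fc q s"
    using eff unfolding F.actions_effective_def pf_def by blast
  note B = F.pullback_arrs[OF pb]
  define Z where "Z = fa_dom g"
  have g: "g : Arr fc" "fa_cod g = one_member y" "fa_dom g = Z"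
    and q: "q : Arr fc" "fa_dom q = W" "fa_cod q = Z"
    using B by (simp_all add: Z_def)
  have gz: "fa_mem g z : Arr A" "dom (fa_mem g z) = mem Z z" "cod (fa_mem g z) = y" if "z : idx Z" for z
    using Fam_arrD(3-6)[OF g(1), of z] that g(2,3) by simp_all
  have qk: "fa_idx q (code i) : idx Z" "fa_mem q (code i) : Arr A" "dom (fa_mem q (code i)) = dom (f i)"
    "cod (fa_mem q (code i)) = mem Z (fa_idx q (code i))" if "i : T" for i
    using Fam_arrD(3-6)[OF q(1), of "code i"] that q(2,3) by simp_all
  \<comment> \<open>A pair of elements of \<open>\<phi> i\<close> and of member \<open>z\<close> of
    \<open>g\<close> with the same image lifts to \<open>W\<close>. The lift has to sit in member
    \<open>code i\<close>, because \<open>fh\<close> preserves indices, so \<open>q\<close> sends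
    that member to \<open>z\<close>.\<close>
  have lift: "fa_idx q (code i) = z \<and> (\<exists>w\<in>hom A (dom t) (dom (f i)). f i ** w = t \<and> fa_mem q (code i) ** w = v)"
    if i: "i : T" and z: "z : idx Z" and t: "arr t" "cod t = dom (\<phi> i)"
      and v: "arr v" "cod v = mem Z z" "dom t = dom v" and e: "\<phi> i ** t = fa_mem g z ** v" for i z t v
  proof -
    note sp = span_encode[OF g i z t v e]
    note S = F.spanD[OF sp]
    have t': "single A (fa_dom p) (code i) t : hom fc (one_member (dom v)) (Dom fc p)"
      "single A Z z v : hom fc (one_member (dom v)) (Dom fc g)"
      using S(1,2) v(3) g(3) by (simp_all add: hom_def)
    obtain h where h: "h : hom fc (one_member (dom v)) (Dom fc fh)"
      "Comp fc fh h = single A (fa_dom p) (code i) t" "Comp fc q h = single A Z z v"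
      by (rule F.pullback_lift[OF pb t' S(6)])
    have ha: "h : Arr fc" "fa_dom h = one_member (dom v)" "fa_cod h = W"
      using h(1) by (simp_all add: hom_def)
    note hs = arr_single[OF ha(1,2), unfolded ha(3)]
    define k w where "k = fa_idx h undefined" and "w = fa_mem h undefined"
    have w: "arr w" "dom w = dom v" "cod w = mem W k" "k : code ` T" and hkw: "h = single A W k w"
      using hs by (simp_all add: k_def w_def)
    have "single A (fa_dom p) k (f (ix k) ** w) = single A (fa_dom p) (code i) t"
      using h(2) unfolding hkw by (subst (asm) comp_single[OF fha]) (use w in simp_all)
    then have k: "k = code i" and fw: "f (ix k) ** w = t" by (rule single_inject)+
    have "single A Z (fa_idx q k) (fa_mem q k ** w) = single A Z z v"
      using h(3) unfolding hkw by (subst (asm) comp_single[OF q(1,2)]) (use w q(3) in simp_all)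
    then have "fa_idx q k = z" "fa_mem q k ** w = v" by (rule single_inject)+
    then show ?thesis using k fw w v(3) i by (intro conjI bexI[of _ w]) (simp_all add: hom_def)
  qed
  \<comment> \<open>The projections of the pullback of \<open>\<phi> i\<close> and
    \<open>fa_mem g z\<close> are such a pair for every \<open>z\<close>, hence each member of
    \<open>Z\<close> is the image of \<open>code i\<close>.\<close>
  have idx_q: "fa_idx q (code i) = z" if i: "i : T" and z: "z : idx Z" for i z
  proof -
    have c: "\<phi> i : Arr A" "fa_mem g z : Arr A" "cod (\<phi> i) = cod (fa_mem g z)"
      using \<phi>_arr[OF i] gz[OF z] by simp_all
    show ?thesis
      using lift[OF i z, of "pi1 (\<phi> i) (fa_mem g z)" "pi2 (\<phi> i) (fa_mem g z)"] spanD[OF pb_span[OF c]] gz[OF z]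
      by simp
  qed
  obtain i0 where i0: "i0 : T" using ne by blast
  define z0 where "z0 = fa_idx q (code i0)"
  have z0: "z0 : idx Z" using qk(1)[OF i0] by (simp add: z0_def)
  have qz: "fa_idx q (code i) = z0" if "i : T" for i by (rule idx_q[OF that z0])
  define G \<kappa> where "G = fa_mem g z0" and "\<kappa> i = fa_mem q (code i)" for i
  show "\<exists>g \<kappa>. \<forall>i\<in>T. is_pullback A (\<phi> i) g (f i) (\<kappa> i) \<and>
        (\<forall>j\<in>T. \<forall>t s. span (\<phi> i) (\<phi> j ** f j) t s --> \<kappa> i ** \<xi> i t j s = \<kappa> j ** s)"
  proof (intro exI[of _ G] exI[of _ \<kappa>] ballI conjI allI impI)
    fix i assume i: "i : T"
    have K: "\<kappa> i : Arr A" "dom (\<kappa> i) = dom (f i)" "cod (\<kappa> i) = mem Z z0"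
      using qk[OF i] qz[OF i] by (simp_all add: \<kappa>_def)
    have Gt: "arr G" "dom G = mem Z z0" "cod G = y" using gz[OF z0] by (simp_all add: G_def)
    have comp_fh: "Comp fc fh (single A W (code i) w) = single A (fa_dom p) (code i) (f i ** w)"
      and comp_q: "Comp fc q (single A W (code i) w) = single A Z z0 (\<kappa> i ** w)"
      if "arr w" "cod w = dom (f i)" for w
      using comp_single[OF fha, of W "code i" w] comp_single[OF q(1,2), of "code i" w] i that q(3) qz[OF i]
      by (simp_all add: \<kappa>_def)
    show "is_pullback A (\<phi> i) G (f i) (\<kappa> i)"
    proof (rule is_pullbackI)
      have "fa_mem (Comp fc p fh) (code i) = fa_mem (Comp fc g q) (code i)"
        using B(9) by (rule arg_cong)
      then show "\<phi> i ** f i = G ** \<kappa> i" using i q(2) qz[OF i] by (simp add: G_def \<kappa>_def)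
    next
      fix u v x assume u: "u : hom A x (dom (\<phi> i))" "v : hom A x (dom G)" "\<phi> i ** u = G ** v"
      then have "\<exists>w\<in>hom A (dom u) (dom (f i)). f i ** w = u \<and> fa_mem q (code i) ** w = v"
        using lift[OF i z0, of u v] Gt by (simp add: hom_def G_def)
      then show "\<exists>h\<in>hom A x (dom (f i)). f i ** h = u \<and> \<kappa> i ** h = v"
        using u(1) by (simp add: hom_def \<kappa>_def)
    next
      fix h h' x assume h: "h : hom A x (dom (f i))" "h' : hom A x (dom (f i))"
        and e: "f i ** h = f i ** h'" "\<kappa> i ** h = \<kappa> i ** h'"
      have H: "arr h" "cod h = dom (f i)" "arr h'" "cod h' = dom (f i)" "dom h = x" "dom h' = x"
        using h by (simp_all add: hom_def)
      have "single A W (code i) h = single A W (code i) h'"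
      proof (rule F.pullback_eq[OF pb, of _ "one_member x"])
        show "single A W (code i) h : hom fc (one_member x) (Dom fc fh)"
          "single A W (code i) h' : hom fc (one_member x) (Dom fc fh)"
          using H i single_arr[OF W] by (simp_all add: hom_def)
        show "Comp fc fh (single A W (code i) h) = Comp fc fh (single A W (code i) h')"
          "Comp fc q (single A W (code i) h) = Comp fc q (single A W (code i) h')"
          unfolding comp_fh[OF H(1,2)] comp_fh[OF H(3,4)] comp_q[OF H(1,2)] comp_q[OF H(3,4)] e by simp_all
      qed
      then show "h = h'" by (rule single_inject)
    qed (use a(1,2)[OF i] \<phi>_arr[OF i] K Gt in simp_all)
    fix j t s assume j: "j : T" and s: "span (\<phi> i) (\<phi> j ** f j) t s"
    note S = spanD[OF s]
    have sj: "cod s = dom (f j)" using S(5) a(1,2)[OF j] \<phi>_arr[OF j] by simp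
    have sp: "F.span p pf (single A (fa_dom p) (code i) t) (single A W (code j) s)"
      by (rule span_encode[OF pf(1,3,2) i]) (use j S sj pf(4) in simp_all)
    have al: "\<alpha> (single A (fa_dom p) (code i) t) (single A W (code j) s) = single A W (code i) (\<xi> i t j s)"
      using i j a(4)[OF i j s] by (simp add: \<alpha>_def single_def fun_eq_iff)
    have "single A Z z0 (\<kappa> i ** \<xi> i t j s) = single A Z z0 (\<kappa> j ** s)"
      using q\<alpha>[OF sp] unfolding al comp_q[OF a(3)[OF i j s] a(5)[OF i j s]]
      using comp_single[OF q(1,2), of "code j" s] j S(2) sj q(3) qz[OF j] by (simp add: \<kappa>_def)
    then show "\<kappa> i ** \<xi> i t j s = \<kappa> j ** s" by (rule single_inject)
  qed
qed

end

section \<open>Enriched categories in terms of generalized elements\<close>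

context universe_cartesian
begin

abbreviation vc where "vc \<equiv> VCat small A"

text \<open>Composition of elements of hom-objects at a common stage. With \<open>un\<close>, the
  unit at the stage \<open>q\<close>, every stage carries an ordinary category, and the enriched
  laws become its laws.\<close>

definition cmp :: "('u, 'o, 'm) vcat => 'u => 'u => 'u => 'm => 'm => 'm" where
  "cmp C x y z a b = VComp C (x, y, z) ** pairing A a b"

definition un :: "('u, 'o, 'm) vcat => 'u => 'o => 'm" where
  "un C x q = VUnit C x ** bang q"

lemma homE: "a : hom A q y ==> arr a \<and> dom a = q \<and> cod a = y \<and> q : Obj A \<and> y : Obj A"
  by (auto simp: hom_def)

lemma vcat_hom_obj:
  "is_vcat A C ==> x : VObj C ==> y : VObj C ==> VHom C (x, y) : Obj A"
  unfolding is_vcat_def by auto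

lemma vcat_unit:
  assumes "is_vcat A C" "x : VObj C"
  shows "VUnit C x : hom A (unit_obj A) (VHom C (x, x))"
proof -
  have "VUnit C : (\<Pi>\<^sub>E x\<in>VObj C. hom A (unit_obj A) (VHom C (x, x)))"
    using assms(1) unfolding is_vcat_def by blast
  then show ?thesis using assms(2) by (rule PiE_mem)
qed

lemma vcat_comp:
  assumes "is_vcat A C" "x : VObj C" "y : VObj C" "z : VObj C"
  shows "VComp C (x, y, z) : hom A (prod_obj A (VHom C (y, z)) (VHom C (x, y))) (VHom C (x, z))"
proof -
  have "VComp C : (\<Pi>\<^sub>E (x, y, z)\<in>VObj C \<times> VObj C \<times> VObj C. hom A (chain3 A C (x, y, z)) (VHom C (x, z)))"
    using assms(1) unfolding is_vcat_def by blast
  from PiE_mem[OF this, of "(x, y, z)"] show ?thesis using assms(2-) by (simp add: chain3_def)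
qed

lemma cmp_hom:
  assumes "is_vcat A C" "x : VObj C" "y : VObj C" "z : VObj C"
    "a : hom A q (VHom C (y, z))" "b : hom A q (VHom C (x, y))"
  shows "cmp C x y z a b : hom A q (VHom C (x, z))"
  using vcat_comp[OF assms(1-4)] assms(5,6) by (simp add: cmp_def hom_def)

lemma cmp_comp:
  assumes "is_vcat A C" "x : VObj C" "y : VObj C" "z : VObj C"
    "a : hom A q (VHom C (y, z))" "b : hom A q (VHom C (x, y))" "r : hom A q' q"
  shows "cmp C x y z a b ** r = cmp C x y z (a ** r) (b ** r)"
  using vcat_comp[OF assms(1-4)] assms(5-7) by (simp add: cmp_def hom_def)

lemma un_hom:
  assumes "is_vcat A C" "x : VObj C" "q : Obj A"
  shows "un C x q : hom A q (VHom C (x, x))"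
  using vcat_unit[OF assms(1,2)] assms(3) by (simp add: un_def hom_def)

lemma un_comp:
  assumes "is_vcat A C" "x : VObj C" "r : hom A q' q"
  shows "un C x q ** r = un C x q'"
  using vcat_unit[OF assms(1,2)] homE[OF assms(3)] by (simp add: un_def hom_def)

text \<open>The associativity diagram, evaluated at the element formed by the pair of
  \<open>a\<close> and \<open>b\<close> together with \<open>c\<close>.\<close>

lemma cmp_assoc:
  assumes C: "is_vcat A C" and o: "w : VObj C" "x : VObj C" "y : VObj C" "z : VObj C"
    and abc: "a : hom A q (VHom C (y, z))" "b : hom A q (VHom C (x, y))" "c : hom A q (VHom C (w, x))"
  shows "cmp C w x z (cmp C x y z a b) c = cmp C w y z a (cmp C w x y b c)"
proof -
  have eq: "VComp C (w, x, z) ** prod_arr A (VComp C (x, y, z)) (Id A (VHom C (w, x))) =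
        VComp C (w, y, z) ** prod_arr A (Id A (VHom C (y, z))) (VComp C (w, x, y)) **
            associator A (VHom C (y, z)) (VHom C (x, y)) (VHom C (w, x))"
    using C o unfolding is_vcat_def by blast
  note h = vcat_hom_obj[OF C]
  note c1 = homE[OF vcat_comp[OF C o(1,2,4)]] and c2 = homE[OF vcat_comp[OF C o(2,3,4)]]
    and c3 = homE[OF vcat_comp[OF C o(1,3,4)]] and c4 = homE[OF vcat_comp[OF C o(1,2,3)]]
  note e = homE[OF abc(1)] homE[OF abc(2)] homE[OF abc(3)]
  have d: "dom a = dom c" "dom b = dom c" using e by simp_all
  note as = associator_pairing[of a b c "VHom C (y, z)" "VHom C (x, y)" "VHom C (w, x)"]
  let ?t = "pairing A (pairing A a b) c"
  have t: "?t : Arr A" "dom ?t = dom c" "cod ?t = prod_obj A (prod_obj A (VHom C (y, z)) (VHom C (x, y))) (VHom C (w, x))"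
    using e d by simp_all
  have "cmp C w x z (cmp C x y z a b) c =
      VComp C (w, x, z) ** prod_arr A (VComp C (x, y, z)) (Id A (VHom C (w, x))) ** ?t"
    unfolding cmp_def using e d c1 c2 by simp
  also have "\<dots> = VComp C (w, y, z) ** (prod_arr A (Id A (VHom C (y, z))) (VComp C (w, x, y)) **
            associator A (VHom C (y, z)) (VHom C (x, y)) (VHom C (w, x))) ** ?t"
    by (rule comp_eq_comp[OF eq]) (use e d t c1 c2 c3 c4 as(2-4) in simp_all)
  also have "\<dots> = cmp C w y z a (cmp C w x y b c)"
    unfolding cmp_def using e d t c1 c2 c3 c4 as by simp
  finally show ?thesis .
qed

lemma cmp_unit:
  assumes C: "is_vcat A C" and o: "x : VObj C" "y : VObj C" and a: "a : hom A q (VHom C (x, y))"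
  shows "cmp C x y y (un C y q) a = a" "cmp C x x y a (un C x q) = a"
proof -
  have eq: "VComp C (x, y, y) ** prod_arr A (VUnit C y) (Id A (VHom C (x, y))) = pr2 A (unit_obj A) (VHom C (x, y))"
    "VComp C (x, x, y) ** prod_arr A (Id A (VHom C (x, y))) (VUnit C x) = pr1 A (VHom C (x, y)) (unit_obj A)"
    using C o unfolding is_vcat_def by blast+
  note c1 = homE[OF vcat_comp[OF C o(1,2,2)]] and c2 = homE[OF vcat_comp[OF C o(1,1,2)]]
  note u = homE[OF vcat_unit[OF C o(1)]] homE[OF vcat_unit[OF C o(2)]] and e = homE[OF a]
  have "cmp C x y y (un C y q) a = VComp C (x, y, y) ** prod_arr A (VUnit C y) (Id A (VHom C (x, y))) ** pairing A (bang q) a"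
    unfolding cmp_def un_def using e c1 u by simp
  also have "\<dots> = pr2 A (unit_obj A) (VHom C (x, y)) ** pairing A (bang q) a"
    by (rule comp_eq_arr[OF eq(1)]) (use e c1 u in simp_all)
  finally show "cmp C x y y (un C y q) a = a" using e by simp
  have "cmp C x x y a (un C x q) = VComp C (x, x, y) ** prod_arr A (Id A (VHom C (x, y))) (VUnit C x) ** pairing A a (bang q)"
    unfolding cmp_def un_def using e c2 u by simp
  also have "\<dots> = pr1 A (VHom C (x, y)) (unit_obj A) ** pairing A a (bang q)"
    by (rule comp_eq_arr[OF eq(2)]) (use e c2 u in simp_all)
  finally show "cmp C x x y a (un C x q) = a" using e by simp
qed

text \<open>The diagrams follow from their instances at generic elements, namely the projections of
  the products involved.\<close>

lemma is_vcatI: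
  assumes H: "VHom C : (VObj C \<times> VObj C \<rightarrow>\<^sub>E Obj A)"
    and U: "VUnit C : (\<Pi>\<^sub>E x\<in>VObj C. hom A (unit_obj A) (VHom C (x, x)))"
    and M: "VComp C : (\<Pi>\<^sub>E (x, y, z)\<in>VObj C \<times> VObj C \<times> VObj C.
       hom A (prod_obj A (VHom C (y, z)) (VHom C (x, y))) (VHom C (x, z)))"
    and assoc: "\<And>w x y z q a b c. w : VObj C ==> x : VObj C ==> y : VObj C ==> z : VObj C ==>
      a : hom A q (VHom C (y, z)) ==> b : hom A q (VHom C (x, y)) ==> c : hom A q (VHom C (w, x)) ==>
      cmp C w x z (cmp C x y z a b) c = cmp C w y z a (cmp C w x y b c)"
    and unit1: "\<And>x y q a. x : VObj C ==> y : VObj C ==> a : hom A q (VHom C (x, y)) ==>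
      cmp C x y y (un C y q) a = a"
    and unit2: "\<And>x y q a. x : VObj C ==> y : VObj C ==> a : hom A q (VHom C (x, y)) ==>
      cmp C x x y a (un C x q) = a"
  shows "is_vcat A C"
proof -
  have ho: "VHom C (x, y) : Obj A" if "x : VObj C" "y : VObj C" for x y using H that by auto
  have u: "VUnit C x : Arr A \<and> dom (VUnit C x) = unit_obj A \<and> cod (VUnit C x) = VHom C (x, x)"
    if "x : VObj C" for x using PiE_mem[OF U that] by (simp add: hom_def)
  have c: "VComp C (x, y, z) : Arr A \<and> dom (VComp C (x, y, z)) = prod_obj A (VHom C (y, z)) (VHom C (x, y)) \<and>
     cod (VComp C (x, y, z)) = VHom C (x, z)"
    if "x : VObj C" "y : VObj C" "z : VObj C" for x y z
    using PiE_mem[OF M, of "(x, y, z)"] that by (simp add: hom_def)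
  show ?thesis
    unfolding is_vcat_def
  proof (intro conjI ballI H U)
    show "VComp C : (\<Pi>\<^sub>E (x, y, z)\<in>VObj C \<times> VObj C \<times> VObj C. hom A (chain3 A C (x, y, z)) (VHom C (x, z)))"
      using M by (simp add: chain3_def)
    fix w x y z assume o: "w : VObj C" "x : VObj C" "y : VObj C" "z : VObj C"
    define h1 h2 h3 where "h1 = VHom C (y, z)" and "h2 = VHom C (x, y)" and "h3 = VHom C (w, x)"
    have h: "h1 : Obj A" "h2 : Obj A" "h3 : Obj A" using ho o by (simp_all add: h1_def h2_def h3_def)
    define k where "k = prod_obj A (prod_obj A h1 h2) h3"
    \<comment> \<open>The arrows \<open>a\<close>, \<open>b\<close> and \<open>c'\<close> form the
      generic composable triple at the stage \<open>k\<close>: paired in this order they give the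
      identity of the threefold product.\<close>
    define b' where "b' = pr1 A (prod_obj A h1 h2) h3"
    define a b c' where "a = pr1 A h1 h2 ** b'" and "b = pr2 A h1 h2 ** b'" and "c' = pr2 A (prod_obj A h1 h2) h3"
    have b': "arr b'" "dom b' = k" "cod b' = prod_obj A h1 h2" using h by (simp_all add: b'_def k_def)
    have ab: "arr a" "dom a = k" "cod a = h1" "arr b" "dom b = k" "cod b = h2"
      "arr c'" "dom c' = k" "cod c' = h3"
      using h b' by (simp_all add: a_def b_def c'_def k_def)
    have g: "pairing A (pairing A a b) c' = Id A k"
      using h b' unfolding a_def b_def by (simp add: b'_def c'_def k_def)
    have ko: "k : Obj A" using h by (simp add: k_def)
    note cc = c[OF o(1,2,4)] c[OF o(2,3,4)] c[OF o(1,3,4)] c[OF o(1,2,3)]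
    note as = associator_pairing[OF ab(1,4,7) _ _ ab(3,6,9)]
    have as': "associator A h1 h2 h3 : Arr A" "dom (associator A h1 h2 h3) = k"
      "associator A h1 h2 h3 ** pairing A (pairing A a b) c' = pairing A a (pairing A b c')"
      using as ab by (simp_all add: k_def)
    then have as2: "associator A h1 h2 h3 = pairing A a (pairing A b c')"
      unfolding g by simp
    have "prod_arr A (VComp C (x, y, z)) (Id A h3) = prod_arr A (VComp C (x, y, z)) (Id A h3) ** pairing A (pairing A a b) c'"
      unfolding g using cc h by (simp add: h1_def h2_def k_def)
    also have "\<dots> = pairing A (VComp C (x, y, z) ** pairing A a b) c'"
      using cc h ab by (simp add: h1_def h2_def h3_def)
    finally have 1: "prod_arr A (VComp C (x, y, z)) (Id A h3) = pairing A (VComp C (x, y, z) ** pairing A a b) c'" .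
    have 2: "prod_arr A (Id A h1) (VComp C (w, x, y)) ** associator A h1 h2 h3 = pairing A a (VComp C (w, x, y) ** pairing A b c')"
      unfolding as2 using cc h ab by (simp add: h1_def h2_def h3_def)
    show "VComp C (w, x, z) ** prod_arr A (VComp C (x, y, z)) (Id A (VHom C (w, x))) =
      VComp C (w, y, z) ** prod_arr A (Id A (VHom C (y, z))) (VComp C (w, x, y)) **
       associator A (VHom C (y, z)) (VHom C (x, y)) (VHom C (w, x))"
      using assoc[OF o, of a k b c'] ab 1 2
      unfolding cmp_def h1_def h2_def h3_def by (simp add: hom_def)
  next
    fix x y assume o: "x : VObj C" "y : VObj C"
    define h t where "h = VHom C (x, y)" and "t = unit_obj A"
    have ht: "h : Obj A" "t : Obj A" using ho o by (simp_all add: h_def t_def)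
    \<comment> \<open>A projection to the terminal object is the unique such arrow, so at this stage
      \<open>un\<close> is the enriched unit composed with the projection.\<close>
    have b1: "pr1 A t h = bang (prod_obj A t h)" by (rule terminal_eq) (use ht in \<open>simp_all add: t_def\<close>)
    have b2: "pr2 A h t = bang (prod_obj A h t)" by (rule terminal_eq) (use ht in \<open>simp_all add: t_def\<close>)
    have "pr2 A t h : hom A (prod_obj A t h) (VHom C (x, y))" using ht by (simp add: hom_def h_def)
    from unit1[OF o this]
    show "VComp C (x, y, y) ** prod_arr A (VUnit C y) (Id A (VHom C (x, y))) = pr2 A (unit_obj A) (VHom C (x, y))"
      unfolding cmp_def un_def b1[symmetric] using u[OF o(2)] ht ho[OF o]
      by (simp add: prod_arr_def h_def t_def)
    have "pr1 A h t : hom A (prod_obj A h t) (VHom C (x, y))" using ht by (simp add: hom_def h_def)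
    from unit2[OF o this]
    show "VComp C (x, x, y) ** prod_arr A (Id A (VHom C (x, y))) (VUnit C x) = pr1 A (VHom C (x, y)) (unit_obj A)"
      unfolding cmp_def un_def b2[symmetric] using u[OF o(1)] ht ho[OF o]
      by (simp add: prod_arr_def h_def t_def)
  qed
qed

lemma vf_obj_in: "is_vfunctor A F ==> x : VObj (vf_dom F) ==> vf_obj F x : VObj (vf_cod F)"
  unfolding is_vfunctor_def by (auto simp: Let_def)

lemma vf_hom_in:
  assumes "is_vfunctor A F" "x : VObj (vf_dom F)" "y : VObj (vf_dom F)"
  shows "vf_hom F (x, y) : hom A (VHom (vf_dom F) (x, y)) (VHom (vf_cod F) (vf_obj F x, vf_obj F y))"
proof -
  have "vf_hom F : (\<Pi>\<^sub>E (x, y)\<in>VObj (vf_dom F) \<times> VObj (vf_dom F).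
       hom A (VHom (vf_dom F) (x, y)) (VHom (vf_cod F) (vf_obj F x, vf_obj F y)))"
    using assms(1) unfolding is_vfunctor_def by (simp add: Let_def)
  from PiE_mem[OF this, of "(x, y)"] show ?thesis using assms(2,3) by simp
qed

lemma vf_ext:
  assumes "is_vfunctor A F"
  shows "vf_obj F : extensional (VObj (vf_dom F))" "vf_hom F : extensional (VObj (vf_dom F) \<times> VObj (vf_dom F))"
  using assms unfolding is_vfunctor_def PiE_def by (simp_all add: Let_def)

lemma vf_unit:
  assumes "is_vfunctor A F" "x : VObj (vf_dom F)"
  shows "vf_hom F (x, x) ** VUnit (vf_dom F) x = VUnit (vf_cod F) (vf_obj F x)"
  using assms unfolding is_vfunctor_def by (simp add: Let_def)

lemma vf_un:
  assumes F: "is_vfunctor A F" and C: "is_vcat A (vf_dom F)" and x: "x : VObj (vf_dom F)" and q: "q : Obj A"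
  shows "vf_hom F (x, x) ** un (vf_dom F) x q = un (vf_cod F) (vf_obj F x) q"
  unfolding un_def
  by (rule comp_eq_arr[OF vf_unit[OF F x]])
    (use homE[OF vf_hom_in[OF F x x]] homE[OF vcat_unit[OF C x]] q in simp_all)

lemma vf_cmp:
  assumes F: "is_vfunctor A F" and C: "is_vcat A (vf_dom F)" and D: "is_vcat A (vf_cod F)"
    and o: "x : VObj (vf_dom F)" "y : VObj (vf_dom F)" "z : VObj (vf_dom F)"
    and ab: "a : hom A q (VHom (vf_dom F) (y, z))" "b : hom A q (VHom (vf_dom F) (x, y))"
  shows "vf_hom F (x, z) ** cmp (vf_dom F) x y z a b =
    cmp (vf_cod F) (vf_obj F x) (vf_obj F y) (vf_obj F z) (vf_hom F (y, z) ** a) (vf_hom F (x, y) ** b)"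
proof -
  have eq: "vf_hom F (x, z) ** VComp (vf_dom F) (x, y, z) =
        VComp (vf_cod F) (vf_obj F x, vf_obj F y, vf_obj F z) ** prod_arr A (vf_hom F (y, z)) (vf_hom F (x, y))"
    using F o unfolding is_vfunctor_def by (simp add: Let_def)
  note h = homE[OF vf_hom_in[OF F o(1,3)]] homE[OF vf_hom_in[OF F o(2,3)]] homE[OF vf_hom_in[OF F o(1,2)]]
  note v = homE[OF vcat_comp[OF C o]] homE[OF vcat_comp[OF D vf_obj_in[OF F o(1)] vf_obj_in[OF F o(2)] vf_obj_in[OF F o(3)]]]
  note e = homE[OF ab(1)] homE[OF ab(2)]
  have "vf_hom F (x, z) ** VComp (vf_dom F) (x, y, z) ** pairing A a b =
    VComp (vf_cod F) (vf_obj F x, vf_obj F y, vf_obj F z) ** prod_arr A (vf_hom F (y, z)) (vf_hom F (x, y)) ** pairing A a b"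
    by (rule comp_eq_comp[OF eq]) (use h v e in simp_all)
  then show ?thesis unfolding cmp_def using h v e by simp
qed

text \<open>Evaluation at the unit stage and at the generic pair of projections recovers the two
  diagrams.\<close>

lemma is_vfunctorI:
  assumes C: "is_vcat A (vf_dom F)" and D: "is_vcat A (vf_cod F)"
    and O: "vf_obj F : (VObj (vf_dom F) \<rightarrow>\<^sub>E VObj (vf_cod F))"
    and H: "vf_hom F : (\<Pi>\<^sub>E (x, y)\<in>VObj (vf_dom F) \<times> VObj (vf_dom F).
       hom A (VHom (vf_dom F) (x, y)) (VHom (vf_cod F) (vf_obj F x, vf_obj F y)))"
    and U: "\<And>x q. x : VObj (vf_dom F) ==> q : Obj A ==>
      vf_hom F (x, x) ** un (vf_dom F) x q = un (vf_cod F) (vf_obj F x) q"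
    and M: "\<And>x y z q a b. x : VObj (vf_dom F) ==> y : VObj (vf_dom F) ==> z : VObj (vf_dom F) ==>
      a : hom A q (VHom (vf_dom F) (y, z)) ==> b : hom A q (VHom (vf_dom F) (x, y)) ==>
      vf_hom F (x, z) ** cmp (vf_dom F) x y z a b =
      cmp (vf_cod F) (vf_obj F x) (vf_obj F y) (vf_obj F z) (vf_hom F (y, z) ** a) (vf_hom F (x, y) ** b)"
  shows "is_vfunctor A F"
proof -
  have h: "vf_hom F (x, y) : hom A (VHom (vf_dom F) (x, y)) (VHom (vf_cod F) (vf_obj F x, vf_obj F y))"
    if "x : VObj (vf_dom F)" "y : VObj (vf_dom F)" for x y
    using PiE_mem[OF H, of "(x, y)"] that by simp
  have ob: "vf_obj F x : VObj (vf_cod F)" if "x : VObj (vf_dom F)" for x using PiE_mem[OF O that] .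
  show ?thesis
    unfolding is_vfunctor_def Let_def
  proof (intro conjI ballI O H)
    fix x assume x: "x : VObj (vf_dom F)"
    have b: "bang (unit_obj A) = Id A (unit_obj A)" by (rule terminal_eq) simp_all
    show "vf_hom F (x, x) ** VUnit (vf_dom F) x = VUnit (vf_cod F) (vf_obj F x)"
      using U[OF x, of "unit_obj A"] homE[OF vcat_unit[OF C x]] homE[OF vcat_unit[OF D ob[OF x]]]
      unfolding un_def b by simp
  next
    fix x y z assume o: "x : VObj (vf_dom F)" "y : VObj (vf_dom F)" "z : VObj (vf_dom F)"
    define h1 h2 where "h1 = VHom (vf_dom F) (y, z)" and "h2 = VHom (vf_dom F) (x, y)"
    have ho: "h1 : Obj A" "h2 : Obj A" using vcat_hom_obj[OF C] o by (simp_all add: h1_def h2_def)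
    have "vf_hom F (x, z) ** cmp (vf_dom F) x y z (pr1 A h1 h2) (pr2 A h1 h2) =
      cmp (vf_cod F) (vf_obj F x) (vf_obj F y) (vf_obj F z) (vf_hom F (y, z) ** pr1 A h1 h2) (vf_hom F (x, y) ** pr2 A h1 h2)"
      by (rule M[OF o, of _ "prod_obj A h1 h2"]) (use ho in \<open>simp_all add: hom_def h1_def h2_def\<close>)
    then show "vf_hom F (x, z) ** VComp (vf_dom F) (x, y, z) =
      VComp (vf_cod F) (vf_obj F x, vf_obj F y, vf_obj F z) ** prod_arr A (vf_hom F (y, z)) (vf_hom F (x, y))"
      using ho homE[OF vcat_comp[OF C o]] homE[OF h[OF o(2,3)]] homE[OF h[OF o(1,2)]]
      unfolding cmp_def by (simp add: prod_arr_def h1_def h2_def)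
  qed
qed

section \<open>The category of enriched categories\<close>

lemma VCat_simps [simp]:
  "Obj vc = {C. small (VObj C) \<and> is_vcat A C}" "Dom vc = vf_dom" "Cod vc = vf_cod"
  "Comp vc G F = \<lparr>vf_dom = vf_dom F, vf_cod = vf_cod G,
       vf_obj = (\<lambda>x\<in>VObj (vf_dom F). vf_obj G (vf_obj F x)),
       vf_hom = (\<lambda>(x, y)\<in>VObj (vf_dom F) \<times> VObj (vf_dom F).
         Comp A (vf_hom G (vf_obj F x, vf_obj F y)) (vf_hom F (x, y)))\<rparr>"
  "Id vc C = \<lparr>vf_dom = C, vf_cod = C, vf_obj = (\<lambda>x\<in>VObj C. x),
       vf_hom = (\<lambda>(x, y)\<in>VObj C \<times> VObj C. Id A (VHom C (x, y)))\<rparr>"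
  by (simp_all add: VCat_def)

lemma VCat_arr_iff:
  "F : Arr vc \<longleftrightarrow> small (VObj (vf_dom F)) \<and> is_vcat A (vf_dom F) \<and>
       small (VObj (vf_cod F)) \<and> is_vcat A (vf_cod F) \<and> is_vfunctor A F"
  by (simp add: VCat_def)

lemma vfunctor_eqI:
  assumes "is_vfunctor A F" "is_vfunctor A G" "vf_dom F = vf_dom G" "vf_cod F = vf_cod G"
    "\<And>x. x : VObj (vf_dom G) ==> vf_obj F x = vf_obj G x"
    "\<And>x y. x : VObj (vf_dom G) ==> y : VObj (vf_dom G) ==> vf_hom F (x, y) = vf_hom G (x, y)"
  shows "F = G"
proof -
  have "vf_obj F = vf_obj G"
    by (rule extensionalityI[OF vf_ext(1)[OF assms(1), unfolded assms(3)] vf_ext(1)[OF assms(2)] assms(5)])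
  moreover have "vf_hom F = vf_hom G"
    by (rule extensionalityI[OF vf_ext(2)[OF assms(1), unfolded assms(3)] vf_ext(2)[OF assms(2)]])
      (use assms(6) in auto)
  ultimately show ?thesis using assms(3,4) by simp
qed

lemma vfunctor_comp:
  assumes F: "F : Arr vc" and G: "G : Arr vc" and FG: "vf_dom G = vf_cod F"
  shows "Comp vc G F : Arr vc"
proof -
  have F': "is_vfunctor A F" "is_vcat A (vf_dom F)" "is_vcat A (vf_cod F)" "small (VObj (vf_dom F))"
    and G': "is_vfunctor A G" "is_vcat A (vf_cod G)" "small (VObj (vf_cod G))"
    using F G unfolding VCat_arr_iff by simp_all
  note Fo = vf_obj_in[OF F'(1)] and Fh = vf_hom_in[OF F'(1)]
  have Go: "vf_obj G x : VObj (vf_cod G)" if "x : VObj (vf_cod F)" for x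
    using vf_obj_in[OF G'(1)] that by (simp add: FG)
  have Gh: "vf_hom G (x, y) : hom A (VHom (vf_cod F) (x, y)) (VHom (vf_cod G) (vf_obj G x, vf_obj G y))"
    if "x : VObj (vf_cod F)" "y : VObj (vf_cod F)" for x y
    using vf_hom_in[OF G'(1), of x y] that by (simp add: FG)
  have h: "vf_hom G (vf_obj F x, vf_obj F y) ** vf_hom F (x, y) \<in>
      hom A (VHom (vf_dom F) (x, y)) (VHom (vf_cod G) (vf_obj G (vf_obj F x), vf_obj G (vf_obj F y)))"
    if "x : VObj (vf_dom F)" "y : VObj (vf_dom F)" for x y
    by (rule comp_hom[OF Fh Gh]) (use that Fo in simp_all)
  have asc: "(vf_hom G (vf_obj F x, vf_obj F y) ** vf_hom F (x, y)) ** a = vf_hom G (vf_obj F x, vf_obj F y) ** vf_hom F (x, y) ** a"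
    if "x : VObj (vf_dom F)" "y : VObj (vf_dom F)" "a : hom A q (VHom (vf_dom F) (x, y))" for x y q a
    by (rule assoc[OF that(3) Fh[OF that(1,2)] Gh[OF Fo[OF that(1)] Fo[OF that(2)]]])
  have "is_vfunctor A (Comp vc G F)"
  proof (rule is_vfunctorI)
    fix x q assume x: "x : VObj (vf_dom (Comp vc G F))" and q: "q : Obj A"
    then have x': "x : VObj (vf_dom F)" by simp
    show "vf_hom (Comp vc G F) (x, x) ** un (vf_dom (Comp vc G F)) x q =
        un (vf_cod (Comp vc G F)) (vf_obj (Comp vc G F) x) q"
      using x' asc[OF x' x' un_hom[OF F'(2) x' q]] vf_un[OF F'(1,2) x' q]
        vf_un[OF G'(1), of "vf_obj F x" q] F'(3) FG Fo[OF x'] q by simp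
  next
    fix x y z q a b assume "x : VObj (vf_dom (Comp vc G F))" "y : VObj (vf_dom (Comp vc G F))" "z : VObj (vf_dom (Comp vc G F))"
      "a : hom A q (VHom (vf_dom (Comp vc G F)) (y, z))" "b : hom A q (VHom (vf_dom (Comp vc G F)) (x, y))"
    then have o: "x : VObj (vf_dom F)" "y : VObj (vf_dom F)" "z : VObj (vf_dom F)"
      and ab: "a : hom A q (VHom (vf_dom F) (y, z))" "b : hom A q (VHom (vf_dom F) (x, y))" by simp_all
    have "vf_hom G (vf_obj F x, vf_obj F z) ** vf_hom F (x, z) ** cmp (vf_dom F) x y z a b =
      cmp (vf_cod G) (vf_obj G (vf_obj F x)) (vf_obj G (vf_obj F y)) (vf_obj G (vf_obj F z))
        (vf_hom G (vf_obj F y, vf_obj F z) ** vf_hom F (y, z) ** a) (vf_hom G (vf_obj F x, vf_obj F y) ** vf_hom F (x, y) ** b)"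
      unfolding vf_cmp[OF F'(1-3) o ab]
      by (rule vf_cmp[OF G'(1), unfolded FG, OF F'(3) G'(2) Fo[OF o(1)] Fo[OF o(2)] Fo[OF o(3)]
            comp_hom[OF ab(1) Fh[OF o(2,3)]] comp_hom[OF ab(2) Fh[OF o(1,2)]]])
    then show "vf_hom (Comp vc G F) (x, z) ** cmp (vf_dom (Comp vc G F)) x y z a b =
      cmp (vf_cod (Comp vc G F)) (vf_obj (Comp vc G F) x) (vf_obj (Comp vc G F) y) (vf_obj (Comp vc G F) z)
        (vf_hom (Comp vc G F) (y, z) ** a) (vf_hom (Comp vc G F) (x, y) ** b)"
      using o asc[OF o(1,3) cmp_hom[OF F'(2) o ab]] asc[OF o(2,3) ab(1)] asc[OF o(1,2) ab(2)] by simp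
  qed (use F' G' Fo Go h in auto)
  then show ?thesis unfolding VCat_arr_iff using F' G' by simp
qed

lemma vfunctor_id:
  assumes "C : Obj vc"
  shows "Id vc C : Arr vc"
proof -
  have C: "small (VObj C)" "is_vcat A C" using assms by simp_all
  note ho = vcat_hom_obj[OF C(2)]
  have "is_vfunctor A (Id vc C)"
  proof (rule is_vfunctorI)
    fix x q assume "x : VObj (vf_dom (Id vc C))" "q : Obj A"
    then show "vf_hom (Id vc C) (x, x) ** un (vf_dom (Id vc C)) x q =
        un (vf_cod (Id vc C)) (vf_obj (Id vc C) x) q"
      using homE[OF un_hom[OF C(2), of x q]] by simp
  next
    fix x y z q a b assume "x : VObj (vf_dom (Id vc C))" "y : VObj (vf_dom (Id vc C))" "z : VObj (vf_dom (Id vc C))"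
      "a : hom A q (VHom (vf_dom (Id vc C)) (y, z))" "b : hom A q (VHom (vf_dom (Id vc C)) (x, y))"
    then have o: "x : VObj C" "y : VObj C" "z : VObj C"
      and ab: "a : hom A q (VHom C (y, z))" "b : hom A q (VHom C (x, y))" by simp_all
    show "vf_hom (Id vc C) (x, z) ** cmp (vf_dom (Id vc C)) x y z a b =
      cmp (vf_cod (Id vc C)) (vf_obj (Id vc C) x) (vf_obj (Id vc C) y) (vf_obj (Id vc C) z)
        (vf_hom (Id vc C) (y, z) ** a) (vf_hom (Id vc C) (x, y) ** b)"
      using o homE[OF cmp_hom[OF C(2) o ab]] homE[OF ab(1)] homE[OF ab(2)] by simp
  qed (use C ho id_hom in auto)
  then show ?thesis unfolding VCat_arr_iff using C by simp
qed

lemma category_VCat: "category vc"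
proof
  fix F assume "F : Arr vc"
  then show "Dom vc F : Obj vc" "Cod vc F : Obj vc" unfolding VCat_arr_iff by simp_all
next
  fix C assume "C : Obj vc"
  then show "Id vc C : hom vc C C" using vfunctor_id by (simp add: hom_def)
next
  fix F G C D E assume "F : hom vc C D" "G : hom vc D E"
  then show "Comp vc G F : hom vc C E" using vfunctor_comp[of F G] by (simp add: hom_def)
next
  fix F C D assume "F : hom vc C D"
  then have F: "F : Arr vc" "vf_dom F = C" "vf_cod F = D" by (simp_all add: hom_def)
  have CD: "C : Obj vc" "D : Obj vc" and vf: "is_vfunctor A F" using F unfolding VCat_arr_iff by auto
  note Fo = vf_obj_in[OF vf, unfolded F(2,3)] and Fh = vf_hom_in[OF vf, unfolded F(2,3)]
  have 1: "is_vfunctor A (Comp vc (Id vc D) F)" "is_vfunctor A (Comp vc F (Id vc C))"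
    using vfunctor_comp[OF F(1) vfunctor_id[OF CD(2)]] vfunctor_comp[OF vfunctor_id[OF CD(1)] F(1)] F
    unfolding VCat_arr_iff by simp_all
  show "Comp vc (Id vc D) F = F"
    by (rule vfunctor_eqI[OF 1(1) vf]) (use F Fo homE[OF Fh] in simp_all)
  show "Comp vc F (Id vc C) = F"
    by (rule vfunctor_eqI[OF 1(2) vf]) (use F homE[OF Fh] in simp_all)
next
  fix F G H B C D E assume "F : hom vc B C" "G : hom vc C D" "H : hom vc D E"
  then have F: "F : Arr vc" "vf_dom F = B" "vf_cod F = C" and G: "G : Arr vc" "vf_dom G = C" "vf_cod G = D"
    and H: "H : Arr vc" "vf_dom H = D" "vf_cod H = E" by (simp_all add: hom_def)
  have vf: "is_vfunctor A F" "is_vfunctor A G" "is_vfunctor A H" using F G H unfolding VCat_arr_iff by simp_all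
  have GF: "Comp vc G F : Arr vc" and HG: "Comp vc H G : Arr vc"
    by (rule vfunctor_comp; use F G H in simp)+
  have 1: "is_vfunctor A (Comp vc (Comp vc H G) F)" "is_vfunctor A (Comp vc H (Comp vc G F))"
    using vfunctor_comp[OF F(1) HG] vfunctor_comp[OF GF H(1)] F G H unfolding VCat_arr_iff by simp_all
  note Fo = vf_obj_in[OF vf(1), unfolded F(2,3)] and Go = vf_obj_in[OF vf(2), unfolded G(2,3)]
  note Fh = vf_hom_in[OF vf(1), unfolded F(2,3)] and Gh = vf_hom_in[OF vf(2), unfolded G(2,3)]
    and Hh = vf_hom_in[OF vf(3), unfolded H(2,3)]
  show "Comp vc (Comp vc H G) F = Comp vc H (Comp vc G F)"
  proof (rule vfunctor_eqI[OF 1])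
    fix x y assume "x : VObj (vf_dom (Comp vc H (Comp vc G F)))" "y : VObj (vf_dom (Comp vc H (Comp vc G F)))"
    then have xy: "x : VObj B" "y : VObj B" using F by simp_all
    have "(vf_hom H (vf_obj G (vf_obj F x), vf_obj G (vf_obj F y)) ** vf_hom G (vf_obj F x, vf_obj F y)) ** vf_hom F (x, y) =
      vf_hom H (vf_obj G (vf_obj F x), vf_obj G (vf_obj F y)) ** vf_hom G (vf_obj F x, vf_obj F y) ** vf_hom F (x, y)"
      by (rule assoc[OF Fh Gh Hh]) (use xy Fo Go in simp_all)
    then show "vf_hom (Comp vc (Comp vc H G) F) (x, y) = vf_hom (Comp vc H (Comp vc G F)) (x, y)"
      using xy F G Fo by simp
  qed (use F G H Fo in simp_all)
qed

end

section \<open>Pullbacks of enriched categories\<close>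

context universe_cartesian
begin

sublocale VC: category vc by (rule category_VCat)

declare VCat_simps(4,5) [simp del]

lemma vf_comp_dom [simp]: "vf_dom (Comp vc G F) = vf_dom F" "vf_cod (Comp vc G F) = vf_cod G"
  by (simp_all add: VCat_simps(4))

lemma vf_arrD:
  assumes "F : Arr vc"
  shows "is_vfunctor A F" "is_vcat A (vf_dom F)" "is_vcat A (vf_cod F)"
    "small (VObj (vf_dom F))" "small (VObj (vf_cod F))"
  using assms unfolding VCat_arr_iff by simp_all

lemma vf_arr_obj: "F : Arr vc ==> x : VObj (vf_dom F) ==> vf_obj F x : VObj (vf_cod F)"
  by (rule vf_obj_in[OF vf_arrD(1)])

lemma vf_arr_hom:
  "F : Arr vc ==> x : VObj (vf_dom F) ==> y : VObj (vf_dom F) ==>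
    vf_hom F (x, y) : hom A (VHom (vf_dom F) (x, y)) (VHom (vf_cod F) (vf_obj F x, vf_obj F y))"
  by (rule vf_hom_in[OF vf_arrD(1)])

lemma vf_arr_el:
  "F : Arr vc ==> x : VObj (vf_dom F) ==> y : VObj (vf_dom F) ==> a : hom A q (VHom (vf_dom F) (x, y)) ==>
    vf_hom F (x, y) ** a : hom A q (VHom (vf_cod F) (vf_obj F x, vf_obj F y))"
  by (rule comp_hom[OF _ vf_arr_hom])

lemma vf_arr_un:
  "F : Arr vc ==> x : VObj (vf_dom F) ==> q : Obj A ==>
    vf_hom F (x, x) ** un (vf_dom F) x q = un (vf_cod F) (vf_obj F x) q"
  by (rule vf_un[OF vf_arrD(1,2)])

lemma vf_arr_cmp:
  "F : Arr vc ==> x : VObj (vf_dom F) ==> y : VObj (vf_dom F) ==> z : VObj (vf_dom F) ==>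
    a : hom A q (VHom (vf_dom F) (y, z)) ==> b : hom A q (VHom (vf_dom F) (x, y)) ==>
    vf_hom F (x, z) ** cmp (vf_dom F) x y z a b =
    cmp (vf_cod F) (vf_obj F x) (vf_obj F y) (vf_obj F z) (vf_hom F (y, z) ** a) (vf_hom F (x, y) ** b)"
  by (rule vf_cmp[OF vf_arrD(1,2,3)])

lemma vf_comp_obj:
  "x : VObj (vf_dom F) ==> vf_obj (Comp vc G F) x = vf_obj G (vf_obj F x)"
  by (simp add: VCat_simps(4))

lemma vf_comp_hom:
  "x : VObj (vf_dom F) ==> y : VObj (vf_dom F) ==>
    vf_hom (Comp vc G F) (x, y) = vf_hom G (vf_obj F x, vf_obj F y) ** vf_hom F (x, y)"
  by (simp add: VCat_simps(4))

lemma vf_comp_el: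
  assumes "F : Arr vc" "G : Arr vc" "vf_dom G = vf_cod F" "x : VObj (vf_dom F)" "y : VObj (vf_dom F)"
    "a : hom A q (VHom (vf_dom F) (x, y))"
  shows "vf_hom (Comp vc G F) (x, y) ** a = vf_hom G (vf_obj F x, vf_obj F y) ** vf_hom F (x, y) ** a"
  unfolding vf_comp_hom[OF assms(4,5)]
  by (rule assoc[OF assms(6) vf_arr_hom[OF assms(1,4,5)] vf_arr_hom[OF assms(2), unfolded assms(3)]])
    (use vf_arr_obj[OF assms(1)] assms(3-5) in simp_all)

lemma vf_eqI:
  assumes "F : Arr vc" "G : Arr vc" "vf_dom F = vf_dom G" "vf_cod F = vf_cod G"
    "\<And>x. x : VObj (vf_dom G) ==> vf_obj F x = vf_obj G x"
    "\<And>x y. x : VObj (vf_dom G) ==> y : VObj (vf_dom G) ==> vf_hom F (x, y) = vf_hom G (x, y)"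
  shows "F = G"
  by (rule vfunctor_eqI[OF vf_arrD(1)[OF assms(1)] vf_arrD(1)[OF assms(2)] assms(3-6)])

text \<open>Both maps are cut off outside the objects of \<open>C\<close>, as equality of enriched
  functors compares whole functions.\<close>

definition mk_vfunctor :: "('u, 'o, 'm) vcat => ('u, 'o, 'm) vcat => ('u => 'u) => ('u => 'u => 'm) => ('u, 'o, 'm) vfunctor" where
  "mk_vfunctor C D f h = \<lparr>vf_dom = C, vf_cod = D, vf_obj = restrict f (VObj C),
     vf_hom = (\<lambda>(x, y)\<in>VObj C \<times> VObj C. h x y)\<rparr>"

lemma mk_vfunctor_simps [simp]:
  "vf_dom (mk_vfunctor C D f h) = C" "vf_cod (mk_vfunctor C D f h) = D"
  "x : VObj C ==> vf_obj (mk_vfunctor C D f h) x = f x"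
  "x : VObj C ==> y : VObj C ==> vf_hom (mk_vfunctor C D f h) (x, y) = h x y"
  by (simp_all add: mk_vfunctor_def)

lemma mk_vfunctor_arr:
  assumes C: "C : Obj vc" and D: "D : Obj vc"
    and f: "\<And>x. x : VObj C ==> f x : VObj D"
    and h: "\<And>x y. x : VObj C ==> y : VObj C ==> h x y : hom A (VHom C (x, y)) (VHom D (f x, f y))"
    and U: "\<And>x q. x : VObj C ==> q : Obj A ==> h x x ** un C x q = un D (f x) q"
    and M: "\<And>x y z q a b. x : VObj C ==> y : VObj C ==> z : VObj C ==>
      a : hom A q (VHom C (y, z)) ==> b : hom A q (VHom C (x, y)) ==>
      h x z ** cmp C x y z a b = cmp D (f x) (f y) (f z) (h y z ** a) (h x y ** b)"
  shows "mk_vfunctor C D f h : Arr vc"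
proof -
  have "is_vfunctor A (mk_vfunctor C D f h)"
  proof (rule is_vfunctorI)
    show "vf_hom (mk_vfunctor C D f h) : (\<Pi>\<^sub>E (x, y)\<in>VObj (vf_dom (mk_vfunctor C D f h)) \<times> VObj (vf_dom (mk_vfunctor C D f h)).
       hom A (VHom (vf_dom (mk_vfunctor C D f h)) (x, y))
         (VHom (vf_cod (mk_vfunctor C D f h)) (vf_obj (mk_vfunctor C D f h) x, vf_obj (mk_vfunctor C D f h) y)))"
    proof (rule PiE_I)
      fix k assume "k : VObj (vf_dom (mk_vfunctor C D f h)) \<times> VObj (vf_dom (mk_vfunctor C D f h))"
      then show "vf_hom (mk_vfunctor C D f h) k : (case k of (x, y) => hom A (VHom (vf_dom (mk_vfunctor C D f h)) (x, y))
         (VHom (vf_cod (mk_vfunctor C D f h)) (vf_obj (mk_vfunctor C D f h) x, vf_obj (mk_vfunctor C D f h) y)))"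
        using h by (cases k) simp
    qed (auto simp: mk_vfunctor_def)
    show "vf_obj (mk_vfunctor C D f h) : VObj (vf_dom (mk_vfunctor C D f h)) \<rightarrow>\<^sub>E VObj (vf_cod (mk_vfunctor C D f h))"
      using f by (auto simp: mk_vfunctor_def)
  qed (use C D U M in simp_all)
  then show ?thesis using C D unfolding VCat_arr_iff by simp
qed

definition mk_vcat :: "'u set => ('u => 'u => 'o) => ('u => 'm) => ('u => 'u => 'u => 'm) => ('u, 'o, 'm) vcat" where
  "mk_vcat S H U M = \<lparr>VObj = S, VHom = (\<lambda>(x, y)\<in>S \<times> S. H x y), VUnit = restrict U S,
     VComp = (\<lambda>(x, y, z)\<in>S \<times> S \<times> S. M x y z)\<rparr>"

lemma mk_vcat_simps [simp]:
  "VObj (mk_vcat S H U M) = S" "x : S ==> y : S ==> VHom (mk_vcat S H U M) (x, y) = H x y"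
  "x : S ==> VUnit (mk_vcat S H U M) x = U x"
  "x : S ==> y : S ==> z : S ==> VComp (mk_vcat S H U M) (x, y, z) = M x y z"
  "x : S ==> y : S ==> z : S ==> cmp (mk_vcat S H U M) x y z a b = M x y z ** pairing A a b"
  "x : S ==> un (mk_vcat S H U M) x q = U x ** bang q"
  by (simp_all add: mk_vcat_def cmp_def un_def)

lemma mk_vcat_obj:
  assumes S: "small S"
    and H: "\<And>x y. x : S ==> y : S ==> H x y : Obj A"
    and U: "\<And>x. x : S ==> U x : hom A (unit_obj A) (H x x)"
    and M: "\<And>x y z. x : S ==> y : S ==> z : S ==> M x y z : hom A (prod_obj A (H y z) (H x y)) (H x z)"
    and assoc: "\<And>w x y z q a b c. w : S ==> x : S ==> y : S ==> z : S ==>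
      a : hom A q (H y z) ==> b : hom A q (H x y) ==> c : hom A q (H w x) ==>
      M w x z ** pairing A (M x y z ** pairing A a b) c = M w y z ** pairing A a (M w x y ** pairing A b c)"
    and unit1: "\<And>x y q a. x : S ==> y : S ==> a : hom A q (H x y) ==>
      M x y y ** pairing A (U y ** bang q) a = a"
    and unit2: "\<And>x y q a. x : S ==> y : S ==> a : hom A q (H x y) ==>
      M x x y ** pairing A a (U x ** bang q) = a"
  shows "mk_vcat S H U M : Obj vc"
proof -
  have "is_vcat A (mk_vcat S H U M)"
  proof (rule is_vcatI)
    show "VHom (mk_vcat S H U M) : VObj (mk_vcat S H U M) \<times> VObj (mk_vcat S H U M) \<rightarrow>\<^sub>E Obj A"
      using H by (auto simp: mk_vcat_def)
    show "VUnit (mk_vcat S H U M) : (\<Pi>\<^sub>E x\<in>VObj (mk_vcat S H U M). hom A (unit_obj A) (VHom (mk_vcat S H U M) (x, x)))"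
    proof (rule PiE_I)
      fix x assume "x : VObj (mk_vcat S H U M)"
      then show "VUnit (mk_vcat S H U M) x : hom A (unit_obj A) (VHom (mk_vcat S H U M) (x, x))" using U by simp
    qed (simp add: mk_vcat_def)
    show "VComp (mk_vcat S H U M) : (\<Pi>\<^sub>E (x, y, z)\<in>VObj (mk_vcat S H U M) \<times> VObj (mk_vcat S H U M) \<times> VObj (mk_vcat S H U M).
       hom A (prod_obj A (VHom (mk_vcat S H U M) (y, z)) (VHom (mk_vcat S H U M) (x, y))) (VHom (mk_vcat S H U M) (x, z)))"
    proof (rule PiE_I)
      fix k assume "k : VObj (mk_vcat S H U M) \<times> VObj (mk_vcat S H U M) \<times> VObj (mk_vcat S H U M)"
      then show "VComp (mk_vcat S H U M) k : (case k of (x, y, z) =>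
        hom A (prod_obj A (VHom (mk_vcat S H U M) (y, z)) (VHom (mk_vcat S H U M) (x, y))) (VHom (mk_vcat S H U M) (x, z)))"
        using M by (cases k) simp
    qed (auto simp: mk_vcat_def)
  qed (use assoc unit1 unit2 in simp_all)
  then show ?thesis using S by simp
qed

text \<open>A concrete form of pullbacks of enriched categories: the objects form a pullback of sets
  and the hom-objects pullbacks in \<open>A\<close>. Unlike the universal property, it can be read
  on elements of single hom-objects.\<close>

definition strict_pullback where
  "strict_pullback F G P R \<longleftrightarrow> F : Arr vc \<and> G : Arr vc \<and> P : Arr vc \<and> R : Arr vc \<and>
     vf_cod F = vf_cod G \<and> vf_dom P = vf_dom R \<and> vf_cod P = vf_dom F \<and> vf_cod R = vf_dom G \<and>
     Comp vc F P = Comp vc G R \<and>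
     (\<forall>c\<in>VObj (vf_dom F). \<forall>z\<in>VObj (vf_dom G). vf_obj F c = vf_obj G z -->
        (\<exists>!e. e : VObj (vf_dom P) \<and> vf_obj P e = c \<and> vf_obj R e = z)) \<and>
     (\<forall>e0\<in>VObj (vf_dom P). \<forall>e1\<in>VObj (vf_dom P).
        is_pullback A (vf_hom F (vf_obj P e0, vf_obj P e1)) (vf_hom G (vf_obj R e0, vf_obj R e1))
          (vf_hom P (e0, e1)) (vf_hom R (e0, e1)))"

lemma vf_square_obj:
  assumes "Comp vc F P = Comp vc G R" "vf_dom P = vf_dom R" "x : VObj (vf_dom P)"
  shows "vf_obj F (vf_obj P x) = vf_obj G (vf_obj R x)"
proof -
  have "vf_obj (Comp vc F P) x = vf_obj (Comp vc G R) x" using assms(1) by simp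
  then show ?thesis using vf_comp_obj[of x P F] vf_comp_obj[of x R G] assms(2,3) by simp
qed

lemma vf_square_hom:
  assumes "Comp vc F P = Comp vc G R" "vf_dom P = vf_dom R" "x : VObj (vf_dom P)" "y : VObj (vf_dom P)"
  shows "vf_hom F (vf_obj P x, vf_obj P y) ** vf_hom P (x, y) = vf_hom G (vf_obj R x, vf_obj R y) ** vf_hom R (x, y)"
proof -
  have "vf_hom (Comp vc F P) (x, y) = vf_hom (Comp vc G R) (x, y)" using assms(1) by simp
  then show ?thesis using vf_comp_hom[of x P y F] vf_comp_hom[of x R y G] assms(2-4) by simp
qed

lemma vf_square_el:
  assumes "Comp vc F P = Comp vc G R" "F : Arr vc" "G : Arr vc" "P : Arr vc" "R : Arr vc"
    "vf_dom F = vf_cod P" "vf_dom G = vf_cod R" "vf_dom P = vf_dom R"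
    "x : VObj (vf_dom P)" "y : VObj (vf_dom P)" "a : hom A q (VHom (vf_dom P) (x, y))"
  shows "vf_hom F (vf_obj P x, vf_obj P y) ** vf_hom P (x, y) ** a = vf_hom G (vf_obj R x, vf_obj R y) ** vf_hom R (x, y) ** a"
  using vf_comp_el[OF assms(4,2,6,9,10,11)] vf_comp_el[OF assms(5,3,7), of x y a q] assms(1,8-11) by simp

lemma strict_pullbackD:
  assumes "strict_pullback F G P R"
  shows "F : Arr vc" "G : Arr vc" "P : Arr vc" "R : Arr vc"
     "vf_cod F = vf_cod G" "vf_dom P = vf_dom R" "vf_cod P = vf_dom F" "vf_cod R = vf_dom G"
     "Comp vc F P = Comp vc G R"
    and "c : VObj (vf_dom F) ==> z : VObj (vf_dom G) ==> vf_obj F c = vf_obj G z ==>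
        \<exists>!e. e : VObj (vf_dom P) \<and> vf_obj P e = c \<and> vf_obj R e = z"
    and "e0 : VObj (vf_dom P) ==> e1 : VObj (vf_dom P) ==>
        is_pullback A (vf_hom F (vf_obj P e0, vf_obj P e1)) (vf_hom G (vf_obj R e0, vf_obj R e1))
          (vf_hom P (e0, e1)) (vf_hom R (e0, e1))"
proof -
  note s = assms[unfolded strict_pullback_def]
  show "F : Arr vc" "G : Arr vc" "P : Arr vc" "R : Arr vc"
     "vf_cod F = vf_cod G" "vf_dom P = vf_dom R" "vf_cod P = vf_dom F" "vf_cod R = vf_dom G"
     "Comp vc F P = Comp vc G R"
    using s by simp_all
  show "\<exists>!e. e : VObj (vf_dom P) \<and> vf_obj P e = c \<and> vf_obj R e = z"
    if "c : VObj (vf_dom F)" "z : VObj (vf_dom G)" "vf_obj F c = vf_obj G z"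
    using s that by (elim conjE) (drule (1) bspec, drule (1) bspec, erule (1) mp)
  show "is_pullback A (vf_hom F (vf_obj P e0, vf_obj P e1)) (vf_hom G (vf_obj R e0, vf_obj R e1))
          (vf_hom P (e0, e1)) (vf_hom R (e0, e1))" if "e0 : VObj (vf_dom P)" "e1 : VObj (vf_dom P)"
    using s that by (elim conjE) (drule (1) bspec[of "VObj (vf_dom P)"], erule (1) bspec)
qed

lemma strict_obj_eq:
  assumes "strict_pullback F G P R" "e : VObj (vf_dom P)" "e' : VObj (vf_dom P)"
    "vf_obj P e = vf_obj P e'" "vf_obj R e = vf_obj R e'"
  shows "e = e'"
proof -
  note S = strict_pullbackD[OF assms(1)]
  have "\<exists>!k. k : VObj (vf_dom P) \<and> vf_obj P k = vf_obj P e' \<and> vf_obj R k = vf_obj R e'"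
    by (rule S(10)) (use vf_arr_obj[OF S(3) assms(3)] vf_arr_obj[OF S(4), of e'] vf_square_obj[OF S(9,6) assms(3)]
        assms(3) S(6-8) in simp_all)
  then show ?thesis using assms(2-5) by (elim ex1E) blast
qed

lemma strict_lift:
  assumes "strict_pullback F G P R" "e0 : VObj (vf_dom P)" "e1 : VObj (vf_dom P)"
    "t : hom A q (VHom (vf_dom F) (vf_obj P e0, vf_obj P e1))"
    "s : hom A q (VHom (vf_dom G) (vf_obj R e0, vf_obj R e1))"
    "vf_hom F (vf_obj P e0, vf_obj P e1) ** t = vf_hom G (vf_obj R e0, vf_obj R e1) ** s"
  obtains h where "h : hom A q (VHom (vf_dom P) (e0, e1))" "vf_hom P (e0, e1) ** h = t" "vf_hom R (e0, e1) ** h = s"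
proof -
  note S = strict_pullbackD[OF assms(1)]
  have o: "vf_obj P e0 : VObj (vf_dom F)" "vf_obj P e1 : VObj (vf_dom F)"
    "vf_obj R e0 : VObj (vf_dom G)" "vf_obj R e1 : VObj (vf_dom G)"
    using vf_arr_obj[OF S(3)] vf_arr_obj[OF S(4)] assms(2,3) S(6-8) by simp_all
  note d = homE[OF vf_arr_hom[OF S(1) o(1,2)]] homE[OF vf_arr_hom[OF S(2) o(3,4)]] homE[OF vf_arr_hom[OF S(3) assms(2,3)]]
  obtain h where "h : hom A q (dom (vf_hom P (e0, e1)))" "vf_hom P (e0, e1) ** h = t" "vf_hom R (e0, e1) ** h = s"
    by (rule pullback_lift[OF S(11)[OF assms(2,3)] _ _ assms(6)]) (use assms(4,5) d in simp_all)
  then show thesis using that d by simp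
qed

lemma strict_hom_eq:
  assumes "strict_pullback F G P R" "e0 : VObj (vf_dom P)" "e1 : VObj (vf_dom P)"
    "h : hom A q (VHom (vf_dom P) (e0, e1))" "h' : hom A q (VHom (vf_dom P) (e0, e1))"
    "vf_hom P (e0, e1) ** h = vf_hom P (e0, e1) ** h'" "vf_hom R (e0, e1) ** h = vf_hom R (e0, e1) ** h'"
  shows "h = h'"
proof -
  note S = strict_pullbackD[OF assms(1)]
  note d = homE[OF vf_arr_hom[OF S(3) assms(2,3)]]
  show ?thesis
    by (rule pullback_eq[OF S(11)[OF assms(2,3)] _ _ assms(6,7)]) (use assms(4,5) d in simp_all)
qed

text \<open>The lift is defined on objects and on each hom-object separately. It preserves units and
  composition because the cone does and the two projections are jointly injective on
  elements.\<close>

lemma strict_is_pullback: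
  assumes sp: "strict_pullback F G P R"
  shows "is_pullback vc F G P R"
proof (rule VC.is_pullbackI)
  note S = strict_pullbackD[OF sp]
  have EC: "vf_dom P : Obj vc" using vf_arrD[OF S(3)] by simp
  show "F : Arr vc" "G : Arr vc" "P : Arr vc" "R : Arr vc" "Cod vc F = Cod vc G" "Dom vc P = Dom vc R"
    "Cod vc P = Dom vc F" "Cod vc R = Dom vc G" "Comp vc F P = Comp vc G R"
    using S by simp_all
  fix K
  {
    fix u v assume "u : hom vc K (Dom vc F)" "v : hom vc K (Dom vc G)" and e: "Comp vc F u = Comp vc G v"
    then have u: "u : Arr vc" "vf_dom u = K" "vf_cod u = vf_dom F" and v: "v : Arr vc" "vf_dom v = K" "vf_cod v = vf_dom G"
      by (simp_all add: hom_def)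
    have KC: "K : Obj vc" using vf_arrD[OF u(1)] u(2) by simp
    have uv: "vf_dom u = vf_dom v" using u v by simp
    have uo: "vf_obj u x : VObj (vf_dom F)" and vo: "vf_obj v x : VObj (vf_dom G)"
      and uvo: "vf_obj F (vf_obj u x) = vf_obj G (vf_obj v x)" if "x : VObj K" for x
      using vf_arr_obj[OF u(1)] vf_arr_obj[OF v(1)] vf_square_obj[OF e uv] that u v by simp_all
    define f where "f x = (THE k. k : VObj (vf_dom P) \<and> vf_obj P k = vf_obj u x \<and> vf_obj R k = vf_obj v x)" for x
    have f: "f x : VObj (vf_dom P)" "vf_obj P (f x) = vf_obj u x" "vf_obj R (f x) = vf_obj v x" if "x : VObj K" for x
      using theI'[OF S(10)[OF uo[OF that] vo[OF that] uvo[OF that]]] unfolding f_def by simp_all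
    have ex: "\<exists>k. k : hom A (VHom K (x, y)) (VHom (vf_dom P) (f x, f y)) \<and> vf_hom P (f x, f y) ** k = vf_hom u (x, y) \<and>
        vf_hom R (f x, f y) ** k = vf_hom v (x, y)" if xy: "x : VObj K" "y : VObj K" for x y
    proof -
      note fx = f[OF xy(1)] and fy = f[OF xy(2)]
      obtain k where "k : hom A (VHom K (x, y)) (VHom (vf_dom P) (f x, f y))" "vf_hom P (f x, f y) ** k = vf_hom u (x, y)"
        "vf_hom R (f x, f y) ** k = vf_hom v (x, y)"
      proof (rule strict_lift[OF sp fx(1) fy(1)])
        show "vf_hom u (x, y) : hom A (VHom K (x, y)) (VHom (vf_dom F) (vf_obj P (f x), vf_obj P (f y)))"
          using vf_arr_hom[OF u(1)] xy u fx fy by simp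
        show "vf_hom v (x, y) : hom A (VHom K (x, y)) (VHom (vf_dom G) (vf_obj R (f x), vf_obj R (f y)))"
          using vf_arr_hom[OF v(1)] xy v fx fy by simp
        show "vf_hom F (vf_obj P (f x), vf_obj P (f y)) ** vf_hom u (x, y) = vf_hom G (vf_obj R (f x), vf_obj R (f y)) ** vf_hom v (x, y)"
          using vf_square_hom[OF e uv] xy u(2) fx fy by simp
      qed blast
      then show ?thesis by blast
    qed
    define h where "h x y = (SOME k. k : hom A (VHom K (x, y)) (VHom (vf_dom P) (f x, f y)) \<and> vf_hom P (f x, f y) ** k = vf_hom u (x, y) \<and>
        vf_hom R (f x, f y) ** k = vf_hom v (x, y))" for x y
    have h: "h x y : hom A (VHom K (x, y)) (VHom (vf_dom P) (f x, f y))" "vf_hom P (f x, f y) ** h x y = vf_hom u (x, y)"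
        "vf_hom R (f x, f y) ** h x y = vf_hom v (x, y)" if "x : VObj K" "y : VObj K" for x y
      using someI_ex[OF ex[OF that]] unfolding h_def by simp_all
    have hel: "vf_hom P (f x, f y) ** h x y ** a = vf_hom u (x, y) ** a" "vf_hom R (f x, f y) ** h x y ** a = vf_hom v (x, y) ** a"
        "h x y ** a : hom A q (VHom (vf_dom P) (f x, f y))"
      if xy: "x : VObj K" "y : VObj K" and a: "a : hom A q (VHom K (x, y))" for x y q a
    proof -
      note H = h[OF xy] and fx = f[OF xy(1)] and fy = f[OF xy(2)]
      note ph = homE[OF vf_arr_hom[OF S(3) fx(1) fy(1)]]
      have fxR: "f x : VObj (vf_dom R)" "f y : VObj (vf_dom R)" using fx(1) fy(1) S(6) by simp_all
      note rh = homE[OF vf_arr_hom[OF S(4) fxR]]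
      show "h x y ** a : hom A q (VHom (vf_dom P) (f x, f y))" by (rule comp_hom[OF a H(1)])
      show "vf_hom P (f x, f y) ** h x y ** a = vf_hom u (x, y) ** a"
        by (rule comp_eq_arr[OF H(2)]) (use homE[OF H(1)] homE[OF a] ph in simp_all)
      show "vf_hom R (f x, f y) ** h x y ** a = vf_hom v (x, y) ** a"
        by (rule comp_eq_arr[OF H(3)]) (use homE[OF H(1)] homE[OF a] rh S(6) in simp_all)
    qed
    define s where "s = mk_vfunctor K (vf_dom P) f h"
    have Kv: "is_vcat A K" and Ev: "is_vcat A (vf_dom P)" using KC EC by simp_all
    have sA: "s : Arr vc"
      unfolding s_def
    proof (rule mk_vfunctor_arr[OF KC EC f(1) h(1)])
      fix x q assume x: "x : VObj K" and q: "q : Obj A"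
      note U = un_hom[OF Kv x q]
      note fx = f[OF x]
      have xu: "x : VObj (vf_dom u)" "x : VObj (vf_dom v)" "f x : VObj (vf_dom R)" using x u v fx S(6) by simp_all
      show "h x x ** un K x q = un (vf_dom P) (f x) q"
      proof (rule strict_hom_eq[OF sp fx(1) fx(1) hel(3)[OF x x U] un_hom[OF Ev fx(1) q]])
        show "vf_hom P (f x, f x) ** h x x ** un K x q = vf_hom P (f x, f x) ** un (vf_dom P) (f x) q"
          unfolding hel(1)[OF x x U] vf_arr_un[OF S(3) fx(1) q] using vf_arr_un[OF u(1) xu(1) q] u(2,3) fx(2) S(7) by simp
        show "vf_hom R (f x, f x) ** h x x ** un K x q = vf_hom R (f x, f x) ** un (vf_dom P) (f x) q"
          unfolding hel(2)[OF x x U] S(6) vf_arr_un[OF S(4) xu(3) q] using vf_arr_un[OF v(1) xu(2) q] v(2,3) fx(3) S(8) by simp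
      qed
    next
      fix x y z q a b assume o: "x : VObj K" "y : VObj K" "z : VObj K"
        and ab: "a : hom A q (VHom K (y, z))" "b : hom A q (VHom K (x, y))"
      note M = cmp_hom[OF Kv o ab]
      note fx = f[OF o(1)] and fy = f[OF o(2)] and fz = f[OF o(3)]
      note ha = hel[OF o(2,3) ab(1)] and hb = hel[OF o(1,2) ab(2)] and hm = hel[OF o(1,3) M]
      have fR: "f x : VObj (vf_dom R)" "f y : VObj (vf_dom R)" "f z : VObj (vf_dom R)" using fx fy fz S(6) by simp_all
      show "h x z ** cmp K x y z a b = cmp (vf_dom P) (f x) (f y) (f z) (h y z ** a) (h x y ** b)"
      proof (rule strict_hom_eq[OF sp fx(1) fz(1) hm(3) cmp_hom[OF Ev fx(1) fy(1) fz(1) ha(3) hb(3)]])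
        show "vf_hom P (f x, f z) ** h x z ** cmp K x y z a b = vf_hom P (f x, f z) ** cmp (vf_dom P) (f x) (f y) (f z) (h y z ** a) (h x y ** b)"
          unfolding hm(1) vf_arr_cmp[OF S(3) fx(1) fy(1) fz(1) ha(3) hb(3)] ha(1) hb(1)
          using vf_arr_cmp[OF u(1), of x y z a q b] o ab u(2,3) fx(2) fy(2) fz(2) S(7) by simp
        show "vf_hom R (f x, f z) ** h x z ** cmp K x y z a b = vf_hom R (f x, f z) ** cmp (vf_dom P) (f x) (f y) (f z) (h y z ** a) (h x y ** b)"
          unfolding hm(2) S(6) vf_arr_cmp[OF S(4) fR ha(3)[unfolded S(6)] hb(3)[unfolded S(6)]] ha(2) hb(2)
          using vf_arr_cmp[OF v(1), of x y z a q b] o ab v(2,3) fx(3) fy(3) fz(3) S(8) by simp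
      qed
    qed
    have Ps: "Comp vc P s : Arr vc" "Comp vc R s : Arr vc"
      by (rule VC.arr_comp; use sA S(3,4,6) in \<open>simp add: s_def\<close>)+
    have "Comp vc P s = u" by (rule vf_eqI[OF Ps(1) u(1)]) (use u S(7) f h in \<open>simp_all add: s_def vf_comp_obj vf_comp_hom\<close>)
    moreover have "Comp vc R s = v" by (rule vf_eqI[OF Ps(2) v(1)]) (use v S(8) f h in \<open>simp_all add: s_def vf_comp_obj vf_comp_hom\<close>)
    moreover have "s : hom vc K (Dom vc P)" using sA by (simp add: hom_def s_def)
    ultimately show "\<exists>h\<in>hom vc K (Dom vc P). Comp vc P h = u \<and> Comp vc R h = v" by blast
  next
    fix h h' assume "h : hom vc K (Dom vc P)" "h' : hom vc K (Dom vc P)"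
      and eP: "Comp vc P h = Comp vc P h'" and eR: "Comp vc R h = Comp vc R h'"
    then have h: "h : Arr vc" "vf_dom h = K" "vf_cod h = vf_dom P" and h': "h' : Arr vc" "vf_dom h' = K" "vf_cod h' = vf_dom P"
      by (simp_all add: hom_def)
    have dd: "vf_dom h = vf_dom h'" using h h' by simp
    have o: "vf_obj h x : VObj (vf_dom P)" "vf_obj h' x : VObj (vf_dom P)" "vf_obj h x = vf_obj h' x" if x: "x : VObj K" for x
    proof -
      show 1: "vf_obj h x : VObj (vf_dom P)" "vf_obj h' x : VObj (vf_dom P)"
        using vf_arr_obj[OF h(1)] vf_arr_obj[OF h'(1)] h h' x by simp_all
      show "vf_obj h x = vf_obj h' x"
        by (rule strict_obj_eq[OF sp 1]) (use vf_square_obj[OF eP dd] vf_square_obj[OF eR dd] x h(2) in simp_all)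
    qed
    show "h = h'"
    proof (rule vf_eqI[OF h(1) h'(1)])
      fix x y assume "x : VObj (vf_dom h')" "y : VObj (vf_dom h')"
      then have xy: "x : VObj K" "y : VObj K" using h' by simp_all
      note ox = o[OF xy(1)] and oy = o[OF xy(2)]
      show "vf_hom h (x, y) = vf_hom h' (x, y)"
      proof (rule strict_hom_eq[OF sp ox(1) oy(1)])
        show "vf_hom h (x, y) : hom A (VHom K (x, y)) (VHom (vf_dom P) (vf_obj h x, vf_obj h y))"
          using vf_arr_hom[OF h(1)] xy h by simp
        show "vf_hom h' (x, y) : hom A (VHom K (x, y)) (VHom (vf_dom P) (vf_obj h x, vf_obj h y))"
          using vf_arr_hom[OF h'(1)] xy h' ox(3) oy(3) by simp
        show "vf_hom P (vf_obj h x, vf_obj h y) ** vf_hom h (x, y) = vf_hom P (vf_obj h x, vf_obj h y) ** vf_hom h' (x, y)"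
          "vf_hom R (vf_obj h x, vf_obj h y) ** vf_hom h (x, y) = vf_hom R (vf_obj h x, vf_obj h y) ** vf_hom h' (x, y)"
          using vf_square_hom[OF eP dd, of x y] vf_square_hom[OF eR dd, of x y] xy h(2) ox(3) oy(3) by simp_all
      qed
    qed (use h h' o in simp_all)
  }
qed

text \<open>With \<open>dec2\<close>, the coordinates of a coded pair: the objects of a pullback
  have to be elements of \<open>'u\<close> again.\<close>

definition dec1 :: "'u => 'u" where "dec1 k = (THE c. \<exists>z. k = pair c z)"
definition dec2 :: "'u => 'u" where "dec2 k = (THE z. \<exists>c. k = pair c z)"

lemma dec_pair [simp]: "dec1 (pair c z) = c" "dec2 (pair c z) = z"
  unfolding dec1_def dec2_def using pair_inject by (intro the_equality; blast)+

text \<open>Objects are coded pairs and hom-objects are chosen pullbacks. Units and composition are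
  lifted from \<open>C\<close> and \<open>Z\<close>, and each law is checked after both projections,
  where it holds in \<open>C\<close> and in \<open>Z\<close>.\<close>

lemma strict_pullback_exists:
  assumes F: "F : Arr vc" and G: "G : Arr vc" and FG: "vf_cod F = vf_cod G"
  obtains P R where "strict_pullback F G P R"
proof -
  define C Z where "C = vf_dom F" and "Z = vf_dom G"
  have C: "is_vcat A C" "small (VObj C)" and Z: "is_vcat A Z" "small (VObj Z)" and E: "is_vcat A (vf_cod G)"
    using vf_arrD[OF F] vf_arrD[OF G] by (simp_all add: C_def Z_def)
  define S where "S = {pair c z | c z. c : VObj C \<and> z : VObj Z \<and> vf_obj F c = vf_obj G z}"
  have S: "dec1 k : VObj C" "dec2 k : VObj Z" "vf_obj F (dec1 k) = vf_obj G (dec2 k)" "pair (dec1 k) (dec2 k) = k"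
    if "k : S" for k using that unfolding S_def by auto
  have "S \<subseteq> (\<Union>c\<in>VObj C. (\<lambda>z. pair c z) ` VObj Z)" unfolding S_def by auto
  moreover have "small (\<Union>c\<in>VObj C. (\<lambda>z. pair c z) ` VObj Z)"
    by (rule small_UN[OF C(2) small_image[OF Z(2)]])
  ultimately have smallS: "small S" by (rule small_subset[rotated])
  define Fh Gh where "Fh k l = vf_hom F (dec1 k, dec1 l)" and "Gh k l = vf_hom G (dec2 k, dec2 l)" for k l
  have Fh: "Fh k l : hom A (VHom C (dec1 k, dec1 l)) (VHom (vf_cod G) (vf_obj F (dec1 k), vf_obj F (dec1 l)))"
    and Gh: "Gh k l : hom A (VHom Z (dec2 k, dec2 l)) (VHom (vf_cod G) (vf_obj F (dec1 k), vf_obj F (dec1 l)))"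
    if "k : S" "l : S" for k l
    using vf_arr_hom[OF F, of "dec1 k" "dec1 l"] vf_arr_hom[OF G, of "dec2 k" "dec2 l"] S[OF that(1)] S[OF that(2)] FG
    by (simp_all add: C_def Z_def Fh_def Gh_def)
  have Ft: "Fh k l : Arr A" "Gh k l : Arr A" "cod (Fh k l) = cod (Gh k l)"
    "dom (Fh k l) = VHom C (dec1 k, dec1 l)" "dom (Gh k l) = VHom Z (dec2 k, dec2 l)"
    if "k : S" "l : S" for k l
    using Fh[OF that] Gh[OF that] by (simp_all add: hom_def)
  define a1 a2 H where "a1 k l = pi1 (Fh k l) (Gh k l)" and "a2 k l = pi2 (Fh k l) (Gh k l)" and "H k l = dom (pi1 (Fh k l) (Gh k l))" for k l
  have pb: "is_pullback A (Fh k l) (Gh k l) (a1 k l) (a2 k l)" if "k : S" "l : S" for k l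
    unfolding a1_def a2_def by (rule pb_is_pullback[OF Ft(1-3)[OF that]])
  have a: "a1 k l : hom A (H k l) (VHom C (dec1 k, dec1 l))" "a2 k l : hom A (H k l) (VHom Z (dec2 k, dec2 l))"
    if "k : S" "l : S" for k l
    using pb_simps[OF Ft(1-3)[OF that]] Ft[OF that] by (simp_all add: a1_def a2_def H_def hom_def)
  have Ho: "H k l : Obj A" if "k : S" "l : S" for k l using homE[OF a(1)[OF that]] by simp
  have ael: "a1 k l ** r : hom A q (VHom C (dec1 k, dec1 l))" "a2 k l ** r : hom A q (VHom Z (dec2 k, dec2 l))"
    "Fh k l ** a1 k l ** r = Gh k l ** a2 k l ** r"
    if kl: "k : S" "l : S" and r: "r : hom A q (H k l)" for k l r q
  proof -
    show "a1 k l ** r : hom A q (VHom C (dec1 k, dec1 l))" "a2 k l ** r : hom A q (VHom Z (dec2 k, dec2 l))"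
      by (rule comp_hom[OF r a(1)[OF kl]], rule comp_hom[OF r a(2)[OF kl]])
    show "Fh k l ** a1 k l ** r = Gh k l ** a2 k l ** r"
      by (rule comp_eq_comp[OF pullback_arrs(9)[OF pb[OF kl]]])
        (use Ft[OF kl] homE[OF a(1)[OF kl]] homE[OF a(2)[OF kl]] homE[OF r] in simp_all)
  qed
  have jm: "r = r'" if kl: "k : S" "l : S" and r: "r : hom A q (H k l)" "r' : hom A q (H k l)"
    and "a1 k l ** r = a1 k l ** r'" "a2 k l ** r = a2 k l ** r'" for k l r r' q
    by (rule pullback_eq[OF pb[OF kl] _ _ that(5,6)]) (use r homE[OF a(1)[OF kl]] in simp_all)
  have lift: "\<exists>h. h : hom A q (H k l) \<and> a1 k l ** h = t \<and> a2 k l ** h = s"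
    if kl: "k : S" "l : S" and ts: "t : hom A q (VHom C (dec1 k, dec1 l))" "s : hom A q (VHom Z (dec2 k, dec2 l))"
      "Fh k l ** t = Gh k l ** s" for k l t s q
  proof -
    obtain h where "h : hom A q (dom (a1 k l))" "a1 k l ** h = t" "a2 k l ** h = s"
      by (rule pullback_lift[OF pb[OF kl] _ _ ts(3)]) (use ts(1,2) Ft[OF kl] in simp_all)
    then show ?thesis using homE[OF a(1)[OF kl]] by auto
  qed
  have Fun: "Fh k k ** un C (dec1 k) q = Gh k k ** un Z (dec2 k) q" if "k : S" "q : Obj A" for k q
    using vf_arr_un[OF F, of "dec1 k" q] vf_arr_un[OF G, of "dec2 k" q] S[OF that(1)] that(2) FG
    by (simp add: C_def Z_def Fh_def Gh_def)
  have "\<exists>U. \<forall>k\<in>S. U k : hom A (unit_obj A) (H k k) \<and> a1 k k ** U k = un C (dec1 k) (unit_obj A) \<and>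
    a2 k k ** U k = un Z (dec2 k) (unit_obj A)"
    by (rule bchoice) (use lift un_hom[OF C(1)] un_hom[OF Z(1)] Fun S in simp)
  then obtain U where U: "\<And>k. k : S ==> U k : hom A (unit_obj A) (H k k)"
    "\<And>k. k : S ==> a1 k k ** U k = un C (dec1 k) (unit_obj A)" "\<And>k. k : S ==> a2 k k ** U k = un Z (dec2 k) (unit_obj A)"
    by blast
  have Fcmp: "Fh k m ** cmp C (dec1 k) (dec1 l) (dec1 m) (a1 l m ** r) (a1 k l ** r') =
      Gh k m ** cmp Z (dec2 k) (dec2 l) (dec2 m) (a2 l m ** r) (a2 k l ** r')"
    if klm: "k : S" "l : S" "m : S" and r: "r : hom A q (H l m)" "r' : hom A q (H k l)" for k l m r r' q
  proof -
    note e = ael[OF klm(2,3) r(1)] and e' = ael[OF klm(1,2) r(2)]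
    have "Fh k m ** cmp C (dec1 k) (dec1 l) (dec1 m) (a1 l m ** r) (a1 k l ** r') =
      cmp (vf_cod G) (vf_obj F (dec1 k)) (vf_obj F (dec1 l)) (vf_obj F (dec1 m)) (Fh l m ** a1 l m ** r) (Fh k l ** a1 k l ** r')"
      unfolding Fh_def C_def FG[symmetric]
      by (rule vf_arr_cmp[OF F]) (use S[OF klm(1)] S[OF klm(2)] S[OF klm(3)] e(1) e'(1) in \<open>simp_all add: C_def\<close>)
    also have "\<dots> = cmp (vf_cod G) (vf_obj G (dec2 k)) (vf_obj G (dec2 l)) (vf_obj G (dec2 m)) (Gh l m ** a2 l m ** r) (Gh k l ** a2 k l ** r')"
      using e(3) e'(3) S(3)[OF klm(1)] S(3)[OF klm(2)] S(3)[OF klm(3)] by simp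
    also have "\<dots> = Gh k m ** cmp Z (dec2 k) (dec2 l) (dec2 m) (a2 l m ** r) (a2 k l ** r')"
      unfolding Gh_def Z_def
      by (rule vf_arr_cmp[OF G, symmetric]) (use S[OF klm(1)] S[OF klm(2)] S[OF klm(3)] e(2) e'(2) in \<open>simp_all add: Z_def\<close>)
    finally show ?thesis .
  qed
  \<comment> \<open>The composite of the generic pair, computed in \<open>C\<close> and in
    \<open>Z\<close> and then lifted; \<open>Mel\<close> evaluates it on arbitrary elements.\<close>
  define M where "M k l m = (SOME h. h : hom A (prod_obj A (H l m) (H k l)) (H k m) \<and>
      a1 k m ** h = cmp C (dec1 k) (dec1 l) (dec1 m) (a1 l m ** pr1 A (H l m) (H k l)) (a1 k l ** pr2 A (H l m) (H k l)) \<and>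
      a2 k m ** h = cmp Z (dec2 k) (dec2 l) (dec2 m) (a2 l m ** pr1 A (H l m) (H k l)) (a2 k l ** pr2 A (H l m) (H k l)))" for k l m
  have M: "M k l m : hom A (prod_obj A (H l m) (H k l)) (H k m)"
      "a1 k m ** M k l m = cmp C (dec1 k) (dec1 l) (dec1 m) (a1 l m ** pr1 A (H l m) (H k l)) (a1 k l ** pr2 A (H l m) (H k l))"
      "a2 k m ** M k l m = cmp Z (dec2 k) (dec2 l) (dec2 m) (a2 l m ** pr1 A (H l m) (H k l)) (a2 k l ** pr2 A (H l m) (H k l))"
    if klm: "k : S" "l : S" "m : S" for k l m
  proof -
    have r: "pr1 A (H l m) (H k l) : hom A (prod_obj A (H l m) (H k l)) (H l m)"
      "pr2 A (H l m) (H k l) : hom A (prod_obj A (H l m) (H k l)) (H k l)"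
      using Ho klm by (simp_all add: hom_def)
    note e = ael[OF klm(2,3) r(1)] and e' = ael[OF klm(1,2) r(2)]
    note s = S[OF klm(1)] S[OF klm(2)] S[OF klm(3)]
    have "\<exists>h. h : hom A (prod_obj A (H l m) (H k l)) (H k m) \<and>
      a1 k m ** h = cmp C (dec1 k) (dec1 l) (dec1 m) (a1 l m ** pr1 A (H l m) (H k l)) (a1 k l ** pr2 A (H l m) (H k l)) \<and>
      a2 k m ** h = cmp Z (dec2 k) (dec2 l) (dec2 m) (a2 l m ** pr1 A (H l m) (H k l)) (a2 k l ** pr2 A (H l m) (H k l))"
      by (rule lift[OF klm(1,3) cmp_hom[OF C(1) s(1,5,9) e(1) e'(1)] cmp_hom[OF Z(1) s(2,6,10) e(2) e'(2)] Fcmp[OF klm r]])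
    from someI_ex[OF this] show "M k l m : hom A (prod_obj A (H l m) (H k l)) (H k m)"
      "a1 k m ** M k l m = cmp C (dec1 k) (dec1 l) (dec1 m) (a1 l m ** pr1 A (H l m) (H k l)) (a1 k l ** pr2 A (H l m) (H k l))"
      "a2 k m ** M k l m = cmp Z (dec2 k) (dec2 l) (dec2 m) (a2 l m ** pr1 A (H l m) (H k l)) (a2 k l ** pr2 A (H l m) (H k l))"
      unfolding M_def by simp_all
  qed
  have Mel: "M k l m ** pairing A r r' : hom A q (H k m)"
      "a1 k m ** M k l m ** pairing A r r' = cmp C (dec1 k) (dec1 l) (dec1 m) (a1 l m ** r) (a1 k l ** r')"
      "a2 k m ** M k l m ** pairing A r r' = cmp Z (dec2 k) (dec2 l) (dec2 m) (a2 l m ** r) (a2 k l ** r')"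
    if klm: "k : S" "l : S" "m : S" and r: "r : hom A q (H l m)" "r' : hom A q (H k l)" for k l m r r' q
  proof -
    have pp: "pr1 A (H l m) (H k l) : hom A (prod_obj A (H l m) (H k l)) (H l m)"
      "pr2 A (H l m) (H k l) : hom A (prod_obj A (H l m) (H k l)) (H k l)"
      using Ho klm by (simp_all add: hom_def)
    have pr: "pairing A r r' : hom A q (prod_obj A (H l m) (H k l))" using r by (simp add: hom_def)
    have ps: "pr1 A (H l m) (H k l) ** pairing A r r' = r" "pr2 A (H l m) (H k l) ** pairing A r r' = r'"
      using r by (simp_all add: hom_def)
    note e = ael[OF klm(2,3) pp(1)] and e' = ael[OF klm(1,2) pp(2)]
    note s = S[OF klm(1)] S[OF klm(2)] S[OF klm(3)]
    show "M k l m ** pairing A r r' : hom A q (H k m)" by (rule comp_hom[OF pr M(1)[OF klm]])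
    have "a1 k m ** M k l m ** pairing A r r' = (a1 k m ** M k l m) ** pairing A r r'"
      by (rule assoc[OF pr M(1)[OF klm] a(1)[OF klm(1,3)], symmetric])
    also have "\<dots> = cmp C (dec1 k) (dec1 l) (dec1 m) ((a1 l m ** pr1 A (H l m) (H k l)) ** pairing A r r') ((a1 k l ** pr2 A (H l m) (H k l)) ** pairing A r r')"
      unfolding M(2)[OF klm] by (rule cmp_comp[OF C(1) s(1,5,9) e(1) e'(1) pr])
    finally show "a1 k m ** M k l m ** pairing A r r' = cmp C (dec1 k) (dec1 l) (dec1 m) (a1 l m ** r) (a1 k l ** r')"
      unfolding assoc[OF pr pp(1) a(1)[OF klm(2,3)]] assoc[OF pr pp(2) a(1)[OF klm(1,2)]] ps .
    have "a2 k m ** M k l m ** pairing A r r' = (a2 k m ** M k l m) ** pairing A r r'"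
      by (rule assoc[OF pr M(1)[OF klm] a(2)[OF klm(1,3)], symmetric])
    also have "\<dots> = cmp Z (dec2 k) (dec2 l) (dec2 m) ((a2 l m ** pr1 A (H l m) (H k l)) ** pairing A r r') ((a2 k l ** pr2 A (H l m) (H k l)) ** pairing A r r')"
      unfolding M(3)[OF klm] by (rule cmp_comp[OF Z(1) s(2,6,10) e(2) e'(2) pr])
    finally show "a2 k m ** M k l m ** pairing A r r' = cmp Z (dec2 k) (dec2 l) (dec2 m) (a2 l m ** r) (a2 k l ** r')"
      unfolding assoc[OF pr pp(1) a(2)[OF klm(2,3)]] assoc[OF pr pp(2) a(2)[OF klm(1,2)]] ps .
  qed
  have Uel: "U k ** bang q : hom A q (H k k)" "a1 k k ** U k ** bang q = un C (dec1 k) q" "a2 k k ** U k ** bang q = un Z (dec2 k) q"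
    if k: "k : S" and q: "q : Obj A" for k q
  proof -
    have b: "bang q : hom A q (unit_obj A)" using q by (simp add: hom_def)
    show "U k ** bang q : hom A q (H k k)" by (rule comp_hom[OF b U(1)[OF k]])
    show "a1 k k ** U k ** bang q = un C (dec1 k) q"
      unfolding assoc[OF b U(1)[OF k] a(1)[OF k k], symmetric] U(2)[OF k] by (rule un_comp[OF C(1) S(1)[OF k] b])
    show "a2 k k ** U k ** bang q = un Z (dec2 k) q"
      unfolding assoc[OF b U(1)[OF k] a(2)[OF k k], symmetric] U(3)[OF k] by (rule un_comp[OF Z(1) S(2)[OF k] b])
  qed
  define E0 where "E0 = mk_vcat S H U M"
  have E0: "E0 : Obj vc"
    unfolding E0_def
  proof (rule mk_vcat_obj[OF smallS Ho U(1) M(1)])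
    fix w x y z q r r' r'' assume o: "w : S" "x : S" "y : S" "z : S"
      and r: "r : hom A q (H y z)" "r' : hom A q (H x y)" "r'' : hom A q (H w x)"
    note m1 = Mel[OF o(2,3,4) r(1,2)] and m2 = Mel[OF o(1,2,3) r(2,3)]
    note m3 = Mel[OF o(1,2,4) m1(1) r(3)] and m4 = Mel[OF o(1,3,4) r(1) m2(1)]
    note e1 = ael[OF o(3,4) r(1)] and e2 = ael[OF o(2,3) r(2)] and e3 = ael[OF o(1,2) r(3)]
    show "M w x z ** pairing A (M x y z ** pairing A r r') r'' = M w y z ** pairing A r (M w x y ** pairing A r' r'')"
      by (rule jm[OF o(1,4) m3(1) m4(1)])
        (unfold m1 m2 m3 m4, rule cmp_assoc[OF C(1) S(1)[OF o(1)] S(1)[OF o(2)] S(1)[OF o(3)] S(1)[OF o(4)] e1(1) e2(1) e3(1)],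
          rule cmp_assoc[OF Z(1) S(2)[OF o(1)] S(2)[OF o(2)] S(2)[OF o(3)] S(2)[OF o(4)] e1(2) e2(2) e3(2)])
  next
    fix x y q r assume o: "x : S" "y : S" and r: "r : hom A q (H x y)"
    have q: "q : Obj A" using homE[OF r] by simp
    note ux = Uel[OF o(1) q] and uy = Uel[OF o(2) q]
    note m1 = Mel[OF o(1,2,2) uy(1) r] and m2 = Mel[OF o(1,1,2) r ux(1)] and e = ael[OF o r]
    show "M x y y ** pairing A (U y ** bang q) r = r"
      by (rule jm[OF o m1(1) r]) (unfold m1 uy, rule cmp_unit[OF C(1) S(1)[OF o(1)] S(1)[OF o(2)] e(1)],
        rule cmp_unit[OF Z(1) S(2)[OF o(1)] S(2)[OF o(2)] e(2)])
    show "M x x y ** pairing A r (U x ** bang q) = r"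
      by (rule jm[OF o m2(1) r]) (unfold m2 ux, rule cmp_unit[OF C(1) S(1)[OF o(1)] S(1)[OF o(2)] e(1)],
        rule cmp_unit[OF Z(1) S(2)[OF o(1)] S(2)[OF o(2)] e(2)])
  qed
  have E0s: "VObj E0 = S" "k : S ==> l : S ==> VHom E0 (k, l) = H k l"
    "k : S ==> l : S ==> m : S ==> cmp E0 k l m r r' = M k l m ** pairing A r r'"
    "k : S ==> un E0 k q = U k ** bang q" for k l m r r' q
    by (simp_all add: E0_def)
  define P R where "P = mk_vfunctor E0 C dec1 a1" and "R = mk_vfunctor E0 Z dec2 a2"
  have CZ: "C : Obj vc" "Z : Obj vc" using C Z by simp_all
  have P: "P : Arr vc"
    unfolding P_def by (rule mk_vfunctor_arr[OF E0 CZ(1)]) (use E0s S a Mel Uel in simp_all)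
  have R: "R : Arr vc"
    unfolding R_def by (rule mk_vfunctor_arr[OF E0 CZ(2)]) (use E0s S a Mel Uel in simp_all)
  have Ps: "vf_dom P = E0" "vf_cod P = C" "k : S ==> vf_obj P k = dec1 k" "k : S ==> l : S ==> vf_hom P (k, l) = a1 k l"
    "vf_dom R = E0" "vf_cod R = Z" "k : S ==> vf_obj R k = dec2 k" "k : S ==> l : S ==> vf_hom R (k, l) = a2 k l" for k l
    unfolding P_def R_def by (simp_all add: E0s(1))
  have FP: "Comp vc F P : Arr vc" "Comp vc G R : Arr vc"
    using VC.arr_comp[OF P F] VC.arr_comp[OF R G] Ps by (simp_all add: C_def Z_def)
  have sq: "Comp vc F P = Comp vc G R"
    by (rule vf_eqI[OF FP])
      (use Ps E0s(1) FG S(3) pullback_arrs(9)[OF pb] in \<open>simp_all add: Fh_def Gh_def vf_comp_obj vf_comp_hom\<close>)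
  have "strict_pullback F G P R"
    unfolding strict_pullback_def
  proof (intro conjI ballI impI F G P R FG sq)
    show "vf_dom P = vf_dom R" "vf_cod P = vf_dom F" "vf_cod R = vf_dom G" using Ps by (simp_all add: C_def Z_def)
    fix c z assume cz: "c : VObj (vf_dom F)" "z : VObj (vf_dom G)" "vf_obj F c = vf_obj G z"
    then have k: "pair c z : S" by (auto simp: S_def C_def Z_def)
    show "\<exists>!e. e : VObj (vf_dom P) \<and> vf_obj P e = c \<and> vf_obj R e = z"
    proof (rule ex1I[of _ "pair c z"])
      show "pair c z : VObj (vf_dom P) \<and> vf_obj P (pair c z) = c \<and> vf_obj R (pair c z) = z"
        using k Ps E0s(1) by simp
      fix e assume e: "e : VObj (vf_dom P) \<and> vf_obj P e = c \<and> vf_obj R e = z"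
      then have "e : S" using Ps(1) E0s(1) by simp
      then show "e = pair c z" using e Ps S(4)[of e] by simp
    qed
  next
    fix e0 e1 assume "e0 : VObj (vf_dom P)" "e1 : VObj (vf_dom P)"
    then have e: "e0 : S" "e1 : S" using Ps(1) E0s(1) by simp_all
    show "is_pullback A (vf_hom F (vf_obj P e0, vf_obj P e1)) (vf_hom G (vf_obj R e0, vf_obj R e1)) (vf_hom P (e0, e1)) (vf_hom R (e0, e1))"
      using pb[OF e] Ps e by (simp add: Fh_def Gh_def)
  qed
  then show thesis by (rule that)
qed

lemma VCat_has_pullbacks: "has_pullbacks vc"
  unfolding has_pullbacks_def
proof (intro ballI impI)
  fix F G assume "F : Arr vc" "G : Arr vc" "Cod vc F = Cod vc G"
  then obtain P R where "strict_pullback F G P R" using strict_pullback_exists[of F G] by auto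
  then show "\<exists>P R. is_pullback vc F G P R" using strict_is_pullback by blast
qed

end

section \<open>Descent along enriched functors\<close>

text \<open>What (a) to (d) say about \<open>F\<close> itself once the images are eliminated;
  \<open>surj\<close> stems from the nonemptiness of the families in (b).\<close>

locale covering_vfunctor = universe_cartesian small pair A
  for small :: "'u set => bool" and pair :: "'u => 'u => 'u" and A :: "('o, 'm) cat" +
  fixes F :: "('u, 'o, 'm) vfunctor" and C D :: "('u, 'o, 'm) vcat"
  assumes F: "F : Arr vc" and dom_F [simp]: "vf_dom F = C" and cod_F [simp]: "vf_cod F = D"
    and surj: "y : VObj D ==> \<exists>x\<in>VObj C. vf_obj F x = y"
    and cov1: "y0 : VObj D ==> y1 : VObj D ==>
      covers (VHom D (y0, y1)) (family_factors (vf_fiber F y0 \<times> vf_fiber F y1) (vf_hom F))"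
    and cov2: "y0 : VObj D ==> y1 : VObj D ==> y2 : VObj D ==>
      covers (chain3 A D (y0, y1, y2))
        (family_factors (vf_fiber F y0 \<times> vf_fiber F y1 \<times> vf_fiber F y2) (vf_chain3 A F))"
    and sep3: "y0 : VObj D ==> y1 : VObj D ==> y2 : VObj D ==> y3 : VObj D ==>
      separating (chain4 A D (y0, y1, y2, y3))
        (family_factors (vf_fiber F y0 \<times> vf_fiber F y1 \<times> vf_fiber F y2 \<times> vf_fiber F y3) (vf_chain4 A F))"
    and eff1: "y0 : VObj D ==> y1 : VObj D ==>
      family_effective (vf_fiber F y0 \<times> vf_fiber F y1) (vf_hom F)"
begin

lemma fiber_iff [simp]: "x : vf_fiber F y \<longleftrightarrow> x : VObj C \<and> vf_obj F x = y"
  by (auto simp: vf_fiber_def)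

lemma C_vcat: "is_vcat A C" "small (VObj C)" "C : Obj vc" and D_vcat: "is_vcat A D" "small (VObj D)" "D : Obj vc"
  using vf_arrD[OF F] by simp_all

lemma F_obj: "x : VObj C ==> vf_obj F x : VObj D"
  using vf_arr_obj[OF F] by simp

lemma F_hom: "x : VObj C ==> y : VObj C ==> vf_hom F (x, y) : hom A (VHom C (x, y)) (VHom D (vf_obj F x, vf_obj F y))"
  using vf_arr_hom[OF F] by simp

lemma F_cmp:
  "x : VObj C ==> y : VObj C ==> z : VObj C ==> a : hom A q (VHom C (y, z)) ==> b : hom A q (VHom C (x, y)) ==>
    vf_hom F (x, z) ** cmp C x y z a b =
    cmp D (vf_obj F x) (vf_obj F y) (vf_obj F z) (vf_hom F (y, z) ** a) (vf_hom F (x, y) ** b)"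
  using vf_arr_cmp[OF F] by simp

lemma F_un: "x : VObj C ==> q : Obj A ==> vf_hom F (x, x) ** un C x q = un D (vf_obj F x) q"
  using vf_arr_un[OF F] by simp

section \<open>Elements of \<open>D\<close> that lift to chains of \<open>C\<close>\<close>

lemma factors1_iff:
  assumes "g : hom A q (VHom D (y0, y1))"
  shows "family_factors (vf_fiber F y0 \<times> vf_fiber F y1) (vf_hom F) g \<longleftrightarrow>
    (\<exists>x0 x1 t. x0 : VObj C \<and> x1 : VObj C \<and> vf_obj F x0 = y0 \<and> vf_obj F x1 = y1 \<and>
      t : hom A q (VHom C (x0, x1)) \<and> vf_hom F (x0, x1) ** t = g)" (is "?L \<longleftrightarrow> ?R")
proof
  assume ?L
  then obtain x0 x1 t where x: "x0 : VObj C" "x1 : VObj C" "vf_obj F x0 = y0" "vf_obj F x1 = y1"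
    and t: "arr t" "cod t = dom (vf_hom F (x0, x1))" "vf_hom F (x0, x1) ** t = g"
    unfolding family_factors_def factors_def by auto
  note h = homE[OF F_hom[OF x(1,2)]]
  have "dom t = dom (vf_hom F (x0, x1) ** t)" using t(1,2) h by simp
  then have "t : hom A q (VHom C (x0, x1))" using t h homE[OF assms] by (simp add: hom_def)
  then show ?R using x t(3) by blast
next
  assume ?R
  then obtain x0 x1 t where x: "x0 : VObj C" "x1 : VObj C" "vf_obj F x0 = y0" "vf_obj F x1 = y1"
    and t: "t : hom A q (VHom C (x0, x1))" "vf_hom F (x0, x1) ** t = g" by blast
  have "factors (vf_hom F (x0, x1)) g"
    by (rule factorsI[of t]) (use homE[OF F_hom[OF x(1,2)]] homE[OF t(1)] t(2) in simp_all)
  then show ?L unfolding family_factors_def using x by (intro bexI[of _ "(x0, x1)"]) simp_all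
qed

lemma chain3_hom:
  assumes "x0 : VObj C" "x1 : VObj C" "x2 : VObj C"
  shows "vf_chain3 A F (x0, x1, x2) : Arr A"
    "dom (vf_chain3 A F (x0, x1, x2)) = prod_obj A (VHom C (x1, x2)) (VHom C (x0, x1))"
    "cod (vf_chain3 A F (x0, x1, x2)) = chain3 A D (vf_obj F x0, vf_obj F x1, vf_obj F x2)"
  using homE[OF F_hom[OF assms(2,3)]] homE[OF F_hom[OF assms(1,2)]] by (simp_all add: vf_chain3_def chain3_def)

lemma chain4_hom:
  assumes "x0 : VObj C" "x1 : VObj C" "x2 : VObj C" "x3 : VObj C"
  shows "vf_chain4 A F (x0, x1, x2, x3) : Arr A"
    "dom (vf_chain4 A F (x0, x1, x2, x3)) =
      prod_obj A (prod_obj A (VHom C (x2, x3)) (VHom C (x1, x2))) (VHom C (x0, x1))"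
    "cod (vf_chain4 A F (x0, x1, x2, x3)) = chain4 A D (vf_obj F x0, vf_obj F x1, vf_obj F x2, vf_obj F x3)"
  using chain3_hom[OF assms(2-4)] homE[OF F_hom[OF assms(1,2)]] by (simp_all add: vf_chain4_def chain4_def)

lemma factors2_I:
  assumes x: "x0 : VObj C" "x1 : VObj C" "x2 : VObj C"
    and t: "t1 : hom A q (VHom C (x1, x2))" "t0 : hom A q (VHom C (x0, x1))"
  shows "family_factors (vf_fiber F (vf_obj F x0) \<times> vf_fiber F (vf_obj F x1) \<times> vf_fiber F (vf_obj F x2)) (vf_chain3 A F)
    (pairing A (vf_hom F (x1, x2) ** t1) (vf_hom F (x0, x1) ** t0))"
proof -
  have "factors (vf_chain3 A F (x0, x1, x2)) (pairing A (vf_hom F (x1, x2) ** t1) (vf_hom F (x0, x1) ** t0))"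
    by (rule factorsI[of "pairing A t1 t0"])
      (use chain3_hom[OF x] homE[OF F_hom[OF x(2,3)]] homE[OF F_hom[OF x(1,2)]] homE[OF t(1)] homE[OF t(2)] in
        \<open>simp_all add: vf_chain3_def\<close>)
  then show ?thesis unfolding family_factors_def using x by (intro bexI[of _ "(x0, x1, x2)"]) simp_all
qed

text \<open>Projecting a single lift of the pair gives lifts of both arrows with a common middle
  object \<open>x1\<close>; lifts found separately need not be composable.\<close>

lemma factors2_E:
  assumes g: "g1 : hom A q (VHom D (y1, y2))" "g0 : hom A q (VHom D (y0, y1))"
    and "family_factors (vf_fiber F y0 \<times> vf_fiber F y1 \<times> vf_fiber F y2) (vf_chain3 A F) (pairing A g1 g0)"
  obtains x0 x1 x2 t1 t0 where "x0 : VObj C" "x1 : VObj C" "x2 : VObj C"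
    "vf_obj F x0 = y0" "vf_obj F x1 = y1" "vf_obj F x2 = y2"
    "t1 : hom A q (VHom C (x1, x2))" "t0 : hom A q (VHom C (x0, x1))"
    "vf_hom F (x1, x2) ** t1 = g1" "vf_hom F (x0, x1) ** t0 = g0"
proof -
  obtain x0 x1 x2 t where x: "x0 : VObj C" "x1 : VObj C" "x2 : VObj C" "vf_obj F x0 = y0" "vf_obj F x1 = y1" "vf_obj F x2 = y2"
    and t: "arr t" "cod t = dom (vf_chain3 A F (x0, x1, x2))" "vf_chain3 A F (x0, x1, x2) ** t = pairing A g1 g0"
    using assms(3) unfolding family_factors_def factors_def by auto
  note h = homE[OF F_hom[OF x(2,3)]] homE[OF F_hom[OF x(1,2)]] and G = homE[OF g(1)] homE[OF g(2)]
  note c = chain3_hom[OF x(1-3)]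
  define t1 t0 where "t1 = pr1 A (VHom C (x1, x2)) (VHom C (x0, x1)) ** t" and "t0 = pr2 A (VHom C (x1, x2)) (VHom C (x0, x1)) ** t"
  have "dom t = dom (vf_chain3 A F (x0, x1, x2) ** t)" using t(1,2) c by simp
  also have "\<dots> = q" unfolding t(3) using G by simp
  finally have T: "t1 : hom A q (VHom C (x1, x2))" "t0 : hom A q (VHom C (x0, x1))"
    using t(1,2) c h by (simp_all add: t1_def t0_def hom_def)
  have "t = pairing A t1 t0" unfolding t1_def t0_def using t(1,2) c h by simp
  then have "pairing A (vf_hom F (x1, x2) ** t1) (vf_hom F (x0, x1) ** t0) = pairing A g1 g0"
    using t(3) h homE[OF T(1)] homE[OF T(2)] by (simp add: vf_chain3_def)
  then have "pr1 A (VHom D (y1, y2)) (VHom D (y0, y1)) ** pairing A (vf_hom F (x1, x2) ** t1) (vf_hom F (x0, x1) ** t0) =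
      pr1 A (VHom D (y1, y2)) (VHom D (y0, y1)) ** pairing A g1 g0"
    "pr2 A (VHom D (y1, y2)) (VHom D (y0, y1)) ** pairing A (vf_hom F (x1, x2) ** t1) (vf_hom F (x0, x1) ** t0) =
      pr2 A (VHom D (y1, y2)) (VHom D (y0, y1)) ** pairing A g1 g0" by simp_all
  then have "vf_hom F (x1, x2) ** t1 = g1" "vf_hom F (x0, x1) ** t0 = g0"
    using h G homE[OF T(1)] homE[OF T(2)] x(4-6) by simp_all
  then show thesis using that x T by blast
qed

lemma factors3_E:
  assumes g: "g2 : hom A q (VHom D (y2, y3))" "g1 : hom A q (VHom D (y1, y2))" "g0 : hom A q (VHom D (y0, y1))"
    and "family_factors (vf_fiber F y0 \<times> vf_fiber F y1 \<times> vf_fiber F y2 \<times> vf_fiber F y3) (vf_chain4 A F)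
      (pairing A (pairing A g2 g1) g0)"
  obtains x0 x1 x2 x3 t2 t1 t0 where "x0 : VObj C" "x1 : VObj C" "x2 : VObj C" "x3 : VObj C"
    "vf_obj F x0 = y0" "vf_obj F x1 = y1" "vf_obj F x2 = y2" "vf_obj F x3 = y3"
    "t2 : hom A q (VHom C (x2, x3))" "t1 : hom A q (VHom C (x1, x2))" "t0 : hom A q (VHom C (x0, x1))"
    "vf_hom F (x2, x3) ** t2 = g2" "vf_hom F (x1, x2) ** t1 = g1" "vf_hom F (x0, x1) ** t0 = g0"
proof -
  obtain x0 x1 x2 x3 t where x: "x0 : VObj C" "x1 : VObj C" "x2 : VObj C" "x3 : VObj C"
      "vf_obj F x0 = y0" "vf_obj F x1 = y1" "vf_obj F x2 = y2" "vf_obj F x3 = y3"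
    and t: "arr t" "cod t = dom (vf_chain4 A F (x0, x1, x2, x3))"
      "vf_chain4 A F (x0, x1, x2, x3) ** t = pairing A (pairing A g2 g1) g0"
    using assms(4) unfolding family_factors_def factors_def by auto
  note h = homE[OF F_hom[OF x(1,2)]] and G = homE[OF g(1)] homE[OF g(2)] homE[OF g(3)]
  note c3 = chain3_hom[OF x(2-4)] and c4 = chain4_hom[OF x(1-4)]
  define T where "T = prod_obj A (VHom C (x2, x3)) (VHom C (x1, x2))"
  have To: "T : Obj A" using vcat_hom_obj[OF C_vcat(1)] x by (simp add: T_def)
  define t' t0 where "t' = pr1 A T (VHom C (x0, x1)) ** t" and "t0 = pr2 A T (VHom C (x0, x1)) ** t"
  have "dom t = dom (vf_chain4 A F (x0, x1, x2, x3) ** t)" using t(1,2) c4 by simp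
  also have "\<dots> = q" unfolding t(3) using G by simp
  finally have T': "t' : hom A q T" and T0: "t0 : hom A q (VHom C (x0, x1))"
    using t(1,2) c4 h To by (simp_all add: t'_def t0_def hom_def T_def)
  define G2 where "G2 = prod_obj A (VHom D (y2, y3)) (VHom D (y1, y2))"
  have "t = pairing A t' t0" unfolding t'_def t0_def using t(1,2) c4 h To by (simp add: T_def)
  then have e: "pairing A (vf_chain3 A F (x1, x2, x3) ** t') (vf_hom F (x0, x1) ** t0) = pairing A (pairing A g2 g1) g0"
    using t(3) h c3 homE[OF T'] homE[OF T0] by (simp add: vf_chain4_def T_def)
  have "pr1 A G2 (VHom D (y0, y1)) ** pairing A (vf_chain3 A F (x1, x2, x3) ** t') (vf_hom F (x0, x1) ** t0) = vf_chain3 A F (x1, x2, x3) ** t'"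
    "pr2 A G2 (VHom D (y0, y1)) ** pairing A (vf_chain3 A F (x1, x2, x3) ** t') (vf_hom F (x0, x1) ** t0) = vf_hom F (x0, x1) ** t0"
    using h c3 homE[OF T'] homE[OF T0] x by (simp_all add: G2_def T_def chain3_def)
  moreover have "pr1 A G2 (VHom D (y0, y1)) ** pairing A (pairing A g2 g1) g0 = pairing A g2 g1"
    "pr2 A G2 (VHom D (y0, y1)) ** pairing A (pairing A g2 g1) g0 = g0"
    using G by (simp_all add: G2_def)
  ultimately have e3: "vf_chain3 A F (x1, x2, x3) ** t' = pairing A g2 g1" and e0: "vf_hom F (x0, x1) ** t0 = g0"
    unfolding e by simp_all
  define t2 t1 where "t2 = pr1 A (VHom C (x2, x3)) (VHom C (x1, x2)) ** t'" and "t1 = pr2 A (VHom C (x2, x3)) (VHom C (x1, x2)) ** t'"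
  note ho = vcat_hom_obj[OF C_vcat(1) x(3,4)] vcat_hom_obj[OF C_vcat(1) x(2,3)]
  note h' = homE[OF F_hom[OF x(3,4)]] homE[OF F_hom[OF x(2,3)]]
  have T21: "t2 : hom A q (VHom C (x2, x3))" "t1 : hom A q (VHom C (x1, x2))"
    using homE[OF T'] ho by (simp_all add: t2_def t1_def hom_def T_def)
  have "t' = pairing A t2 t1" unfolding t2_def t1_def using homE[OF T'] ho by (simp add: T_def)
  then have e2: "pairing A (vf_hom F (x2, x3) ** t2) (vf_hom F (x1, x2) ** t1) = pairing A g2 g1"
    using e3 h' homE[OF T21(1)] homE[OF T21(2)] by (simp add: vf_chain3_def)
  have "pr1 A (VHom D (y2, y3)) (VHom D (y1, y2)) ** pairing A (vf_hom F (x2, x3) ** t2) (vf_hom F (x1, x2) ** t1) = vf_hom F (x2, x3) ** t2"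
    "pr2 A (VHom D (y2, y3)) (VHom D (y1, y2)) ** pairing A (vf_hom F (x2, x3) ** t2) (vf_hom F (x1, x2) ** t1) = vf_hom F (x1, x2) ** t1"
    using h' homE[OF T21(1)] homE[OF T21(2)] x by simp_all
  moreover have "pr1 A (VHom D (y2, y3)) (VHom D (y1, y2)) ** pairing A g2 g1 = g2" "pr2 A (VHom D (y2, y3)) (VHom D (y1, y2)) ** pairing A g2 g1 = g1"
    using G by simp_all
  ultimately have "vf_hom F (x2, x3) ** t2 = g2" "vf_hom F (x1, x2) ** t1 = g1" unfolding e2 by simp_all
  then show thesis using that x T21 T0 e0 by blast
qed

text \<open>With its analogues for pairs and triples, the form in which separation is applied:
  equality may be tested after those restrictions \<open>r\<close> along which the given elements of
  \<open>D\<close> lift to \<open>C\<close>.\<close>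

lemma local1:
  assumes y: "y0 : VObj D" "y1 : VObj D" and g: "g : hom A z (VHom D (y0, y1))"
    and k: "k : hom A z x" "k' : hom A z x"
    and e: "\<And>q r x0 x1 t. r : hom A q z ==> x0 : VObj C ==> x1 : VObj C ==> vf_obj F x0 = y0 ==> vf_obj F x1 = y1 ==>
      t : hom A q (VHom C (x0, x1)) ==> vf_hom F (x0, x1) ** t = g ** r ==> k ** r = k' ** r"
  shows "k = k'"
proof (rule separatingD[OF covers_separating[OF cov1[OF y]], of g])
  fix r assume r: "arr r" "cod r = dom g" "family_factors (vf_fiber F y0 \<times> vf_fiber F y1) (vf_hom F) (g ** r)"
  have r': "r : hom A (dom r) z" using r homE[OF g] by (simp add: hom_def)
  have gr: "g ** r : hom A (dom r) (VHom D (y0, y1))" by (rule comp_hom[OF r' g])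
  show "k ** r = k' ** r" using r(3) unfolding factors1_iff[OF gr] using e[OF r'] by blast
qed (use homE[OF g] homE[OF k(1)] homE[OF k(2)] in simp_all)

lemma local2:
  assumes y: "y0 : VObj D" "y1 : VObj D" "y2 : VObj D"
    and g: "g1 : hom A z (VHom D (y1, y2))" "g0 : hom A z (VHom D (y0, y1))"
    and k: "k : hom A z x" "k' : hom A z x"
    and e: "\<And>q r x0 x1 x2 t1 t0. r : hom A q z ==> x0 : VObj C ==> x1 : VObj C ==> x2 : VObj C ==>
      vf_obj F x0 = y0 ==> vf_obj F x1 = y1 ==> vf_obj F x2 = y2 ==>
      t1 : hom A q (VHom C (x1, x2)) ==> t0 : hom A q (VHom C (x0, x1)) ==>
      vf_hom F (x1, x2) ** t1 = g1 ** r ==> vf_hom F (x0, x1) ** t0 = g0 ** r ==> k ** r = k' ** r"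
  shows "k = k'"
proof -
  note G = homE[OF g(1)] homE[OF g(2)]
  show ?thesis
  proof (rule separatingD[OF covers_separating[OF cov2[OF y]], of "pairing A g1 g0"])
    fix r assume r: "arr r" "cod r = dom (pairing A g1 g0)"
      "family_factors (vf_fiber F y0 \<times> vf_fiber F y1 \<times> vf_fiber F y2) (vf_chain3 A F) (pairing A g1 g0 ** r)"
    have r': "r : hom A (dom r) z" using r G by (simp add: hom_def)
    have p: "pairing A g1 g0 ** r = pairing A (g1 ** r) (g0 ** r)" using G homE[OF r'] by simp
    show "k ** r = k' ** r"
      by (rule factors2_E[OF comp_hom[OF r' g(1)] comp_hom[OF r' g(2)] r(3)[unfolded p]]) (rule e[OF r'])
  qed (use G homE[OF k(1)] homE[OF k(2)] in \<open>simp_all add: chain3_def\<close>)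
qed

lemma local3:
  assumes y: "y0 : VObj D" "y1 : VObj D" "y2 : VObj D" "y3 : VObj D"
    and g: "g2 : hom A z (VHom D (y2, y3))" "g1 : hom A z (VHom D (y1, y2))" "g0 : hom A z (VHom D (y0, y1))"
    and k: "k : hom A z x" "k' : hom A z x"
    and e: "\<And>q r x0 x1 x2 x3 t2 t1 t0. r : hom A q z ==> x0 : VObj C ==> x1 : VObj C ==> x2 : VObj C ==> x3 : VObj C ==>
      vf_obj F x0 = y0 ==> vf_obj F x1 = y1 ==> vf_obj F x2 = y2 ==> vf_obj F x3 = y3 ==>
      t2 : hom A q (VHom C (x2, x3)) ==> t1 : hom A q (VHom C (x1, x2)) ==> t0 : hom A q (VHom C (x0, x1)) ==>
      vf_hom F (x2, x3) ** t2 = g2 ** r ==> vf_hom F (x1, x2) ** t1 = g1 ** r ==> vf_hom F (x0, x1) ** t0 = g0 ** r ==>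
      k ** r = k' ** r"
  shows "k = k'"
proof -
  note G = homE[OF g(1)] homE[OF g(2)] homE[OF g(3)]
  show ?thesis
  proof (rule separatingD[OF sep3[OF y], of "pairing A (pairing A g2 g1) g0"])
    fix r assume r: "arr r" "cod r = dom (pairing A (pairing A g2 g1) g0)"
      "family_factors (vf_fiber F y0 \<times> vf_fiber F y1 \<times> vf_fiber F y2 \<times> vf_fiber F y3) (vf_chain4 A F)
        (pairing A (pairing A g2 g1) g0 ** r)"
    have r': "r : hom A (dom r) z" using r G by (simp add: hom_def)
    have p: "pairing A (pairing A g2 g1) g0 ** r = pairing A (pairing A (g2 ** r) (g1 ** r)) (g0 ** r)" using G homE[OF r'] by simp
    show "k ** r = k' ** r"
      by (rule factors3_E[OF comp_hom[OF r' g(1)] comp_hom[OF r' g(2)] comp_hom[OF r' g(3)] r(3)[unfolded p]])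
        (rule e[OF r'])
  qed (use G homE[OF k(1)] homE[OF k(2)] in \<open>simp_all add: chain3_def chain4_def\<close>)
qed

text \<open>The values \<open>u r\<close> depend on the restriction only; the lift \<open>t\<close>
  merely witnesses that \<open>r\<close> belongs to the covering sieve.\<close>

lemma glue1:
  assumes y: "y0 : VObj D" "y1 : VObj D" and g: "g : hom A z (VHom D (y0, y1))" and x: "x : Obj A"
    and u: "\<And>q r x0 x1 t. r : hom A q z ==> x0 : VObj C ==> x1 : VObj C ==> vf_obj F x0 = y0 ==> vf_obj F x1 = y1 ==>
      t : hom A q (VHom C (x0, x1)) ==> vf_hom F (x0, x1) ** t = g ** r ==>
      u r : hom A q x \<and> (\<forall>q' r'. r' : hom A q' q --> u (r ** r') = u r ** r')"
  obtains k where "k : hom A z x"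
    "\<And>q r x0 x1 t. r : hom A q z ==> x0 : VObj C ==> x1 : VObj C ==> vf_obj F x0 = y0 ==> vf_obj F x1 = y1 ==>
      t : hom A q (VHom C (x0, x1)) ==> vf_hom F (x0, x1) ** t = g ** r ==> k ** r = u r"
proof -
  note G = homE[OF g]
  have fac: "family_factors (vf_fiber F y0 \<times> vf_fiber F y1) (vf_hom F) (g ** r) \<longleftrightarrow>
    (\<exists>x0 x1 t. x0 : VObj C \<and> x1 : VObj C \<and> vf_obj F x0 = y0 \<and> vf_obj F x1 = y1 \<and>
      t : hom A q (VHom C (x0, x1)) \<and> vf_hom F (x0, x1) ** t = g ** r)" if "r : hom A q z" for r q
    by (rule factors1_iff[OF comp_hom[OF that g]])
  have m: "matching g (family_factors (vf_fiber F y0 \<times> vf_fiber F y1) (vf_hom F)) x u"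
    unfolding matching_def
  proof (intro allI impI)
    fix r assume r: "arr r" "cod r = dom g" "family_factors (vf_fiber F y0 \<times> vf_fiber F y1) (vf_hom F) (g ** r)"
    have r': "r : hom A (dom r) z" using r G by (simp add: hom_def)
    have "u r : hom A (dom r) x \<and> (\<forall>q' r'. r' : hom A q' (dom r) --> u (r ** r') = u r ** r')"
      using r(3) unfolding fac[OF r'] using u[OF r'] by blast
    then show "u r : hom A (dom r) x \<and> (\<forall>ra. arr ra --> cod ra = dom r --> u (r ** ra) = u r ** ra)"
      by (simp add: hom_def)
  qed
  have "arr g" "cod g = VHom D (y0, y1)" using G by simp_all
  from coversE[OF cov1[OF y] this x m] obtain k where k: "arr k" "dom k = dom g" "cod k = x"
    "\<And>r. arr r ==> cod r = dom g ==> family_factors (vf_fiber F y0 \<times> vf_fiber F y1) (vf_hom F) (g ** r) ==> k ** r = u r"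
    by metis
  show thesis
  proof (rule that)
    show "k : hom A z x" using k(1-3) G by (simp add: hom_def)
    fix q r x0 x1 t assume r: "r : hom A q z" and t: "x0 : VObj C" "x1 : VObj C" "vf_obj F x0 = y0" "vf_obj F x1 = y1"
      "t : hom A q (VHom C (x0, x1))" "vf_hom F (x0, x1) ** t = g ** r"
    show "k ** r = u r"
      by (rule k(4)) (use homE[OF r] G fac[OF r] t in auto)
  qed
qed

lemma glue2:
  assumes y: "y0 : VObj D" "y1 : VObj D" "y2 : VObj D"
    and g: "g1 : hom A z (VHom D (y1, y2))" "g0 : hom A z (VHom D (y0, y1))" and x: "x : Obj A"
    and u: "\<And>q r x0 x1 x2 t1 t0. r : hom A q z ==> x0 : VObj C ==> x1 : VObj C ==> x2 : VObj C ==>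
      vf_obj F x0 = y0 ==> vf_obj F x1 = y1 ==> vf_obj F x2 = y2 ==>
      t1 : hom A q (VHom C (x1, x2)) ==> t0 : hom A q (VHom C (x0, x1)) ==>
      vf_hom F (x1, x2) ** t1 = g1 ** r ==> vf_hom F (x0, x1) ** t0 = g0 ** r ==>
      u r : hom A q x \<and> (\<forall>q' r'. r' : hom A q' q --> u (r ** r') = u r ** r')"
  obtains k where "k : hom A z x"
    "\<And>q r x0 x1 x2 t1 t0. r : hom A q z ==> x0 : VObj C ==> x1 : VObj C ==> x2 : VObj C ==>
      vf_obj F x0 = y0 ==> vf_obj F x1 = y1 ==> vf_obj F x2 = y2 ==>
      t1 : hom A q (VHom C (x1, x2)) ==> t0 : hom A q (VHom C (x0, x1)) ==>
      vf_hom F (x1, x2) ** t1 = g1 ** r ==> vf_hom F (x0, x1) ** t0 = g0 ** r ==> k ** r = u r"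
proof -
  note G = homE[OF g(1)] homE[OF g(2)]
  have p: "pairing A g1 g0 ** r = pairing A (g1 ** r) (g0 ** r)" if "r : hom A q z" for r q
    using G homE[OF that] by simp
  have m: "matching (pairing A g1 g0) (family_factors (vf_fiber F y0 \<times> vf_fiber F y1 \<times> vf_fiber F y2) (vf_chain3 A F)) x u"
    unfolding matching_def
  proof (intro allI impI)
    fix r assume r: "arr r" "cod r = dom (pairing A g1 g0)"
      "family_factors (vf_fiber F y0 \<times> vf_fiber F y1 \<times> vf_fiber F y2) (vf_chain3 A F) (pairing A g1 g0 ** r)"
    have r': "r : hom A (dom r) z" using r G by (simp add: hom_def)
    have "u r : hom A (dom r) x \<and> (\<forall>q' r'. r' : hom A q' (dom r) --> u (r ** r') = u r ** r')"
      by (rule factors2_E[OF comp_hom[OF r' g(1)] comp_hom[OF r' g(2)] r(3)[unfolded p[OF r']]]) (rule u[OF r'])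
    then show "u r : hom A (dom r) x \<and> (\<forall>ra. arr ra --> cod ra = dom r --> u (r ** ra) = u r ** ra)"
      by (simp add: hom_def)
  qed
  have "pairing A g1 g0 : Arr A" "cod (pairing A g1 g0) = chain3 A D (y0, y1, y2)" using G by (simp_all add: chain3_def)
  from coversE[OF cov2[OF y] this x m] obtain k where k: "arr k" "dom k = dom (pairing A g1 g0)" "cod k = x"
    "\<And>r. arr r ==> cod r = dom (pairing A g1 g0) ==>
      family_factors (vf_fiber F y0 \<times> vf_fiber F y1 \<times> vf_fiber F y2) (vf_chain3 A F) (pairing A g1 g0 ** r) ==> k ** r = u r"
    by metis
  show thesis
  proof (rule that)
    show "k : hom A z x" using k(1-3) G by (simp add: hom_def)
    fix q r x0 x1 x2 t1 t0 assume r: "r : hom A q z" and o: "x0 : VObj C" "x1 : VObj C" "x2 : VObj C"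
      "vf_obj F x0 = y0" "vf_obj F x1 = y1" "vf_obj F x2 = y2"
      and t: "t1 : hom A q (VHom C (x1, x2))" "t0 : hom A q (VHom C (x0, x1))"
      and e: "vf_hom F (x1, x2) ** t1 = g1 ** r" "vf_hom F (x0, x1) ** t0 = g0 ** r"
    show "k ** r = u r"
      by (rule k(4)) (use homE[OF r] G p[OF r] factors2_I[OF o(1-3) t] o(4-6) e in simp_all)
  qed
qed

text \<open>The two functors agree on the pullback of \<open>F\<close> along \<open>G\<close>, by
  the hypothesis at the universal span. Every object of the domain of \<open>G\<close> comes from
  this pullback by \<open>surj\<close>, and every element of a hom-object does so locally.\<close>

lemma F_separates: "VC.separates F"
  unfolding VC.separates_def
proof (intro allI impI)
  fix G G' K K'
  assume G: "G : Arr vc" "G' : Arr vc" "Cod vc G = Cod vc F" "Cod vc G' = Cod vc F"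
    and K: "K : hom vc (Dom vc G) (Dom vc G')" "K' : hom vc (Dom vc G) (Dom vc G')"
    and agree: "\<forall>t q. VC.span F G t q --> Comp vc K q = Comp vc K' q"
  define Z where "Z = vf_dom G"
  have Gd: "vf_cod F = vf_cod G" "vf_cod G = D" using G by simp_all
  obtain P R where sp: "strict_pullback F G P R" by (rule strict_pullback_exists[OF F G(1) Gd(1)])
  note S = strict_pullbackD[OF sp]
  have K: "K : Arr vc" "vf_dom K = Z" "vf_cod K = vf_dom G'" and K': "K' : Arr vc" "vf_dom K' = Z" "vf_cod K' = vf_dom G'"
    using K by (simp_all add: hom_def Z_def)
  have "VC.span F G P R" using S by (simp add: VC.span_def)
  then have KR: "Comp vc K R = Comp vc K' R" using agree by blast
  have RZ: "vf_cod R = Z" using S by (simp add: Z_def)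
  have Go: "vf_obj G z : VObj D" if "z : VObj Z" for z using vf_arr_obj[OF G(1)] that Gd by (simp add: Z_def)
  have Ko: "vf_obj K z = vf_obj K' z" if z: "z : VObj Z" for z
  proof -
    obtain c where c: "c : VObj C" "vf_obj F c = vf_obj G z" using surj[OF Go[OF z]] by blast
    then obtain e where e: "e : VObj (vf_dom P)" "vf_obj R e = z" using S(10)[of c z] z by (auto simp: Z_def)
    show ?thesis using vf_square_obj[OF KR refl, of e] e S(6) by simp
  qed
  show "K = K'"
  proof (rule vf_eqI[OF K(1) K'(1)])
    fix z0 z1 assume "z0 : VObj (vf_dom K')" "z1 : VObj (vf_dom K')"
    then have z: "z0 : VObj Z" "z1 : VObj Z" using K' by simp_all
    have gh: "vf_hom G (z0, z1) : hom A (VHom Z (z0, z1)) (VHom D (vf_obj G z0, vf_obj G z1))"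
      using vf_arr_hom[OF G(1)] z Gd by (simp add: Z_def)
    show "vf_hom K (z0, z1) = vf_hom K' (z0, z1)"
    proof (rule local1[OF Go[OF z(1)] Go[OF z(2)] gh])
      show "vf_hom K (z0, z1) : hom A (VHom Z (z0, z1)) (VHom (vf_dom G') (vf_obj K z0, vf_obj K z1))"
        "vf_hom K' (z0, z1) : hom A (VHom Z (z0, z1)) (VHom (vf_dom G') (vf_obj K z0, vf_obj K z1))"
        using vf_arr_hom[OF K(1)] vf_arr_hom[OF K'(1)] K K' z Ko by simp_all
      fix q r x0 x1 t assume r: "r : hom A q (VHom Z (z0, z1))" and x: "x0 : VObj C" "x1 : VObj C" "vf_obj F x0 = vf_obj G z0"
        "vf_obj F x1 = vf_obj G z1" and t: "t : hom A q (VHom C (x0, x1))" "vf_hom F (x0, x1) ** t = vf_hom G (z0, z1) ** r"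
      obtain e0 where e0: "e0 : VObj (vf_dom P)" "vf_obj P e0 = x0" "vf_obj R e0 = z0" using S(10)[of x0 z0] x z by (auto simp: Z_def)
      obtain e1 where e1: "e1 : VObj (vf_dom P)" "vf_obj P e1 = x1" "vf_obj R e1 = z1" using S(10)[of x1 z1] x z by (auto simp: Z_def)
      obtain h where h: "h : hom A q (VHom (vf_dom P) (e0, e1))" "vf_hom R (e0, e1) ** h = r"
        by (rule strict_lift[OF sp e0(1) e1(1), of t q r]) (use e0 e1 r t in \<open>simp_all add: Z_def\<close>)
      have "vf_hom K (vf_obj R e0, vf_obj R e1) ** vf_hom R (e0, e1) ** h = vf_hom K' (vf_obj R e0, vf_obj R e1) ** vf_hom R (e0, e1) ** h"
        by (rule vf_square_el[OF KR K(1) K'(1) S(4,4)]) (use K K' RZ e0 e1 h S(6) in simp_all)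
      then show "vf_hom K (z0, z1) ** r = vf_hom K' (z0, z1) ** r" using h e0 e1 by simp
    qed
  qed (use K K' Ko in simp_all)
qed

text \<open>The value \<open>U\<close> of the data at the universal span is an enriched functor on
  the pullback \<open>E\<close>, to be factored through the projection \<open>R\<close>. As
  \<open>U\<close> identifies what \<open>R\<close> identifies, and \<open>R\<close> is surjective
  on objects and locally on elements, the factorization is defined by choice on objects and by
  gluing on hom-objects.\<close>

lemma F_glues: "VC.glues F"
  unfolding VC.glues_def
proof (intro allI impI)
  fix G G' u
  assume G: "G : Arr vc" "G' : Arr vc" "Cod vc G = Cod vc F" "Cod vc G' = Cod vc F"
    and u: "VC.lifts F G G' u"
  define Z Z' where "Z = vf_dom G" and "Z' = vf_dom G'"
  have Gd: "vf_cod F = vf_cod G" "vf_cod G = D" "vf_cod G' = D" using G by simp_all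
  have Zv: "Z : Obj vc" "Z' : Obj vc" "is_vcat A Z" "is_vcat A Z'"
    using vf_arrD[OF G(1)] vf_arrD[OF G(2)] by (simp_all add: Z_def Z'_def)
  obtain P R where sp: "strict_pullback F G P R" by (rule strict_pullback_exists[OF F G(1) Gd(1)])
  note S = strict_pullbackD[OF sp]
  define E where "E = vf_dom P"
  have PR: "vf_dom P = E" "vf_dom R = E" "vf_cod P = C" "vf_cod R = Z" using S by (simp_all add: E_def Z_def)
  have Ev: "is_vcat A E" using vf_arrD[OF S(3)] by (simp add: E_def)
  have spanPR: "VC.span F G P R" using S by (simp add: VC.span_def)
  define U where "U = u R"
  have U: "U : Arr vc" "vf_dom U = E" "vf_cod U = Z'" "Comp vc G' U = Comp vc G R"
    using u spanPR PR unfolding VC.lifts_def hom_def U_def by (simp_all add: Z'_def)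
  have Un: "u (Comp vc R s) = Comp vc U s" if "s : Arr vc" "vf_cod s = E" for s
    using u spanPR that PR unfolding VC.lifts_def U_def by simp
  \<comment> \<open>The kernel pair of \<open>R\<close>. Naturality of the data gives
    \<open>U\<close> after \<open>S1\<close> and \<open>U\<close> after \<open>S2\<close> as values
    at the same arrow, so \<open>U\<close> is constant on the fibres of \<open>R\<close>, on objects
    and on elements.\<close>
  obtain S1 S2 where sk: "strict_pullback R R S1 S2" by (rule strict_pullback_exists[OF S(4,4) refl])
  note K = strict_pullbackD[OF sk]
  have "u (Comp vc R S1) = Comp vc U S1" "u (Comp vc R S2) = Comp vc U S2"
    by (rule Un; use K(3,4,7,8) PR in simp)+
  then have US: "Comp vc U S1 = Comp vc U S2" unfolding K(9) by simp
  have Kd: "vf_dom S1 = vf_dom S2" "vf_cod S1 = E" "vf_cod S2 = E" using K PR by simp_all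
  have Uo: "vf_obj U e = vf_obj U e'" if e: "e : VObj E" "e' : VObj E" "vf_obj R e = vf_obj R e'" for e e'
  proof -
    obtain n where "n : VObj (vf_dom S1)" "vf_obj S1 n = e" "vf_obj S2 n = e'" using K(10)[of e e'] e PR by auto
    then show ?thesis using vf_square_obj[OF US Kd(1), of n] by simp
  qed
  have Uh: "vf_hom U (e0, e1) ** h = vf_hom U (e0', e1') ** h'"
    if e: "e0 : VObj E" "e1 : VObj E" "e0' : VObj E" "e1' : VObj E" "vf_obj R e0 = vf_obj R e0'" "vf_obj R e1 = vf_obj R e1'"
      and h: "h : hom A q (VHom E (e0, e1))" "h' : hom A q (VHom E (e0', e1'))" "vf_hom R (e0, e1) ** h = vf_hom R (e0', e1') ** h'"
    for e0 e1 e0' e1' h h' q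
  proof -
    obtain n0 where n0: "n0 : VObj (vf_dom S1)" "vf_obj S1 n0 = e0" "vf_obj S2 n0 = e0'" using K(10)[of e0 e0'] e PR by auto
    obtain n1 where n1: "n1 : VObj (vf_dom S1)" "vf_obj S1 n1 = e1" "vf_obj S2 n1 = e1'" using K(10)[of e1 e1'] e PR by auto
    obtain k where k: "k : hom A q (VHom (vf_dom S1) (n0, n1))" "vf_hom S1 (n0, n1) ** k = h" "vf_hom S2 (n0, n1) ** k = h'"
      by (rule strict_lift[OF sk n0(1) n1(1), of h q h']) (use n0 n1 h PR in simp_all)
    have "vf_hom U (vf_obj S1 n0, vf_obj S1 n1) ** vf_hom S1 (n0, n1) ** k = vf_hom U (vf_obj S2 n0, vf_obj S2 n1) ** vf_hom S2 (n0, n1) ** k"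
      by (rule vf_square_el[OF US U(1,1) K(3,4)]) (use U Kd n0 n1 k in simp_all)
    then show ?thesis using n0 n1 k by simp
  qed
  have Go: "vf_obj G z : VObj D" if "z : VObj Z" for z using vf_arr_obj[OF G(1)] that Gd by (simp add: Z_def)
  have ob: "\<exists>e. e : VObj E \<and> vf_obj P e = c \<and> vf_obj R e = z" if "c : VObj C" "z : VObj Z" "vf_obj F c = vf_obj G z" for c z
    using S(10)[of c z] that PR by (auto simp: Z_def)
  have "\<exists>e. e : VObj E \<and> vf_obj R e = z" if z: "z : VObj Z" for z using surj[OF Go[OF z]] ob z by blast
  \<comment> \<open>A section of \<open>R\<close> on objects; by \<open>Uo\<close> the value of
    \<open>U\<close> does not depend on it.\<close>
  then obtain \<epsilon> where \<epsilon>: "\<And>z. z : VObj Z ==> \<epsilon> z : VObj E \<and> vf_obj R (\<epsilon> z) = z" by metis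
  define f where "f z = vf_obj U (\<epsilon> z)" for z
  have fU: "f (vf_obj R e) = vf_obj U e" if "e : VObj E" for e
    unfolding f_def using \<epsilon>[of "vf_obj R e"] vf_arr_obj[OF S(4), of e] that PR by (intro Uo) simp_all
  have RE: "vf_obj R e : VObj Z" if "e : VObj E" for e using vf_arr_obj[OF S(4), of e] that PR by simp
  have UE: "vf_obj U e : VObj Z'" if "e : VObj E" for e using vf_arr_obj[OF U(1), of e] that U by simp
  have fZ: "f z : VObj Z'" if "z : VObj Z" for z using UE \<epsilon>[OF that] by (simp add: f_def)
  have Uhom: "vf_hom U (e0, e1) ** h : hom A q (VHom Z' (vf_obj U e0, vf_obj U e1))"
    if "e0 : VObj E" "e1 : VObj E" "h : hom A q (VHom E (e0, e1))" for e0 e1 h q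
    using vf_arr_el[OF U(1), of e0 e1 h q] that U by simp
  have Rhom: "vf_hom R (e0, e1) ** h : hom A q (VHom Z (vf_obj R e0, vf_obj R e1))"
    if "e0 : VObj E" "e1 : VObj E" "h : hom A q (VHom E (e0, e1))" for e0 e1 h q
    using vf_arr_el[OF S(4), of e0 e1 h q] that PR by simp
  have Ghom: "vf_hom G (z0, z1) : hom A (VHom Z (z0, z1)) (VHom D (vf_obj G z0, vf_obj G z1))" if "z0 : VObj Z" "z1 : VObj Z" for z0 z1
    using vf_arr_hom[OF G(1)] that Gd by (simp add: Z_def)
  have lift: "\<exists>e0 e1 h. e0 : VObj E \<and> e1 : VObj E \<and> vf_obj P e0 = x0 \<and> vf_obj P e1 = x1 \<and> vf_obj R e0 = z0 \<and> vf_obj R e1 = z1 \<and>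
      h : hom A q (VHom E (e0, e1)) \<and> vf_hom R (e0, e1) ** h = r"
    if z: "z0 : VObj Z" "z1 : VObj Z" and r: "r : hom A q (VHom Z (z0, z1))" and x: "x0 : VObj C" "x1 : VObj C" "vf_obj F x0 = vf_obj G z0"
        "vf_obj F x1 = vf_obj G z1" and t: "t : hom A q (VHom C (x0, x1))" "vf_hom F (x0, x1) ** t = vf_hom G (z0, z1) ** r" for z0 z1 r q x0 x1 t
  proof -
    obtain e0 where e0: "e0 : VObj E" "vf_obj P e0 = x0" "vf_obj R e0 = z0" using ob[of x0 z0] x z by blast
    obtain e1 where e1: "e1 : VObj E" "vf_obj P e1 = x1" "vf_obj R e1 = z1" using ob[of x1 z1] x z by blast
    obtain h where "h : hom A q (VHom E (e0, e1))" "vf_hom R (e0, e1) ** h = r"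
      by (rule strict_lift[OF sp, unfolded PR, OF e0(1) e1(1), of t q r]) (use e0 e1 r t in \<open>simp_all add: Z_def\<close>)
    then show ?thesis using e0 e1 by blast
  qed
  define kp where "kp z0 z1 k \<longleftrightarrow> k : hom A (VHom Z (z0, z1)) (VHom Z' (f z0, f z1)) \<and>
      (\<forall>e0 e1 h q. e0 : VObj E --> e1 : VObj E --> vf_obj R e0 = z0 --> vf_obj R e1 = z1 --> h : hom A q (VHom E (e0, e1)) -->
        k ** vf_hom R (e0, e1) ** h = vf_hom U (e0, e1) ** h)" for z0 z1 k
  have "\<exists>k. kp z0 z1 k" if z: "z0 : VObj Z" "z1 : VObj Z" for z0 z1
  proof -
    \<comment> \<open>The value of \<open>U\<close> at any preimage of \<open>r\<close> under
      \<open>R\<close>; it is well defined by \<open>Uh\<close>.\<close>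
    define w where "w r = (SOME v. \<exists>e0 e1 h q. e0 : VObj E \<and> e1 : VObj E \<and> vf_obj R e0 = z0 \<and> vf_obj R e1 = z1 \<and>
      h : hom A q (VHom E (e0, e1)) \<and> vf_hom R (e0, e1) ** h = r \<and> v = vf_hom U (e0, e1) ** h)" for r
    have w: "w (vf_hom R (e0, e1) ** h) = vf_hom U (e0, e1) ** h"
      if e: "e0 : VObj E" "e1 : VObj E" "vf_obj R e0 = z0" "vf_obj R e1 = z1" and h: "h : hom A q (VHom E (e0, e1))" for e0 e1 h q
      unfolding w_def
    proof (rule some_equality)
      fix v assume "\<exists>e0' e1' h' q'. e0' : VObj E \<and> e1' : VObj E \<and> vf_obj R e0' = z0 \<and> vf_obj R e1' = z1 \<and>
        h' : hom A q' (VHom E (e0', e1')) \<and> vf_hom R (e0', e1') ** h' = vf_hom R (e0, e1) ** h \<and> v = vf_hom U (e0', e1') ** h'"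
      then obtain e0' e1' h' q' where e': "e0' : VObj E" "e1' : VObj E" "vf_obj R e0' = z0" "vf_obj R e1' = z1"
        and h': "h' : hom A q' (VHom E (e0', e1'))" "vf_hom R (e0', e1') ** h' = vf_hom R (e0, e1) ** h" and v: "v = vf_hom U (e0', e1') ** h'" by blast
      \<comment> \<open>The stage of a preimage is fixed as the domain of its image under
        \<open>R\<close>.\<close>
      have "q' = q" using homE[OF Rhom[OF e'(1,2) h'(1)]] homE[OF Rhom[OF e(1,2) h]] h'(2) by simp
      then show "v = vf_hom U (e0, e1) ** h" unfolding v by (intro Uh[of _ _ _ _ _ q]) (use e e' h h' in simp_all)
    qed (use that in blast)
    obtain k where k: "k : hom A (VHom Z (z0, z1)) (VHom Z' (f z0, f z1))"
      and kw: "\<And>q r x0 x1 t. r : hom A q (VHom Z (z0, z1)) ==> x0 : VObj C ==> x1 : VObj C ==> vf_obj F x0 = vf_obj G z0 ==>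
        vf_obj F x1 = vf_obj G z1 ==> t : hom A q (VHom C (x0, x1)) ==> vf_hom F (x0, x1) ** t = vf_hom G (z0, z1) ** r ==> k ** r = w r"
    proof (rule glue1[OF Go[OF z(1)] Go[OF z(2)] Ghom[OF z] vcat_hom_obj[OF Zv(4) fZ[OF z(1)] fZ[OF z(2)]]])
      fix q r x0 x1 t assume r: "r : hom A q (VHom Z (z0, z1))" and x: "x0 : VObj C" "x1 : VObj C" "vf_obj F x0 = vf_obj G z0"
        "vf_obj F x1 = vf_obj G z1" and t: "t : hom A q (VHom C (x0, x1))" "vf_hom F (x0, x1) ** t = vf_hom G (z0, z1) ** r"
      obtain e0 e1 h where e: "e0 : VObj E" "e1 : VObj E" "vf_obj R e0 = z0" "vf_obj R e1 = z1"
        and h: "h : hom A q (VHom E (e0, e1))" "vf_hom R (e0, e1) ** h = r" using lift[OF z r x t] by blast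
      have wr: "w r = vf_hom U (e0, e1) ** h" using w[OF e h(1)] h(2) by simp
      have "w (r ** r') = w r ** r'" if r': "r' : hom A q' q" for q' r'
      proof -
        have RA: "vf_hom R (e0, e1) : hom A (VHom E (e0, e1)) (VHom Z (z0, z1))" "vf_hom U (e0, e1) : hom A (VHom E (e0, e1)) (VHom Z' (vf_obj U e0, vf_obj U e1))"
          using vf_arr_hom[OF S(4), of e0 e1] vf_arr_hom[OF U(1), of e0 e1] e PR U by simp_all
        have "w (vf_hom R (e0, e1) ** h ** r') = vf_hom U (e0, e1) ** h ** r'" by (rule w[OF e comp_hom[OF r' h(1)]])
        then show ?thesis unfolding wr using assoc[OF r' h(1) RA(1)] assoc[OF r' h(1) RA(2)] h(2) by simp
      qed
      moreover have "w r : hom A q (VHom Z' (f z0, f z1))" unfolding wr using Uhom[OF e(1,2) h(1)] fU[OF e(1)] fU[OF e(2)] e by simp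
      ultimately show "w r : hom A q (VHom Z' (f z0, f z1)) \<and> (\<forall>q' r'. r' : hom A q' q --> w (r ** r') = w r ** r')" by blast
    qed (rule that)
    have "k ** vf_hom R (e0, e1) ** h = vf_hom U (e0, e1) ** h"
      if e: "e0 : VObj E" "e1 : VObj E" "vf_obj R e0 = z0" "vf_obj R e1 = z1" and h: "h : hom A q (VHom E (e0, e1))" for e0 e1 h q
    proof -
      have "k ** vf_hom R (e0, e1) ** h = w (vf_hom R (e0, e1) ** h)"
      proof (rule kw[of _ q "vf_obj P e0" "vf_obj P e1" "vf_hom P (e0, e1) ** h"])
        show "vf_hom R (e0, e1) ** h : hom A q (VHom Z (z0, z1))" using Rhom[OF e(1,2) h] e by simp
        show "vf_obj P e0 : VObj C" "vf_obj P e1 : VObj C" using vf_arr_obj[OF S(3)] e PR by simp_all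
        show "vf_obj F (vf_obj P e0) = vf_obj G z0" "vf_obj F (vf_obj P e1) = vf_obj G z1"
          using vf_square_obj[OF S(9,6), of e0] vf_square_obj[OF S(9,6), of e1] e PR by simp_all
        show "vf_hom P (e0, e1) ** h : hom A q (VHom C (vf_obj P e0, vf_obj P e1))"
          using vf_arr_el[OF S(3), of e0 e1 h q] e h PR by simp
        show "vf_hom F (vf_obj P e0, vf_obj P e1) ** vf_hom P (e0, e1) ** h = vf_hom G (z0, z1) ** vf_hom R (e0, e1) ** h"
          using vf_square_el[OF S(9,1,2,3,4), of e0 e1 h q] e h PR by (simp add: Z_def)
      qed
      then show ?thesis unfolding w[OF e h] .
    qed
    then show ?thesis using k unfolding kp_def by blast
  qed
  then obtain k where kkp: "\<And>z0 z1. z0 : VObj Z ==> z1 : VObj Z ==> kp z0 z1 (k z0 z1)" by metis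
  have k: "k z0 z1 : hom A (VHom Z (z0, z1)) (VHom Z' (f z0, f z1))" if "z0 : VObj Z" "z1 : VObj Z" for z0 z1
    using kkp[OF that] unfolding kp_def by blast
  have kU: "k (vf_obj R e0) (vf_obj R e1) ** vf_hom R (e0, e1) ** h = vf_hom U (e0, e1) ** h"
    if "e0 : VObj E" "e1 : VObj E" "h : hom A q (VHom E (e0, e1))" for e0 e1 h q
    using kkp[OF RE[OF that(1)] RE[OF that(2)]] that unfolding kp_def by blast
  define K where "K = mk_vfunctor Z Z' f k"
  have KA: "K : Arr vc"
    unfolding K_def
  proof (rule mk_vfunctor_arr[OF Zv(1,2) fZ k])
    fix z q assume z: "z : VObj Z" and q: "q : Obj A"
    define e where "e = \<epsilon> z"
    have e: "e : VObj E" "vf_obj R e = z" using \<epsilon>[OF z] by (simp_all add: e_def)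
    have "vf_hom R (e, e) ** un E e q = un Z z q" using vf_arr_un[OF S(4), of e q] e q PR by simp
    moreover have "vf_hom U (e, e) ** un E e q = un Z' (f z) q" using vf_arr_un[OF U(1), of e q] e q U fU[OF e(1)] by simp
    ultimately show "k z z ** un Z z q = un Z' (f z) q" using kU[OF e(1,1) un_hom[OF Ev e(1) q]] e(2) by simp
  next
    fix z0 z1 z2 q a b assume z: "z0 : VObj Z" "z1 : VObj Z" "z2 : VObj Z"
      and ab: "a : hom A q (VHom Z (z1, z2))" "b : hom A q (VHom Z (z0, z1))"
    note ka = comp_hom[OF ab(1) k[OF z(2,3)]] and kb = comp_hom[OF ab(2) k[OF z(1,2)]]
    note M = cmp_hom[OF Zv(3) z ab]
    have km: "k z0 z2 ** cmp Z z0 z1 z2 a b : hom A q (VHom Z' (f z0, f z2))" by (rule comp_hom[OF M k[OF z(1,3)]])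
    note M' = cmp_hom[OF Zv(4) fZ[OF z(1)] fZ[OF z(2)] fZ[OF z(3)] ka kb]
    show "k z0 z2 ** cmp Z z0 z1 z2 a b = cmp Z' (f z0) (f z1) (f z2) (k z1 z2 ** a) (k z0 z1 ** b)"
    proof (rule local2[OF Go[OF z(1)] Go[OF z(2)] Go[OF z(3)] comp_hom[OF ab(1) Ghom[OF z(2,3)]] comp_hom[OF ab(2) Ghom[OF z(1,2)]] km M'])
      fix q' r x0 x1 x2 t1 t0 assume r: "r : hom A q' q" and x: "x0 : VObj C" "x1 : VObj C" "x2 : VObj C"
        "vf_obj F x0 = vf_obj G z0" "vf_obj F x1 = vf_obj G z1" "vf_obj F x2 = vf_obj G z2"
        and t: "t1 : hom A q' (VHom C (x1, x2))" "t0 : hom A q' (VHom C (x0, x1))"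
        and e: "vf_hom F (x1, x2) ** t1 = (vf_hom G (z1, z2) ** a) ** r" "vf_hom F (x0, x1) ** t0 = (vf_hom G (z0, z1) ** b) ** r"
      have ar: "a ** r : hom A q' (VHom Z (z1, z2))" and br: "b ** r : hom A q' (VHom Z (z0, z1))"
        by (rule comp_hom[OF r ab(1)], rule comp_hom[OF r ab(2)])
      have e': "vf_hom F (x1, x2) ** t1 = vf_hom G (z1, z2) ** a ** r" "vf_hom F (x0, x1) ** t0 = vf_hom G (z0, z1) ** b ** r"
        using e assoc[OF r ab(1) Ghom[OF z(2,3)]] assoc[OF r ab(2) Ghom[OF z(1,2)]] by simp_all
      obtain e1 e2 h1 where e12: "e1 : VObj E" "e2 : VObj E" "vf_obj P e1 = x1" "vf_obj R e1 = z1" "vf_obj R e2 = z2"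
        and h1: "h1 : hom A q' (VHom E (e1, e2))" "vf_hom R (e1, e2) ** h1 = a ** r"
        using lift[OF z(2,3) ar x(2,3,5,6) t(1) e'(1)] by blast
      obtain e0 e1' h0 where e01: "e0 : VObj E" "e1' : VObj E" "vf_obj P e1' = x1" "vf_obj R e0 = z0" "vf_obj R e1' = z1"
        and h0': "h0 : hom A q' (VHom E (e0, e1'))" "vf_hom R (e0, e1') ** h0 = b ** r"
        using lift[OF z(1,2) br x(1,2,4,5) t(2) e'(2)] by blast
      \<comment> \<open>The lifts to \<open>C\<close> share the middle object \<open>x1\<close>, and
        an object of the pullback is determined by its two projections. Hence the two arrows of
        \<open>E\<close> compose, which is why functoriality is tested on lifted pairs.\<close>
      have "e1' = e1" by (rule strict_obj_eq[OF sp]) (use e01 e12 PR in simp_all)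
      then have h0: "h0 : hom A q' (VHom E (e0, e1))" "vf_hom R (e0, e1) ** h0 = b ** r" using h0' by simp_all
      note hm = cmp_hom[OF Ev e01(1) e12(1,2) h1(1) h0(1)]
      have "vf_hom R (e0, e2) ** cmp E e0 e1 e2 h1 h0 = cmp Z z0 z1 z2 (a ** r) (b ** r)"
        using vf_arr_cmp[OF S(4), of e0 e1 e2 h1 q' h0] PR e01 e12 h1 h0 by simp
      then have "k z0 z2 ** cmp Z z0 z1 z2 (a ** r) (b ** r) = vf_hom U (e0, e2) ** cmp E e0 e1 e2 h1 h0"
        using kU[OF e01(1) e12(2) hm] e01 e12 by simp
      also have "\<dots> = cmp Z' (vf_obj U e0) (vf_obj U e1) (vf_obj U e2) (vf_hom U (e1, e2) ** h1) (vf_hom U (e0, e1) ** h0)"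
        using vf_arr_cmp[OF U(1), of e0 e1 e2 h1 q' h0] U e01 e12 h1 h0 by simp
      also have "\<dots> = cmp Z' (f z0) (f z1) (f z2) (k z1 z2 ** a ** r) (k z0 z1 ** b ** r)"
        using kU[OF e12(1,2) h1(1)] kU[OF e01(1) e12(1) h0(1)] fU[OF e01(1)] fU[OF e12(1)] fU[OF e12(2)] e01 e12 h1(2) h0(2) by simp
      finally have fin: "k z0 z2 ** cmp Z z0 z1 z2 (a ** r) (b ** r) = cmp Z' (f z0) (f z1) (f z2) (k z1 z2 ** a ** r) (k z0 z1 ** b ** r)" .
      show "(k z0 z2 ** cmp Z z0 z1 z2 a b) ** r = cmp Z' (f z0) (f z1) (f z2) (k z1 z2 ** a) (k z0 z1 ** b) ** r"
        unfolding assoc[OF r M k[OF z(1,3)]] cmp_comp[OF Zv(3) z ab r] cmp_comp[OF Zv(4) fZ[OF z(1)] fZ[OF z(2)] fZ[OF z(3)] ka kb r]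
          assoc[OF r ab(1) k[OF z(2,3)]] assoc[OF r ab(2) k[OF z(1,2)]] by (rule fin)
    qed
  qed
  have Kd: "vf_dom K = Z" "vf_cod K = Z'" by (simp_all add: K_def)
  have KR: "Comp vc K R = U"
  proof (rule vf_eqI[OF _ U(1)])
    show "Comp vc K R : Arr vc" by (rule VC.arr_comp[OF S(4) KA]) (use Kd PR in simp)
    fix e assume "e : VObj (vf_dom U)"
    then have e: "e : VObj E" using U by simp
    show "vf_obj (Comp vc K R) e = vf_obj U e" using e PR RE[OF e] fU[OF e] by (simp add: vf_comp_obj K_def)
    fix e' assume "e' : VObj (vf_dom U)"
    then have e': "e' : VObj E" using U by simp
    have ho: "VHom E (e, e') : Obj A" by (rule vcat_hom_obj[OF Ev e e'])
    have Rh: "vf_hom R (e, e') : hom A (VHom E (e, e')) (VHom Z (vf_obj R e, vf_obj R e'))"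
      and Uh': "vf_hom U (e, e') : hom A (VHom E (e, e')) (VHom Z' (vf_obj U e, vf_obj U e'))"
      using vf_arr_hom[OF S(4), of e e'] vf_arr_hom[OF U(1), of e e'] e e' PR U by simp_all
    have "k (vf_obj R e) (vf_obj R e') ** vf_hom R (e, e') = vf_hom U (e, e')"
      using kU[OF e e' id_hom[OF ho]] homE[OF Rh] homE[OF Uh'] by simp
    then show "vf_hom (Comp vc K R) (e, e') = vf_hom U (e, e')"
      using e e' PR RE[OF e] RE[OF e'] by (simp add: vf_comp_hom K_def)
  qed (use PR U Kd in simp_all)
  have G'K: "Comp vc G' K = G"
  proof (rule vf_eqI[OF _ G(1)])
    show "Comp vc G' K : Arr vc" by (rule VC.arr_comp[OF KA G(2)]) (use Kd in \<open>simp add: Z'_def\<close>)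
    show "vf_dom (Comp vc G' K) = vf_dom G" "vf_cod (Comp vc G' K) = vf_cod G" using Kd Gd by (simp_all add: Z_def)
    have G'f: "vf_obj G' (f z) = vf_obj G z" if z: "z : VObj Z" for z
    proof -
      define e where "e = \<epsilon> z"
      have e: "e : VObj E" "vf_obj R e = z" using \<epsilon>[OF z] by (simp_all add: e_def)
      show ?thesis using vf_square_obj[OF U(4), of e] U PR e fU[OF e(1)] by simp
    qed
    fix z0 assume "z0 : VObj (vf_dom G)"
    then have z0: "z0 : VObj Z" by (simp add: Z_def)
    show "vf_obj (Comp vc G' K) z0 = vf_obj G z0" using z0 G'f Kd by (simp add: vf_comp_obj) (simp add: K_def)
    fix z1 assume "z1 : VObj (vf_dom G)"
    then have z1: "z1 : VObj Z" by (simp add: Z_def)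
    have G'h: "vf_hom G' (f z0, f z1) : hom A (VHom Z' (f z0, f z1)) (VHom D (vf_obj G z0, vf_obj G z1))"
      using vf_arr_hom[OF G(2), of "f z0" "f z1"] fZ z0 z1 Gd G'f by (simp add: Z'_def)
    have "vf_hom G' (f z0, f z1) ** k z0 z1 = vf_hom G (z0, z1)"
    proof (rule local1[OF Go[OF z0] Go[OF z1] Ghom[OF z0 z1] comp_hom[OF k[OF z0 z1] G'h] Ghom[OF z0 z1]])
      fix q r x0 x1 t assume r: "r : hom A q (VHom Z (z0, z1))" and x: "x0 : VObj C" "x1 : VObj C" "vf_obj F x0 = vf_obj G z0"
        "vf_obj F x1 = vf_obj G z1" and t: "t : hom A q (VHom C (x0, x1))" "vf_hom F (x0, x1) ** t = vf_hom G (z0, z1) ** r"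
      obtain e0 e1 h where e: "e0 : VObj E" "e1 : VObj E" "vf_obj R e0 = z0" "vf_obj R e1 = z1"
        and h: "h : hom A q (VHom E (e0, e1))" "vf_hom R (e0, e1) ** h = r" using lift[OF z0 z1 r x t] by blast
      have "vf_hom G' (vf_obj U e0, vf_obj U e1) ** vf_hom U (e0, e1) ** h = vf_hom G (vf_obj R e0, vf_obj R e1) ** vf_hom R (e0, e1) ** h"
        by (rule vf_square_el[OF U(4) G(2,1) U(1) S(4)]) (use U PR e h in \<open>simp_all add: Z_def Z'_def\<close>)
      then have "vf_hom G' (f z0, f z1) ** k z0 z1 ** r = vf_hom G (z0, z1) ** r"
        using kU[OF e(1,2) h(1)] e h fU[OF e(1)] fU[OF e(2)] by simp
      then show "(vf_hom G' (f z0, f z1) ** k z0 z1) ** r = vf_hom G (z0, z1) ** r"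
        unfolding assoc[OF r k[OF z0 z1] G'h] .
    qed
    then show "vf_hom (Comp vc G' K) (z0, z1) = vf_hom G (z0, z1)"
      using z0 z1 Kd by (simp add: vf_comp_hom) (simp add: K_def)
  qed
  show "\<exists>k. k : hom vc (Dom vc G) (Dom vc G') \<and> Comp vc G' k = G \<and> (\<forall>t q. VC.span F G t q --> Comp vc k q = u q)"
  proof (intro exI[of _ K] conjI allI impI G'K)
    show "K : hom vc (Dom vc G) (Dom vc G')" using KA Kd by (simp add: hom_def Z_def Z'_def)
    fix t q assume s: "VC.span F G t q"
    note T = VC.spanD[OF s]
    have tq: "t : hom vc (vf_dom q) (Dom vc F)" "q : hom vc (vf_dom q) (Dom vc G)" using T(1-5) by (simp_all add: hom_def)
    \<comment> \<open>Every span factors through the universal one, so naturality of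
      \<open>u\<close> reduces the claim to its value \<open>U\<close> there.\<close>
    obtain s' where s': "s' : hom vc (vf_dom q) (Dom vc P)" "Comp vc R s' = q"
      by (rule VC.pullback_lift[OF strict_is_pullback[OF sp] tq T(6)])
    have sA: "s' : Arr vc" "vf_cod s' = E" using s'(1) PR by (simp_all add: hom_def)
    have "Comp vc K q = Comp vc K (Comp vc R s')" by (simp only: s'(2))
    also have "\<dots> = Comp vc (Comp vc K R) s'"
      by (rule VC.comp_assoc[symmetric]) (use sA S(4) KA PR Kd in simp_all)
    also have "\<dots> = u (Comp vc R s')" unfolding KR Un[OF sA] ..
    finally show "Comp vc K q = u q" unfolding s'(2) .
  qed
qed

end

text \<open>
  An algebra over \<open>F\<close>, seen on objects and on generalized elements of hom-objects: \<open>X c w\<close> is \<open>w\<close>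
  transported to lie over \<open>c\<close>, and \<open>Xh c0 w0 c1 w1 t s\<close> is \<open>s\<close> transported to lie over \<open>t\<close>. The
  predicates \<open>mt\<close> and \<open>me\<close> say that the two data have the same image under \<open>F\<close>.
\<close>

locale vfunctor_action = covering_vfunctor small pair A F C D
  for small :: "'u set => bool" and pair :: "'u => 'u => 'u" and A :: "('o, 'm) cat"
    and F :: "('u, 'o, 'm) vfunctor" and C D :: "('u, 'o, 'm) vcat" +
  fixes f :: "('u, 'o, 'm) vfunctor" and W :: "('u, 'o, 'm) vcat"
    and X :: "'u => 'u => 'u" and Xh :: "'u => 'u => 'u => 'u => 'm => 'm => 'm"
    and mt :: "'u => 'u => bool" and me :: "'u => 'u => 'u => 'u => 'o => 'm => 'm => bool"
  defines "mt c w \<equiv> c : VObj C \<and> w : VObj W \<and> vf_obj F c = vf_obj F (vf_obj f w)"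
    and "me c0 w0 c1 w1 q t s \<equiv> mt c0 w0 \<and> mt c1 w1 \<and> t : hom A q (VHom C (c0, c1)) \<and> s : hom A q (VHom W (w0, w1)) \<and>
      vf_hom F (c0, c1) ** t = vf_hom F (vf_obj f w0, vf_obj f w1) ** vf_hom f (w0, w1) ** s"
  assumes f: "f : Arr vc" and dom_f [simp]: "vf_dom f = W" and cod_f [simp]: "vf_cod f = C"
    and X_obj: "mt c w ==> X c w : VObj W" "mt c w ==> vf_obj f (X c w) = c"
    and X_unit: "w : VObj W ==> X (vf_obj f w) w = w"
    and X_act: "mt c w ==> mt c' w ==> X c' (X c w) = X c' w"
    and Xh_hom: "me c0 w0 c1 w1 q t s ==> Xh c0 w0 c1 w1 t s : hom A q (VHom W (X c0 w0, X c1 w1))"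
    and Xh_over: "me c0 w0 c1 w1 q t s ==> vf_hom f (X c0 w0, X c1 w1) ** Xh c0 w0 c1 w1 t s = t"
    and Xh_nat: "me c0 w0 c1 w1 q t s ==> r : hom A q' q ==> Xh c0 w0 c1 w1 (t ** r) (s ** r) = Xh c0 w0 c1 w1 t s ** r"
    and Xh_unit: "w0 : VObj W ==> w1 : VObj W ==> s : hom A q (VHom W (w0, w1)) ==>
      Xh (vf_obj f w0) w0 (vf_obj f w1) w1 (vf_hom f (w0, w1) ** s) s = s"
    and Xh_act: "me c0 w0 c1 w1 q t s ==> me c0' w0 c1' w1 q t' s ==>
      Xh c0' (X c0 w0) c1' (X c1 w1) t' (Xh c0 w0 c1 w1 t s) = Xh c0' w0 c1' w1 t' s"
    and Xh_cmp: "me c1 w1 c2 w2 q t1 s1 ==> me c0 w0 c1 w1 q t0 s0 ==>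
      Xh c0 w0 c2 w2 (cmp C c0 c1 c2 t1 t0) (cmp W w0 w1 w2 s1 s0) =
      cmp W (X c0 w0) (X c1 w1) (X c2 w2) (Xh c1 w1 c2 w2 t1 s1) (Xh c0 w0 c1 w1 t0 s0)"
    and Xh_un: "mt c w ==> q : Obj A ==> Xh c w c w (un C c q) (un W w q) = un W (X c w) q"
begin

lemma W_vcat: "is_vcat A W" "small (VObj W)" "W : Obj vc"
  using vf_arrD[OF f] by simp_all

lemma f_obj: "w : VObj W ==> vf_obj f w : VObj C"
  using vf_arr_obj[OF f] by simp

lemma f_hom: "w : VObj W ==> w' : VObj W ==> vf_hom f (w, w') : hom A (VHom W (w, w')) (VHom C (vf_obj f w, vf_obj f w'))"
  using vf_arr_hom[OF f] by simp

lemma f_el: "w : VObj W ==> w' : VObj W ==> a : hom A q (VHom W (w, w')) ==>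
    vf_hom f (w, w') ** a : hom A q (VHom C (vf_obj f w, vf_obj f w'))"
  using vf_arr_el[OF f] by simp

lemma mt_f: "w : VObj W ==> mt (vf_obj f w) w"
  by (simp add: mt_def f_obj)

lemma mt_X: "mt c w ==> mt c' w ==> mt c' (X c w)"
  using X_obj by (simp add: mt_def)

lemma me_cmp:
  assumes "me c1 w1 c2 w2 q t1 s1" "me c0 w0 c1 w1 q t0 s0"
  shows "me c0 w0 c2 w2 q (cmp C c0 c1 c2 t1 t0) (cmp W w0 w1 w2 s1 s0)"
proof -
  have c: "c0 : VObj C" "c1 : VObj C" "c2 : VObj C" "w0 : VObj W" "w1 : VObj W" "w2 : VObj W"
    and t: "t1 : hom A q (VHom C (c1, c2))" "t0 : hom A q (VHom C (c0, c1))"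
    and s: "s1 : hom A q (VHom W (w1, w2))" "s0 : hom A q (VHom W (w0, w1))"
    using assms unfolding me_def mt_def by simp_all
  note fw = f_obj[OF c(4)] f_obj[OF c(5)] f_obj[OF c(6)]
  have "vf_hom f (w0, w2) ** cmp W w0 w1 w2 s1 s0 = cmp C (vf_obj f w0) (vf_obj f w1) (vf_obj f w2) (vf_hom f (w1, w2) ** s1) (vf_hom f (w0, w1) ** s0)"
    using vf_arr_cmp[OF f, of w0 w1 w2 s1 q s0] c s by simp
  then have "vf_hom F (c0, c2) ** cmp C c0 c1 c2 t1 t0 =
    vf_hom F (vf_obj f w0, vf_obj f w2) ** vf_hom f (w0, w2) ** cmp W w0 w1 w2 s1 s0"
    using F_cmp[OF c(1-3) t] F_cmp[OF fw f_el[OF c(5,6) s(1)] f_el[OF c(4,5) s(2)]] assms unfolding me_def mt_def by simp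
  then show ?thesis
    using assms cmp_hom[OF C_vcat(1) c(1-3) t] cmp_hom[OF W_vcat(1) c(4-6) s] unfolding me_def by simp
qed

lemma me_un: "mt c w ==> q : Obj A ==> me c w c w q (un C c q) (un W w q)"
  using un_hom[OF C_vcat(1), of c q] un_hom[OF W_vcat(1), of w q] F_un[of c q] F_un[of "vf_obj f w" q] f_obj[of w]
    vf_arr_un[OF f, of w q] unfolding me_def mt_def by simp

definition sec :: "'u => 'u" where "sec y = (SOME x. x : VObj C \<and> vf_obj F x = y)"

lemma sec: "y : VObj D ==> sec y : VObj C" "y : VObj D ==> vf_obj F (sec y) = y"
  using someI_ex[of "\<lambda>x. x : VObj C \<and> vf_obj F x = y"] surj[of y] unfolding sec_def by blast+

definition under :: "'u => 'u" where "under w = vf_obj F (vf_obj f w)"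

lemma under: "w : VObj W ==> under w : VObj D"
  by (simp add: under_def F_obj f_obj)

text \<open>Each orbit has exactly one object over the chosen section of \<open>F\<close>; the quotient is built on these.\<close>

definition orbits :: "'u set" where "orbits = {w : VObj W. vf_obj f w = sec (under w)}"

definition orbit :: "'u => 'u" where "orbit w = X (sec (under w)) w"

lemma orbitsD: "z : orbits ==> z : VObj W" "z : orbits ==> under z : VObj D"
  by (simp_all add: orbits_def under)

lemma mt_under: "mt c w \<longleftrightarrow> c : VObj C \<and> w : VObj W \<and> vf_obj F c = under w"
  by (simp add: mt_def under_def)

lemma mt_sec: "w : VObj W ==> mt (sec (under w)) w"
  unfolding mt_under using sec[OF under] by simp

lemma under_X: "mt c w ==> under (X c w) = under w"
  using X_obj by (simp add: under_def mt_def)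

lemma orbit_in: "w : VObj W ==> orbit w : orbits" "w : VObj W ==> under (orbit w) = under w"
  using mt_sec[of w] X_obj[of "sec (under w)" w] under_X[of "sec (under w)" w] by (simp_all add: orbits_def orbit_def)

lemma orbit_X:
  assumes m: "mt c w"
  shows "orbit (X c w) = orbit w"
proof -
  have "w : VObj W" using m by (simp add: mt_def)
  then show ?thesis unfolding orbit_def under_X[OF m] by (rule X_act[OF m mt_sec])
qed

lemma X_orbit: "w : VObj W ==> X (vf_obj f w) (orbit w) = w"
  unfolding orbit_def using X_act[OF mt_sec mt_f, of w] X_unit by simp

lemma orbit_id: "z : orbits ==> orbit z = z"
  unfolding orbit_def using X_unit[of z] by (simp add: orbits_def)

lemma orbits_X_f: "z : orbits ==> X (vf_obj f z) z = z"
  using X_unit orbitsD by simp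

lemma family_exists:
  assumes z: "z0 : orbits" "z1 : orbits"
  shows "\<exists>g \<kappa>. \<forall>x0 x1. mt x0 z0 --> mt x1 z1 -->
    is_pullback A (vf_hom F (x0, x1)) g (vf_hom f (X x0 z0, X x1 z1)) (\<kappa> (x0, x1)) \<and>
    (\<forall>x0' x1' q t s. mt x0' z0 --> mt x1' z1 --> me x0 (X x0' z0) x1 (X x1' z1) q t s -->
      \<kappa> (x0, x1) ** Xh x0 (X x0' z0) x1 (X x1' z1) t s = \<kappa> (x0', x1') ** s)"
proof -
  define J where "J = vf_fiber F (under z0) \<times> vf_fiber F (under z1)"
  define fW where "fW = (\<lambda>(x0, x1). vf_hom f (X x0 z0, X x1 z1))"
  define \<Xi> where "\<Xi> = (\<lambda>(x0, x1) t (x0', x1') s. Xh x0 (X x0' z0) x1 (X x1' z1) t s)"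
  have zW: "z0 : VObj W" "z1 : VObj W" using z orbitsD by simp_all
  have J: "(x0, x1) : J \<longleftrightarrow> mt x0 z0 \<and> mt x1 z1" for x0 x1
    using zW by (auto simp: J_def mt_under)
  have fh: "fW (x0, x1) : hom A (VHom W (X x0 z0, X x1 z1)) (VHom C (x0, x1))" if "(x0, x1) : J" for x0 x1
    using f_hom[of "X x0 z0" "X x1 z1"] that X_obj by (simp add: J fW_def)
  have Fh: "vf_hom F (x0, x1) : hom A (VHom C (x0, x1)) (VHom D (under z0, under z1))" if "(x0, x1) : J" for x0 x1
    using F_hom[of x0 x1] that by (simp add: J mt_under)
  have me: "me x0 (X x0' z0) x1 (X x1' z1) (dom s) t s"
    if i: "(x0, x1) : J" "(x0', x1') : J" and s: "span (vf_hom F (x0, x1)) (vf_hom F (x0', x1') ** fW (x0', x1')) t s" for x0 x1 x0' x1' t s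
  proof -
    note S = spanD[OF s]
    note h = homE[OF fh[OF i(2)]] homE[OF Fh[OF i(1)]] homE[OF Fh[OF i(2)]]
    have "t : hom A (dom s) (VHom C (x0, x1))" "s : hom A (dom s) (VHom W (X x0' z0, X x1' z1))"
      using S(1-5) h by (simp_all add: hom_def)
    moreover have "vf_hom F (x0, x1) ** t = vf_hom F (x0', x1') ** vf_hom f (X x0' z0, X x1' z1) ** s"
      using S h by (simp add: fW_def)
    ultimately show ?thesis
      unfolding me_def using i mt_X[of x0' z0 x0] mt_X[of x1' z1 x1] X_obj(2)[of x0' z0] X_obj(2)[of x1' z1] by (simp add: J)
  qed
  have XX: "X x0 (X x0' z0) = X x0 z0" "X x1 (X x1' z1) = X x1 z1" if "(x0, x1) : J" "(x0', x1') : J" for x0 x1 x0' x1'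
    using X_act that by (simp_all add: J)
  have "family_action J (vf_hom F) fW \<Xi>"
    unfolding family_action_def
  proof (intro conjI ballI allI impI; (elim prod.exhaust[of _ thesis for thesis])?)
    fix i assume i: "i : J"
    obtain x0 x1 where ix: "i = (x0, x1)" by (cases i)
    note i = i[unfolded ix]
    show "fW i : Arr A" "cod (fW i) = dom (vf_hom F i)" using homE[OF fh[OF i]] homE[OF Fh[OF i]] by (simp_all add: ix)
    fix s assume s: "arr s" "cod s = dom (fW i)"
    have X: "X x0 z0 : VObj W" "X x1 z1 : VObj W" "vf_obj f (X x0 z0) = x0" "vf_obj f (X x1 z1) = x1"
      using X_obj i by (simp_all add: J)
    have "s : hom A (dom s) (VHom W (X x0 z0, X x1 z1))" using s homE[OF fh[OF i]] by (simp add: hom_def ix)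
    from Xh_unit[OF X(1,2) this] show "\<Xi> i (fW i ** s) i s = s" by (simp add: \<Xi>_def fW_def ix X(3,4))
  next
    fix i j t s assume i: "i : J" and j: "j : J" and s: "span (vf_hom F i) (vf_hom F j ** fW j) t s"
    obtain x0 x1 x0' x1' where ij: "i = (x0, x1)" "j = (x0', x1')" by (cases i, cases j)
    note i = i[unfolded ij] and j = j[unfolded ij] and m = me[OF i[unfolded ij] j[unfolded ij] s[unfolded ij]]
    note xx = XX[OF i j]
    show "\<Xi> i t j s : hom A (dom s) (dom (fW i))" using Xh_hom[OF m] homE[OF fh[OF i]] xx by (simp add: \<Xi>_def ij)
    show "fW i ** \<Xi> i t j s = t" using Xh_over[OF m] xx by (simp add: \<Xi>_def fW_def ij)
    fix r assume "arr r" "cod r = dom s"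
    then have "r : hom A (dom r) (dom s)" by (simp add: hom_def)
    from Xh_nat[OF m this] show "\<Xi> i (t ** r) j (s ** r) = \<Xi> i t j s ** r" by (simp add: \<Xi>_def ij)
  next
    fix i i' j t t' s assume i: "i : J" and i': "i' : J" and j: "j : J" and s: "span (vf_hom F i) (vf_hom F j ** fW j) t s"
      and s': "span (vf_hom F i') (vf_hom F j ** fW j) t' s"
    obtain x0 x1 y0 y1 x0' x1' where ij: "i = (x0, x1)" "i' = (y0, y1)" "j = (x0', x1')" by (cases i, cases i', cases j)
    note i = i[unfolded ij] and i' = i'[unfolded ij] and j = j[unfolded ij]
    note m = me[OF i j s[unfolded ij]] and m' = me[OF i' j s'[unfolded ij]]
    show "\<Xi> i' t' i (\<Xi> i t j s) = \<Xi> i' t' j s"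
      using Xh_act[OF m m'] XX[OF i j] by (simp add: \<Xi>_def ij)
  qed
  moreover have "family_effective J (vf_hom F)"
    unfolding J_def by (rule eff1) (use orbitsD z in simp_all)
  ultimately obtain g \<kappa> where g\<kappa>: "\<And>i. i : J ==> is_pullback A (vf_hom F i) g (fW i) (\<kappa> i) \<and>
        (\<forall>j\<in>J. \<forall>t s. span (vf_hom F i) (vf_hom F j ** fW j) t s --> \<kappa> i ** \<Xi> i t j s = \<kappa> j ** s)"
    unfolding family_effective_def by blast
  show ?thesis
  proof (rule exI[of _ g], rule exI[of _ \<kappa>], intro allI impI conjI)
    fix x0 x1 assume "mt x0 z0" "mt x1 z1"
    then have i: "(x0, x1) : J" by (simp add: J)
    show "is_pullback A (vf_hom F (x0, x1)) g (vf_hom f (X x0 z0, X x1 z1)) (\<kappa> (x0, x1))"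
      using g\<kappa>[OF i] by (simp add: fW_def)
    fix x0' x1' q t s assume "mt x0' z0" "mt x1' z1" and m: "me x0 (X x0' z0) x1 (X x1' z1) q t s"
    then have j: "(x0', x1') : J" by (simp add: J)
    have "vf_obj f (X x0' z0) = x0'" "vf_obj f (X x1' z1) = x1'" using X_obj j by (simp_all add: J)
    then have "span (vf_hom F (x0, x1)) (vf_hom F (x0', x1') ** fW (x0', x1')) t s"
      using m homE[OF fh[OF j]] homE[OF Fh[OF i]] homE[OF Fh[OF j]] unfolding me_def
      by (simp add: span_def hom_def) (simp add: fW_def)
    then show "\<kappa> (x0, x1) ** Xh x0 (X x0' z0) x1 (X x1' z1) t s = \<kappa> (x0', x1') ** s"
      using g\<kappa>[OF i] j by (auto simp: \<Xi>_def)
  qed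
qed

lemma quotient_exists:
  "\<exists>G K. strict_pullback F G f K \<and> (\<forall>c w. mt c w --> vf_obj K (X c w) = vf_obj K w) \<and>
    (\<forall>c0 w0 c1 w1 q t s. me c0 w0 c1 w1 q t s -->
      vf_hom K (X c0 w0, X c1 w1) ** Xh c0 w0 c1 w1 t s = vf_hom K (w0, w1) ** s)"
proof -
  obtain g \<kappa> where g\<kappa>: "\<And>z0 z1. z0 : orbits ==> z1 : orbits ==> \<forall>x0 x1. mt x0 z0 --> mt x1 z1 -->
    is_pullback A (vf_hom F (x0, x1)) (g z0 z1) (vf_hom f (X x0 z0, X x1 z1)) (\<kappa> z0 z1 (x0, x1)) \<and>
    (\<forall>x0' x1' q t s. mt x0' z0 --> mt x1' z1 --> me x0 (X x0' z0) x1 (X x1' z1) q t s -->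
      \<kappa> z0 z1 (x0, x1) ** Xh x0 (X x0' z0) x1 (X x1' z1) t s = \<kappa> z0 z1 (x0', x1') ** s)"
    using family_exists by metis
  have pb: "is_pullback A (vf_hom F (x0, x1)) (g z0 z1) (vf_hom f (X x0 z0, X x1 z1)) (\<kappa> z0 z1 (x0, x1))"
    if "z0 : orbits" "z1 : orbits" "mt x0 z0" "mt x1 z1" for z0 z1 x0 x1
    using g\<kappa>[OF that(1,2)] that(3,4) by blast
  have kact: "\<kappa> z0 z1 (x0, x1) ** Xh x0 (X x0' z0) x1 (X x1' z1) t s = \<kappa> z0 z1 (x0', x1') ** s"
    if "z0 : orbits" "z1 : orbits" "mt x0 z0" "mt x1 z1" "mt x0' z0" "mt x1' z1" "me x0 (X x0' z0) x1 (X x1' z1) q t s"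
    for z0 z1 x0 x1 x0' x1' q t s
    using g\<kappa>[OF that(1,2)] that(3-) by blast
  define H where "H z0 z1 = dom (g z0 z1)" for z0 z1
  have mtz: "mt (vf_obj f z) z" if "z : orbits" for z using mt_f orbitsD(1)[OF that] by simp
  have fX: "vf_obj f (X x z) = x" "X x z : VObj W" if "mt x z" for x z using X_obj that by simp_all
  have Fmt: "vf_hom F (x0, x1) : hom A (VHom C (x0, x1)) (VHom D (under z0, under z1))" if "mt x0 z0" "mt x1 z1" for x0 x1 z0 z1
    using F_hom[of x0 x1] that by (simp add: mt_under)
  have fmt: "vf_hom f (X x0 z0, X x1 z1) : hom A (VHom W (X x0 z0, X x1 z1)) (VHom C (x0, x1))" if "mt x0 z0" "mt x1 z1" for x0 x1 z0 z1
    using f_hom[OF fX(2)[OF that(1)] fX(2)[OF that(2)]] fX(1)[OF that(1)] fX(1)[OF that(2)] by simp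
  have g: "g z0 z1 : hom A (H z0 z1) (VHom D (under z0, under z1))" if "z0 : orbits" "z1 : orbits" for z0 z1
    using pullback_arrs(2,5)[OF pb[OF that mtz[OF that(1)] mtz[OF that(2)]]] homE[OF Fmt[OF mtz[OF that(1)] mtz[OF that(2)]]]
    by (simp add: hom_def H_def)
  have Ho: "H z0 z1 : Obj A" if "z0 : orbits" "z1 : orbits" for z0 z1 using homE[OF g[OF that]] by simp
  have k: "\<kappa> z0 z1 (x0, x1) : hom A (VHom W (X x0 z0, X x1 z1)) (H z0 z1)"
    if "z0 : orbits" "z1 : orbits" "mt x0 z0" "mt x1 z1" for z0 z1 x0 x1
    using pullback_arrs(4,6,8)[OF pb[OF that]] homE[OF fmt[OF that(3,4)]] by (simp add: hom_def H_def)
  have kel: "\<kappa> z0 z1 (x0, x1) ** s : hom A q (H z0 z1)" "vf_hom f (X x0 z0, X x1 z1) ** s : hom A q (VHom C (x0, x1))"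
    "g z0 z1 ** \<kappa> z0 z1 (x0, x1) ** s = vf_hom F (x0, x1) ** vf_hom f (X x0 z0, X x1 z1) ** s"
    if z: "z0 : orbits" "z1 : orbits" and x: "mt x0 z0" "mt x1 z1" and s: "s : hom A q (VHom W (X x0 z0, X x1 z1))" for z0 z1 x0 x1 s q
  proof -
    show "\<kappa> z0 z1 (x0, x1) ** s : hom A q (H z0 z1)" by (rule comp_hom[OF s k[OF z x]])
    show "vf_hom f (X x0 z0, X x1 z1) ** s : hom A q (VHom C (x0, x1))" by (rule comp_hom[OF s fmt[OF x]])
    show "g z0 z1 ** \<kappa> z0 z1 (x0, x1) ** s = vf_hom F (x0, x1) ** vf_hom f (X x0 z0, X x1 z1) ** s"
      by (rule comp_eq_comp[OF pullback_arrs(9)[OF pb[OF z x], symmetric]])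
        (use homE[OF k[OF z x]] homE[OF fmt[OF x]] homE[OF Fmt[OF x]] homE[OF g[OF z]] homE[OF s] in simp_all)
  qed
  have klift: "\<exists>s. s : hom A q (VHom W (X x0 z0, X x1 z1)) \<and> vf_hom f (X x0 z0, X x1 z1) ** s = t \<and> \<kappa> z0 z1 (x0, x1) ** s = v"
    if z: "z0 : orbits" "z1 : orbits" and x: "mt x0 z0" "mt x1 z1" and v: "v : hom A q (H z0 z1)" and t: "t : hom A q (VHom C (x0, x1))"
      and e: "vf_hom F (x0, x1) ** t = g z0 z1 ** v" for z0 z1 x0 x1 v q t
  proof -
    obtain s where "s : hom A q (dom (vf_hom f (X x0 z0, X x1 z1)))" "vf_hom f (X x0 z0, X x1 z1) ** s = t" "\<kappa> z0 z1 (x0, x1) ** s = v"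
      by (rule pullback_lift[OF pb[OF z x] _ _ e]) (use v t homE[OF Fmt[OF x]] in \<open>simp_all add: H_def\<close>)
    then show ?thesis using homE[OF fmt[OF x]] by auto
  qed
  have kuniq: "s = s'" if z: "z0 : orbits" "z1 : orbits" and x: "mt x0 z0" "mt x1 z1"
    and s: "s : hom A q (VHom W (X x0 z0, X x1 z1))" "s' : hom A q (VHom W (X x0 z0, X x1 z1))"
    and e: "vf_hom f (X x0 z0, X x1 z1) ** s = vf_hom f (X x0 z0, X x1 z1) ** s'" "\<kappa> z0 z1 (x0, x1) ** s = \<kappa> z0 z1 (x0, x1) ** s'"
    for z0 z1 x0 x1 s s' q
    by (rule pullback_eq[OF pb[OF z x] _ _ e]) (use s homE[OF fmt[OF x]] in simp_all)
  have related: "me x0' (X x0 z0) x1' (X x1 z1) q (vf_hom f (X x0' z0, X x1' z1) ** s') s"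
    "s' = Xh x0' (X x0 z0) x1' (X x1 z1) (vf_hom f (X x0' z0, X x1' z1) ** s') s"
    if z: "z0 : orbits" "z1 : orbits" and x: "mt x0 z0" "mt x1 z1" and x': "mt x0' z0" "mt x1' z1"
      and s: "s : hom A q (VHom W (X x0 z0, X x1 z1))" and s': "s' : hom A q (VHom W (X x0' z0, X x1' z1))"
      and e: "\<kappa> z0 z1 (x0, x1) ** s = \<kappa> z0 z1 (x0', x1') ** s'"
    for z0 z1 x0 x1 x0' x1' s s' q
  proof -
    note ks = kel[OF z x s] and ks' = kel[OF z x' s']
    show m: "me x0' (X x0 z0) x1' (X x1 z1) q (vf_hom f (X x0' z0, X x1' z1) ** s') s"
      unfolding me_def using mt_X[OF x(1) x'(1)] mt_X[OF x(2) x'(2)] ks ks' s e fX(1)[OF x(1)] fX(1)[OF x(2)] by simp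
    note XX = X_act[OF x(1) x'(1)] X_act[OF x(2) x'(2)]
    show "s' = Xh x0' (X x0 z0) x1' (X x1 z1) (vf_hom f (X x0' z0, X x1' z1) ** s') s"
      by (rule kuniq[OF z x' s']) (use Xh_hom[OF m] Xh_over[OF m] kact[OF z x' x m] e XX in simp_all)
  qed
  have xmt: "mt x z" if "x : VObj C" "vf_obj F x = under z" "z : orbits" for x z
    using that orbitsD(1)[OF that(3)] by (simp add: mt_under)
  define Mp where "Mp z0 z1 z2 m \<longleftrightarrow> m : hom A (prod_obj A (H z1 z2) (H z0 z1)) (H z0 z2) \<and>
    (\<forall>x0 x1 x2 q s1 s0. mt x0 z0 --> mt x1 z1 --> mt x2 z2 --> s1 : hom A q (VHom W (X x1 z1, X x2 z2)) -->
      s0 : hom A q (VHom W (X x0 z0, X x1 z1)) -->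
      m ** pairing A (\<kappa> z1 z2 (x1, x2) ** s1) (\<kappa> z0 z1 (x0, x1) ** s0) = \<kappa> z0 z2 (x0, x2) ** cmp W (X x0 z0) (X x1 z1) (X x2 z2) s1 s0)" for z0 z1 z2 m
  have "\<exists>m. Mp z0 z1 z2 m" if z: "z0 : orbits" "z1 : orbits" "z2 : orbits" for z0 z1 z2
  proof -
    define p1 p2 where "p1 = pr1 A (H z1 z2) (H z0 z1)" and "p2 = pr2 A (H z1 z2) (H z0 z1)"
    define pq where "pq = prod_obj A (H z1 z2) (H z0 z1)"
    have p: "p1 : hom A pq (H z1 z2)" "p2 : hom A pq (H z0 z1)"
      using Ho z by (simp_all add: p1_def p2_def pq_def hom_def)
    define lft where "lft r v x0 x1 x2 q s1 s0 \<longleftrightarrow> mt x0 z0 \<and> mt x1 z1 \<and> mt x2 z2 \<and> s1 : hom A q (VHom W (X x1 z1, X x2 z2)) \<and>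
      s0 : hom A q (VHom W (X x0 z0, X x1 z1)) \<and> \<kappa> z1 z2 (x1, x2) ** s1 = p1 ** r \<and> \<kappa> z0 z1 (x0, x1) ** s0 = p2 ** r \<and>
      v = \<kappa> z0 z2 (x0, x2) ** cmp W (X x0 z0) (X x1 z1) (X x2 z2) s1 s0" for r v x0 x1 x2 q s1 s0
    define u where "u r = (SOME v. \<exists>x0 x1 x2 q s1 s0. lft r v x0 x1 x2 q s1 s0)" for r
    have u: "u r = v" if L: "lft r v x0 x1 x2 q s1 s0" for r v x0 x1 x2 q s1 s0
      unfolding u_def
    proof (rule some_equality)
      show "\<exists>x0 x1 x2 q s1 s0. lft r v x0 x1 x2 q s1 s0" using L by blast
      fix v' assume "\<exists>x0 x1 x2 q s1 s0. lft r v' x0 x1 x2 q s1 s0"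
      then obtain x0' x1' x2' q' s1' s0' where L': "lft r v' x0' x1' x2' q' s1' s0'" by blast
      have x: "mt x0 z0" "mt x1 z1" "mt x2 z2" and s: "s1 : hom A q (VHom W (X x1 z1, X x2 z2))" "s0 : hom A q (VHom W (X x0 z0, X x1 z1))"
        and e: "\<kappa> z1 z2 (x1, x2) ** s1 = p1 ** r" "\<kappa> z0 z1 (x0, x1) ** s0 = p2 ** r"
        and v: "v = \<kappa> z0 z2 (x0, x2) ** cmp W (X x0 z0) (X x1 z1) (X x2 z2) s1 s0" using L unfolding lft_def by simp_all
      have x': "mt x0' z0" "mt x1' z1" "mt x2' z2" and s'': "s1' : hom A q' (VHom W (X x1' z1, X x2' z2))" "s0' : hom A q' (VHom W (X x0' z0, X x1' z1))"
        and e': "\<kappa> z1 z2 (x1', x2') ** s1' = p1 ** r" "\<kappa> z0 z1 (x0', x1') ** s0' = p2 ** r"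
        and v': "v' = \<kappa> z0 z2 (x0', x2') ** cmp W (X x0' z0) (X x1' z1) (X x2' z2) s1' s0'" using L' unfolding lft_def by simp_all
      have "q' = q" using homE[OF kel(1)[OF z(2,3) x(2,3) s(1)]] homE[OF kel(1)[OF z(2,3) x'(2,3) s''(1)]] e e' by simp
      then have s': "s1' : hom A q (VHom W (X x1' z1, X x2' z2))" "s0' : hom A q (VHom W (X x0' z0, X x1' z1))" using s'' by simp_all
      note r1 = related[OF z(2,3) x(2,3) x'(2,3) s(1) s'(1) trans[OF e(1) e'(1)[symmetric]]]
      note r0 = related[OF z(1,2) x(1,2) x'(1,2) s(2) s'(2) trans[OF e(2) e'(2)[symmetric]]]
      define t1 t0 where "t1 = vf_hom f (X x1' z1, X x2' z2) ** s1'" and "t0 = vf_hom f (X x0' z0, X x1' z1) ** s0'"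
      note r1 = r1[folded t1_def] and r0 = r0[folded t0_def]
      have "Xh x0' (X x0 z0) x2' (X x2 z2) (cmp C x0' x1' x2' t1 t0) (cmp W (X x0 z0) (X x1 z1) (X x2 z2) s1 s0) =
        cmp W (X x0' (X x0 z0)) (X x1' (X x1 z1)) (X x2' (X x2 z2)) s1' s0'"
        unfolding Xh_cmp[OF r1(1) r0(1)] using r1(2) r0(2) by simp
      also have "\<dots> = cmp W (X x0' z0) (X x1' z1) (X x2' z2) s1' s0'"
        unfolding X_act[OF x(1) x'(1)] X_act[OF x(2) x'(2)] X_act[OF x(3) x'(3)] ..
      finally have "v' = \<kappa> z0 z2 (x0', x2') ** Xh x0' (X x0 z0) x2' (X x2 z2) (cmp C x0' x1' x2' t1 t0) (cmp W (X x0 z0) (X x1 z1) (X x2 z2) s1 s0)"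
        unfolding v' by simp
      also have "\<dots> = v" unfolding v by (rule kact[OF z(1,3) x'(1,3) x(1,3) me_cmp[OF r1(1) r0(1)]])
      finally show "v' = v" .
    qed
    have Lnat: "lft (r ** r') (v ** r') x0 x1 x2 q' (s1 ** r') (s0 ** r')"
      if L: "lft r v x0 x1 x2 q s1 s0" and r: "r : hom A q pq" and r': "r' : hom A q' q" for r v x0 x1 x2 q s1 s0 r' q'
    proof -
      have x: "mt x0 z0" "mt x1 z1" "mt x2 z2" and s: "s1 : hom A q (VHom W (X x1 z1, X x2 z2))" "s0 : hom A q (VHom W (X x0 z0, X x1 z1))"
        and e: "\<kappa> z1 z2 (x1, x2) ** s1 = p1 ** r" "\<kappa> z0 z1 (x0, x1) ** s0 = p2 ** r"
        and v: "v = \<kappa> z0 z2 (x0, x2) ** cmp W (X x0 z0) (X x1 z1) (X x2 z2) s1 s0" using L unfolding lft_def by simp_all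
      note XW = fX(2)[OF x(1)] fX(2)[OF x(2)] fX(2)[OF x(3)]
      show ?thesis
        unfolding lft_def v assoc[OF r' cmp_hom[OF W_vcat(1) XW s] k[OF z(1,3) x(1,3)]] cmp_comp[OF W_vcat(1) XW s r']
        using x comp_hom[OF r' s(1)] comp_hom[OF r' s(2)] e assoc[OF r' s(1) k[OF z(2,3) x(2,3)]] assoc[OF r' s(2) k[OF z(1,2) x(1,2)]]
          assoc[OF r' r p(1)] assoc[OF r' r p(2)] by simp
    qed
    have gp: "g z1 z2 ** p1 : hom A pq (VHom D (under z1, under z2))" "g z0 z1 ** p2 : hom A pq (VHom D (under z0, under z1))"
      by (rule comp_hom[OF p(1) g[OF z(2,3)]], rule comp_hom[OF p(2) g[OF z(1,2)]])
    have ex: "\<exists>s1 s0. lft r (u r) x0 x1 x2 q s1 s0"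
      if r: "r : hom A q pq" and x: "x0 : VObj C" "x1 : VObj C" "x2 : VObj C"
        "vf_obj F x0 = under z0" "vf_obj F x1 = under z1" "vf_obj F x2 = under z2"
        and t: "t1 : hom A q (VHom C (x1, x2))" "t0 : hom A q (VHom C (x0, x1))"
        and e: "vf_hom F (x1, x2) ** t1 = (g z1 z2 ** p1) ** r" "vf_hom F (x0, x1) ** t0 = (g z0 z1 ** p2) ** r" for r q x0 x1 x2 t1 t0
    proof -
      have m: "mt x0 z0" "mt x1 z1" "mt x2 z2" using xmt x z by simp_all
      obtain s1 where s1: "s1 : hom A q (VHom W (X x1 z1, X x2 z2))" "\<kappa> z1 z2 (x1, x2) ** s1 = p1 ** r"
        using klift[OF z(2,3) m(2,3) comp_hom[OF r p(1)] t(1)] e(1) assoc[OF r p(1) g[OF z(2,3)]] by auto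
      obtain s0 where s0: "s0 : hom A q (VHom W (X x0 z0, X x1 z1))" "\<kappa> z0 z1 (x0, x1) ** s0 = p2 ** r"
        using klift[OF z(1,2) m(1,2) comp_hom[OF r p(2)] t(2)] e(2) assoc[OF r p(2) g[OF z(1,2)]] by auto
      have L: "lft r (\<kappa> z0 z2 (x0, x2) ** cmp W (X x0 z0) (X x1 z1) (X x2 z2) s1 s0) x0 x1 x2 q s1 s0"
        unfolding lft_def using m s1 s0 by simp
      show ?thesis unfolding u[OF L] by (intro exI) (rule L)
    qed
    obtain m where m: "m : hom A pq (H z0 z2)"
      and mu: "\<And>q r x0 x1 x2 t1 t0. r : hom A q pq ==> x0 : VObj C ==> x1 : VObj C ==> x2 : VObj C ==>
      vf_obj F x0 = under z0 ==> vf_obj F x1 = under z1 ==> vf_obj F x2 = under z2 ==>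
      t1 : hom A q (VHom C (x1, x2)) ==> t0 : hom A q (VHom C (x0, x1)) ==>
      vf_hom F (x1, x2) ** t1 = (g z1 z2 ** p1) ** r ==> vf_hom F (x0, x1) ** t0 = (g z0 z1 ** p2) ** r ==> m ** r = u r"
    proof (rule glue2[OF orbitsD(2)[OF z(1)] orbitsD(2)[OF z(2)] orbitsD(2)[OF z(3)] gp Ho[OF z(1,3)]])
      fix q r x0 x1 x2 t1 t0 assume r: "r : hom A q pq" and x: "x0 : VObj C" "x1 : VObj C" "x2 : VObj C"
        "vf_obj F x0 = under z0" "vf_obj F x1 = under z1" "vf_obj F x2 = under z2"
        and t: "t1 : hom A q (VHom C (x1, x2))" "t0 : hom A q (VHom C (x0, x1))"
        and e: "vf_hom F (x1, x2) ** t1 = (g z1 z2 ** p1) ** r" "vf_hom F (x0, x1) ** t0 = (g z0 z1 ** p2) ** r"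
      obtain s1 s0 where L: "lft r (u r) x0 x1 x2 q s1 s0" using ex[OF r x t e] by blast
      then have xm: "mt x0 z0" "mt x1 z1" "mt x2 z2" and s: "s1 : hom A q (VHom W (X x1 z1, X x2 z2))" "s0 : hom A q (VHom W (X x0 z0, X x1 z1))"
        and v: "u r = \<kappa> z0 z2 (x0, x2) ** cmp W (X x0 z0) (X x1 z1) (X x2 z2) s1 s0" unfolding lft_def by simp_all
      have "u r : hom A q (H z0 z2)"
        unfolding v by (rule kel(1)[OF z(1,3) xm(1,3) cmp_hom[OF W_vcat(1) fX(2)[OF xm(1)] fX(2)[OF xm(2)] fX(2)[OF xm(3)] s]])
      moreover have "u (r ** r') = u r ** r'" if "r' : hom A q' q" for q' r' by (rule u[OF Lnat[OF L r that]])
      ultimately show "u r : hom A q (H z0 z2) \<and> (\<forall>q' r'. r' : hom A q' q --> u (r ** r') = u r ** r')" by blast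
    qed (rule that)
    have "m ** pairing A (\<kappa> z1 z2 (x1, x2) ** s1) (\<kappa> z0 z1 (x0, x1) ** s0) = \<kappa> z0 z2 (x0, x2) ** cmp W (X x0 z0) (X x1 z1) (X x2 z2) s1 s0"
      if x: "mt x0 z0" "mt x1 z1" "mt x2 z2" and s: "s1 : hom A q (VHom W (X x1 z1, X x2 z2))" "s0 : hom A q (VHom W (X x0 z0, X x1 z1))" for x0 x1 x2 q s1 s0
    proof -
      note k1 = kel[OF z(2,3) x(2,3) s(1)] and k0 = kel[OF z(1,2) x(1,2) s(2)]
      define r where "r = pairing A (\<kappa> z1 z2 (x1, x2) ** s1) (\<kappa> z0 z1 (x0, x1) ** s0)"
      have r: "r : hom A q pq" using homE[OF k1(1)] homE[OF k0(1)] by (simp add: r_def pq_def hom_def)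
      have pr: "p1 ** r = \<kappa> z1 z2 (x1, x2) ** s1" "p2 ** r = \<kappa> z0 z1 (x0, x1) ** s0"
        using homE[OF k1(1)] homE[OF k0(1)] by (simp_all add: r_def p1_def p2_def)
      have L: "lft r (\<kappa> z0 z2 (x0, x2) ** cmp W (X x0 z0) (X x1 z1) (X x2 z2) s1 s0) x0 x1 x2 q s1 s0"
        unfolding lft_def using x s pr by simp
      have "m ** r = u r"
        by (rule mu[OF r _ _ _ _ _ _ k1(2) k0(2)])
          (use x k1(3) k0(3) pr assoc[OF r p(1) g[OF z(2,3)]] assoc[OF r p(2) g[OF z(1,2)]] in \<open>simp_all add: mt_under\<close>)
      then show ?thesis unfolding u[OF L] by (simp add: r_def)
    qed
    then show ?thesis using m unfolding Mp_def pq_def by blast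
  qed
  then obtain M where MMp: "\<And>z0 z1 z2. z0 : orbits ==> z1 : orbits ==> z2 : orbits ==> Mp z0 z1 z2 (M z0 z1 z2)" by metis
  have M: "M z0 z1 z2 : hom A (prod_obj A (H z1 z2) (H z0 z1)) (H z0 z2)" if "z0 : orbits" "z1 : orbits" "z2 : orbits" for z0 z1 z2
    using MMp[OF that] unfolding Mp_def by blast
  have Mk: "M z0 z1 z2 ** pairing A (\<kappa> z1 z2 (x1, x2) ** s1) (\<kappa> z0 z1 (x0, x1) ** s0) = \<kappa> z0 z2 (x0, x2) ** cmp W (X x0 z0) (X x1 z1) (X x2 z2) s1 s0"
    if "z0 : orbits" "z1 : orbits" "z2 : orbits" "mt x0 z0" "mt x1 z1" "mt x2 z2" "s1 : hom A q (VHom W (X x1 z1, X x2 z2))"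
      "s0 : hom A q (VHom W (X x0 z0, X x1 z1))" for z0 z1 z2 x0 x1 x2 s1 s0 q
    using MMp[OF that(1-3)] that(4-) unfolding Mp_def by blast
  have Mel: "M z0 z1 z2 ** pairing A a b : hom A q (H z0 z2)" if "z0 : orbits" "z1 : orbits" "z2 : orbits"
    "a : hom A q (H z1 z2)" "b : hom A q (H z0 z1)" for z0 z1 z2 a b q
    using homE[OF M[OF that(1-3)]] homE[OF that(4)] homE[OF that(5)] by (simp add: hom_def)
  have Mr: "(M z0 z1 z2 ** pairing A a b) ** r = M z0 z1 z2 ** pairing A (a ** r) (b ** r)" if "z0 : orbits" "z1 : orbits" "z2 : orbits"
    "a : hom A q (H z1 z2)" "b : hom A q (H z0 z1)" "r : hom A q' q" for z0 z1 z2 a b q r q'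
    using homE[OF M[OF that(1-3)]] homE[OF that(4)] homE[OF that(5)] homE[OF that(6)] by simp
  define U where "U z = \<kappa> z z (vf_obj f z, vf_obj f z) ** VUnit W z" for z
  have kz: "\<kappa> z z (vf_obj f z, vf_obj f z) : hom A (VHom W (z, z)) (H z z)" if z: "z : orbits" for z
    using k[OF z z mtz[OF z] mtz[OF z]] orbits_X_f[OF z] by simp
  have U: "U z : hom A (unit_obj A) (H z z)" if z: "z : orbits" for z
    unfolding U_def by (rule comp_hom[OF vcat_unit[OF W_vcat(1) orbitsD(1)[OF z]] kz[OF z]])
  have Ub: "U z ** bang q = \<kappa> z z (x, x) ** un W (X x z) q" if z: "z : orbits" and q: "q : Obj A" and x: "mt x z" for z q x
  proof -
    have b: "bang q : hom A q (unit_obj A)" using q by (simp add: hom_def)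
    note zW = orbitsD(1)[OF z]
    have "U z ** bang q = \<kappa> z z (vf_obj f z, vf_obj f z) ** un W z q"
      unfolding U_def un_def by (rule assoc[OF b vcat_unit[OF W_vcat(1) zW] kz[OF z]])
    also have "\<dots> = \<kappa> z z (x, x) ** Xh x z x z (un C x q) (un W z q)"
      using kact[OF z z x x mtz[OF z] mtz[OF z], of q "un C x q" "un W z q"] me_un[OF x q] orbits_X_f[OF z] by simp
    also have "\<dots> = \<kappa> z z (x, x) ** un W (X x z) q" unfolding Xh_un[OF x q] ..
    finally show ?thesis .
  qed
  have Uel: "U z ** bang q : hom A q (H z z)" if "z : orbits" "q : Obj A" for z q
    using homE[OF U[OF that(1)]] that(2) by (simp add: hom_def)
  have klift': "\<exists>s. s : hom A q' (VHom W (X x0 z0, X x1 z1)) \<and> \<kappa> z0 z1 (x0, x1) ** s = a ** r"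
    if z: "z0 : orbits" "z1 : orbits" and a: "a : hom A q (H z0 z1)" and r: "r : hom A q' q" and x: "x0 : VObj C" "x1 : VObj C"
      "vf_obj F x0 = under z0" "vf_obj F x1 = under z1" and t: "t : hom A q' (VHom C (x0, x1))" and e: "vf_hom F (x0, x1) ** t = (g z0 z1 ** a) ** r"
    for z0 z1 a q r q' x0 x1 t
    using klift[OF z xmt[OF x(1,3) z(1)] xmt[OF x(2,4) z(2)] comp_hom[OF r a] t] e assoc[OF r a g[OF z]] by auto
  define Z where "Z = mk_vcat orbits H U M"
  have Zobj: "Z : Obj vc"
    unfolding Z_def
  proof (rule mk_vcat_obj[OF _ Ho U M])
    show "small orbits" by (rule small_subset[OF W_vcat(2)]) (auto simp: orbits_def)
  next
    fix z0 z1 z2 z3 q a b c assume z: "z0 : orbits" "z1 : orbits" "z2 : orbits" "z3 : orbits"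
      and abc: "a : hom A q (H z2 z3)" "b : hom A q (H z1 z2)" "c : hom A q (H z0 z1)"
    note ab = Mel[OF z(2,3,4) abc(1,2)] and bc = Mel[OF z(1,2,3) abc(2,3)]
    show "M z0 z1 z3 ** pairing A (M z1 z2 z3 ** pairing A a b) c = M z0 z2 z3 ** pairing A a (M z0 z1 z2 ** pairing A b c)"
    proof (rule local3[OF orbitsD(2)[OF z(1)] orbitsD(2)[OF z(2)] orbitsD(2)[OF z(3)] orbitsD(2)[OF z(4)]
          comp_hom[OF abc(1) g[OF z(3,4)]] comp_hom[OF abc(2) g[OF z(2,3)]] comp_hom[OF abc(3) g[OF z(1,2)]]
          Mel[OF z(1,2,4) ab abc(3)] Mel[OF z(1,3,4) abc(1) bc]])
      fix q' r x0 x1 x2 x3 t2 t1 t0 assume r: "r : hom A q' q"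
        and x: "x0 : VObj C" "x1 : VObj C" "x2 : VObj C" "x3 : VObj C"
        and Fx: "vf_obj F x0 = under z0" "vf_obj F x1 = under z1" "vf_obj F x2 = under z2" "vf_obj F x3 = under z3"
        and t: "t2 : hom A q' (VHom C (x2, x3))" "t1 : hom A q' (VHom C (x1, x2))" "t0 : hom A q' (VHom C (x0, x1))"
        and e: "vf_hom F (x2, x3) ** t2 = (g z2 z3 ** a) ** r" "vf_hom F (x1, x2) ** t1 = (g z1 z2 ** b) ** r"
          "vf_hom F (x0, x1) ** t0 = (g z0 z1 ** c) ** r"
      note m = xmt[OF x(1) Fx(1) z(1)] xmt[OF x(2) Fx(2) z(2)] xmt[OF x(3) Fx(3) z(3)] xmt[OF x(4) Fx(4) z(4)]
      note XW = fX(2)[OF m(1)] fX(2)[OF m(2)] fX(2)[OF m(3)] fX(2)[OF m(4)]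
      obtain s2 where s2: "s2 : hom A q' (VHom W (X x2 z2, X x3 z3))" "\<kappa> z2 z3 (x2, x3) ** s2 = a ** r"
        using klift'[OF z(3,4) abc(1) r x(3,4) Fx(3,4) t(1) e(1)] by blast
      obtain s1 where s1: "s1 : hom A q' (VHom W (X x1 z1, X x2 z2))" "\<kappa> z1 z2 (x1, x2) ** s1 = b ** r"
        using klift'[OF z(2,3) abc(2) r x(2,3) Fx(2,3) t(2) e(2)] by blast
      obtain s0 where s0: "s0 : hom A q' (VHom W (X x0 z0, X x1 z1))" "\<kappa> z0 z1 (x0, x1) ** s0 = c ** r"
        using klift'[OF z(1,2) abc(3) r x(1,2) Fx(1,2) t(3) e(3)] by blast
      have L: "(M z0 z1 z3 ** pairing A (M z1 z2 z3 ** pairing A a b) c) ** r =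
        \<kappa> z0 z3 (x0, x3) ** cmp W (X x0 z0) (X x1 z1) (X x3 z3) (cmp W (X x1 z1) (X x2 z2) (X x3 z3) s2 s1) s0"
        unfolding Mr[OF z(1,2,4) ab abc(3) r] Mr[OF z(2,3,4) abc(1,2) r] s2(2)[symmetric] s1(2)[symmetric] s0(2)[symmetric]
          Mk[OF z(2,3,4) m(2,3,4) s2(1) s1(1)]
        by (rule Mk[OF z(1,2,4) m(1,2,4) cmp_hom[OF W_vcat(1) XW(2,3,4) s2(1) s1(1)] s0(1)])
      have R: "(M z0 z2 z3 ** pairing A a (M z0 z1 z2 ** pairing A b c)) ** r =
        \<kappa> z0 z3 (x0, x3) ** cmp W (X x0 z0) (X x2 z2) (X x3 z3) s2 (cmp W (X x0 z0) (X x1 z1) (X x2 z2) s1 s0)"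
        unfolding Mr[OF z(1,3,4) abc(1) bc r] Mr[OF z(1,2,3) abc(2,3) r] s2(2)[symmetric] s1(2)[symmetric] s0(2)[symmetric]
          Mk[OF z(1,2,3) m(1,2,3) s1(1) s0(1)]
        by (rule Mk[OF z(1,3,4) m(1,3,4) s2(1) cmp_hom[OF W_vcat(1) XW(1,2,3) s1(1) s0(1)]])
      show "(M z0 z1 z3 ** pairing A (M z1 z2 z3 ** pairing A a b) c) ** r = (M z0 z2 z3 ** pairing A a (M z0 z1 z2 ** pairing A b c)) ** r"
        unfolding L R cmp_assoc[OF W_vcat(1) XW s2(1) s1(1) s0(1)] ..
    qed
  next
    fix z0 z1 q a assume z: "z0 : orbits" "z1 : orbits" and a: "a : hom A q (H z0 z1)"
    have q: "q : Obj A" using homE[OF a] by simp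
    note u0 = Uel[OF z(1) q] and u1 = Uel[OF z(2) q]
    have br: "(U z ** bang q) ** r = U z ** bang q'" if "z : orbits" "r : hom A q' q" for z r q'
      using homE[OF U[OF that(1)]] homE[OF that(2)] by simp
    show "M z0 z1 z1 ** pairing A (U z1 ** bang q) a = a"
    proof (rule local1[OF orbitsD(2)[OF z(1)] orbitsD(2)[OF z(2)] comp_hom[OF a g[OF z]] Mel[OF z(1,2,2) u1 a] a])
      fix q' r x0 x1 t assume r: "r : hom A q' q" and x: "x0 : VObj C" "x1 : VObj C" "vf_obj F x0 = under z0" "vf_obj F x1 = under z1"
        and t: "t : hom A q' (VHom C (x0, x1))" and e: "vf_hom F (x0, x1) ** t = (g z0 z1 ** a) ** r"
      note m = xmt[OF x(1,3) z(1)] xmt[OF x(2,4) z(2)]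
      have qo: "q' : Obj A" using homE[OF r] by simp
      obtain s where s: "s : hom A q' (VHom W (X x0 z0, X x1 z1))" "\<kappa> z0 z1 (x0, x1) ** s = a ** r" using klift'[OF z a r x t e] by blast
      have "(M z0 z1 z1 ** pairing A (U z1 ** bang q) a) ** r =
        \<kappa> z0 z1 (x0, x1) ** cmp W (X x0 z0) (X x1 z1) (X x1 z1) (un W (X x1 z1) q') s"
        unfolding Mr[OF z(1,2,2) u1 a r] br[OF z(2) r] Ub[OF z(2) qo m(2)] s(2)[symmetric]
        by (rule Mk[OF z(1,2,2) m(1,2,2) un_hom[OF W_vcat(1) fX(2)[OF m(2)]] s(1)]) (rule qo)
      then show "(M z0 z1 z1 ** pairing A (U z1 ** bang q) a) ** r = a ** r"
        unfolding cmp_unit(1)[OF W_vcat(1) fX(2)[OF m(1)] fX(2)[OF m(2)] s(1)] s(2) .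
    qed
    show "M z0 z0 z1 ** pairing A a (U z0 ** bang q) = a"
    proof (rule local1[OF orbitsD(2)[OF z(1)] orbitsD(2)[OF z(2)] comp_hom[OF a g[OF z]] Mel[OF z(1,1,2) a u0] a])
      fix q' r x0 x1 t assume r: "r : hom A q' q" and x: "x0 : VObj C" "x1 : VObj C" "vf_obj F x0 = under z0" "vf_obj F x1 = under z1"
        and t: "t : hom A q' (VHom C (x0, x1))" and e: "vf_hom F (x0, x1) ** t = (g z0 z1 ** a) ** r"
      note m = xmt[OF x(1,3) z(1)] xmt[OF x(2,4) z(2)]
      have qo: "q' : Obj A" using homE[OF r] by simp
      obtain s where s: "s : hom A q' (VHom W (X x0 z0, X x1 z1))" "\<kappa> z0 z1 (x0, x1) ** s = a ** r" using klift'[OF z a r x t e] by blast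
      have "(M z0 z0 z1 ** pairing A a (U z0 ** bang q)) ** r =
        \<kappa> z0 z1 (x0, x1) ** cmp W (X x0 z0) (X x0 z0) (X x1 z1) s (un W (X x0 z0) q')"
        unfolding Mr[OF z(1,1,2) a u0 r] br[OF z(1) r] Ub[OF z(1) qo m(1)] s(2)[symmetric]
        by (rule Mk[OF z(1,1,2) m(1,1,2) s(1) un_hom[OF W_vcat(1) fX(2)[OF m(1)]]]) (rule qo)
      then show "(M z0 z0 z1 ** pairing A a (U z0 ** bang q)) ** r = a ** r"
        unfolding cmp_unit(2)[OF W_vcat(1) fX(2)[OF m(1)] fX(2)[OF m(2)] s(1)] s(2) .
    qed
  qed
  have Zs: "VObj Z = orbits" "z0 : orbits ==> z1 : orbits ==> VHom Z (z0, z1) = H z0 z1"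
    "z0 : orbits ==> z1 : orbits ==> z2 : orbits ==> cmp Z z0 z1 z2 a b = M z0 z1 z2 ** pairing A a b"
    "z0 : orbits ==> un Z z0 q = U z0 ** bang q" for z0 z1 z2 a b q
    by (simp_all add: Z_def)
  define G where "G = mk_vfunctor Z D under g"
  have G: "G : Arr vc"
    unfolding G_def
  proof (rule mk_vfunctor_arr[OF Zobj D_vcat(3)])
    fix z q assume "z : VObj Z" and q: "q : Obj A"
    then have z: "z : orbits" by (simp add: Zs)
    note fz = mtz[OF z] and zW = orbitsD(1)[OF z]
    have un: "un W (X (vf_obj f z) z) q : hom A q (VHom W (X (vf_obj f z) z, X (vf_obj f z) z))"
      by (rule un_hom[OF W_vcat(1) fX(2)[OF fz] q])
    have "g z z ** un Z z q = vf_hom F (vf_obj f z, vf_obj f z) ** vf_hom f (z, z) ** un W z q"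
      using kel(3)[OF z z fz fz un] Ub[OF z q fz] orbits_X_f[OF z] Zs(4)[OF z] by simp
    also have "\<dots> = un D (under z) q"
      using vf_arr_un[OF f, of z q] F_un[OF f_obj[OF zW] q] zW q by (simp add: under_def)
    finally show "g z z ** un Z z q = un D (under z) q" .
  next
    fix z0 z1 z2 q a b assume z': "z0 : VObj Z" "z1 : VObj Z" "z2 : VObj Z"
      and ab': "a : hom A q (VHom Z (z1, z2))" "b : hom A q (VHom Z (z0, z1))"
    then have z: "z0 : orbits" "z1 : orbits" "z2 : orbits" and ab: "a : hom A q (H z1 z2)" "b : hom A q (H z0 z1)"
      by (simp_all add: Zs)
    note y = orbitsD(2)[OF z(1)] orbitsD(2)[OF z(2)] orbitsD(2)[OF z(3)]
    note ga = comp_hom[OF ab(1) g[OF z(2,3)]] and gb = comp_hom[OF ab(2) g[OF z(1,2)]] and Mab = Mel[OF z ab]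
    have "g z0 z2 ** M z0 z1 z2 ** pairing A a b = cmp D (under z0) (under z1) (under z2) (g z1 z2 ** a) (g z0 z1 ** b)"
    proof (rule local2[OF y ga gb comp_hom[OF Mab g[OF z(1,3)]] cmp_hom[OF D_vcat(1) y ga gb]])
      fix q' r x0 x1 x2 t1 t0 assume r: "r : hom A q' q" and x: "x0 : VObj C" "x1 : VObj C" "x2 : VObj C"
        and Fx: "vf_obj F x0 = under z0" "vf_obj F x1 = under z1" "vf_obj F x2 = under z2"
        and t: "t1 : hom A q' (VHom C (x1, x2))" "t0 : hom A q' (VHom C (x0, x1))"
        and e: "vf_hom F (x1, x2) ** t1 = (g z1 z2 ** a) ** r" "vf_hom F (x0, x1) ** t0 = (g z0 z1 ** b) ** r"
      note m = xmt[OF x(1) Fx(1) z(1)] xmt[OF x(2) Fx(2) z(2)] xmt[OF x(3) Fx(3) z(3)]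
      note XW = fX(2)[OF m(1)] fX(2)[OF m(2)] fX(2)[OF m(3)]
      obtain s1 where s1: "s1 : hom A q' (VHom W (X x1 z1, X x2 z2))" "\<kappa> z1 z2 (x1, x2) ** s1 = a ** r"
        using klift'[OF z(2,3) ab(1) r x(2,3) Fx(2,3) t(1) e(1)] by blast
      obtain s0 where s0: "s0 : hom A q' (VHom W (X x0 z0, X x1 z1))" "\<kappa> z0 z1 (x0, x1) ** s0 = b ** r"
        using klift'[OF z(1,2) ab(2) r x(1,2) Fx(1,2) t(2) e(2)] by blast
      note k1 = kel[OF z(2,3) m(2,3) s1(1)] and k0 = kel[OF z(1,2) m(1,2) s0(1)]
      note kc = kel[OF z(1,3) m(1,3) cmp_hom[OF W_vcat(1) XW s1(1) s0(1)]]
      have "(g z0 z2 ** M z0 z1 z2 ** pairing A a b) ** r = g z0 z2 ** (M z0 z1 z2 ** pairing A a b) ** r"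
        by (rule assoc[OF r Mab g[OF z(1,3)]])
      also have "\<dots> = g z0 z2 ** \<kappa> z0 z2 (x0, x2) ** cmp W (X x0 z0) (X x1 z1) (X x2 z2) s1 s0"
        unfolding Mr[OF z ab r] s1(2)[symmetric] s0(2)[symmetric] Mk[OF z m s1(1) s0(1)] ..
      also have "\<dots> = vf_hom F (x0, x2) ** vf_hom f (X x0 z0, X x2 z2) ** cmp W (X x0 z0) (X x1 z1) (X x2 z2) s1 s0" by (rule kc(3))
      also have "vf_hom f (X x0 z0, X x2 z2) ** cmp W (X x0 z0) (X x1 z1) (X x2 z2) s1 s0 =
        cmp C x0 x1 x2 (vf_hom f (X x1 z1, X x2 z2) ** s1) (vf_hom f (X x0 z0, X x1 z1) ** s0)"
        using vf_arr_cmp[OF f, of "X x0 z0" "X x1 z1" "X x2 z2" s1 q' s0] XW s1(1) s0(1) fX(1)[OF m(1)] fX(1)[OF m(2)] fX(1)[OF m(3)] by simp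
      also have "vf_hom F (x0, x2) ** \<dots> = cmp D (under z0) (under z1) (under z2)
          (vf_hom F (x1, x2) ** vf_hom f (X x1 z1, X x2 z2) ** s1) (vf_hom F (x0, x1) ** vf_hom f (X x0 z0, X x1 z1) ** s0)"
        using F_cmp[OF x k1(2) k0(2)] Fx by simp
      also have "\<dots> = cmp D (under z0) (under z1) (under z2) (g z1 z2 ** a ** r) (g z0 z1 ** b ** r)"
        using k1(3) k0(3) s1(2) s0(2) by simp
      also have "\<dots> = cmp D (under z0) (under z1) (under z2) (g z1 z2 ** a) (g z0 z1 ** b) ** r"
        unfolding cmp_comp[OF D_vcat(1) y ga gb r] assoc[OF r ab(1) g[OF z(2,3)]] assoc[OF r ab(2) g[OF z(1,2)]] ..
      finally show "(g z0 z2 ** M z0 z1 z2 ** pairing A a b) ** r = cmp D (under z0) (under z1) (under z2) (g z1 z2 ** a) (g z0 z1 ** b) ** r" .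
    qed
    then show "g z0 z2 ** cmp Z z0 z1 z2 a b = cmp D (under z0) (under z1) (under z2) (g z1 z2 ** a) (g z0 z1 ** b)"
      using z by (simp add: Zs)
  qed (use g orbitsD in \<open>simp_all add: Zs\<close>)
  define kw where "kw w0 w1 = \<kappa> (orbit w0) (orbit w1) (vf_obj f w0, vf_obj f w1)" for w0 w1
  have mto: "mt (vf_obj f w) (orbit w)" if "w : VObj W" for w
    using orbit_in[OF that] orbitsD(1)[OF orbit_in(1)[OF that]] that f_obj[OF that] by (simp add: mt_under under_def)
  have kw: "kw w0 w1 : hom A (VHom W (w0, w1)) (H (orbit w0) (orbit w1))" if "w0 : VObj W" "w1 : VObj W" for w0 w1
    using k[OF orbit_in(1)[OF that(1)] orbit_in(1)[OF that(2)] mto[OF that(1)] mto[OF that(2)]] X_orbit that by (simp add: kw_def)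
  define K where "K = mk_vfunctor W Z orbit kw"
  have K: "K : Arr vc"
    unfolding K_def
  proof (rule mk_vfunctor_arr[OF W_vcat(3) Zobj])
    fix w q assume w: "w : VObj W" and q: "q : Obj A"
    show "kw w w ** un W w q = un Z (orbit w) q"
      using Ub[OF orbit_in(1)[OF w] q mto[OF w]] X_orbit[OF w] orbit_in(1)[OF w] by (simp add: kw_def Zs)
  next
    fix w0 w1 w2 q a b assume w: "w0 : VObj W" "w1 : VObj W" "w2 : VObj W"
      and ab: "a : hom A q (VHom W (w1, w2))" "b : hom A q (VHom W (w0, w1))"
    note o = orbit_in(1)[OF w(1)] orbit_in(1)[OF w(2)] orbit_in(1)[OF w(3)]
    note m = mto[OF w(1)] mto[OF w(2)] mto[OF w(3)]
    note X = X_orbit[OF w(1)] X_orbit[OF w(2)] X_orbit[OF w(3)]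
    show "kw w0 w2 ** cmp W w0 w1 w2 a b = cmp Z (orbit w0) (orbit w1) (orbit w2) (kw w1 w2 ** a) (kw w0 w1 ** b)"
      using Mk[OF o m, unfolded X, OF ab] o by (simp add: kw_def Zs)
  qed (use kw orbit_in in \<open>simp_all add: Zs\<close>)
  have Gs: "vf_dom G = Z" "vf_cod G = D" "z : orbits ==> vf_obj G z = under z" "z : orbits ==> z' : orbits ==> vf_hom G (z, z') = g z z'" for z z'
    by (simp_all add: G_def Zs(1))
  have Ks: "vf_dom K = W" "vf_cod K = Z" "w : VObj W ==> vf_obj K w = orbit w" "w : VObj W ==> w' : VObj W ==> vf_hom K (w, w') = kw w w'" for w w'
    by (simp_all add: K_def)
  have pbw: "is_pullback A (vf_hom F (vf_obj f w0, vf_obj f w1)) (g (orbit w0) (orbit w1)) (vf_hom f (w0, w1)) (kw w0 w1)"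
    if "w0 : VObj W" "w1 : VObj W" for w0 w1
    using pb[OF orbit_in(1)[OF that(1)] orbit_in(1)[OF that(2)] mto[OF that(1)] mto[OF that(2)]] X_orbit that by (simp add: kw_def)
  have "strict_pullback F G f K"
    unfolding strict_pullback_def
  proof (intro conjI ballI impI F G f K)
    show "vf_cod F = vf_cod G" "vf_dom f = vf_dom K" "vf_cod f = vf_dom F" "vf_cod K = vf_dom G" using Gs Ks by simp_all
    have 1: "Comp vc F f : Arr vc" "Comp vc G K : Arr vc"
      using VC.arr_comp[OF f F] VC.arr_comp[OF K G] Gs Ks by simp_all
    show "Comp vc F f = Comp vc G K"
      by (rule vf_eqI[OF 1])
        (use Gs Ks orbit_in pullback_arrs(9)[OF pbw] in \<open>simp_all add: vf_comp_obj vf_comp_hom under_def\<close>)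
    fix c z assume c: "c : VObj (vf_dom F)" and z': "z : VObj (vf_dom G)" and e: "vf_obj F c = vf_obj G z"
    then have z: "z : orbits" using Gs(1) Zs(1) by simp
    then have m: "mt c z" using c e Gs(3)[OF z] xmt[of c z] by simp
    show "\<exists>!e. e : VObj (vf_dom f) \<and> vf_obj f e = c \<and> vf_obj K e = z"
    proof (rule ex1I[of _ "X c z"])
      show "X c z : VObj (vf_dom f) \<and> vf_obj f (X c z) = c \<and> vf_obj K (X c z) = z"
        using fX[OF m] Ks(3) orbit_X[OF m] orbit_id[OF z] by simp
      fix w assume "w : VObj (vf_dom f) \<and> vf_obj f w = c \<and> vf_obj K w = z"
      then show "w = X c z" using X_orbit[of w] Ks(3)[of w] by simp
    qed
  next
    fix w0 w1 assume "w0 : VObj (vf_dom f)" "w1 : VObj (vf_dom f)"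
    then have w: "w0 : VObj W" "w1 : VObj W" by simp_all
    show "is_pullback A (vf_hom F (vf_obj f w0, vf_obj f w1)) (vf_hom G (vf_obj K w0, vf_obj K w1)) (vf_hom f (w0, w1)) (vf_hom K (w0, w1))"
      using pbw[OF w] Gs(4)[OF orbit_in(1)[OF w(1)] orbit_in(1)[OF w(2)]] Ks(3)[OF w(1)] Ks(3)[OF w(2)] Ks(4)[OF w] by simp
  qed
  moreover have "vf_obj K (X c w) = vf_obj K w" if m: "mt c w" for c w
    using Ks(3) fX(2)[OF m] orbit_X[OF m] m by (simp add: mt_def)
  moreover have "vf_hom K (X c0 w0, X c1 w1) ** Xh c0 w0 c1 w1 t s = vf_hom K (w0, w1) ** s" if m: "me c0 w0 c1 w1 q t s" for c0 w0 c1 w1 q t s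
  proof -
    have c: "mt c0 w0" "mt c1 w1" using m unfolding me_def by simp_all
    have w: "w0 : VObj W" "w1 : VObj W" using c unfolding mt_def by simp_all
    have co: "mt c0 (orbit w0)" "mt c1 (orbit w1)"
      using c orbit_in[OF w(1)] orbit_in[OF w(2)] orbitsD(1) by (simp_all add: mt_under)
    have "\<kappa> (orbit w0) (orbit w1) (c0, c1) ** Xh c0 (X (vf_obj f w0) (orbit w0)) c1 (X (vf_obj f w1) (orbit w1)) t s =
      \<kappa> (orbit w0) (orbit w1) (vf_obj f w0, vf_obj f w1) ** s"
      by (rule kact[OF orbit_in(1)[OF w(1)] orbit_in(1)[OF w(2)] co mto[OF w(1)] mto[OF w(2)]]) (use m X_orbit w in simp)
    then show ?thesis
      using Ks(4)[OF fX(2)[OF c(1)] fX(2)[OF c(2)]] Ks(4)[OF w] fX(1)[OF c(1)] fX(1)[OF c(2)] orbit_X[OF c(1)] orbit_X[OF c(2)] X_orbit w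
      by (simp add: kw_def)
  qed
  ultimately show ?thesis by blast
qed

end

context covering_vfunctor
begin

lemma F_actions_effective: "VC.actions_effective F"
  unfolding VC.actions_effective_def
proof (intro allI impI)
  fix f \<alpha> assume act: "VC.action F f \<alpha>"
  note a = VC.actionD[OF act]
  define W where "W = vf_dom f"
  have fA: "f : Arr vc" and fd: "vf_dom f = W" "vf_cod f = C" using a(1,2) by (simp_all add: W_def)
  define Ff where "Ff = Comp vc F f"
  have FfA: "Ff : Arr vc" and Ffd: "vf_dom Ff = W" "vf_cod Ff = D"
    using VC.arr_comp[OF fA F] fd by (simp_all add: Ff_def)
  have spanI: "VC.span F Ff t s" if "t : Arr vc" "s : Arr vc" "vf_dom t = vf_dom s" "vf_cod t = C" "vf_cod s = W"
    "Comp vc F t = Comp vc Ff s" for t s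
    using that Ffd by (simp add: VC.span_def)
  obtain P R where sp: "strict_pullback F Ff P R" using strict_pullback_exists[OF F FfA] Ffd by auto
  note S = strict_pullbackD[OF sp]
  define E where "E = vf_dom P"
  have PR: "vf_dom P = E" "vf_dom R = E" "vf_cod P = C" "vf_cod R = W" using S(6-8) Ffd by (simp_all add: E_def)
  have Ev: "is_vcat A E" using vf_arrD(2)[OF S(3)] by (simp add: E_def)
  have sPR: "VC.span F Ff P R" by (rule spanI[OF S(3,4) _ _ _ S(9)]) (simp_all add: PR)
  define \<xi> where "\<xi> = \<alpha> P R"
  have \<xi>: "\<xi> : Arr vc" "vf_dom \<xi> = E" "vf_cod \<xi> = W" and f\<xi>: "Comp vc f \<xi> = P"
    using a(3)[OF sPR[unfolded Ff_def]] a(4)[OF sPR[unfolded Ff_def]] PR fd by (simp_all add: \<xi>_def hom_def)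
  have \<xi>m: "\<exists>m. m : Arr vc \<and> vf_dom m = vf_dom s \<and> vf_cod m = E \<and> Comp vc P m = t \<and> Comp vc R m = s \<and> \<alpha> t s = Comp vc \<xi> m"
    if ts: "VC.span F Ff t s" for t s
  proof -
    note T = VC.spanD[OF ts]
    have "t : hom vc (vf_dom s) (Dom vc F)" "s : hom vc (vf_dom s) (Dom vc Ff)" using T(1-5) by (simp_all add: hom_def)
    from VC.pullback_lift[OF strict_is_pullback[OF sp] this T(6)] obtain m
      where m: "m : hom vc (vf_dom s) (Dom vc P)" "Comp vc P m = t" "Comp vc R m = s" by blast
    have mA: "m : Arr vc" "vf_dom m = vf_dom s" "vf_cod m = E" using m(1) PR by (simp_all add: hom_def)
    have "\<alpha> (Comp vc P m) (Comp vc R m) = Comp vc \<xi> m"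
      unfolding \<xi>_def by (rule a(5)[OF sPR[unfolded Ff_def] mA(1)]) (use mA PR in simp)
    then show ?thesis using m mA by (auto simp: m(2,3))
  qed
  define mt where "mt c w \<longleftrightarrow> c : VObj C \<and> w : VObj W \<and> vf_obj F c = vf_obj F (vf_obj f w)" for c w
  define me where "me c0 w0 c1 w1 q t s \<longleftrightarrow> mt c0 w0 \<and> mt c1 w1 \<and> t : hom A q (VHom C (c0, c1)) \<and> s : hom A q (VHom W (w0, w1)) \<and>
      vf_hom F (c0, c1) ** t = vf_hom F (vf_obj f w0, vf_obj f w1) ** vf_hom f (w0, w1) ** s" for c0 w0 c1 w1 q t s
  define pt where "pt c w = (THE e. e : VObj E \<and> vf_obj P e = c \<and> vf_obj R e = w)" for c w
  have Ffo: "vf_obj Ff w = vf_obj F (vf_obj f w)" if "w : VObj W" for w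
    unfolding Ff_def by (rule vf_comp_obj) (simp add: fd that)
  have pt: "pt c w : VObj E" "vf_obj P (pt c w) = c" "vf_obj R (pt c w) = w" if "mt c w" for c w
  proof -
    have "\<exists>!e. e : VObj E \<and> vf_obj P e = c \<and> vf_obj R e = w"
      using S(10)[of c w] that Ffd Ffo unfolding mt_def by (simp add: PR)
    from theI'[OF this] show "pt c w : VObj E" "vf_obj P (pt c w) = c" "vf_obj R (pt c w) = w" by (simp_all add: pt_def)
  qed
  have pt_eq: "pt (vf_obj P e) (vf_obj R e) = e" if "e : VObj E" for e
    unfolding pt_def by (rule the_equality) (use strict_obj_eq[OF sp] that in \<open>auto simp: PR\<close>)
  have Po: "vf_obj P e : VObj C" "vf_obj R e : VObj W" "vf_obj \<xi> e : VObj W" if "e : VObj E" for e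
    using vf_arr_obj[OF S(3), of e] vf_arr_obj[OF S(4), of e] vf_arr_obj[OF \<xi>(1), of e] that PR \<xi> by simp_all
  have mtE: "mt (vf_obj P e) (vf_obj R e)" if "e : VObj E" for e
    using Po[OF that] vf_square_obj[OF S(9,6), of e] that Ffo[OF Po(2)[OF that]] PR by (simp add: mt_def)
  have Ph: "vf_hom P (e, e') ** h : hom A q (VHom C (vf_obj P e, vf_obj P e'))"
    "vf_hom R (e, e') ** h : hom A q (VHom W (vf_obj R e, vf_obj R e'))"
    "vf_hom \<xi> (e, e') ** h : hom A q (VHom W (vf_obj \<xi> e, vf_obj \<xi> e'))"
    if "e : VObj E" "e' : VObj E" "h : hom A q (VHom E (e, e'))" for e e' h q
    using vf_arr_el[OF S(3), of e e' h q] vf_arr_el[OF S(4), of e e' h q] vf_arr_el[OF \<xi>(1), of e e' h q] that PR \<xi> by simp_all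
  define X where "X c w = vf_obj \<xi> (pt c w)" for c w
  define Xh where "Xh c0 w0 c1 w1 t s = vf_hom \<xi> (pt c0 w0, pt c1 w1) **
    (SOME h. h : hom A (dom s) (VHom E (pt c0 w0, pt c1 w1)) \<and>
      vf_hom P (pt c0 w0, pt c1 w1) ** h = t \<and> vf_hom R (pt c0 w0, pt c1 w1) ** h = s)" for c0 w0 c1 w1 t s
  have XE: "X (vf_obj P e) (vf_obj R e) = vf_obj \<xi> e" if "e : VObj E" for e
    by (simp add: X_def pt_eq[OF that])
  have XhE: "Xh (vf_obj P e0) (vf_obj R e0) (vf_obj P e1) (vf_obj R e1) (vf_hom P (e0, e1) ** h) (vf_hom R (e0, e1) ** h) =
    vf_hom \<xi> (e0, e1) ** h" if e: "e0 : VObj E" "e1 : VObj E" and h: "h : hom A q (VHom E (e0, e1))" for e0 e1 h q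
  proof -
    have q: "dom (vf_hom R (e0, e1) ** h) = q" using homE[OF Ph(2)[OF e h]] by simp
    have "(SOME k. k : hom A q (VHom E (e0, e1)) \<and> vf_hom P (e0, e1) ** k = vf_hom P (e0, e1) ** h \<and>
      vf_hom R (e0, e1) ** k = vf_hom R (e0, e1) ** h) = h"
    proof (rule some_equality)
      fix k assume k: "k : hom A q (VHom E (e0, e1)) \<and> vf_hom P (e0, e1) ** k = vf_hom P (e0, e1) ** h \<and>
        vf_hom R (e0, e1) ** k = vf_hom R (e0, e1) ** h"
      show "k = h" by (rule strict_hom_eq[OF sp, of e0 e1 k q h]) (use k e h PR in simp_all)
    qed (use h in simp)
    then show ?thesis unfolding Xh_def pt_eq[OF e(1)] pt_eq[OF e(2)] q by simp
  qed
  have lft: "\<exists>h. h : hom A q (VHom E (pt c0 w0, pt c1 w1)) \<and> vf_hom P (pt c0 w0, pt c1 w1) ** h = t \<and>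
      vf_hom R (pt c0 w0, pt c1 w1) ** h = s \<and> Xh c0 w0 c1 w1 t s = vf_hom \<xi> (pt c0 w0, pt c1 w1) ** h"
    if m: "me c0 w0 c1 w1 q t s" for c0 w0 c1 w1 q t s
  proof -
    have mm: "mt c0 w0" "mt c1 w1" and ts: "t : hom A q (VHom C (c0, c1))" "s : hom A q (VHom W (w0, w1))"
      and e: "vf_hom F (c0, c1) ** t = vf_hom F (vf_obj f w0, vf_obj f w1) ** vf_hom f (w0, w1) ** s"
      using m unfolding me_def by simp_all
    note p0 = pt[OF mm(1)] and p1 = pt[OF mm(2)]
    have w: "w0 : VObj W" "w1 : VObj W" using mm by (simp_all add: mt_def)
    have "vf_hom Ff (w0, w1) ** s = vf_hom F (vf_obj f w0, vf_obj f w1) ** vf_hom f (w0, w1) ** s"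
      unfolding Ff_def by (rule vf_comp_el[OF fA F]) (use fd w ts in simp_all)
    then have e': "vf_hom F (c0, c1) ** t = vf_hom Ff (w0, w1) ** s" using e by simp
    obtain h where h: "h : hom A q (VHom E (pt c0 w0, pt c1 w1))" "vf_hom P (pt c0 w0, pt c1 w1) ** h = t"
      "vf_hom R (pt c0 w0, pt c1 w1) ** h = s"
      by (rule strict_lift[OF sp, of "pt c0 w0" "pt c1 w1" t q s]) (use p0 p1 ts e' PR Ffd in simp_all)
    show ?thesis using XhE[OF p0(1) p1(1) h(1)] h p0(2,3) p1(2,3) by auto
  qed
  have X_obj: "X c w : VObj W" "vf_obj f (X c w) = c" if "mt c w" for c w
  proof -
    note p = pt[OF that]
    show "X c w : VObj W" unfolding X_def by (rule Po(3)[OF p(1)])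
    show "vf_obj f (X c w) = c" unfolding X_def
      using vf_comp_obj[of "pt c w" \<xi> f] f\<xi> p \<xi>(2) by simp
  qed
  have Xh_hom: "Xh c0 w0 c1 w1 t s : hom A q (VHom W (X c0 w0, X c1 w1))"
    and Xh_over: "vf_hom f (X c0 w0, X c1 w1) ** Xh c0 w0 c1 w1 t s = t"
    and Xh_nat: "r : hom A q' q ==> Xh c0 w0 c1 w1 (t ** r) (s ** r) = Xh c0 w0 c1 w1 t s ** r"
    if m: "me c0 w0 c1 w1 q t s" for c0 w0 c1 w1 q t s r q'
  proof -
    have mm: "mt c0 w0" "mt c1 w1" using m unfolding me_def by simp_all
    note p0 = pt[OF mm(1)] and p1 = pt[OF mm(2)]
    obtain h where h: "h : hom A q (VHom E (pt c0 w0, pt c1 w1))" "vf_hom P (pt c0 w0, pt c1 w1) ** h = t"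
      "vf_hom R (pt c0 w0, pt c1 w1) ** h = s" "Xh c0 w0 c1 w1 t s = vf_hom \<xi> (pt c0 w0, pt c1 w1) ** h"
      using lft[OF m] by blast
    show "Xh c0 w0 c1 w1 t s : hom A q (VHom W (X c0 w0, X c1 w1))"
      unfolding h(4) X_def by (rule Ph(3)[OF p0(1) p1(1) h(1)])
    show "vf_hom f (X c0 w0, X c1 w1) ** Xh c0 w0 c1 w1 t s = t"
      unfolding h(4) X_def using vf_comp_el[OF \<xi>(1) fA, of "pt c0 w0" "pt c1 w1" h q] f\<xi> \<xi> fd p0(1) p1(1) h(1,2) by simp
    assume r: "r : hom A q' q"
    note hh = vf_arr_hom[OF S(3), of "pt c0 w0" "pt c1 w1"] vf_arr_hom[OF S(4), of "pt c0 w0" "pt c1 w1"] vf_arr_hom[OF \<xi>(1), of "pt c0 w0" "pt c1 w1"]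
    have HH: "vf_hom P (pt c0 w0, pt c1 w1) : hom A (VHom E (pt c0 w0, pt c1 w1)) (VHom C (c0, c1))"
      "vf_hom R (pt c0 w0, pt c1 w1) : hom A (VHom E (pt c0 w0, pt c1 w1)) (VHom W (w0, w1))"
      "vf_hom \<xi> (pt c0 w0, pt c1 w1) : hom A (VHom E (pt c0 w0, pt c1 w1)) (VHom W (X c0 w0, X c1 w1))"
      using hh p0 p1 PR \<xi> by (simp_all add: X_def)
    show "Xh c0 w0 c1 w1 (t ** r) (s ** r) = Xh c0 w0 c1 w1 t s ** r"
      using XhE[OF p0(1) p1(1) comp_hom[OF r h(1)]] p0(2,3) p1(2,3) h(2-4) assoc[OF r h(1) HH(1)] assoc[OF r h(1) HH(2)] assoc[OF r h(1) HH(3)]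
      by simp
  qed
  have WId: "Id vc W : Arr vc" "vf_dom (Id vc W) = W" "vf_cod (Id vc W) = W"
    using vfunctor_id[of W] vf_arrD[OF fA] fd by (simp_all add: VCat_simps(5))
  have "VC.span F Ff f (Id vc W)"
    by (rule spanI[OF fA WId(1)]) (use WId fd VC.id_right[of Ff W D] FfA Ffd in \<open>simp_all add: hom_def Ff_def\<close>)
  from \<xi>m[OF this] obtain m0 where m0: "m0 : Arr vc" "vf_dom m0 = W" "vf_cod m0 = E" "Comp vc P m0 = f" "Comp vc R m0 = Id vc W"
    and \<alpha>0: "\<alpha> f (Id vc W) = Comp vc \<xi> m0" using WId by auto
  have "\<alpha> (Comp vc f (Id vc W)) (Id vc W) = Id vc W" by (rule a(7)) (use WId fd in simp_all)
  moreover have "Comp vc f (Id vc W) = f" by (rule VC.id_right[of f W C]) (simp add: hom_def fA fd)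
  ultimately have \<xi>0: "Comp vc \<xi> m0 = Id vc W" using \<alpha>0 by simp
  have m0o: "vf_obj m0 w : VObj E" "vf_obj P (vf_obj m0 w) = vf_obj f w" "vf_obj R (vf_obj m0 w) = w" "vf_obj \<xi> (vf_obj m0 w) = w"
    if "w : VObj W" for w
    using vf_arr_obj[OF m0(1), of w] vf_comp_obj[of w m0 P] vf_comp_obj[of w m0 R] vf_comp_obj[of w m0 \<xi>] m0(2-5) \<xi>0 that
    by (simp_all add: VCat_simps(5))
  have X_unit: "X (vf_obj f w) w = w" if "w : VObj W" for w
    using XE[OF m0o(1)[OF that]] m0o(2-4)[OF that] by simp
  have Xh_unit: "Xh (vf_obj f w0) w0 (vf_obj f w1) w1 (vf_hom f (w0, w1) ** s) s = s"
    if w: "w0 : VObj W" "w1 : VObj W" and s: "s : hom A q (VHom W (w0, w1))" for w0 w1 s q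
  proof -
    define h where "h = vf_hom m0 (w0, w1) ** s"
    note o0 = m0o[OF w(1)] and o1 = m0o[OF w(2)]
    have h: "h : hom A q (VHom E (vf_obj m0 w0, vf_obj m0 w1))" using vf_arr_el[OF m0(1), of w0 w1 s q] w s m0(2,3) by (simp add: h_def)
    have I: "vf_hom (Id vc W) (w0, w1) ** s = s" using w s homE[OF s] by (simp add: VCat_simps(5))
    have "vf_hom P (vf_obj m0 w0, vf_obj m0 w1) ** h = vf_hom f (w0, w1) ** s" "vf_hom R (vf_obj m0 w0, vf_obj m0 w1) ** h = s"
      "vf_hom \<xi> (vf_obj m0 w0, vf_obj m0 w1) ** h = s"
      using vf_comp_el[OF m0(1) S(3), of w0 w1 s q] vf_comp_el[OF m0(1) S(4), of w0 w1 s q] vf_comp_el[OF m0(1) \<xi>(1), of w0 w1 s q]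
        I w s PR \<xi>(2) m0(2-5) \<xi>0 by (simp_all add: h_def)
    then show ?thesis using XhE[OF o0(1) o1(1) h] o0(2,3) o1(2,3) by simp
  qed
  define FP where "FP = Comp vc F P"
  have FP: "FP : Arr vc" "vf_dom FP = E" "vf_cod FP = D" using VC.arr_comp[OF S(3) F] PR by (simp_all add: FP_def)
  obtain Q1 Q2 where sq: "strict_pullback F FP Q1 Q2" using strict_pullback_exists[OF F FP(1)] FP by auto
  note T = strict_pullbackD[OF sq]
  define N where "N = vf_dom Q1"
  have Qd: "vf_dom Q1 = N" "vf_dom Q2 = N" "vf_cod Q1 = C" "vf_cod Q2 = E" using T(6-8) FP by (simp_all add: N_def)
  define \<xi>Q RQ where "\<xi>Q = Comp vc \<xi> Q2" and "RQ = Comp vc R Q2"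
  have \<xi>Q: "\<xi>Q : Arr vc" "vf_dom \<xi>Q = N" "vf_cod \<xi>Q = W" using VC.arr_comp[OF T(4) \<xi>(1)] Qd \<xi> by (simp_all add: \<xi>Q_def)
  have RQ: "RQ : Arr vc" "vf_dom RQ = N" "vf_cod RQ = W" using VC.arr_comp[OF T(4) S(4)] Qd PR by (simp_all add: RQ_def)
  have FPQ: "Comp vc FP Q2 = Comp vc F (Comp vc P Q2)"
    unfolding FP_def by (rule VC.comp_assoc) (use T(4) S(3) F Qd PR in simp_all)
  have "Comp vc Ff \<xi>Q = Comp vc F (Comp vc f \<xi>Q)"
    unfolding Ff_def by (rule VC.comp_assoc) (use \<xi>Q F fA fd in simp_all)
  also have "Comp vc f \<xi>Q = Comp vc (Comp vc f \<xi>) Q2"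
    unfolding \<xi>Q_def by (rule VC.comp_assoc[symmetric]) (use T(4) \<xi> fA fd Qd in simp_all)
  finally have 1: "Comp vc Ff \<xi>Q = Comp vc F (Comp vc P Q2)" unfolding f\<xi> .
  have "Comp vc Ff RQ = Comp vc (Comp vc Ff R) Q2"
    unfolding RQ_def by (rule VC.comp_assoc[symmetric]) (use T(4) S(4) FfA Ffd Qd PR in simp_all)
  then have 2: "Comp vc Ff RQ = Comp vc FP Q2" by (simp only: FP_def S(9))
  have s1: "VC.span F Ff Q1 \<xi>Q" by (rule spanI[OF T(3) \<xi>Q(1)]) (use Qd \<xi>Q T(9) 1 FPQ in simp_all)
  have s2: "VC.span F Ff Q1 RQ" by (rule spanI[OF T(3) RQ(1)]) (use Qd RQ T(9) 2 in simp_all)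
  have s3: "VC.span F Ff (Comp vc P Q2) RQ"
    by (rule spanI[OF _ RQ(1)]) (use VC.arr_comp[OF T(4) S(3)] Qd PR RQ 2 FPQ in simp_all)
  obtain m1 where m1: "m1 : Arr vc" "vf_dom m1 = N" "vf_cod m1 = E" "Comp vc P m1 = Q1" "Comp vc R m1 = \<xi>Q" "\<alpha> Q1 \<xi>Q = Comp vc \<xi> m1"
    using \<xi>m[OF s1] \<xi>Q by auto
  obtain m2 where m2: "m2 : Arr vc" "vf_dom m2 = N" "vf_cod m2 = E" "Comp vc P m2 = Q1" "Comp vc R m2 = RQ" "\<alpha> Q1 RQ = Comp vc \<xi> m2"
    using \<xi>m[OF s2] RQ by auto
  have "\<xi>Q = \<alpha> (Comp vc P Q2) RQ"
    unfolding \<xi>Q_def \<xi>_def RQ_def by (rule a(5)[OF sPR[unfolded Ff_def] T(4), symmetric]) (use Qd PR in simp)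
  then have \<xi>12: "Comp vc \<xi> m1 = Comp vc \<xi> m2"
    using a(6)[OF s3[unfolded Ff_def] s2[unfolded Ff_def]] m1(6) m2(6) by simp
  have no: "vf_obj P (vf_obj m1 n) = vf_obj Q1 n" "vf_obj R (vf_obj m1 n) = vf_obj \<xi> (vf_obj Q2 n)" "vf_obj P (vf_obj m2 n) = vf_obj Q1 n"
    "vf_obj R (vf_obj m2 n) = vf_obj R (vf_obj Q2 n)" "vf_obj \<xi> (vf_obj m1 n) = vf_obj \<xi> (vf_obj m2 n)"
    "vf_obj m1 n : VObj E" "vf_obj m2 n : VObj E" if "n : VObj N" for n
    using vf_comp_obj[of n m1 P] vf_comp_obj[of n m1 R] vf_comp_obj[of n m2 P] vf_comp_obj[of n m2 R] vf_comp_obj[of n Q2 \<xi>] vf_comp_obj[of n Q2 R]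
      vf_square_obj[OF \<xi>12, of n] vf_arr_obj[OF m1(1), of n] vf_arr_obj[OF m2(1), of n] m1(2-5) m2(2-5) Qd(2) that
    by (simp_all add: \<xi>Q_def RQ_def)
  have npt: "\<exists>n. n : VObj N \<and> vf_obj Q1 n = c' \<and> vf_obj Q2 n = pt c w" if m: "mt c w" "mt c' w" for c c' w
  proof -
    have "vf_obj FP (pt c w) = vf_obj F c" using vf_comp_obj[of "pt c w" P F] pt[OF m(1)] PR by (simp add: FP_def)
    then show ?thesis using T(10)[of c' "pt c w"] m pt[OF m(1)] FP Qd unfolding mt_def by auto
  qed
  have X_act: "X c' (X c w) = X c' w" if m: "mt c w" "mt c' w" for c c' w
  proof -
    obtain n where n: "n : VObj N" "vf_obj Q1 n = c'" "vf_obj Q2 n = pt c w" using npt[OF m] by blast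
    note o = no[OF n(1)]
    show ?thesis using XE[OF o(6)] XE[OF o(7)] o(1-5) n(2,3) pt[OF m(1)] by (simp add: X_def[of c w])
  qed
  have Xh_act: "Xh c0' (X c0 w0) c1' (X c1 w1) t' (Xh c0 w0 c1 w1 t s) = Xh c0' w0 c1' w1 t' s"
    if m: "me c0 w0 c1 w1 q t s" and m': "me c0' w0 c1' w1 q t' s" for c0 w0 c1 w1 q t s c0' c1' t'
  proof -
    have mm: "mt c0 w0" "mt c1 w1" and t: "t : hom A q (VHom C (c0, c1))" and Ft: "vf_hom F (c0, c1) ** t = vf_hom F (vf_obj f w0, vf_obj f w1) ** vf_hom f (w0, w1) ** s"
      using m unfolding me_def by simp_all
    have mm': "mt c0' w0" "mt c1' w1" and t': "t' : hom A q (VHom C (c0', c1'))" and Ft': "vf_hom F (c0', c1') ** t' = vf_hom F (vf_obj f w0, vf_obj f w1) ** vf_hom f (w0, w1) ** s"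
      using m' unfolding me_def by simp_all
    note p0 = pt[OF mm(1)] and p1 = pt[OF mm(2)]
    obtain n0 where n0: "n0 : VObj N" "vf_obj Q1 n0 = c0'" "vf_obj Q2 n0 = pt c0 w0" using npt[OF mm(1) mm'(1)] by blast
    obtain n1 where n1: "n1 : VObj N" "vf_obj Q1 n1 = c1'" "vf_obj Q2 n1 = pt c1 w1" using npt[OF mm(2) mm'(2)] by blast
    note o0 = no[OF n0(1)] and o1 = no[OF n1(1)]
    obtain h where h: "h : hom A q (VHom E (pt c0 w0, pt c1 w1))" "vf_hom P (pt c0 w0, pt c1 w1) ** h = t"
      "vf_hom R (pt c0 w0, pt c1 w1) ** h = s" "Xh c0 w0 c1 w1 t s = vf_hom \<xi> (pt c0 w0, pt c1 w1) ** h"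
      using lft[OF m] by blast
    have "vf_hom FP (pt c0 w0, pt c1 w1) ** h = vf_hom F (c0, c1) ** t"
      using vf_comp_el[OF S(3) F, of "pt c0 w0" "pt c1 w1" h q] PR p0 p1 h(1,2) by (simp add: FP_def)
    then have e: "vf_hom F (c0', c1') ** t' = vf_hom FP (pt c0 w0, pt c1 w1) ** h" using Ft Ft' by simp
    obtain k where k: "k : hom A q (VHom N (n0, n1))" "vf_hom Q1 (n0, n1) ** k = t'" "vf_hom Q2 (n0, n1) ** k = h"
      by (rule strict_lift[OF sq, of n0 n1 t' q h]) (use n0 n1 t' h(1) e Qd FP in simp_all)
    define k1 k2 where "k1 = vf_hom m1 (n0, n1) ** k" and "k2 = vf_hom m2 (n0, n1) ** k"
    have kh: "k1 : hom A q (VHom E (vf_obj m1 n0, vf_obj m1 n1))" "k2 : hom A q (VHom E (vf_obj m2 n0, vf_obj m2 n1))"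
      using vf_arr_el[OF m1(1), of n0 n1 k q] vf_arr_el[OF m2(1), of n0 n1 k q] m1(2,3) m2(2,3) n0(1) n1(1) k(1) by (simp_all add: k1_def k2_def)
    have e1: "vf_hom P (vf_obj m1 n0, vf_obj m1 n1) ** k1 = t'"
      using vf_comp_el[OF m1(1) S(3), of n0 n1 k q] m1(2-4) PR n0(1) n1(1) k(1,2) by (simp add: k1_def)
    have e2: "vf_hom P (vf_obj m2 n0, vf_obj m2 n1) ** k2 = t'"
      using vf_comp_el[OF m2(1) S(3), of n0 n1 k q] m2(2-4) PR n0(1) n1(1) k(1,2) by (simp add: k2_def)
    have e3: "vf_hom R (vf_obj m1 n0, vf_obj m1 n1) ** k1 = Xh c0 w0 c1 w1 t s"
      using vf_comp_el[OF m1(1) S(4), of n0 n1 k q] vf_comp_el[OF T(4) \<xi>(1), of n0 n1 k q] m1(2,3,5) PR Qd \<xi>(2) n0(1,3) n1(1,3) k(1,3) h(4)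
      by (simp add: k1_def \<xi>Q_def)
    have e4: "vf_hom R (vf_obj m2 n0, vf_obj m2 n1) ** k2 = s"
      using vf_comp_el[OF m2(1) S(4), of n0 n1 k q] vf_comp_el[OF T(4) S(4), of n0 n1 k q] m2(2,3,5) PR Qd n0(1,3) n1(1,3) k(1,3) h(3)
      by (simp add: k2_def RQ_def)
    have e5: "vf_hom \<xi> (vf_obj m1 n0, vf_obj m1 n1) ** k1 = vf_hom \<xi> (vf_obj m2 n0, vf_obj m2 n1) ** k2"
      using vf_square_el[OF \<xi>12 \<xi>(1,1) m1(1) m2(1), of n0 n1 k q] m1(2,3) m2(2,3) \<xi>(2) n0(1) n1(1) k(1) by (simp add: k1_def k2_def)
    have P1: "vf_obj P (vf_obj m1 n0) = c0'" "vf_obj R (vf_obj m1 n0) = X c0 w0" "vf_obj P (vf_obj m1 n1) = c1'" "vf_obj R (vf_obj m1 n1) = X c1 w1"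
      using o0(1,2) o1(1,2) n0(2,3) n1(2,3) by (simp_all add: X_def)
    have P2: "vf_obj P (vf_obj m2 n0) = c0'" "vf_obj R (vf_obj m2 n0) = w0" "vf_obj P (vf_obj m2 n1) = c1'" "vf_obj R (vf_obj m2 n1) = w1"
      using o0(3,4) o1(3,4) n0(2,3) n1(2,3) p0(3) p1(3) by simp_all
    show ?thesis
      using XhE[OF o0(6) o1(6) kh(1)] XhE[OF o0(7) o1(7) kh(2)] unfolding e1 e2 e3 e4 e5 P1 P2 by simp
  qed
  have Xh_cmp: "Xh c0 w0 c2 w2 (cmp C c0 c1 c2 t1 t0) (cmp W w0 w1 w2 s1 s0) =
      cmp W (X c0 w0) (X c1 w1) (X c2 w2) (Xh c1 w1 c2 w2 t1 s1) (Xh c0 w0 c1 w1 t0 s0)"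
    if M1: "me c1 w1 c2 w2 q t1 s1" and M0: "me c0 w0 c1 w1 q t0 s0" for c0 w0 c1 w1 c2 w2 q t1 s1 t0 s0
  proof -
    have mm: "mt c0 w0" "mt c1 w1" "mt c2 w2" using M1 M0 unfolding me_def by simp_all
    note p0 = pt[OF mm(1)] and p1 = pt[OF mm(2)] and p2 = pt[OF mm(3)]
    obtain h1 where h1: "h1 : hom A q (VHom E (pt c1 w1, pt c2 w2))" "vf_hom P (pt c1 w1, pt c2 w2) ** h1 = t1"
      "vf_hom R (pt c1 w1, pt c2 w2) ** h1 = s1" "Xh c1 w1 c2 w2 t1 s1 = vf_hom \<xi> (pt c1 w1, pt c2 w2) ** h1" using lft[OF M1] by blast
    obtain h0 where h0: "h0 : hom A q (VHom E (pt c0 w0, pt c1 w1))" "vf_hom P (pt c0 w0, pt c1 w1) ** h0 = t0"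
      "vf_hom R (pt c0 w0, pt c1 w1) ** h0 = s0" "Xh c0 w0 c1 w1 t0 s0 = vf_hom \<xi> (pt c0 w0, pt c1 w1) ** h0" using lft[OF M0] by blast
    note C = cmp_hom[OF Ev p0(1) p1(1) p2(1) h1(1) h0(1)]
    note eP = vf_arr_cmp[OF S(3), of "pt c0 w0" "pt c1 w1" "pt c2 w2" h1 q h0, unfolded PR, OF p0(1) p1(1) p2(1) h1(1) h0(1)]
    note eR = vf_arr_cmp[OF S(4), of "pt c0 w0" "pt c1 w1" "pt c2 w2" h1 q h0, unfolded PR, OF p0(1) p1(1) p2(1) h1(1) h0(1)]
    note eX = vf_arr_cmp[OF \<xi>(1), of "pt c0 w0" "pt c1 w1" "pt c2 w2" h1 q h0, unfolded \<xi>(2,3), OF p0(1) p1(1) p2(1) h1(1) h0(1)]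
    show ?thesis
      using XhE[OF p0(1) p2(1) C] unfolding eP eR eX p0(2,3) p1(2,3) p2(2,3) h1(2,3) h0(2,3) h1(4)[symmetric] h0(4)[symmetric] X_def .
  qed
  have Xh_un: "Xh c w c w (un C c q) (un W w q) = un W (X c w) q" if m: "mt c w" and q: "q : Obj A" for c w q
  proof -
    note p = pt[OF m]
    note eP = vf_arr_un[OF S(3), of "pt c w" q, unfolded PR, OF p(1) q]
    note eR = vf_arr_un[OF S(4), of "pt c w" q, unfolded PR, OF p(1) q]
    note eX = vf_arr_un[OF \<xi>(1), of "pt c w" q, unfolded \<xi>(2,3), OF p(1) q]
    show ?thesis using XhE[OF p(1,1) un_hom[OF Ev p(1) q]] unfolding eP eR eX p(2,3) X_def .
  qed
  have va: "vfunctor_action small pair A F C D f W X Xh"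
    by (unfold_locales, fold mt_def, fold me_def)
      (fact fA fd X_obj X_unit X_act Xh_hom Xh_over Xh_nat Xh_unit Xh_act Xh_cmp Xh_un)+
  note quot = vfunctor_action.quotient_exists[OF va, folded mt_def, folded me_def]
  obtain G K where GK: "strict_pullback F G f K" and Ko: "\<And>c w. mt c w ==> vf_obj K (X c w) = vf_obj K w"
    and Kh: "\<And>c0 w0 c1 w1 q t s. me c0 w0 c1 w1 q t s ==> vf_hom K (X c0 w0, X c1 w1) ** Xh c0 w0 c1 w1 t s = vf_hom K (w0, w1) ** s"
    using quot by blast
  note U = strict_pullbackD[OF GK]
  have Kd: "vf_dom K = W" using U(6) fd by simp
  have K\<xi>: "Comp vc K \<xi> = Comp vc K R"
  proof (rule vf_eqI)
    show "Comp vc K \<xi> : Arr vc" "Comp vc K R : Arr vc"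
      using VC.arr_comp[OF \<xi>(1) U(4)] VC.arr_comp[OF S(4) U(4)] Kd \<xi> PR by simp_all
    fix e0 assume "e0 : VObj (vf_dom (Comp vc K R))"
    then have e0: "e0 : VObj E" by (simp add: PR)
    show "vf_obj (Comp vc K \<xi>) e0 = vf_obj (Comp vc K R) e0"
      using Ko[OF mtE[OF e0]] XE[OF e0] e0 by (simp add: vf_comp_obj PR \<xi>)
    fix e1 assume "e1 : VObj (vf_dom (Comp vc K R))"
    then have e1: "e1 : VObj E" by (simp add: PR)
    define q where "q = VHom E (e0, e1)"
    have i: "Id A q : hom A q (VHom E (e0, e1))" using id_hom[OF vcat_hom_obj[OF Ev e0 e1]] by (simp add: q_def)
    have "vf_hom F (vf_obj P e0, vf_obj P e1) ** vf_hom P (e0, e1) ** Id A q = vf_hom Ff (vf_obj R e0, vf_obj R e1) ** vf_hom R (e0, e1) ** Id A q"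
      by (rule vf_square_el[OF S(9,1-4)]) (use PR Ffd e0 e1 i in simp_all)
    also have "\<dots> = vf_hom F (vf_obj f (vf_obj R e0), vf_obj f (vf_obj R e1)) ** vf_hom f (vf_obj R e0, vf_obj R e1) ** vf_hom R (e0, e1) ** Id A q"
      unfolding Ff_def by (rule vf_comp_el[OF fA F]) (use fd Po[OF e0] Po[OF e1] Ph(2)[OF e0 e1 i] in simp_all)
    finally have "me (vf_obj P e0) (vf_obj R e0) (vf_obj P e1) (vf_obj R e1) q (vf_hom P (e0, e1) ** Id A q) (vf_hom R (e0, e1) ** Id A q)"
      unfolding me_def using mtE[OF e0] mtE[OF e1] Ph[OF e0 e1 i] by simp
    from Kh[OF this] have "vf_hom K (vf_obj \<xi> e0, vf_obj \<xi> e1) ** vf_hom \<xi> (e0, e1) ** Id A q =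
      vf_hom K (vf_obj R e0, vf_obj R e1) ** vf_hom R (e0, e1) ** Id A q"
      unfolding XhE[OF e0 e1 i] XE[OF e0] XE[OF e1] .
    moreover have "vf_hom \<xi> (e0, e1) : hom A q (VHom W (vf_obj \<xi> e0, vf_obj \<xi> e1))" "vf_hom R (e0, e1) : hom A q (VHom W (vf_obj R e0, vf_obj R e1))"
      using vf_arr_hom[OF \<xi>(1), of e0 e1] vf_arr_hom[OF S(4), of e0 e1] e0 e1 PR \<xi> by (simp_all add: q_def)
    ultimately show "vf_hom (Comp vc K \<xi>) (e0, e1) = vf_hom (Comp vc K R) (e0, e1)"
      using e0 e1 by (simp add: vf_comp_hom PR \<xi> hom_def)
  qed (simp_all add: PR \<xi>)
  have "Comp vc K (\<alpha> t s) = Comp vc K s" if ts: "VC.span F (Comp vc F f) t s" for t s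
  proof -
    obtain m where m: "m : Arr vc" "vf_cod m = E" "Comp vc R m = s" "\<alpha> t s = Comp vc \<xi> m" using \<xi>m[OF ts[folded Ff_def]] by blast
    have "Comp vc K (\<alpha> t s) = Comp vc (Comp vc K \<xi>) m"
      unfolding m(4) by (rule VC.comp_assoc[symmetric]) (use m \<xi> U(4) Kd in simp_all)
    also have "\<dots> = Comp vc K (Comp vc R m)"
      unfolding K\<xi> by (rule VC.comp_assoc) (use m(1,2) S(4) PR U(4) Kd in simp_all)
    finally show ?thesis unfolding m(3) .
  qed
  then show "\<exists>g q. is_pullback vc F g f q \<and> (\<forall>t s. VC.span F (Comp vc F f) t s --> Comp vc q (\<alpha> t s) = Comp vc q s)"
    using strict_is_pullback[OF GK] by blast
qed

end

context universe_cartesian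
begin

lemma family_intoI:
  assumes "inj_on code T" "category fc" "fam_into A code T \<phi> y : Arr fc"
  shows "family_into small pair A code T \<phi> y"
  by (intro family_into.intro family_into_axioms.intro universe_cartesian_axioms assms)

lemma family_almost_descent:
  assumes "inj_on code T" "almost_descent fc (fam_into A code T \<phi> y)"
  shows "separating y (family_factors T \<phi>)" "i : T ==> \<phi> i : Arr A \<and> cod (\<phi> i) = y"
proof -
  interpret family_into small pair A code T \<phi> y
    by (rule family_intoI[OF assms(1)]) (use assms(2) in \<open>simp_all only: almost_descent_def\<close>)
  show "separating y (family_factors T \<phi>)" by (rule separates_separating[OF almost_descent_separates[OF assms(2)]])
  show "i : T ==> \<phi> i : Arr A \<and> cod (\<phi> i) = y" by (simp add: \<phi>_arr)
qed

lemma family_descent: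
  assumes "inj_on code T" "descent fc (fam_into A code T \<phi> y)"
  shows "covers y (family_factors T \<phi>)" "i : T ==> \<phi> i : Arr A \<and> cod (\<phi> i) = y"
proof -
  interpret family_into small pair A code T \<phi> y
    by (rule family_intoI[OF assms(1)]) (use assms(2) in \<open>simp_all only: descent_def\<close>)
  show "covers y (family_factors T \<phi>)" by (rule glues_covers[OF descent_glues(2,1)[OF assms(2)]])
  show "i : T ==> \<phi> i : Arr A \<and> cod (\<phi> i) = y" by (simp add: \<phi>_arr)
qed

lemma family_effective_descent:
  assumes "inj_on code T" "effective_descent fc (fam_into A code T \<phi> y)"
  shows "T \<noteq> {}" "covers y (family_factors T \<phi>)" "family_effective T \<phi>" "i : T ==> \<phi> i : Arr A \<and> cod (\<phi> i) = y"
proof -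
  have C: "category fc" "has_pullbacks fc" "fam_into A code T \<phi> y : Arr fc"
    using assms(2) by (simp_all only: effective_descent_def)
  interpret family_into small pair A code T \<phi> y
    by (rule family_intoI[OF assms(1) C(1,3)])
  have e: "F.separates p" "F.glues p" "F.actions_effective p"
    using assms(2) unfolding effective_descent_iff[OF C] by simp_all
  show T: "T \<noteq> {}" by (rule glues_nonempty[OF e(2)])
  show "covers y (family_factors T \<phi>)" by (rule glues_covers[OF e(1,2)])
  show "family_effective T \<phi>" by (rule effective_family_effective[OF e(3) T])
  show "i : T ==> \<phi> i : Arr A \<and> cod (\<phi> i) = y" by (simp add: \<phi>_arr)
qed

end

theorem theorem3p4p9:
  fixes small :: "'u set \<Rightarrow> bool" and pair :: "'u \<Rightarrow> 'u \<Rightarrow> 'u"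
    and V :: "('o, 'm) cat"
    and C D :: "('u, 'o, 'm) vcat" and F :: "('u, 'o, 'm) vfunctor"
    and P\<^sub>1 I\<^sub>1 :: "'u \<times> 'u \<Rightarrow> 'm"
    and P\<^sub>2 I\<^sub>2 :: "'u \<times> 'u \<times> 'u \<Rightarrow> 'm"
    and P\<^sub>3 I\<^sub>3 :: "'u \<times> 'u \<times> 'u \<times> 'u \<Rightarrow> 'm"
  assumes "universe small pair"
    and "regular_category V"
    and "F \<in> hom (VCat small V) C D"
    and "\<And>x0 x1. \<lbrakk>x0 \<in> VObj C; x1 \<in> VObj C\<rbrakk> \<Longrightarrow>
      is_regepi_mono_fact V (vf_hom F (x0, x1)) (P\<^sub>1 (x0, x1)) (I\<^sub>1 (x0, x1))"
    and "\<And>x0 x1 x2. \<lbrakk>x0 \<in> VObj C; x1 \<in> VObj C; x2 \<in> VObj C\<rbrakk> \<Longrightarrow>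
      is_regepi_mono_fact V (vf_chain3 V F (x0, x1, x2)) (P\<^sub>2 (x0, x1, x2)) (I\<^sub>2 (x0, x1, x2))"
    and "\<And>x0 x1 x2 x3. \<lbrakk>x0 \<in> VObj C; x1 \<in> VObj C; x2 \<in> VObj C; x3 \<in> VObj C\<rbrakk> \<Longrightarrow>
      is_regepi_mono_fact V (vf_chain4 V F (x0, x1, x2, x3))
        (P\<^sub>3 (x0, x1, x2, x3)) (I\<^sub>3 (x0, x1, x2, x3))"
    and a: "\<And>x0 x1. \<lbrakk>x0 \<in> VObj C; x1 \<in> VObj C\<rbrakk> \<Longrightarrow> effective_descent V (P\<^sub>1 (x0, x1))"
    and b: "\<And>y0 y1. \<lbrakk>y0 \<in> VObj D; y1 \<in> VObj D\<rbrakk> \<Longrightarrow>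
      effective_descent (Fam small V)
        (fam_into V (code2 pair) (vf_fiber F y0 \<times> vf_fiber F y1) I\<^sub>1 (VHom D (y0, y1)))"
    and c: "\<And>y0 y1 y2. \<lbrakk>y0 \<in> VObj D; y1 \<in> VObj D; y2 \<in> VObj D\<rbrakk> \<Longrightarrow>
      descent (Fam small V)
        (fam_into V (code3 pair) (vf_fiber F y0 \<times> vf_fiber F y1 \<times> vf_fiber F y2)
          I\<^sub>2 (chain3 V D (y0, y1, y2)))"
    and d: "\<And>y0 y1 y2 y3. \<lbrakk>y0 \<in> VObj D; y1 \<in> VObj D; y2 \<in> VObj D; y3 \<in> VObj D\<rbrakk> \<Longrightarrow>
      almost_descent (Fam small V)
        (fam_into V (code4 pair)
          (vf_fiber F y0 \<times> vf_fiber F y1 \<times> vf_fiber F y2 \<times> vf_fiber F y3)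
          I\<^sub>3 (chain4 V D (y0, y1, y2, y3)))"
  shows "effective_descent (VCat small V) F"
proof -
  have V: "category V" "has_finite_limits V"
    and stable: "\<And>f g a b. is_pullback V f g a b ==> is_regular_epi V g ==> is_regular_epi V a"
    using assms(2) unfolding regular_category_def by blast+
  interpret cartesian V by (rule category.finite_limits_cartesian[OF V])
  interpret universe small pair by fact
  interpret universe_cartesian small pair V ..
  have F: "F : Arr (VCat small V)" "vf_dom F = C" "vf_cod F = D" using assms(3) by (simp_all add: hom_def)
  have fiber: "x : vf_fiber F y \<longleftrightarrow> x : VObj C \<and> vf_obj F x = y" for x y by (auto simp: vf_fiber_def F)
  have fact: "p : Arr V" "Dom V i = Cod V p" "g = Comp V i p" "covers (Cod V p) (factors p)"
    if "is_regepi_mono_fact V g p i" for g p i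
    using that regular_epi_arr regular_epi_covers[OF stable] unfolding is_regepi_mono_fact_def by simp_all
  note fact1 = fact[OF assms(4)] and fact2 = fact[OF assms(5)] and fact3 = fact[OF assms(6)]
  have inj2: "inj_on (code2 pair) T" for T
    by (rule inj_onI) (auto simp: code2_def dest!: pair_inject)
  have inj3: "inj_on (code3 pair) T" for T
    by (rule inj_onI) (auto simp: code3_def dest!: pair_inject)
  have inj4: "inj_on (code4 pair) T" for T
    by (rule inj_onI) (auto simp: code4_def dest!: pair_inject)
  note fam1 = family_effective_descent[OF inj2 b] and fam2 = family_descent[OF inj3 c] and fam3 = family_almost_descent[OF inj4 d]
  have P1: "actions_effective (P\<^sub>1 (x0, x1))" if "x0 : VObj C" "x1 : VObj C" for x0 x1
    using a[OF that] effective_descent_iff[OF V(1) has_pullbacks fact1(1)[OF that]] by simp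
  interpret covering_vfunctor small pair V F C D
  proof
    fix y assume y: "y : VObj D"
    show "\<exists>x\<in>VObj C. vf_obj F x = y" using fam1(1)[OF y y] by (auto simp: fiber)
  next
    fix y0 y1 assume y: "y0 : VObj D" "y1 : VObj D"
    have ty: "P\<^sub>1 i : Arr V \<and> I\<^sub>1 i : Arr V \<and> Dom V (I\<^sub>1 i) = Cod V (P\<^sub>1 i) \<and> Cod V (I\<^sub>1 i) = VHom D (y0, y1) \<and>
      vf_hom F i = Comp V (I\<^sub>1 i) (P\<^sub>1 i)" "covers (Cod V (P\<^sub>1 i)) (factors (P\<^sub>1 i))" "actions_effective (P\<^sub>1 i)"
      if "i : vf_fiber F y0 \<times> vf_fiber F y1" for i
      using that fam1(4)[OF y that] fact1 P1 by (auto simp: fiber)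
    show "covers (VHom D (y0, y1)) (family_factors (vf_fiber F y0 \<times> vf_fiber F y1) (vf_hom F))"
      by (rule family_covers_comp(1)[OF ty(1,2) fam1(2)[OF y]])
    show "family_effective (vf_fiber F y0 \<times> vf_fiber F y1) (vf_hom F)"
    proof (rule family_effective_comp[OF _ ty(2,3) fam1(3)[OF y]])
      fix i assume "i : vf_fiber F y0 \<times> vf_fiber F y1"
      from ty(1)[OF this] show "P\<^sub>1 i : Arr V \<and> I\<^sub>1 i : Arr V \<and> Dom V (I\<^sub>1 i) = Cod V (P\<^sub>1 i) \<and> vf_hom F i = Comp V (I\<^sub>1 i) (P\<^sub>1 i)"
        by (elim conjE) (intro conjI)
    qed
  next
    fix y0 y1 y2 assume y: "y0 : VObj D" "y1 : VObj D" "y2 : VObj D"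
    have ty: "P\<^sub>2 i : Arr V \<and> I\<^sub>2 i : Arr V \<and> Dom V (I\<^sub>2 i) = Cod V (P\<^sub>2 i) \<and> Cod V (I\<^sub>2 i) = chain3 V D (y0, y1, y2) \<and>
      vf_chain3 V F i = Comp V (I\<^sub>2 i) (P\<^sub>2 i)" "covers (Cod V (P\<^sub>2 i)) (factors (P\<^sub>2 i))"
      if "i : vf_fiber F y0 \<times> vf_fiber F y1 \<times> vf_fiber F y2" for i
      using that fam2(2)[OF y that] fact2 by (auto simp: fiber)
    show "covers (chain3 V D (y0, y1, y2)) (family_factors (vf_fiber F y0 \<times> vf_fiber F y1 \<times> vf_fiber F y2) (vf_chain3 V F))"
      by (rule family_covers_comp(1)[OF ty fam2(1)[OF y]])
  next
    fix y0 y1 y2 y3 assume y: "y0 : VObj D" "y1 : VObj D" "y2 : VObj D" "y3 : VObj D"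
    have ty: "P\<^sub>3 i : Arr V \<and> I\<^sub>3 i : Arr V \<and> Dom V (I\<^sub>3 i) = Cod V (P\<^sub>3 i) \<and> Cod V (I\<^sub>3 i) = chain4 V D (y0, y1, y2, y3) \<and>
      vf_chain4 V F i = Comp V (I\<^sub>3 i) (P\<^sub>3 i)" "covers (Cod V (P\<^sub>3 i)) (factors (P\<^sub>3 i))"
      if "i : vf_fiber F y0 \<times> vf_fiber F y1 \<times> vf_fiber F y2 \<times> vf_fiber F y3" for i
      using that fam3(2)[OF y that] fact3 by (auto simp: fiber)
    show "separating (chain4 V D (y0, y1, y2, y3))
        (family_factors (vf_fiber F y0 \<times> vf_fiber F y1 \<times> vf_fiber F y2 \<times> vf_fiber F y3) (vf_chain4 V F))"
      by (rule family_covers_comp(2)[OF ty fam3(1)[OF y]])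
  qed (simp_all add: F)
  show ?thesis
    unfolding effective_descent_iff[OF category_VCat VCat_has_pullbacks F(1)]
    using F_separates F_glues F_actions_effective by simp
qed

end
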